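(* Let $(K,v)$ be an arbitrary valued field with henselization $(K^h,v^h)$. Let $\mu\in\mathcal T$ be an inner node, let $\phi\in\mathrm{KP}(\mu)$ be a key polynomial for $\mu$, and let $g\in K[x]$ be nonzero. Write $N=N^+_{\mu,\phi}(g)$ for the principal Newton polygon, and let $Q=Q_{\mu,\phi}\in\mathrm{Irr}(K^h)$ be the irreducible factor of $\phi$ determined by $\mu$. Then: (i) every $G\in\mathcal F_{\mu,\phi}(g)$ has degree a multiple of $\deg(Q)$; (ii) for all $\lambda\in\Gamma_{\mathbb Q}$, $$\sum_{G\in\mathcal F_{\mu,\phi}(g)(\lambda)}\deg(G)=\ell\big(S_\lambda(N)\big)\,\deg(Q).$$ In particular, if $\ell(S_\lambda(N))=1$, then $\mathcal F_{\mu,\phi}(g)(\lambda)$ contains a unique irreducible factor of $g$, and this factor has degree $\deg(Q)$.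
   Context: **Setting.** $(K,v)$ is a valued field, $\Gamma=v(K^* )$, $\Gamma_{\mathbb Q}=\Gamma\otimes\mathbb Q$. Fix an algebraic closure $\overline K$ and an extension $\bar v$ of $v$ to $\overline K$; $(K^h,v^h)$ is the corresponding henselization inside $\overline K$ (fixed field in the separable closure of the decomposition group of $\bar v$, $v^h=\bar v|_{K^h}$). $\mathrm{Irr}(E)$ is the set of monic irreducible polynomials of $E[x]$. $\mathcal T$ is the set of all valuations $\mu:K[x]\to\Gamma_{\mathbb Q}\cup\{\infty\}$ with $\mu|_K=v$ (nonzero support $\mu^{-1}(\infty)$ allowed), ordered by $\mu\le\nu\iff\mu(f)\le\nu(f)$ for all $f$. An inner node is a non-maximal element of $\mathcal T$. For $F\in\mathrm{Irr}(K^h)$ with root $\theta\in\overline K$, put $v_F(q)=\bar v(q(\theta))$ for $q\in K^h[x]$, and $w_F=(v_F)|_{K[x]}\in\mathcal T$. (Known: $F\mapsto w_F$ is a bijection from $\mathrm{Irr}(K^h)$ onto the elements of $\mathcal T$ with nonzero support.) **Key polynomials.** For $\mu\in\mathcal T$, $\mathcal G_\mu=\bigoplus_\alpha\{f:\mu(f)\ge\alpha\}/\{f:\mu(f)>\alpha\}$ is the graded algebra and $\mathrm{in}_\mu f$ is the class of $f$ in degree $\mu(f)$ ($\mathrm{in}_\mu f=0$ if $\mu(f)=\infty$). Write $f\sim_\mu h$ if $\mathrm{in}_\mu f=\mathrm{in}_\mu h$, and $h\mid_\mu f$ if $\mathrm{in}_\mu h$ divides $\mathrm{in}_\mu f$ in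 $\mathcal G_\mu$. A key polynomial for $\mu$ is a monic $\phi\in K[x]$ such that $\mathrm{in}_\mu\phi$ is a prime element and $\phi\nmid_\mu f$ for all nonzero $f$ with $\deg f<\deg\phi$. $\mathrm{KP}(\mu)$ is the set of key polynomials; it is nonempty exactly when $\mu$ is an inner node. $[\phi]_\mu=\{\phi'\in\mathrm{KP}(\mu):\phi'\sim_\mu\phi\}$. For $\mu<\nu$, $\mathbf t(\mu,\nu)$ is the set of monic polynomials $\phi$ of minimal degree with $\mu(\phi)<\nu(\phi)$; it is one of the classes $[\phi]_\mu$. **Augmentation.** For $\phi\in\mathrm{KP}(\mu)$ and $\gamma\in\Gamma_{\mathbb Q}\cup\{\infty\}$, $\gamma>\mu(\phi)$, the valuation $[\mu;\phi,\gamma]\in\mathcal T$ sends $\sum_n a_n\phi^n$ ($\deg a_n<\deg\phi$) to $\min_n\{\mu(a_n)+n\gamma\}$. The valuation $[\mu;\phi,\infty]$ has support $\phi K[x]$, so there is a unique irreducible factor $Q_{\mu,\phi}\in\mathrm{Irr}(K^h)$ of $\phi$ with $[\mu;\phi,\infty]=w_{Q_{\mu,\phi}}$; it is called the irreducible factor of $\phi$ determined by $\mu$. **Newton polygons.** For nonzero $g=\sum_na_n\phi^n$, $\deg a_n<\deg\phi$, $N_{\mu,\phi}(g)\subset\mathbb Q\times\Gamma_{\mathbb Q}$ is the lower convex hull of $\{(n,\mu(a_n)):a_n\ne0\}$ (a single point, or a chain of sides with increasing slopes in $\Gamma_{\mathbb Q}$). The principal polygon $N^+_{\mu,\phi}(g)$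 is formed by the sides of slope $<-\mu(\phi)$; if there are none, it is the left endpoint of $N_{\mu,\phi}(g)$. For a polygon $N$ and $\lambda\in\Gamma_{\mathbb Q}$, $S_\lambda(N)=\{(n,\alpha)\in N:\alpha+n\lambda\text{ is minimal}\}$ (the side of slope $-\lambda$ if there is one, otherwise a vertex), and $\ell(S_\lambda(N))$ is the length of its projection to the horizontal axis. **Sets of factors** (multisets, counting multiplicities as factors of $g$): $\mathcal F_{\mu,\phi}(g)=\{G\in\mathrm{Irr}(K^h): G\mid g,\ \mu<w_G,\ \mathbf t(\mu,w_G)=[\phi]_\mu\}$ and $\mathcal F_{\mu,\phi}(g)(\lambda)=\{G\in\mathcal F_{\mu,\phi}(g): w_G(\phi)=\lambda\}$. *)

theory Defs
  imports
    "HOL-Algebra.Ring_Divisibility"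
    "HOL-Library.Set_Algebras"
    "HOL-Library.Multiset"
    "HOL-Computational_Algebra.Computational_Algebra"
begin

section \<open>Value groups\<close>

text \<open>
  Totally ordered rational vector spaces. Multiplication by a positive rational is automatically
  strictly monotone, so no compatibility axiom is needed.
\<close>

class linordered_rat_vector = linordered_ab_group_add +
  fixes scaleQ :: "rat \<Rightarrow> 'a \<Rightarrow> 'a"  (infixr \<open>*\<^sub>Q\<close> 75)
  assumes scaleQ_add_right: "q *\<^sub>Q (x + y) = q *\<^sub>Q x + q *\<^sub>Q y"
    and scaleQ_add_left: "(q + r) *\<^sub>Q x = q *\<^sub>Q x + r *\<^sub>Q x"
    and scaleQ_scaleQ: "q *\<^sub>Q r *\<^sub>Q x = (q * r) *\<^sub>Q x"
    and scaleQ_one: "1 *\<^sub>Q x = x"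

text \<open>The group \<open>'g\<close> with a largest, absorbing element adjoined.\<close>

datatype 'g vext = Fin 'g | Infty

instantiation vext :: (linorder) linorder
begin

fun less_eq_vext :: "'a vext \<Rightarrow> 'a vext \<Rightarrow> bool" where
  "Fin x \<le> Fin y \<longleftrightarrow> x \<le> y"
| "_ \<le> Infty \<longleftrightarrow> True"
| "Infty \<le> Fin _ \<longleftrightarrow> False"

definition less_vext :: "'a vext \<Rightarrow> 'a vext \<Rightarrow> bool" where
  "(x :: 'a vext) < y \<longleftrightarrow> x \<le> y \<and> \<not> y \<le> x"

instance
proof
  fix x y z :: "'a vext"
  show "x < y \<longleftrightarrow> x \<le> y \<and> \<not> y \<le> x" by (fact less_vext_def)
  show "x \<le> x" by (cases x) auto
  show "x \<le> y \<Longrightarrow> y \<le> z \<Longrightarrow> x \<le> z" by (cases x; cases y; cases z) auto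
  show "x \<le> y \<Longrightarrow> y \<le> x \<Longrightarrow> x = y" by (cases x; cases y) auto
  show "x \<le> y \<or> y \<le> x" by (cases x; cases y) auto
qed

end

instantiation vext :: (comm_monoid_add) comm_monoid_add
begin

definition zero_vext :: "'a vext" where
  "0 = Fin 0"

fun plus_vext :: "'a vext \<Rightarrow> 'a vext \<Rightarrow> 'a vext" where
  "Fin x + Fin y = Fin (x + y)"
| "Infty + _ = Infty"
| "_ + Infty = Infty"

instance
proof
  fix x y z :: "'a vext"
  show "x + y + z = x + (y + z)" by (cases x; cases y; cases z) (auto simp: add.assoc)
  show "x + y = y + x" by (cases x; cases y) (auto simp: add.commute)
  show "0 + x = x" by (cases x) (auto simp: zero_vext_def)
qed

end

section \<open>Valued fields and henselization\<close>

text \<open>On a field, such a map is finite on nonzero elements.\<close>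

definition is_valuation :: "('r::comm_ring_1 \<Rightarrow> 'g::linordered_ab_group_add vext) \<Rightarrow> bool" where
  "is_valuation u \<longleftrightarrow>
     u 0 = Infty \<and> u 1 = 0 \<and>
     (\<forall>a b. u (a * b) = u a + u b) \<and>
     (\<forall>a b. min (u a) (u b) \<le> u (a + b))"

text \<open>
  \<open>'c\<close>, via \<open>emb\<close>, is an algebraic closure of the field \<open>'a\<close>, and \<open>vbar\<close> extends \<open>v\<close>.
  If \<open>\<Gamma>\<close> is the value group of \<open>v\<close>, then \<open>'g\<close> is (a copy of) \<open>\<Gamma> \<otimes> \<rat>\<close>: as \<open>\<Gamma>\<close> is torsion-free,
  this means a rational vector space containing \<open>\<Gamma>\<close> in which every element has the form
  \<open>(1/n) \<gamma>\<close> with \<open>\<gamma> \<in> \<Gamma>\<close> and \<open>n > 0\<close>.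
\<close>

locale valued_field_closure =
  fixes emb :: "'a::field \<Rightarrow> 'c::alg_closed_field"
    and v :: "'a \<Rightarrow> 'g::linordered_rat_vector vext"
    and vbar :: "'c \<Rightarrow> 'g vext"
  assumes emb_one: "emb 1 = 1"
    and emb_add: "emb (a + b) = emb a + emb b"
    and emb_mult: "emb (a * b) = emb a * emb b"
    and emb_algebraic: "\<exists>p. p \<noteq> 0 \<and> poly (map_poly emb p) x = 0"
    and valuation_v: "is_valuation v"
    and value_group: "\<exists>a n. a \<noteq> 0 \<and> n > 0 \<and> v a = Fin (of_nat n *\<^sub>Q \<gamma>)"
    and valuation_vbar: "is_valuation vbar"
    and vbar_extends: "vbar (emb a) = v a"

definition separable_closure :: "('a::field \<Rightarrow> 'c::field) \<Rightarrow> 'c set" where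
  "separable_closure emb =
     {x. \<exists>p. irreducible p \<and> rsquarefree (map_poly emb p) \<and> poly (map_poly emb p) x = 0}"

text \<open>Only the restriction of \<open>\<sigma>\<close> to the separable closure matters.\<close>

definition galois_group :: "('a::field \<Rightarrow> 'c::field) \<Rightarrow> ('c \<Rightarrow> 'c) set" where
  "galois_group emb =
     {\<sigma>. bij_betw \<sigma> (separable_closure emb) (separable_closure emb) \<and>
         (\<forall>x\<in>separable_closure emb. \<forall>y\<in>separable_closure emb.
            \<sigma> (x + y) = \<sigma> x + \<sigma> y \<and> \<sigma> (x * y) = \<sigma> x * \<sigma> y) \<and>
         (\<forall>a. \<sigma> (emb a) = emb a)}"

definition decomposition_group ::
    "('a::field \<Rightarrow> 'c::field) \<Rightarrow> ('c \<Rightarrow> 'g vext) \<Rightarrow> ('c \<Rightarrow> 'c) set" where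
  "decomposition_group emb vbar =
     {\<sigma>\<in>galois_group emb. \<forall>x\<in>separable_closure emb. vbar (\<sigma> x) = vbar x}"

definition henselization :: "('a::field \<Rightarrow> 'c::field) \<Rightarrow> ('c \<Rightarrow> 'g vext) \<Rightarrow> 'c set" where
  "henselization emb vbar =
     {x\<in>separable_closure emb. \<forall>\<sigma>\<in>decomposition_group emb vbar. \<sigma> x = x}"

section \<open>Irreducible polynomials over a subfield\<close>

definition polys_over :: "'c::field set \<Rightarrow> 'c poly set" where
  "polys_over E = {p. \<forall>i. coeff p i \<in> E}"

text \<open>For a subfield \<open>E\<close>, the monic irreducible elements of \<open>E[x]\<close>.\<close>

definition Irr :: "'c::field set \<Rightarrow> 'c poly set" where
  "Irr E = {F\<in>polys_over E. lead_coeff F = 1 \<and> degree F > 0 \<and>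
     (\<forall>p\<in>polys_over E. \<forall>q\<in>polys_over E. F = p * q \<longrightarrow> degree p = 0 \<or> degree q = 0)}"

text \<open>
  The monic irreducible factors of \<open>g \<noteq> 0\<close> in \<open>E[x]\<close>, with multiplicity. Divisibility is tested over the
  ambient field; for polynomials over the subfield \<open>E\<close> it agrees with divisibility in \<open>E[x]\<close>.
\<close>

definition irr_factors :: "'c::field set \<Rightarrow> 'c poly \<Rightarrow> 'c poly multiset" where
  "irr_factors E g = (\<Sum>G | G \<in> Irr E \<and> G dvd g. replicate_mset (GREATEST n. G ^ n dvd g) G)"

section \<open>Valuations on the polynomial ring\<close>

definition \<T> ::
    "('a::field \<Rightarrow> 'g::linordered_rat_vector vext) \<Rightarrow> ('a poly \<Rightarrow> 'g vext) set" where
  "\<T> v = {\<mu>. is_valuation \<mu> \<and> (\<forall>a. \<mu> [:a:] = v a)}"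

text \<open>The order on \<open>\<T> v\<close> is the pointwise order on functions.\<close>

definition inner_node ::
    "('a::field \<Rightarrow> 'g::linordered_rat_vector vext) \<Rightarrow> ('a poly \<Rightarrow> 'g vext) \<Rightarrow> bool" where
  "inner_node v \<mu> \<longleftrightarrow> \<mu> \<in> \<T> v \<and> (\<exists>\<nu>\<in>\<T> v. \<mu> < \<nu>)"

text \<open>
  For \<open>F\<close> irreducible over the henselization the value does not depend on the choice of the root.
\<close>

definition root_val ::
    "('a::field \<Rightarrow> 'c::field) \<Rightarrow> ('c \<Rightarrow> 'g vext) \<Rightarrow> 'c poly \<Rightarrow> 'a poly \<Rightarrow> 'g vext" where
  "root_val emb vbar F f = vbar (poly (map_poly emb f) (SOME \<theta>. poly F \<theta> = 0))"

section \<open>The graded algebra and key polynomials\<close>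

definition val_gt :: "('r \<Rightarrow> 'g::linorder vext) \<Rightarrow> 'g \<Rightarrow> 'r set" where
  "val_gt \<mu> \<alpha> = {f. \<mu> f > Fin \<alpha>}"

text \<open>
  An element of the graded algebra is a finitely supported family \<open>x\<close>, where \<open>x \<alpha>\<close> is a coset of
  \<open>{f. \<mu> f > \<alpha>}\<close> in \<open>{f. \<mu> f \<ge> \<alpha>}\<close>. Sums and products of cosets are elementwise; the elementwise
  product of cosets of degrees \<open>\<alpha>\<close> and \<open>\<beta>\<close> is merely contained in a coset of degree \<open>\<alpha> + \<beta>\<close>,
  which is recovered by adding \<open>val_gt \<mu> (\<alpha> + \<beta>)\<close>.
\<close>

definition graded_algebra ::
    "('r::comm_ring_1 \<Rightarrow> 'g::linordered_ab_group_add vext) \<Rightarrow> ('g \<Rightarrow> 'r set) ring" where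
  "graded_algebra \<mu> =
     \<lparr>carrier = {x. (\<forall>\<alpha>. \<exists>f. \<mu> f \<ge> Fin \<alpha> \<and> x \<alpha> = f +o val_gt \<mu> \<alpha>) \<and>
                    finite {\<alpha>. x \<alpha> \<noteq> val_gt \<mu> \<alpha>}},
      monoid.mult = (\<lambda>x y \<gamma>. (\<Sum>\<alpha> | x \<alpha> \<noteq> val_gt \<mu> \<alpha>. x \<alpha> * y (\<gamma> - \<alpha>)) + val_gt \<mu> \<gamma>),
      one = (\<lambda>\<alpha>. if \<alpha> = 0 then 1 +o val_gt \<mu> 0 else val_gt \<mu> \<alpha>),
      ring.zero = val_gt \<mu>,
      add = (\<lambda>x y \<alpha>. x \<alpha> + y \<alpha>)\<rparr>"

text \<open>If \<open>\<mu> f = Infty\<close>, this is the zero element.\<close>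

definition initial_form ::
    "('r::comm_ring_1 \<Rightarrow> 'g::linordered_ab_group_add vext) \<Rightarrow> 'r \<Rightarrow> 'g \<Rightarrow> 'r set" where
  "initial_form \<mu> f = (\<lambda>\<alpha>. if \<mu> f = Fin \<alpha> then f +o val_gt \<mu> \<alpha> else val_gt \<mu> \<alpha>)"

definition mu_equiv ::
    "('r::comm_ring_1 \<Rightarrow> 'g::linordered_ab_group_add vext) \<Rightarrow> 'r \<Rightarrow> 'r \<Rightarrow> bool" where
  "mu_equiv \<mu> f h \<longleftrightarrow> initial_form \<mu> f = initial_form \<mu> h"

definition mu_dvd ::
    "('r::comm_ring_1 \<Rightarrow> 'g::linordered_ab_group_add vext) \<Rightarrow> 'r \<Rightarrow> 'r \<Rightarrow> bool" where
  "mu_dvd \<mu> h f \<longleftrightarrow> initial_form \<mu> h divides\<^bsub>graded_algebra \<mu>\<^esub> initial_form \<mu> f"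

definition KP :: "('a::field poly \<Rightarrow> 'g::linordered_ab_group_add vext) \<Rightarrow> 'a poly set" where
  "KP \<mu> = {\<phi>. lead_coeff \<phi> = 1 \<and> ring_prime\<^bsub>graded_algebra \<mu>\<^esub> (initial_form \<mu> \<phi>) \<and>
              (\<forall>f. f \<noteq> 0 \<and> degree f < degree \<phi> \<longrightarrow> \<not> mu_dvd \<mu> \<phi> f)}"

definition KP_class ::
    "('a::field poly \<Rightarrow> 'g::linordered_ab_group_add vext) \<Rightarrow> 'a poly \<Rightarrow> 'a poly set" where
  "KP_class \<mu> \<phi> = {\<phi>'\<in>KP \<mu>. mu_equiv \<mu> \<phi>' \<phi>}"

definition tangent_direction ::
    "('a::field poly \<Rightarrow> 'g::linorder vext) \<Rightarrow> ('a poly \<Rightarrow> 'g vext) \<Rightarrow> 'a poly set" where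
  "tangent_direction \<mu> \<nu> =
     {\<phi>. lead_coeff \<phi> = 1 \<and> \<mu> \<phi> < \<nu> \<phi> \<and>
         (\<forall>\<psi>. lead_coeff \<psi> = 1 \<and> \<mu> \<psi> < \<nu> \<psi> \<longrightarrow> degree \<phi> \<le> degree \<psi>)}"

section \<open>Augmentation\<close>

text \<open>
  The coefficient \<open>a\<^sub>n\<close> of the \<open>\<phi>\<close>-expansion \<open>f = (\<Sum>n. a\<^sub>n * \<phi> ^ n)\<close>, \<open>degree a\<^sub>n < degree \<phi>\<close>
  (for non-constant \<open>\<phi>\<close>); it vanishes for \<open>n > degree f\<close>.
\<close>

definition phi_coeff :: "'a::field poly \<Rightarrow> 'a poly \<Rightarrow> nat \<Rightarrow> 'a poly" where
  "phi_coeff \<phi> f n = (f div \<phi> ^ n) mod \<phi>"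

text \<open>The inner sum is \<open>n \<gamma>\<close>, with \<open>0 \<cdot> Infty = 0\<close>.\<close>

definition augmentation ::
    "('a::field poly \<Rightarrow> 'g::linordered_ab_group_add vext) \<Rightarrow> 'a poly \<Rightarrow> 'g vext \<Rightarrow>
     'a poly \<Rightarrow> 'g vext" where
  "augmentation \<mu> \<phi> \<gamma> f = (MIN n\<in>{..degree f}. \<mu> (phi_coeff \<phi> f n) + (\<Sum>i<n. \<gamma>))"

definition determined_factor ::
    "('a::field \<Rightarrow> 'c::field) \<Rightarrow> ('c \<Rightarrow> 'g::linordered_rat_vector vext) \<Rightarrow>
     ('a poly \<Rightarrow> 'g vext) \<Rightarrow> 'a poly \<Rightarrow> 'c poly" where
  "determined_factor emb vbar \<mu> \<phi> =
     (THE Q. Q \<in> Irr (henselization emb vbar) \<and> Q dvd map_poly emb \<phi> \<and>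
             augmentation \<mu> \<phi> Infty = root_val emb vbar Q)"

section \<open>Newton polygons\<close>

definition rat_convex_hull ::
    "(rat \<times> 'g::linordered_rat_vector) set \<Rightarrow> (rat \<times> 'g) set" where
  "rat_convex_hull C =
     {(\<Sum>p\<in>S. w p * fst p, \<Sum>p\<in>S. w p *\<^sub>Q snd p) | S w.
        finite S \<and> S \<subseteq> C \<and> (\<forall>p\<in>S. 0 \<le> w p) \<and> sum w S = 1}"

definition lower_convex_hull ::
    "(rat \<times> 'g::linordered_rat_vector) set \<Rightarrow> (rat \<times> 'g) set" where
  "lower_convex_hull C =
     {(s, \<alpha>) | s \<alpha>. (s, \<alpha>) \<in> rat_convex_hull C \<and> (\<forall>\<beta>. (s, \<beta>) \<in> rat_convex_hull C \<longrightarrow> \<alpha> \<le> \<beta>)}"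

definition newton_polygon ::
    "('a::field poly \<Rightarrow> 'g::linordered_rat_vector vext) \<Rightarrow> 'a poly \<Rightarrow> 'a poly \<Rightarrow>
     (rat \<times> 'g) set" where
  "newton_polygon \<mu> \<phi> g =
     lower_convex_hull {(of_nat n, \<alpha>) | n \<alpha>. phi_coeff \<phi> g n \<noteq> 0 \<and> \<mu> (phi_coeff \<phi> g n) = Fin \<alpha>}"

definition polygon_component ::
    "'g::linordered_rat_vector \<Rightarrow> (rat \<times> 'g) set \<Rightarrow> (rat \<times> 'g) set" where
  "polygon_component lam N =
     {p\<in>N. \<forall>q\<in>N. snd p + fst p *\<^sub>Q lam \<le> snd q + fst q *\<^sub>Q lam}"

text \<open>\<open>N\<close> has a side of slope \<open>-lam\<close>, namely \<open>polygon_component lam N\<close>.\<close>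

definition has_side :: "'g::linordered_rat_vector \<Rightarrow> (rat \<times> 'g) set \<Rightarrow> bool" where
  "has_side lam N \<longleftrightarrow> (\<exists>p\<in>polygon_component lam N. \<exists>q\<in>polygon_component lam N. p \<noteq> q)"

text \<open>The sides of slope less than \<open>-\<mu> \<phi>\<close>, or the left endpoint if there are none.\<close>

definition principal_polygon ::
    "('a::field poly \<Rightarrow> 'g::linordered_rat_vector vext) \<Rightarrow> 'a poly \<Rightarrow> 'a poly \<Rightarrow>
     (rat \<times> 'g) set" where
  "principal_polygon \<mu> \<phi> g =
     (let N = newton_polygon \<mu> \<phi> g;
          \<Lambda> = {lam. has_side lam N \<and> Fin lam > \<mu> \<phi>}
      in if \<Lambda> = {} then {p\<in>N. \<forall>q\<in>N. fst p \<le> fst q}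
         else (\<Union>lam\<in>\<Lambda>. polygon_component lam N))"

definition horizontal_length :: "(rat \<times> 'g) set \<Rightarrow> rat" where
  "horizontal_length S = (GREATEST x. x \<in> fst ` S) - (LEAST x. x \<in> fst ` S)"

section \<open>Sets of irreducible factors\<close>

definition factors_along ::
    "('a::field \<Rightarrow> 'c::field) \<Rightarrow> ('c \<Rightarrow> 'g::linordered_rat_vector vext) \<Rightarrow>
     ('a poly \<Rightarrow> 'g vext) \<Rightarrow> 'a poly \<Rightarrow> 'a poly \<Rightarrow> 'c poly multiset" where
  "factors_along emb vbar \<mu> \<phi> g =
     {#G \<in># irr_factors (henselization emb vbar) (map_poly emb g).
        \<mu> < root_val emb vbar G \<and> tangent_direction \<mu> (root_val emb vbar G) = KP_class \<mu> \<phi>#}"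

definition factors_at ::
    "('a::field \<Rightarrow> 'c::field) \<Rightarrow> ('c \<Rightarrow> 'g::linordered_rat_vector vext) \<Rightarrow>
     ('a poly \<Rightarrow> 'g vext) \<Rightarrow> 'a poly \<Rightarrow> 'a poly \<Rightarrow> 'g \<Rightarrow> 'c poly multiset" where
  "factors_at emb vbar \<mu> \<phi> g lam =
     {#G \<in># factors_along emb vbar \<mu> \<phi> g. root_val emb vbar G \<phi> = Fin lam#}"

end

(* Everything is reduced to counting roots in the algebraic closure. The roots of phi at which
   f |-> vbar (f theta) dominates mu form one orbit under the decomposition group; they are the roots
   of Q. For gamma > mu phi, the set D of all theta that dominate mu and satisfy vbar (phi theta) >= gamma
   is a disjoint union of balls of equal type around this orbit, and on each of these balls the Gauss
   valuation agrees with the augmentation [mu; phi, gamma] on K[x]. Adjoining an infinitesimal to the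
   value group (a lexicographic product with the rationals) turns the infinitesimal part of the Gauss
   value of f into the number of roots of f in an open or a closed ball, so the extreme minimal indices
   of the phi-expansion of g count roots: their difference times deg Q is the number of roots of g in D
   with vbar (phi theta) = gamma. This is (ii), with the difference being the length of the side.
   For (i), a valuation that extends vbar to polynomials has the same values on K^h[x] as on K[x] up to
   differences of values (the henselization is immediate); hence the infinitesimal part of the value of G
   is integral, and deg G is an integral multiple of deg Q. *)

theory Submission
  imports Defs "HOL-Library.Product_Lexorder" "HOL-Library.Product_Plus"
begin

subsection \<open>Polynomials over a subfield\<close>

text \<open>K may be imperfect, so roots need not be separable, whereas the henselization consists
  of separable elements. Hence statements about a root \<theta> are proved for a separable power
  \<theta>^q, and multiplicities of roots in \<phi> and in Q have to be compared before degrees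
  become root counts. The henselization enters as a fixed field: automorphisms preserving
  \<open>vbar\<close> fix it, and they are built by extending embeddings one algebraic element at a
  time. The value at one radius does not show how many roots a ball contains; the count is the rate
  at which the value changes with the radius. The perturbation is put into \<gamma> and not into the
  radius, because the expansion only knows \<gamma>. The infinitesimal part of the radius then
  depends on the number of roots of \<phi> in the ball, so what one reads off is a ratio of two
  counts. A factor G has no expansion whose coefficients \<mu> could value, as its coefficients lie
  outside K. A unit of K^h whose conjugates have positive value whenever they accompany another
  conjugate of G isolates G among its conjugates, and then the value of G is expressed by
  coefficients in K[x].\<close>

definition is_subfield :: "'c::field set \<Rightarrow> bool" where
  "is_subfield E \<longleftrightarrow> 1 \<in> E \<and> (\<forall>x\<in>E. \<forall>y\<in>E. x - y \<in> E \<and> x * y \<in> E) \<and> (\<forall>x\<in>E. inverse x \<in> E)"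

lemma is_subfieldD:
  assumes "is_subfield E"
  shows "1 \<in> E" "0 \<in> E" "x \<in> E \<Longrightarrow> y \<in> E \<Longrightarrow> x - y \<in> E" "x \<in> E \<Longrightarrow> y \<in> E \<Longrightarrow> x * y \<in> E"
    "x \<in> E \<Longrightarrow> inverse x \<in> E" "x \<in> E \<Longrightarrow> - x \<in> E" "x \<in> E \<Longrightarrow> y \<in> E \<Longrightarrow> x + y \<in> E"
    "x \<in> E \<Longrightarrow> y \<in> E \<Longrightarrow> x / y \<in> E" "x \<in> E \<Longrightarrow> x ^ n \<in> E"
proof -
  have 1: "1 \<in> E" and m: "\<And>x y. x \<in> E \<Longrightarrow> y \<in> E \<Longrightarrow> x - y \<in> E" "\<And>x y. x \<in> E \<Longrightarrow> y \<in> E \<Longrightarrow> x * y \<in> E"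
    and i: "\<And>x. x \<in> E \<Longrightarrow> inverse x \<in> E"
    using assms by (auto simp: is_subfield_def)
  have 0: "0 \<in> E" using m(1)[OF 1 1] by simp
  have n: "- x \<in> E" if "x \<in> E" for x using m(1)[OF 0 that] by simp
  show "1 \<in> E" "0 \<in> E" "x \<in> E \<Longrightarrow> y \<in> E \<Longrightarrow> x - y \<in> E" "x \<in> E \<Longrightarrow> y \<in> E \<Longrightarrow> x * y \<in> E"
    "x \<in> E \<Longrightarrow> inverse x \<in> E" "x \<in> E \<Longrightarrow> - x \<in> E"
    by (fact 1 0 m i n)+
  show "x \<in> E \<Longrightarrow> y \<in> E \<Longrightarrow> x + y \<in> E" using m(1)[of x "- y"] n[of y] by simp
  show "x \<in> E \<Longrightarrow> y \<in> E \<Longrightarrow> x / y \<in> E" using m(2)[of x "inverse y"] i[of y] by (simp add: divide_inverse)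
  show "x \<in> E \<Longrightarrow> x ^ n \<in> E" by (induction n) (auto intro: 1 m(2))
qed

lemma sum_in_subfield: "is_subfield E \<Longrightarrow> (\<And>i. i \<in> I \<Longrightarrow> f i \<in> E) \<Longrightarrow> sum f I \<in> E"
  by (induction I rule: infinite_finite_induct) (auto simp: is_subfieldD)

lemma polys_overI: "(\<And>i. coeff p i \<in> E) \<Longrightarrow> p \<in> polys_over E"
  and polys_overD: "p \<in> polys_over E \<Longrightarrow> coeff p i \<in> E"
  by (auto simp: polys_over_def)

lemma polys_over_mono: "p \<in> polys_over E \<Longrightarrow> E \<subseteq> F \<Longrightarrow> p \<in> polys_over F"
  by (auto simp: polys_over_def)

lemma polys_over_closed:
  assumes "is_subfield E"
  shows "0 \<in> polys_over E" "1 \<in> polys_over E"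
    "p \<in> polys_over E \<Longrightarrow> q \<in> polys_over E \<Longrightarrow> p + q \<in> polys_over E"
    "p \<in> polys_over E \<Longrightarrow> q \<in> polys_over E \<Longrightarrow> p - q \<in> polys_over E"
    "p \<in> polys_over E \<Longrightarrow> - p \<in> polys_over E"
    "p \<in> polys_over E \<Longrightarrow> q \<in> polys_over E \<Longrightarrow> p * q \<in> polys_over E"
    "a \<in> E \<Longrightarrow> p \<in> polys_over E \<Longrightarrow> pCons a p \<in> polys_over E"
    "a \<in> E \<Longrightarrow> p \<in> polys_over E \<Longrightarrow> smult a p \<in> polys_over E"
    "a \<in> E \<Longrightarrow> monom a n \<in> polys_over E"
    "p \<in> polys_over E \<Longrightarrow> p ^ n \<in> polys_over E"
proof -
  show m: "p \<in> polys_over E \<Longrightarrow> q \<in> polys_over E \<Longrightarrow> p * q \<in> polys_over E" for p q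
    by (rule polys_overI) (auto simp: coeff_mult intro!: sum_in_subfield is_subfieldD[OF assms] polys_overD assms)
  show o: "1 \<in> polys_over E"
    by (rule polys_overI) (auto simp: is_subfieldD[OF assms] one_pCons coeff_pCons split: nat.splits)
  show "p \<in> polys_over E \<Longrightarrow> p ^ n \<in> polys_over E" by (induction n) (auto intro: m o)
qed (auto simp: polys_over_def is_subfieldD[OF assms] coeff_pCons coeff_monom split: nat.splits)

lemma polys_over_prod: "is_subfield E \<Longrightarrow> (\<And>i. i \<in> I \<Longrightarrow> f i \<in> polys_over E) \<Longrightarrow> prod f I \<in> polys_over E"
  by (induction I rule: infinite_finite_induct) (auto simp: polys_over_closed)

lemma polys_over_pderiv:
  assumes "is_subfield E" "p \<in> polys_over E" shows "pderiv p \<in> polys_over E"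
proof -
  have n: "of_nat n \<in> E" for n by (induction n) (auto simp: is_subfieldD[OF assms(1)])
  then show ?thesis
    by (intro polys_overI) (auto simp only: coeff_pderiv intro!: is_subfieldD[OF assms(1)] polys_overD[OF assms(2)])
qed

lemma polys_over_pcompose:
  assumes E: "is_subfield E" and "p \<in> polys_over E" and q: "q \<in> polys_over E"
  shows "pcompose p q \<in> polys_over E"
  using assms(2)
proof (induction p)
  case (pCons a p)
  have "a \<in> E" using polys_overD[OF pCons.prems, of 0] by simp
  moreover have "p \<in> polys_over E" using polys_overD[OF pCons.prems, of "Suc i" for i] by (intro polys_overI) auto
  ultimately show ?case using pCons.IH q by (auto simp: pcompose_pCons polys_over_closed[OF E])
qed (simp add: polys_over_closed[OF E])

lemma poly_in_subfield: "is_subfield E \<Longrightarrow> p \<in> polys_over E \<Longrightarrow> x \<in> E \<Longrightarrow> poly p x \<in> E"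
  unfolding poly_altdef by (intro sum_in_subfield is_subfieldD polys_overD)

text \<open>Long division only divides by the leading coefficient of q, so it stays over E.
  Uniqueness of quotient and remainder in the ambient ring then identifies them with
  \<open>div\<close> and \<open>mod\<close>.\<close>

lemma polys_over_div_mod_exists:
  assumes E: "is_subfield E" and p: "p \<in> polys_over E" and q: "q \<in> polys_over E" "q \<noteq> 0"
  shows "\<exists>d\<in>polys_over E. \<exists>r\<in>polys_over E. p = d * q + r \<and> (r = 0 \<or> degree r < degree q)"
  using p
proof (induction "degree p" arbitrary: p rule: less_induct)
  case less
  show ?case
  proof (cases "p = 0 \<or> degree p < degree q")
    case True
    then show ?thesis using less.prems polys_over_closed[OF E] by (intro bexI[of _ 0] bexI[of _ p]) auto
  next
    case False
    define t where "t = monom (lead_coeff p / lead_coeff q) (degree p - degree q)"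
    have t: "t \<in> polys_over E"
      using less.prems q by (auto simp: t_def intro!: polys_over_closed E is_subfieldD polys_overD)
    define p' where "p' = p - t * q"
    have p': "p' \<in> polys_over E" using t q less.prems by (auto simp: p'_def polys_over_closed[OF E])
    have nz: "lead_coeff p / lead_coeff q \<noteq> 0" using False q by auto
    have "degree (t * q) = degree p"
      using nz q False by (subst degree_mult_eq) (auto simp: t_def degree_monom_eq)
    moreover have "lead_coeff (t * q) = lead_coeff p"
      using nz q by (subst lead_coeff_mult) (auto simp: t_def degree_monom_eq)
    ultimately have deg: "p' = 0 \<or> degree p' < degree p"
      unfolding p'_def using degree_diff_le[of p "degree p" "t * q"] eq_zero_or_degree_less[of "p - t * q" "degree p"]
      by auto
    show ?thesis
    proof (cases "p' = 0")
      case True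
      then show ?thesis using t p'_def polys_over_closed[OF E] by (intro bexI[of _ t] bexI[of _ 0]) auto
    next
      case False
      then obtain d r where "d \<in> polys_over E" "r \<in> polys_over E" "p' = d * q + r" "r = 0 \<or> degree r < degree q"
        using less.hyps[OF _ p'] deg by auto
      then show ?thesis using t
        by (intro bexI[of _ "t + d"] bexI[of _ r]) (auto simp: p'_def algebra_simps polys_over_closed[OF E])
    qed
  qed
qed

lemma polys_over_div_mod:
  assumes E: "is_subfield E" and p: "p \<in> polys_over E" and q: "q \<in> polys_over E"
  shows "p div q \<in> polys_over E" "p mod q \<in> polys_over E"
proof -
  have "p div q \<in> polys_over E \<and> p mod q \<in> polys_over E"
  proof (cases "q = 0")
    case True
    then show ?thesis using p polys_over_closed[OF E] by simp
  next
    case False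
    then obtain d r where dr: "d \<in> polys_over E" "r \<in> polys_over E" "p = d * q + r" "r = 0 \<or> degree r < degree q"
      using polys_over_div_mod_exists[OF E p q] by blast
    have "r mod q = r" "r div q = 0" using dr(4) by (auto simp: mod_poly_less div_poly_less)
    then have "p div q = d" "p mod q = r" using dr(3) False by (simp_all add: div_mult_self3)
    then show ?thesis using dr by simp
  qed
  then show "p div q \<in> polys_over E" "p mod q \<in> polys_over E" by auto
qed

lemma polys_over_dvd_factor:
  assumes "is_subfield E" "p * q \<in> polys_over E" "p \<in> polys_over E" "p \<noteq> 0"
  shows "q \<in> polys_over E"
  using polys_over_div_mod(1)[OF assms(1,2,3)] assms(4) by simp

text \<open>A nonzero combination of least degree divides every combination, because the remainder
  is again one. This keeps the cofactors over E, which a gcd taken in the ambient ring would not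
  show.\<close>

lemma polys_over_ideal_generator:
  assumes E: "is_subfield E" and f: "f \<in> polys_over E" and g: "g \<in> polys_over E" and nz: "f \<noteq> 0"
  shows "\<exists>A\<in>polys_over E. \<exists>B\<in>polys_over E. A * f + B * g \<noteq> 0 \<and> A * f + B * g dvd f \<and> A * f + B * g dvd g"
proof -
  define I where "I = {A * f + B * g | A B. A \<in> polys_over E \<and> B \<in> polys_over E}"
  note c = polys_over_closed[OF E]
  have fI: "f \<in> I" unfolding I_def mem_Collect_eq by (rule exI[of _ 1], rule exI[of _ 0]) (auto simp: c)
  have gI: "g \<in> I" unfolding I_def mem_Collect_eq by (rule exI[of _ 0], rule exI[of _ 1]) (auto simp: c)
  obtain d where d: "d \<in> I" "d \<noteq> 0" and min: "\<And>e. e \<in> I \<Longrightarrow> e \<noteq> 0 \<Longrightarrow> degree d \<le> degree e"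
    using arg_min_nat_lemma[of "\<lambda>d. d \<in> I \<and> d \<noteq> 0" f degree] fI nz by blast
  obtain A B where AB: "A \<in> polys_over E" "B \<in> polys_over E" "d = A * f + B * g" using d(1) by (auto simp: I_def)
  have dE: "d \<in> polys_over E" using AB f g c by auto
  have dvd: "d dvd h" if h: "h \<in> I" for h
  proof -
    obtain A' B' where h': "A' \<in> polys_over E" "B' \<in> polys_over E" "h = A' * f + B' * g" using h by (auto simp: I_def)
    then have hE: "h \<in> polys_over E" using f g c by auto
    have "h mod d = h - h div d * d" by (metis minus_div_mult_eq_mod)
    also have "\<dots> = (A' - h div d * A) * f + (B' - h div d * B) * g" by (simp add: AB(3) h'(3) algebra_simps)
    finally have "h mod d = (A' - h div d * A) * f + (B' - h div d * B) * g" .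
    moreover have "A' - h div d * A \<in> polys_over E" "B' - h div d * B \<in> polys_over E"
      using polys_over_div_mod(1)[OF E hE dE] h'(1,2) AB(1,2) c(4,6) by auto
    ultimately have "h mod d \<in> I" unfolding I_def mem_Collect_eq by blast
    then have "h mod d = 0" using min[of "h mod d"] degree_mod_less[OF d(2), of h] by (metis not_le)
    then show ?thesis by auto
  qed
  show ?thesis using AB d dvd[OF fI] dvd[OF gI] by blast
qed

section \<open>Irreducible polynomials over a subfield and minimal polynomials\<close>

lemma IrrD:
  assumes "F \<in> Irr E"
  shows "F \<in> polys_over E" "lead_coeff F = 1" "degree F > 0" "F \<noteq> 0"
    "p \<in> polys_over E \<Longrightarrow> q \<in> polys_over E \<Longrightarrow> F = p * q \<Longrightarrow> degree p = 0 \<or> degree q = 0"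
  using assms by (auto simp: Irr_def)

text \<open>A common divisor of P and f over E is constant or, by irreducibility, associated to P;
  the second case would make P divide f.\<close>

lemma Irr_bezout:
  assumes E: "is_subfield E" and P: "P \<in> Irr E" and f: "f \<in> polys_over E" and nd: "\<not> P dvd f"
  shows "\<exists>A\<in>polys_over E. \<exists>B\<in>polys_over E. A * P + B * f = 1"
proof -
  obtain A B where AB: "A \<in> polys_over E" "B \<in> polys_over E" and nz: "A * P + B * f \<noteq> 0"
    and dP: "A * P + B * f dvd P" and df: "A * P + B * f dvd f"
    using polys_over_ideal_generator[OF E IrrD(1)[OF P] f IrrD(4)[OF P]] by blast
  define d where "d = A * P + B * f"
  have dE: "d \<in> polys_over E" using AB f IrrD(1)[OF P] polys_over_closed[OF E] by (auto simp: d_def)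
  obtain r where r: "P = d * r" using dP by (auto simp: d_def)
  have dnz: "d \<noteq> 0" using nz by (simp add: d_def)
  have rE: "r \<in> polys_over E" by (rule polys_over_dvd_factor[OF E _ dE dnz]) (use r IrrD(1)[OF P] in simp)
  have "degree d = 0 \<or> degree r = 0" by (rule IrrD(5)[OF P dE rE r])
  moreover have "degree r \<noteq> 0"
  proof
    assume "degree r = 0"
    then obtain c where "r = [:c:]" by (rule degree_eq_zeroE)
    then have "P = smult c d" "c \<noteq> 0" using r IrrD(4)[OF P] by auto
    then have "P dvd d" by (metis dvd_refl smult_dvd)
    then show False using nd df dvd_trans unfolding d_def by blast
  qed
  ultimately obtain c where c: "d = [:c:]" by (auto elim: degree_eq_zeroE)
  have cE: "c \<in> E" "c \<noteq> 0" using polys_overD[OF dE, of 0] dnz by (simp_all add: c)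
  show ?thesis
  proof (intro bexI)
    have "smult (inverse c) A * P + smult (inverse c) B * f = smult (inverse c) d"
      by (simp only: d_def smult_add_right mult_smult_left)
    then show "smult (inverse c) A * P + smult (inverse c) B * f = 1"
      using c cE by simp
  qed (use AB cE polys_over_closed[OF E] is_subfieldD[OF E] in auto)
qed

text \<open>At a common root a Bezout relation would read 0 = 1. So divisibility by P is decided at
  a single root.\<close>

lemma Irr_dvd:
  assumes E: "is_subfield E" and P: "P \<in> Irr E" and f: "f \<in> polys_over E" and "poly P x = 0" "poly f x = 0"
  shows "P dvd f"
proof (rule ccontr)
  assume "\<not> P dvd f"
  then obtain A B where "A * P + B * f = 1" using Irr_bezout[OF E P f] by blast
  then have "poly (A * P + B * f) x = 1" by simp
  then show False using assms by simp
qed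

lemma Irr_unique:
  assumes E: "is_subfield E" and P: "P \<in> Irr E" and Q: "Q \<in> Irr E" and "poly P x = 0" "poly Q x = 0"
  shows "P = Q"
proof -
  have "P dvd Q" using Irr_dvd[OF E P IrrD(1)[OF Q]] assms by auto
  then obtain r where r: "Q = P * r" by blast
  have "degree P = 0 \<or> degree r = 0"
    by (rule IrrD(5)[OF Q IrrD(1)[OF P] _ r])
      (rule polys_over_dvd_factor[OF E _ IrrD(1,4)[OF P]], use r IrrD(1)[OF Q] in simp)
  then obtain c where "r = [:c:]" using IrrD(3)[OF P] by (auto elim: degree_eq_zeroE)
  moreover from this have "c = 1" using r IrrD(2)[OF P] IrrD(2)[OF Q] by (cases "c = 0") auto
  ultimately show ?thesis using r by simp
qed

definition algebraic_over :: "'c::field set \<Rightarrow> 'c \<Rightarrow> bool" where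
  "algebraic_over E x \<longleftrightarrow> (\<exists>p\<in>polys_over E. p \<noteq> 0 \<and> poly p x = 0)"

lemma algebraic_over_mono: "algebraic_over E x \<Longrightarrow> E \<subseteq> F \<Longrightarrow> algebraic_over F x"
  unfolding algebraic_over_def using polys_over_mono by blast

text \<open>Take a nonzero polynomial of least degree vanishing at x and make it monic. In a
  factorization one factor vanishes at x and so has full degree.\<close>

lemma Irr_exists:
  assumes E: "is_subfield E" and x: "algebraic_over E x"
  shows "\<exists>P\<in>Irr E. poly P x = 0"
proof -
  let ?S = "\<lambda>p. p \<in> polys_over E \<and> p \<noteq> 0 \<and> poly p x = 0"
  obtain p0 where "?S p0" using x by (auto simp: algebraic_over_def)
  then obtain p where p: "?S p" and min: "\<And>q. ?S q \<Longrightarrow> degree p \<le> degree q"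
    using arg_min_nat_lemma[of ?S p0 degree] by blast
  define P where "P = smult (inverse (lead_coeff p)) p"
  have PE: "P \<in> polys_over E" using p by (auto simp: P_def intro!: polys_over_closed E is_subfieldD polys_overD)
  have P: "?S P" "lead_coeff P = 1" "degree P = degree p" using p PE by (auto simp: P_def)
  have "degree P > 0"
  proof (rule ccontr)
    assume "\<not> ?thesis"
    then obtain c where "P = [:c:]" by (auto elim: degree_eq_zeroE)
    then show False using P by auto
  qed
  moreover have "degree a = 0 \<or> degree b = 0" if ab: "a \<in> polys_over E" "b \<in> polys_over E" "P = a * b" for a b
  proof -
    have nz: "a \<noteq> 0" "b \<noteq> 0" using P(1) ab(3) by auto
    then have d: "degree P = degree a + degree b" using ab(3) degree_mult_eq by blast
    have "poly a x = 0 \<or> poly b x = 0" using P(1) ab(3) by auto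
    then have "degree p \<le> degree a \<or> degree p \<le> degree b" using min ab nz by blast
    then show ?thesis using d P(3) by auto
  qed
  ultimately have "P \<in> Irr E" using P PE by (auto simp: Irr_def)
  then show ?thesis using P by blast
qed

subsection \<open>Simple extensions and their embeddings\<close>

text \<open>The ring E[x], which is the field E(x) as soon as x is algebraic.\<close>

definition adjoin :: "'c::field set \<Rightarrow> 'c \<Rightarrow> 'c set" where
  "adjoin E x = {poly f x | f. f \<in> polys_over E}"

lemma adjoinI: "f \<in> polys_over E \<Longrightarrow> y = poly f x \<Longrightarrow> y \<in> adjoin E x"
  by (auto simp: adjoin_def)

lemma adjoin_base: assumes "is_subfield E" "a \<in> E" shows "a \<in> adjoin E x"
  by (rule adjoinI[of "[:a:]"]) (auto simp: assms polys_over_closed)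

lemma adjoin_gen: assumes "is_subfield E" shows "x \<in> adjoin E x"
  by (rule adjoinI[of "[:0,1:]"]) (auto simp: polys_over_closed[OF assms] is_subfieldD[OF assms])

lemma adjoin_mono: "E \<subseteq> F \<Longrightarrow> adjoin E x \<subseteq> adjoin F x"
  unfolding adjoin_def using polys_over_mono by blast

text \<open>Inverses come from a Bezout relation with the minimal polynomial of x.\<close>

lemma is_subfield_adjoin:
  assumes E: "is_subfield E" and x: "algebraic_over E x"
  shows "is_subfield (adjoin E x)"
  unfolding is_subfield_def
proof (intro conjI ballI)
  note c = polys_over_closed[OF E]
  show "1 \<in> adjoin E x" by (rule adjoin_base) (auto simp: E is_subfieldD[OF E])
  fix y z assume y: "y \<in> adjoin E x"
  then obtain f where f: "f \<in> polys_over E" "y = poly f x" by (auto simp: adjoin_def)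
  { assume "z \<in> adjoin E x"
    then obtain g where g: "g \<in> polys_over E" "z = poly g x" by (auto simp: adjoin_def)
    show "y - z \<in> adjoin E x" by (rule adjoinI[of "f - g"]) (auto simp: f g c)
    show "y * z \<in> adjoin E x" by (rule adjoinI[of "f * g"]) (auto simp: f g c) }
  show "inverse y \<in> adjoin E x"
  proof (cases "y = 0")
    case True
    then show ?thesis using adjoin_base[OF E, of 0] is_subfieldD[OF E] by simp
  next
    case False
    obtain P where P: "P \<in> Irr E" "poly P x = 0" using Irr_exists[OF E x] by blast
    have "\<not> P dvd f" using P False f by (auto elim!: dvdE)
    then obtain A B where AB: "B \<in> polys_over E" "A * P + B * f = 1" using Irr_bezout[OF E P(1) f(1)] by blast
    have "poly (A * P + B * f) x = 1" unfolding AB(2) by simp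
    then have "poly B x * y = 1" using P f by simp
    then have "inverse y = poly B x" using False by (simp add: field_simps)
    then show ?thesis using AB(1) by (auto simp: adjoin_def)
  qed
qed

text \<open>\<sigma> is a total function of which the values on E matter; the condition at 1
  excludes the zero map.\<close>

definition is_embedding :: "'c::field set \<Rightarrow> ('c \<Rightarrow> 'c) \<Rightarrow> bool" where
  "is_embedding E \<sigma> \<longleftrightarrow> \<sigma> 1 = 1 \<and>
     (\<forall>x\<in>E. \<forall>y\<in>E. \<sigma> (x + y) = \<sigma> x + \<sigma> y \<and> \<sigma> (x * y) = \<sigma> x * \<sigma> y)"

lemma is_embeddingD:
  assumes E: "is_subfield E" and "is_embedding E \<sigma>"
  shows "\<sigma> 1 = 1" "\<sigma> 0 = 0" "x \<in> E \<Longrightarrow> y \<in> E \<Longrightarrow> \<sigma> (x + y) = \<sigma> x + \<sigma> y"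
    "x \<in> E \<Longrightarrow> y \<in> E \<Longrightarrow> \<sigma> (x * y) = \<sigma> x * \<sigma> y" "x \<in> E \<Longrightarrow> \<sigma> (- x) = - \<sigma> x"
    "x \<in> E \<Longrightarrow> y \<in> E \<Longrightarrow> \<sigma> (x - y) = \<sigma> x - \<sigma> y"
    "x \<in> E \<Longrightarrow> \<sigma> (inverse x) = inverse (\<sigma> x)" "x \<in> E \<Longrightarrow> \<sigma> x = 0 \<longleftrightarrow> x = 0"
    "x \<in> E \<Longrightarrow> \<sigma> (x ^ n) = \<sigma> x ^ n"
    "x \<in> E \<Longrightarrow> y \<in> E \<Longrightarrow> \<sigma> x = \<sigma> y \<longleftrightarrow> x = y"
proof -
  note e = is_subfieldD[OF E]
  have 1: "\<sigma> 1 = 1" and a: "\<And>x y. x \<in> E \<Longrightarrow> y \<in> E \<Longrightarrow> \<sigma> (x + y) = \<sigma> x + \<sigma> y"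
    and m: "\<And>x y. x \<in> E \<Longrightarrow> y \<in> E \<Longrightarrow> \<sigma> (x * y) = \<sigma> x * \<sigma> y"
    using assms(2) by (auto simp: is_embedding_def)
  have 0: "\<sigma> 0 = 0" using a[of 0 0] e(2) by (metis add.right_neutral add_cancel_right_right)
  have n: "\<sigma> (- x) = - \<sigma> x" if "x \<in> E" for x using a[of x "- x"] e that 0 by (simp add: eq_neg_iff_add_eq_0 add.commute)
  have d: "\<sigma> (x - y) = \<sigma> x - \<sigma> y" if "x \<in> E" "y \<in> E" for x y using a[of x "- y"] n e that by simp
  have i: "\<sigma> (inverse x) = inverse (\<sigma> x) \<and> (\<sigma> x = 0 \<longleftrightarrow> x = 0)" if "x \<in> E" for x
  proof (cases "x = 0")
    case False
    then have "\<sigma> x * \<sigma> (inverse x) = 1" using m[of x "inverse x"] e that 1 by simp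
    then show ?thesis using False by (metis inverse_unique mult_zero_left zero_neq_one)
  qed (simp add: 0)
  show "\<sigma> 1 = 1" "\<sigma> 0 = 0" "x \<in> E \<Longrightarrow> y \<in> E \<Longrightarrow> \<sigma> (x + y) = \<sigma> x + \<sigma> y"
    "x \<in> E \<Longrightarrow> y \<in> E \<Longrightarrow> \<sigma> (x * y) = \<sigma> x * \<sigma> y" "x \<in> E \<Longrightarrow> \<sigma> (- x) = - \<sigma> x"
    "x \<in> E \<Longrightarrow> y \<in> E \<Longrightarrow> \<sigma> (x - y) = \<sigma> x - \<sigma> y" by (fact 1 0 a m n d)+
  show "x \<in> E \<Longrightarrow> \<sigma> (inverse x) = inverse (\<sigma> x)" "x \<in> E \<Longrightarrow> \<sigma> x = 0 \<longleftrightarrow> x = 0" using i by auto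
  show "x \<in> E \<Longrightarrow> y \<in> E \<Longrightarrow> \<sigma> x = \<sigma> y \<longleftrightarrow> x = y" using i[of "x - y"] d[of x y] e by auto
  show "x \<in> E \<Longrightarrow> \<sigma> (x ^ n) = \<sigma> x ^ n" by (induction n) (auto simp: 1 m e)
qed

lemma embedding_sum:
  assumes E: "is_subfield E" and s: "is_embedding E \<sigma>" and "\<And>i. i \<in> I \<Longrightarrow> f i \<in> E"
  shows "\<sigma> (sum f I) = (\<Sum>i\<in>I. \<sigma> (f i))"
  using assms(3) by (induction I rule: infinite_finite_induct)
    (auto simp: is_embeddingD[OF E s] sum_in_subfield[OF E])

lemma coeff_map_poly_embedding:
  assumes E: "is_subfield E" and s: "is_embedding E \<sigma>"
  shows "coeff (map_poly \<sigma> p) i = \<sigma> (coeff p i)"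
  by (rule coeff_map_poly) (rule is_embeddingD[OF E s])

lemma map_poly_embedding:
  assumes E: "is_subfield E" and s: "is_embedding E \<sigma>"
  shows "p \<in> polys_over E \<Longrightarrow> q \<in> polys_over E \<Longrightarrow> map_poly \<sigma> (p + q) = map_poly \<sigma> p + map_poly \<sigma> q"
    "p \<in> polys_over E \<Longrightarrow> q \<in> polys_over E \<Longrightarrow> map_poly \<sigma> (p - q) = map_poly \<sigma> p - map_poly \<sigma> q"
    "p \<in> polys_over E \<Longrightarrow> q \<in> polys_over E \<Longrightarrow> map_poly \<sigma> (p * q) = map_poly \<sigma> p * map_poly \<sigma> q"
    "map_poly \<sigma> 1 = 1" "map_poly \<sigma> 0 = 0" "p \<in> polys_over E \<Longrightarrow> map_poly \<sigma> p = 0 \<longleftrightarrow> p = 0"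
    "p \<in> polys_over E \<Longrightarrow> degree (map_poly \<sigma> p) = degree p"
    "x \<in> E \<Longrightarrow> p \<in> polys_over E \<Longrightarrow> poly (map_poly \<sigma> p) (\<sigma> x) = \<sigma> (poly p x)"
    "map_poly \<sigma> [:- x, 1:] = [:\<sigma> (- x), 1:]"
proof -
  note c = coeff_map_poly_embedding[OF E s]
  note d = is_embeddingD[OF E s]
  show "p \<in> polys_over E \<Longrightarrow> q \<in> polys_over E \<Longrightarrow> map_poly \<sigma> (p + q) = map_poly \<sigma> p + map_poly \<sigma> q"
    "p \<in> polys_over E \<Longrightarrow> q \<in> polys_over E \<Longrightarrow> map_poly \<sigma> (p - q) = map_poly \<sigma> p - map_poly \<sigma> q"
    by (auto intro!: poly_eqI simp: c d polys_overD)
  show "p \<in> polys_over E \<Longrightarrow> q \<in> polys_over E \<Longrightarrow> map_poly \<sigma> (p * q) = map_poly \<sigma> p * map_poly \<sigma> q"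
  proof (rule poly_eqI)
    fix n assume "p \<in> polys_over E" "q \<in> polys_over E"
    then show "coeff (map_poly \<sigma> (p * q)) n = coeff (map_poly \<sigma> p * map_poly \<sigma> q) n"
      unfolding c coeff_mult
      by (subst embedding_sum[OF E s]) (auto simp: polys_overD d is_subfieldD[OF E])
  qed
  show "map_poly \<sigma> 1 = 1" using d by (simp add: map_poly_1')
  show "map_poly \<sigma> 0 = 0" by simp
  show z: "p \<in> polys_over E \<Longrightarrow> map_poly \<sigma> p = 0 \<longleftrightarrow> p = 0"
    by (auto simp: poly_eq_iff c d polys_overD)
  show dg: "degree (map_poly \<sigma> p) = degree p" if p: "p \<in> polys_over E"
  proof (cases "p = 0")
    case False
    then have "\<sigma> (lead_coeff p) \<noteq> 0" using d(8)[OF polys_overD[OF p, of "degree p"]] by simp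
    then show ?thesis by (rule map_poly_degree_eq)
  qed simp
  show "poly (map_poly \<sigma> p) (\<sigma> x) = \<sigma> (poly p x)" if "x \<in> E" and p: "p \<in> polys_over E"
    unfolding poly_altdef dg[OF p] c
    using that by (subst embedding_sum[OF E s]) (auto simp: d polys_overD is_subfieldD[OF E])
  show "map_poly \<sigma> [:- x, 1:] = [:\<sigma> (- x), 1:]" using d by (intro poly_eqI) (auto simp: c coeff_pCons split: nat.splits)
qed

text \<open>The image of f(x) does not depend on f: two choices differ by a multiple of P, and
  \<sigma>P vanishes at y.\<close>

lemma extend_embedding:
  assumes E: "is_subfield E" and s: "is_embedding E \<sigma>" and P: "P \<in> Irr E" "poly P x = 0"
    and y: "poly (map_poly \<sigma> P) y = 0"
  shows "\<exists>\<tau>. is_embedding (adjoin E x) \<tau> \<and> (\<forall>f\<in>polys_over E. \<tau> (poly f x) = poly (map_poly \<sigma> f) y)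
    \<and> \<tau> x = y \<and> (\<forall>a\<in>E. \<tau> a = \<sigma> a)"
proof -
  note m = map_poly_embedding[OF E s]
  note c = polys_over_closed[OF E]
  define \<tau> where "\<tau> = (\<lambda>z. poly (map_poly \<sigma> (SOME f. f \<in> polys_over E \<and> z = poly f x)) y)"
  have \<tau>: "\<tau> (poly f x) = poly (map_poly \<sigma> f) y" if f: "f \<in> polys_over E" for f
  proof -
    define g where "g = (SOME g. g \<in> polys_over E \<and> poly f x = poly g x)"
    have g: "g \<in> polys_over E \<and> poly f x = poly g x" unfolding g_def by (rule someI[of _ f]) (simp add: f)
    then have "P dvd f - g" using Irr_dvd[OF E P(1) _ P(2), of "f - g"] c f by simp
    then obtain h where h: "f - g = P * h" by blast
    then have hE: "h \<in> polys_over E"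
      using polys_over_dvd_factor[OF E _ IrrD(1)[OF P(1)] IrrD(4)[OF P(1)]] c(4)[OF f, of g] g by metis
    have "map_poly \<sigma> f - map_poly \<sigma> g = map_poly \<sigma> P * map_poly \<sigma> h"
      using h m(2)[OF f, of g] m(3)[OF IrrD(1)[OF P(1)] hE] g by simp
    then have "poly (map_poly \<sigma> f) y - poly (map_poly \<sigma> g) y = 0"
      using y by (metis mult_zero_left poly_diff poly_mult)
    then show ?thesis by (simp add: \<tau>_def g_def)
  qed
  have b: "\<tau> a = \<sigma> a" if "a \<in> E" for a
    using \<tau>[of "[:a:]"] that c is_embeddingD(2)[OF E s] by (simp add: map_poly_pCons)
  have "is_embedding (adjoin E x) \<tau>"
    unfolding is_embedding_def
  proof (intro conjI ballI)
    show "\<tau> 1 = 1" using b[of 1] is_subfieldD[OF E] is_embeddingD[OF E s] by simp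
    fix u w assume "u \<in> adjoin E x" "w \<in> adjoin E x"
    then obtain f g where fg: "f \<in> polys_over E" "g \<in> polys_over E" "u = poly f x" "w = poly g x"
      by (auto simp: adjoin_def)
    show "\<tau> (u + w) = \<tau> u + \<tau> w" using \<tau>[of "f + g"] fg c m \<tau> by simp
    show "\<tau> (u * w) = \<tau> u * \<tau> w" using \<tau>[of "f * g"] fg c m \<tau> by simp
  qed
  moreover have "\<tau> x = y"
    using \<tau>[of "[:0, 1:]"] c is_subfieldD[OF E] is_embeddingD[OF E s] by (simp add: map_poly_pCons)
  ultimately show ?thesis using \<tau> b by blast
qed

section \<open>Conjugates, and extension of embeddings to the whole closure\<close>

lemma is_subfield_UNIV: "is_subfield UNIV"
  by (auto simp: is_subfield_def)

lemma polys_over_UNIV [simp]: "p \<in> polys_over UNIV"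
  by (auto simp: polys_over_def)

lemma is_embedding_id: "is_embedding E (\<lambda>x. x)"
  by (auto simp: is_embedding_def)

lemma is_embedding_mono: "is_embedding E \<sigma> \<Longrightarrow> F \<subseteq> E \<Longrightarrow> is_embedding F \<sigma>"
  by (auto simp: is_embedding_def)

lemma map_poly_fixed: "p \<in> polys_over E \<Longrightarrow> (\<And>a. a \<in> E \<Longrightarrow> \<sigma> a = a) \<Longrightarrow> 0 \<in> E \<Longrightarrow> map_poly \<sigma> p = p"
  by (intro poly_eqI) (auto simp: coeff_map_poly polys_overD)

text \<open>The isomorphism from E(c) to E(c') over E is extended to E(c)(\<theta>), and the image
  of \<theta> is the required root. Every conjugate of F(\<theta>) is thereby a value of F at a root
  of \<phi>.\<close>

lemma conjugate_lift:
  fixes E :: "'c::alg_closed_field set"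
  assumes E: "is_subfield E" and alg: "\<And>x. algebraic_over E x"
    and m: "m \<in> Irr E" "poly m c = 0" "poly m c' = 0"
    and F: "F \<in> polys_over E" "poly F \<theta> = c" and \<phi>: "\<phi> \<in> polys_over E" "poly \<phi> \<theta> = 0"
  shows "\<exists>\<theta>'. poly \<phi> \<theta>' = 0 \<and> poly F \<theta>' = c'"
proof -
  have "poly (map_poly (\<lambda>x. x) m) c' = 0" using m by (simp add: map_poly_idI)
  then obtain \<tau> where \<tau>: "is_embedding (adjoin E c) \<tau>" "\<tau> c = c'" "\<And>a. a \<in> E \<Longrightarrow> \<tau> a = a"
    using extend_embedding[OF E is_embedding_id m(1,2)] by blast
  let ?F = "adjoin E c"
  have sF: "is_subfield ?F" using E alg by (rule is_subfield_adjoin)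
  have EF: "E \<subseteq> ?F" using adjoin_base[OF E] by blast
  have "algebraic_over ?F \<theta>" using alg EF algebraic_over_mono by blast
  then obtain p where p: "p \<in> Irr ?F" "poly p \<theta> = 0" using Irr_exists[OF sF] by blast
  have "degree (map_poly \<tau> p) > 0" using map_poly_embedding(7)[OF sF \<tau>(1) IrrD(1)[OF p(1)]] IrrD(3)[OF p(1)] by simp
  then obtain y where "poly (map_poly \<tau> p) y = 0" using alg_closed_imp_poly_has_root by blast
  then obtain \<rho> where \<rho>: "is_embedding (adjoin ?F \<theta>) \<rho>" "\<rho> \<theta> = y" "\<And>a. a \<in> ?F \<Longrightarrow> \<rho> a = \<tau> a"
    using extend_embedding[OF sF \<tau>(1) p] by blast
  have fixE: "\<rho> a = a" if "a \<in> E" for a using \<rho>(3) \<tau>(3) EF that by auto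
  have sG: "is_subfield (adjoin ?F \<theta>)" using sF alg EF algebraic_over_mono is_subfield_adjoin by metis
  have EG: "E \<subseteq> adjoin ?F \<theta>" using EF adjoin_base[OF sF] by blast
  have *: "poly f y = \<rho> (poly f \<theta>)" if "f \<in> polys_over E" for f
    using map_poly_embedding(8)[OF sG \<rho>(1) adjoin_gen[OF sF] polys_over_mono[OF that EG]]
      map_poly_fixed[OF that, of \<rho>] fixE is_subfieldD[OF E] \<rho>(2) by simp
  have "\<rho> 0 = 0" using fixE is_subfieldD[OF E] by simp
  moreover have "c \<in> ?F" by (rule adjoin_gen[OF E])
  ultimately show ?thesis using *[OF F(1)] *[OF \<phi>(1)] F(2) \<phi>(2) \<rho>(3) \<tau>(2) by (intro exI[of _ y]) simp
qed

text \<open>Zorn's lemma is applied to the graphs of the partial embeddings.\<close>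

lemma extend_embedding_UNIV:
  fixes K E\<^sub>0 :: "'c::field set" and u :: "'c \<Rightarrow> 'z"
  assumes alg: "\<And>x. algebraic_over K x"
    and step: "\<And>E \<sigma> x. K \<subseteq> E \<Longrightarrow> is_subfield E \<Longrightarrow> is_embedding E \<sigma> \<Longrightarrow> \<forall>a\<in>K. \<sigma> a = a \<Longrightarrow> \<forall>a\<in>E. u (\<sigma> a) = u a
        \<Longrightarrow> \<exists>\<tau>. is_embedding (adjoin E x) \<tau> \<and> (\<forall>a\<in>E. \<tau> a = \<sigma> a) \<and> (\<forall>a\<in>adjoin E x. u (\<tau> a) = u a)"
    and init: "K \<subseteq> E\<^sub>0" "is_subfield E\<^sub>0" "is_embedding E\<^sub>0 \<sigma>\<^sub>0" "\<forall>a\<in>K. \<sigma>\<^sub>0 a = a" "\<forall>a\<in>E\<^sub>0. u (\<sigma>\<^sub>0 a) = u a"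
  shows "\<exists>\<tau>. is_embedding UNIV \<tau> \<and> (\<forall>a\<in>E\<^sub>0. \<tau> a = \<sigma>\<^sub>0 a) \<and> (\<forall>a. u (\<tau> a) = u a)"
proof -
  \<comment> \<open>\<open>u\<close> is an arbitrary function that the extensions have to preserve;
    a constant function gives the extension of plain embeddings.\<close>
  define good where "good E \<sigma> \<longleftrightarrow> E\<^sub>0 \<subseteq> E \<and> is_subfield E \<and> is_embedding E \<sigma> \<and> (\<forall>a\<in>E\<^sub>0. \<sigma> a = \<sigma>\<^sub>0 a) \<and> (\<forall>a\<in>E. u (\<sigma> a) = u a)"
    for E \<sigma>
  define G where "G E \<sigma> = {(x, \<sigma> x) | x. x \<in> E}" for E :: "'c set" and \<sigma> :: "'c \<Rightarrow> 'c"
  define A where "A = {G E \<sigma> | E \<sigma>. good E \<sigma>}"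
  have "\<exists>M\<in>A. \<forall>X\<in>A. M \<subseteq> X \<longrightarrow> X = M"
  proof (rule subset_Zorn_nonempty)
    show "A \<noteq> {}" using init by (auto simp: A_def good_def)
    fix C assume C: "C \<noteq> {}" "subset.chain A C"
    define U where "U = \<Union>C"
    define E where "E = Domain U"
    define \<sigma> where "\<sigma> x = (SOME y. (x, y) \<in> U)" for x
    have sub: "\<exists>E' \<sigma>'. good E' \<sigma>' \<and> G E' \<sigma>' \<in> C \<and> p \<in> G E' \<sigma>' \<and> q \<in> G E' \<sigma>'" if pq: "p \<in> U" "q \<in> U" for p q
    proof -
      obtain R S where RS: "R \<in> C" "S \<in> C" "p \<in> R" "q \<in> S" using pq by (auto simp: U_def)
      then have "R \<subseteq> S \<or> S \<subseteq> R" using C(2) by (auto simp: subset_chain_def)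
      then obtain T where "T \<in> C" "p \<in> T" "q \<in> T" using RS by blast
      moreover have "T \<in> A" using \<open>T \<in> C\<close> C(2) by (auto simp: subset_chain_def)
      ultimately show ?thesis unfolding A_def by blast
    qed
    have sv: "y = z" if "(x, y) \<in> U" "(x, z) \<in> U" for x y z
      using sub[OF that] by (auto simp: G_def)
    have \<sigma>: "\<sigma> x = y" if "(x, y) \<in> U" for x y
      unfolding \<sigma>_def by (rule some_equality) (use sv that in blast)+
    have \<sigma>U: "(x, \<sigma> x) \<in> U" if "x \<in> E" for x using that \<sigma> by (auto simp: E_def)
    \<comment> \<open>Field axioms and homomorphism laws involve at most two elements at a time, and
      these lie in one member of the chain.\<close>
    have pair: "\<exists>E' \<sigma>'. good E' \<sigma>' \<and> x \<in> E' \<and> y \<in> E' \<and> E' \<subseteq> E \<and> (\<forall>z\<in>E'. \<sigma> z = \<sigma>' z)"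
      if xy: "x \<in> E" "y \<in> E" for x y
    proof -
      obtain E' \<sigma>' where g: "good E' \<sigma>'" "G E' \<sigma>' \<in> C" "(x, \<sigma> x) \<in> G E' \<sigma>'" "(y, \<sigma> y) \<in> G E' \<sigma>'"
        using sub[OF \<sigma>U[OF xy(1)] \<sigma>U[OF xy(2)]] by blast
      have in_U: "(z, \<sigma>' z) \<in> U" if "z \<in> E'" for z
        unfolding U_def by (rule UnionI[OF g(2)]) (use that in \<open>simp add: G_def\<close>)
      show ?thesis
      proof (intro exI conjI ballI)
        show "E' \<subseteq> E" using in_U by (auto simp: E_def)
        show "\<sigma> z = \<sigma>' z" if "z \<in> E'" for z using in_U[OF that] \<sigma> by blast
      qed (use g in \<open>auto simp: G_def\<close>)
    qed
    have E0: "E\<^sub>0 \<subseteq> E"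
    proof -
      obtain R where "R \<in> C" using C by blast
      then obtain E' \<sigma>' where g: "good E' \<sigma>'" "R = G E' \<sigma>'" using C(2) unfolding subset_chain_def A_def by blast
      then have "(x, \<sigma>' x) \<in> U" if "x \<in> E'" for x
        unfolding U_def by (intro UnionI[OF \<open>R \<in> C\<close>]) (use that g(2) in \<open>simp add: G_def\<close>)
      then show ?thesis using g by (auto simp: E_def good_def)
    qed
    have "good E \<sigma>"
      unfolding good_def
    proof (intro conjI ballI)
      show "E\<^sub>0 \<subseteq> E" by (rule E0)
      show "is_subfield E" unfolding is_subfield_def
      proof (intro conjI ballI)
        show "1 \<in> E" using E0 is_subfieldD(1)[OF init(2)] by blast
        fix x y assume x: "x \<in> E"
        obtain E' \<sigma>' where "good E' \<sigma>'" "x \<in> E'" "E' \<subseteq> E" using pair[OF x x] by blast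
        then show "inverse x \<in> E" using is_subfieldD(5)[of E' x] by (auto simp: good_def)
        assume y: "y \<in> E"
        obtain E'' \<sigma>'' where "good E'' \<sigma>''" "x \<in> E''" "y \<in> E''" "E'' \<subseteq> E" using pair[OF x y] by blast
        then show "x - y \<in> E" "x * y \<in> E" using is_subfieldD(3,4)[of E'' x y] by (auto simp: good_def)
      qed
      show "is_embedding E \<sigma>" unfolding is_embedding_def
      proof (intro conjI ballI)
        have 1: "1 \<in> E" using E0 is_subfieldD(1)[OF init(2)] by blast
        obtain E' \<sigma>' where "good E' \<sigma>'" "1 \<in> E'" "\<forall>z\<in>E'. \<sigma> z = \<sigma>' z" using pair[OF 1 1] by blast
        then show "\<sigma> 1 = 1" by (auto simp: good_def is_embedding_def)
        fix x y assume xy: "x \<in> E" "y \<in> E"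
        then obtain E' \<sigma>' where g: "good E' \<sigma>'" "x \<in> E'" "y \<in> E'" "\<forall>z\<in>E'. \<sigma> z = \<sigma>' z" using pair by blast
        then have e: "is_subfield E'" "is_embedding E' \<sigma>'" by (auto simp: good_def)
        show "\<sigma> (x + y) = \<sigma> x + \<sigma> y" "\<sigma> (x * y) = \<sigma> x * \<sigma> y"
          using g is_subfieldD(4,7)[OF e(1)] is_embeddingD(3,4)[OF e] by auto
      qed
      show "\<sigma> a = \<sigma>\<^sub>0 a" if "a \<in> E\<^sub>0" for a
      proof -
        have "a \<in> E" using E0 that by blast
        from pair[OF this this] show ?thesis using that unfolding good_def by auto
      qed
      show "u (\<sigma> a) = u a" if "a \<in> E" for a using pair[OF that that] unfolding good_def by auto
    qed
    moreover have "U = G E \<sigma>" using \<sigma>U \<sigma> by (auto simp: G_def E_def)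
    ultimately show "\<Union>C \<in> A" unfolding A_def U_def by blast
  qed
  then obtain M where M: "M \<in> A" "\<And>X. X \<in> A \<Longrightarrow> M \<subseteq> X \<Longrightarrow> X = M" by blast
  then obtain E \<sigma> where g: "good E \<sigma>" and ME: "M = G E \<sigma>" unfolding A_def by blast
  have max: "G E' \<sigma>' = G E \<sigma>" if "good E' \<sigma>'" "G E \<sigma> \<subseteq> G E' \<sigma>'" for E' \<sigma>'
    using M(2)[of "G E' \<sigma>'"] that unfolding ME A_def by blast
  have E: "is_subfield E" "is_embedding E \<sigma>" "E\<^sub>0 \<subseteq> E" "\<And>a. a \<in> E\<^sub>0 \<Longrightarrow> \<sigma> a = \<sigma>\<^sub>0 a" "\<And>a. a \<in> E \<Longrightarrow> u (\<sigma> a) = u a"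
    using g by (auto simp: good_def)
  have "x \<in> E" for x
  proof -
    have KE: "K \<subseteq> E" using E(3) init(1) by blast
    have "\<forall>a\<in>K. \<sigma> a = a" using init(1,4) E(4) by auto
    then obtain \<tau> where \<tau>: "is_embedding (adjoin E x) \<tau>" "\<forall>a\<in>E. \<tau> a = \<sigma> a" "\<forall>a\<in>adjoin E x. u (\<tau> a) = u a"
      using step[OF KE E(1,2)] E(5) by blast
    have sub: "E \<subseteq> adjoin E x" using adjoin_base[OF E(1)] by blast
    have "good (adjoin E x) \<tau>" unfolding good_def
    proof (intro conjI ballI)
      show "is_subfield (adjoin E x)" using is_subfield_adjoin[OF E(1)] alg algebraic_over_mono KE by blast
      show "E\<^sub>0 \<subseteq> adjoin E x" using sub E(3) by blast
      show "\<tau> a = \<sigma>\<^sub>0 a" if "a \<in> E\<^sub>0" for a using that E(3,4) \<tau>(2) by auto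
    qed (use \<tau> in auto)
    moreover have "G E \<sigma> \<subseteq> G (adjoin E x) \<tau>" using sub \<tau>(2) by (auto simp: G_def)
    ultimately have "G (adjoin E x) \<tau> = G E \<sigma>" by (rule max)
    then have "(x, \<tau> x) \<in> G E \<sigma>" using adjoin_gen[OF E(1)] by (auto simp: G_def)
    then show ?thesis by (auto simp: G_def)
  qed
  then have "E = UNIV" by blast
  then show ?thesis using E by blast
qed

subsection \<open>Separable elements\<close>

text \<open>q is a power of the characteristic exponent. Additivity is demanded for polynomials,
  since linear factors have to be raised to the power q.\<close>

definition frob :: "'c::field itself \<Rightarrow> nat \<Rightarrow> bool" where
  "frob _ q \<longleftrightarrow> q > 0 \<and> (\<forall>x y :: 'c poly. (x + y) ^ q = x ^ q + y ^ q) \<and> (q = 1 \<or> of_nat q = (0 :: 'c))"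

lemma frob_add: "frob TYPE('c::field) q \<Longrightarrow> (x + y :: 'c) ^ q = x ^ q + y ^ q"
proof -
  assume "frob TYPE('c) q"
  then have "([:x:] + [:y:]) ^ q = [:x:] ^ q + [:y:] ^ q" by (simp only: frob_def)
  then have "poly (([:x:] + [:y:]) ^ q) 0 = poly ([:x:] ^ q + [:y:] ^ q) 0" by (rule arg_cong)
  then show ?thesis by simp
qed

lemma frob_1: "frob TYPE('c::field) 1"
  by (simp add: frob_def)

lemma frob_mult: "frob TYPE('c::field) q \<Longrightarrow> frob TYPE('c) r \<Longrightarrow> frob TYPE('c) (q * r)"
  by (auto simp: frob_def power_mult)

lemma frob_CHAR: "CHAR('c::field) > 0 \<Longrightarrow> frob TYPE('c) CHAR('c)"
  using freshmans_dream[where 'a = "'c poly"] prime_CHAR_semidom[where 'a = 'c] by (auto simp: frob_def)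

lemma frob_embedding: "frob TYPE('c::field) q \<Longrightarrow> is_embedding UNIV (\<lambda>x::'c. x ^ q)"
  using frob_add by (auto simp: is_embedding_def power_mult_distrib)

lemma frob_inj: "frob TYPE('c::field) q \<Longrightarrow> (x::'c) ^ q = y ^ q \<Longrightarrow> x = y"
  using is_embeddingD(10)[OF is_subfield_UNIV frob_embedding[of q], of x y] by simp

text \<open>Being a simple root of some polynomial over E passes to larger fields with the same
  witness.\<close>

definition separable_over :: "'c::field set \<Rightarrow> 'c \<Rightarrow> bool" where
  "separable_over E x \<longleftrightarrow> (\<exists>R\<in>polys_over E. poly R x = 0 \<and> poly (pderiv R) x \<noteq> 0)"

lemma separable_over_mono: "separable_over E x \<Longrightarrow> E \<subseteq> F \<Longrightarrow> separable_over F x"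
  unfolding separable_over_def using polys_over_mono by blast

lemma separable_over_algebraic: "separable_over E x \<Longrightarrow> algebraic_over E x"
  unfolding separable_over_def algebraic_over_def by (metis pderiv_0 poly_0)

lemma coeff_pcompose_monom:
  assumes "q > 0"
  shows "coeff (pcompose R (monom (1::'c::comm_ring_1) q)) i = (if q dvd i then coeff R (i div q) else 0)"
proof (induction R arbitrary: i)
  case (pCons a R)
  have "coeff (pcompose (pCons a R) (monom 1 q)) i =
      (if i = 0 then a else 0) + (if i < q then 0 else coeff (pcompose R (monom 1 q)) (i - q))"
    by (auto simp: pcompose_pCons coeff_monom_mult coeff_pCons split: nat.splits)
  also have "\<dots> = (if q dvd i then coeff (pCons a R) (i div q) else 0)"
  proof (cases "i < q")
    case True
    then show ?thesis using assms by (auto dest: dvd_imp_le)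
  next
    case False
    then have "i div q = Suc ((i - q) div q)" using assms by (simp add: le_div_geq)
    moreover have "q dvd i - q \<longleftrightarrow> q dvd i" using False by (simp add: dvd_minus_self)
    ultimately show ?thesis using False assms pCons.IH[of "i - q"] by auto
  qed
  finally show ?case .
qed simp

text \<open>If P shared a root with its derivative it would divide it, and then every multiple of P,
  in particular R, would have a multiple root at x.\<close>

lemma Irr_simple_root_separable:
  assumes E: "is_subfield E" and P: "P \<in> Irr E" "poly P x = 0" and x: "separable_over E x" and y: "poly P y = 0"
  shows "poly (pderiv P) y \<noteq> 0"
proof
  assume "poly (pderiv P) y = 0"
  then have "P dvd pderiv P" using Irr_dvd[OF E P(1) polys_over_pderiv[OF E IrrD(1)[OF P(1)]] y] by simp
  obtain R where R: "R \<in> polys_over E" "poly R x = 0" "poly (pderiv R) x \<noteq> 0" using x by (auto simp: separable_over_def)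
  then obtain S where "R = P * S" using Irr_dvd[OF E P(1) R(1) P(2)] by blast
  then have "poly (pderiv R) x = poly S x * poly (pderiv P) x" using P(2) by (simp add: pderiv_mult)
  then have "poly (pderiv P) x \<noteq> 0" using R by auto
  then show False using \<open>P dvd pderiv P\<close> P(2) by (auto elim: dvdE)
qed

text \<open>If x is a multiple root of P, then P divides its derivative, which therefore vanishes.
  So all exponents are divisible by the characteristic p, and P = R(T^p) with R irreducible of
  smaller degree.\<close>

lemma Irr_separable_decomposition:
  fixes E :: "'c::field set"
  assumes E: "is_subfield E" and "P \<in> Irr E" "poly P x = 0"
  shows "\<exists>q R. frob TYPE('c) q \<and> R \<in> Irr E \<and> P = pcompose R (monom 1 q) \<and> poly R (x ^ q) = 0
    \<and> poly (pderiv R) (x ^ q) \<noteq> 0"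
  using assms(2,3)
proof (induction "degree P" arbitrary: P x rule: less_induct)
  case less
  note P = less.prems
  show ?case
  proof (cases "poly (pderiv P) x = 0")
    case False
    have "monom 1 1 = [:0, 1::'c:]" by (simp add: monom_altdef)
    then show ?thesis using P False frob_1 by (intro exI[of _ 1] exI[of _ P]) auto
  next
    case True
    then have "P dvd pderiv P" using Irr_dvd[OF E P(1) polys_over_pderiv[OF E IrrD(1)[OF P(1)]] P(2)] by simp
    moreover have "degree (pderiv P) < degree P"
    proof -
      have "degree (pderiv P) \<le> degree P - 1" by (rule degree_le) (auto simp: coeff_pderiv coeff_eq_0)
      then show ?thesis using IrrD(3)[OF P(1)] by auto
    qed
    ultimately have pd: "pderiv P = 0" by (metis dvd_imp_degree_le not_le)
    define p where "p = CHAR('c)"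
    have dvd: "p dvd i" if "coeff P i \<noteq> 0" for i
    proof (cases i)
      case (Suc j)
      have "coeff (pderiv P) j = 0" using pd by simp
      then show ?thesis using that Suc by (simp add: coeff_pderiv p_def of_nat_eq_0_iff_char_dvd del: of_nat_Suc)
    qed simp
    have p0: "p > 0" using dvd[of "degree P"] IrrD(3,4)[OF P(1)] by (cases "p = 0") auto
    have fr: "frob TYPE('c) p" using frob_CHAR p0 by (simp add: p_def)
    have "prime p" using prime_CHAR_semidom[where 'a='c] p0 p_def by simp
    then have p1: "p > 1" by (rule prime_gt_1_nat)
    define R where "R = (\<Sum>j\<le>degree P. monom (coeff P (p * j)) j)"
    have cR: "coeff R j = coeff P (p * j)" for j
    proof -
      have "coeff R j = (if j \<le> degree P then coeff P (p * j) else 0)" by (simp add: R_def coeff_sum)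
      moreover have "coeff P (p * j) = 0" if "\<not> j \<le> degree P"
      proof (rule coeff_eq_0)
        have "1 * j \<le> p * j" using p1 by (intro mult_right_mono) auto
        then have "j \<le> p * j" by simp
        then show "degree P < p * j" using that by linarith
      qed
      ultimately show ?thesis by simp
    qed
    have PR: "P = pcompose R (monom 1 p)"
    proof (rule poly_eqI)
      fix i
      have "p * (i div p) = i" if "p dvd i" using that by simp
      then show "coeff P i = coeff (pcompose R (monom 1 p)) i"
        unfolding coeff_pcompose_monom[OF p0] cR using dvd[of i] by metis
    qed
    have mon: "degree (monom (1::'c) p) = p" by (simp add: degree_monom_eq)
    have dR: "degree P = degree R * p" unfolding PR degree_pcompose mon by simp
    have "lead_coeff R = 1" using IrrD(2)[OF P(1)] p0 lead_coeff_comp[of "monom (1::'c) p" R] by (simp add: PR[symmetric] mon lead_coeff_monom)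
    moreover have RE: "R \<in> polys_over E" using IrrD(1)[OF P(1)] by (auto simp: polys_over_def cR)
    moreover have "degree a = 0 \<or> degree b = 0" if ab: "a \<in> polys_over E" "b \<in> polys_over E" "R = a * b" for a b
    proof -
      have P_ab: "P = pcompose a (monom 1 p) * pcompose b (monom 1 p)" using PR ab(3) by (simp add: pcompose_mult)
      have m: "monom 1 p \<in> polys_over E" using polys_over_closed[OF E] is_subfieldD[OF E] by auto
      have "degree (pcompose a (monom (1::'c) p)) = 0 \<or> degree (pcompose b (monom (1::'c) p)) = 0"
        by (rule IrrD(5)[OF P(1) polys_over_pcompose[OF E ab(1) m] polys_over_pcompose[OF E ab(2) m] P_ab])
      then show ?thesis using p0 by (auto simp: degree_pcompose mon)
    qed
    moreover have "degree R > 0" "degree R < degree P" using dR IrrD(3)[OF P(1)] p1 by auto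
    ultimately have R: "R \<in> Irr E" "degree R < degree P" by (auto simp: Irr_def)
    have "poly R (x ^ p) = 0" using P(2) by (simp add: PR poly_pcompose poly_monom)
    then obtain q S where S: "frob TYPE('c) q" "S \<in> Irr E" "R = pcompose S (monom 1 q)" "poly S ((x ^ p) ^ q) = 0"
      "poly (pderiv S) ((x ^ p) ^ q) \<noteq> 0" using less.hyps[OF R(2) R(1)] by blast
    have "pcompose (monom 1 q) (monom 1 p) = (monom 1 (p * q) :: 'c poly)"
    proof (rule poly_eqI)
      fix i
      have "p dvd i \<and> q = i div p \<longleftrightarrow> p * q = i" using p0 by (metis dvd_mult_div_cancel dvd_triv_left nonzero_mult_div_cancel_left neq0_conv)
      then show "coeff (pcompose (monom 1 q) (monom 1 p)) i = coeff (monom (1::'c) (p * q)) i"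
        unfolding coeff_pcompose_monom[OF p0] coeff_monom by metis
    qed
    moreover have "P = pcompose (pcompose S (monom 1 q)) (monom 1 p)" using PR S(3) by metis
    ultimately have "P = pcompose S (monom 1 (p * q))" by (metis pcompose_assoc)
    then show ?thesis using S frob_mult[OF fr S(1)] by (intro exI[of _ "p * q"] exI[of _ S]) (auto simp: power_mult)
  qed
qed

lemma frob_separable:
  fixes E :: "'c::field set"
  assumes E: "is_subfield E" and x: "algebraic_over E x"
  shows "\<exists>q. frob TYPE('c) q \<and> separable_over E (x ^ q)"
proof -
  obtain P where "P \<in> Irr E" "poly P x = 0" using Irr_exists[OF assms] by blast
  then show ?thesis using Irr_separable_decomposition[OF E] unfolding separable_over_def using IrrD(1) by metis
qed

lemma order_simple_root:
  assumes "poly p (a::'c::field) = 0" "poly (pderiv p) a \<noteq> 0"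
  shows "Polynomial.order a p = 1"
proof -
  obtain r where r: "p = [:- a, 1:] * r" using assms(1) poly_eq_0_iff_dvd by blast
  have nz: "p \<noteq> 0" using assms by auto
  have pd: "pderiv p = r + [:- a, 1:] * pderiv r" unfolding r by (subst pderiv_mult) (simp add: pderiv_pCons)
  have "poly (pderiv p) a = poly r a" unfolding pd by simp
  then have "poly r a \<noteq> 0" using assms by simp
  then show ?thesis using order_mult[of "[:- a, 1:]" r a] nz r order_power_n_n[of a 1] by (simp add: order_0I)
qed

lemma order_multiple_root:
  assumes "p \<noteq> 0" "poly p (a::'c::field) = 0" "poly (pderiv p) a = 0"
  shows "Polynomial.order a p > 1"
proof -
  obtain r where r: "p = [:- a, 1:] * r" using assms poly_eq_0_iff_dvd by blast
  have pd: "pderiv p = r + [:- a, 1:] * pderiv r" unfolding r by (subst pderiv_mult) (simp add: pderiv_pCons)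
  have "poly (pderiv p) a = poly r a" unfolding pd by simp
  then have "poly r a = 0" using assms by simp
  then have "Polynomial.order a r > 0" using order_root assms(1) r by (metis mult_zero_right neq0_conv)
  then show ?thesis using order_mult[of "[:- a, 1:]" r a] assms(1) r order_power_n_n[of a 1] by simp
qed

lemma size_proots: "size (proots (p :: 'c::alg_closed_field poly)) = degree p"
proof (cases "p = 0")
  case False
  then obtain A where A: "size A = degree p" "p = smult (lead_coeff p) (\<Prod>x\<in>#A. [:- x, 1:])"
    using alg_closed_imp_factorization by blast
  have "proots p = proots (\<Prod>x\<in>#A. [:- x, 1:])" using False by (subst A(2)) simp
  also have "\<dots> = A"
  proof (induction A)
    case (add x A)
    have "(\<Prod>x\<in>#A. [:- x, 1:]) \<noteq> 0" by (auto simp: prod_mset_zero_iff)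
    then show ?case using add proots_mult[of "[:- x, 1:]" "\<Prod>x\<in>#A. [:- x, 1:]"] by simp
  qed simp
  finally show ?thesis using A(1) by simp
qed simp

text \<open>Write t = h(x) with deg h < deg P. A conjugate y of x satisfies h(y)^q = t^q, hence h(y)
  = t as the q-th power is injective. Thus h - t has as many roots as P and vanishes
  identically.\<close>

lemma separable_adjoin_purely_inseparable:
  fixes E :: "'c::alg_closed_field set"
  assumes E: "is_subfield E" and x: "separable_over E x" and t: "t \<in> adjoin E x"
    and q: "frob TYPE('c) q" "t ^ q \<in> E"
  shows "t \<in> E"
proof -
  obtain P where P: "P \<in> Irr E" "poly P x = 0" using Irr_exists[OF E separable_over_algebraic[OF x]] by blast
  note c = polys_over_closed[OF E]
  obtain h0 where h0: "h0 \<in> polys_over E" "t = poly h0 x" using t by (auto simp: adjoin_def)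
  define h where "h = h0 mod P"
  have h: "h \<in> polys_over E" "t = poly h x"
  proof -
    show "h \<in> polys_over E" unfolding h_def by (rule polys_over_div_mod(2)[OF E h0(1) IrrD(1)[OF P(1)]])
    have "h0 = h0 div P * P + h" by (simp add: h_def)
    then have "poly h0 x = poly (h0 div P * P + h) x" by simp
    then show "t = poly h x" using h0 P by simp
  qed
  have dh: "degree h < degree P" using degree_mod_less'[of P h0] IrrD(3,4)[OF P(1)] unfolding h_def
    by (cases "h0 mod P = 0") auto
  have roots: "poly h y = t" if y: "poly P y = 0" for y
  proof -
    have emb: "is_embedding UNIV (\<lambda>z::'c. z ^ q)" by (rule frob_embedding[OF q(1)])
    \<comment> \<open>f takes the value h(z)^q - t^q at z and has coefficients in E: the power q is
      applied to the coefficients of h, and T^q is substituted for T.\<close>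
    define f where "f = pcompose (map_poly (\<lambda>z. z ^ q) h) (monom 1 q) - [:t ^ q:]"
    have pf: "poly f z = poly h z ^ q - t ^ q" for z
      using map_poly_embedding(8)[OF is_subfield_UNIV emb UNIV_I polys_over_UNIV, of h z]
      by (simp add: f_def poly_pcompose poly_monom)
    have "map_poly (\<lambda>z. z ^ q) h \<in> polys_over E"
      by (rule polys_overI) (auto simp: coeff_map_poly_embedding[OF is_subfield_UNIV emb] is_subfieldD[OF E] polys_overD[OF h(1)])
    then have "f \<in> polys_over E" unfolding f_def
      by (intro c(4) polys_over_pcompose[OF E]) (auto simp: c q is_subfieldD[OF E])
    then have "P dvd f" by (rule Irr_dvd[OF E P(1) _ P(2)]) (simp add: pf h(2))
    then have "poly f y = 0" using y by (auto elim: dvdE)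
    then show ?thesis using pf frob_inj[OF q(1)] by simp
  qed
  have "h - [:t:] = 0"
  proof (rule ccontr)
    assume nz: "h - [:t:] \<noteq> 0"
    \<comment> \<open>The roots of P are simple, so one occurrence of each in h - t
      suffices.\<close>
    have "proots P \<subseteq># proots (h - [:t:])"
    proof (rule mset_subset_eqI)
      fix y
      show "count (proots P) y \<le> count (proots (h - [:t:])) y"
      proof (cases "poly P y = 0")
        case True
        have "Polynomial.order y P = 1" using order_simple_root[OF True] Irr_simple_root_separable[OF E P x True] by simp
        moreover have "Polynomial.order y (h - [:t:]) \<noteq> 0" using roots[OF True] nz order_root[of "h - [:t:]" y] by simp
        ultimately show ?thesis using nz IrrD(4)[OF P(1)] by simp
      next
        case False
        then show ?thesis using IrrD(4)[OF P(1)] order_0I[OF False] by simp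
      qed
    qed
    then have "degree P \<le> degree (h - [:t:])"
      using size_mset_mono size_proots by metis
    also have "degree (h - [:t:]) \<le> degree h" by (rule degree_diff_le) auto
    finally show False using dh by simp
  qed
  then have "coeff h 0 = t" by simp
  then show ?thesis using polys_overD[OF h(1)] by metis
qed

section \<open>Towers of separable extensions and the separable closure\<close>

fun adjoin_list :: "'c::field set \<Rightarrow> 'c list \<Rightarrow> 'c set" where
  "adjoin_list E [] = E"
| "adjoin_list E (x # xs) = adjoin_list (adjoin E x) xs"

lemma adjoin_list_basics:
  assumes "is_subfield E" "\<forall>x\<in>set xs. algebraic_over E x"
  shows "is_subfield (adjoin_list E xs) \<and> E \<subseteq> adjoin_list E xs \<and> set xs \<subseteq> adjoin_list E xs"
  using assms
proof (induction xs arbitrary: E)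
  case (Cons x xs)
  have s: "is_subfield (adjoin E x)" "E \<subseteq> adjoin E x" "x \<in> adjoin E x"
    using Cons.prems is_subfield_adjoin adjoin_base adjoin_gen by auto
  then show ?case using Cons.IH[OF s(1)] Cons.prems algebraic_over_mono[OF _ s(2)] by auto
qed simp

lemma adjoin_list_mono: "E \<subseteq> F \<Longrightarrow> adjoin_list E xs \<subseteq> adjoin_list F xs"
proof (induction xs arbitrary: E F)
  case (Cons x xs)
  then show ?case using Cons.IH[OF adjoin_mono[OF Cons.prems]] by simp
qed simp

lemma separable_adjoin_list_purely_inseparable:
  fixes E :: "'c::alg_closed_field set"
  assumes "is_subfield E" "\<forall>x\<in>set xs. separable_over E x" "t \<in> adjoin_list E xs" "frob TYPE('c) q" "t ^ q \<in> E"
  shows "t \<in> E"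
  using assms
proof (induction xs arbitrary: E)
  case (Cons x xs)
  have s: "is_subfield (adjoin E x)" "E \<subseteq> adjoin E x"
    using Cons.prems(1,2) is_subfield_adjoin[OF Cons.prems(1) separable_over_algebraic] adjoin_base by auto
  have "\<forall>y\<in>set xs. separable_over (adjoin E x) y" using Cons.prems(2) separable_over_mono[OF _ s(2)] by auto
  then have "t \<in> adjoin E x" using Cons.IH[OF s(1)] Cons.prems s(2) by auto
  then show ?case using separable_adjoin_purely_inseparable Cons.prems by auto
qed simp

text \<open>If \<open>x ^ q\<close> is separable, then the hypotheses put \<open>x\<close> into \<open>E(x ^ q)\<close>; for \<open>q \<noteq> 1\<close> a relation
  \<open>x = h (x ^ q)\<close> is separable, as the derivative of \<open>h (T ^ q)\<close> vanishes.\<close>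

lemma separable_over_trans:
  fixes E :: "'c::alg_closed_field set"
  assumes E: "is_subfield E" and alg: "algebraic_over E x" and xs: "\<forall>y\<in>set xs. separable_over E y"
    and x: "separable_over (adjoin_list E xs) x"
  shows "separable_over E x"
proof -
  obtain q where q: "frob TYPE('c) q" "separable_over E (x ^ q)" using frob_separable[OF E alg] by blast
  show ?thesis
  proof (cases "q = 1")
    case False
    then have q0: "of_nat q = (0::'c)" using q(1) by (auto simp: frob_def)
    let ?F = "adjoin E (x ^ q)"
    have F: "is_subfield ?F" "E \<subseteq> ?F" "x ^ q \<in> ?F"
      using E is_subfield_adjoin adjoin_base adjoin_gen separable_over_algebraic[OF q(2)] by auto
    have xsF: "\<forall>y\<in>set xs. separable_over ?F y" using xs F(2) separable_over_mono by blast
    define V where "V = adjoin_list ?F xs"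
    have V: "is_subfield V" "?F \<subseteq> V"
      using adjoin_list_basics[OF F(1)] xsF separable_over_algebraic by (auto simp: V_def)
    have "separable_over V x" using x adjoin_list_mono[OF F(2)] separable_over_mono unfolding V_def by blast
    then have "x \<in> V"
      using separable_adjoin_purely_inseparable[OF V(1) _ adjoin_gen[OF V(1)] q(1)] F(3) V(2) by blast
    then have "x \<in> ?F"
      using separable_adjoin_list_purely_inseparable[OF F(1) xsF _ q(1) F(3)] by (simp add: V_def)
    then obtain h where h: "h \<in> polys_over E" "x = poly h (x ^ q)" by (auto simp: adjoin_def)
    define R where "R = pcompose h (monom 1 q) - [:0, 1:]"
    have "R \<in> polys_over E"
      using polys_over_closed[OF E] is_subfieldD[OF E] polys_over_pcompose[OF E h(1)] by (auto simp: R_def)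
    moreover have "poly R x = 0" using h(2) by (simp add: R_def poly_pcompose poly_monom)
    moreover have "pderiv R = [:- 1:]" using q0
      by (simp add: R_def pderiv_diff pderiv_pcompose pderiv_monom pderiv_pCons)
    ultimately show ?thesis unfolding separable_over_def by (intro bexI[of _ R]) auto
  qed (use q in auto)
qed

text \<open>x is the simple root of T - x over the tower, and transitivity applies.\<close>

lemma separable_over_adjoin_list:
  fixes E :: "'c::alg_closed_field set"
  assumes E: "is_subfield E" and alg: "\<And>x. algebraic_over E x" and xs: "\<forall>y\<in>set xs. separable_over E y"
    and x: "x \<in> adjoin_list E xs"
  shows "separable_over E x"
proof (rule separable_over_trans[OF E alg xs])
  have V: "is_subfield (adjoin_list E xs)" using adjoin_list_basics[OF E] alg by blast
  show "separable_over (adjoin_list E xs) x" unfolding separable_over_def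
    using x polys_over_closed[OF V] is_subfieldD[OF V]
    by (intro bexI[of _ "[:- x, 1:]"]) (auto simp: pderiv_pCons)
qed

lemma is_subfield_separable_closure:
  fixes E :: "'c::alg_closed_field set"
  assumes E: "is_subfield E" and alg: "\<And>x. algebraic_over E x"
  shows "is_subfield {x. separable_over E x}"
  unfolding is_subfield_def
proof (intro conjI ballI)
  have base: "a \<in> E \<Longrightarrow> separable_over E a" for a using separable_over_adjoin_list[OF E alg, of "[]"] by auto
  show "1 \<in> {x. separable_over E x}" using base is_subfieldD[OF E] by auto
  fix x y assume x: "x \<in> {x. separable_over E x}"
  { have "is_subfield (adjoin_list E [x])" "x \<in> adjoin_list E [x]"
      using adjoin_list_basics[OF E, of "[x]"] alg by auto
    then have "inverse x \<in> adjoin_list E [x]" using is_subfieldD by blast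
    then show "inverse x \<in> {x. separable_over E x}" using separable_over_adjoin_list[OF E alg, of "[x]"] x by auto }
  assume y: "y \<in> {x. separable_over E x}"
  have *: "is_subfield (adjoin_list E [x, y])" "x \<in> adjoin_list E [x, y]" "y \<in> adjoin_list E [x, y]"
    using adjoin_list_basics[OF E, of "[x, y]"] alg by auto
  have xy: "\<forall>z\<in>set [x, y]. separable_over E z" using x y by simp
  show "x - y \<in> {x. separable_over E x}" "x * y \<in> {x. separable_over E x}"
    using separable_over_adjoin_list[OF E alg xy is_subfieldD(3)[OF *]]
      separable_over_adjoin_list[OF E alg xy is_subfieldD(4)[OF *]] by simp_all
qed

text \<open>The finitely many coefficients of R generate a finite separable tower, over which x is
  separable.\<close>

lemma separable_over_separable_closure:
  fixes E :: "'c::alg_closed_field set"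
  assumes E: "is_subfield E" and alg: "\<And>x. algebraic_over E x" and x: "separable_over {y. separable_over E y} x"
  shows "separable_over E x"
proof -
  obtain R where R: "R \<in> polys_over {y. separable_over E y}" "poly R x = 0" "poly (pderiv R) x \<noteq> 0"
    using x by (auto simp: separable_over_def)
  define xs where "xs = coeffs R"
  have xs: "\<forall>y\<in>set xs. separable_over E y"
    using R(1) unfolding xs_def polys_over_def by (auto simp: coeffs_def split: if_splits)
  have *: "is_subfield (adjoin_list E xs)" "set xs \<subseteq> adjoin_list E xs" using adjoin_list_basics[OF E] alg by auto
  have "coeff R i \<in> adjoin_list E xs" for i
  proof (cases "coeff R i = 0")
    case True
    then show ?thesis using is_subfieldD(2)[OF *(1)] by simp
  next
    case False
    then have "coeff R i \<in> set xs" unfolding xs_def by (metis coeff_in_coeffs coeff_0 le_degree)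
    then show ?thesis using *(2) by blast
  qed
  then have "separable_over (adjoin_list E xs) x" unfolding separable_over_def using R(2,3) by (auto intro!: polys_overI)
  then show ?thesis by (rule separable_over_trans[OF E alg xs])
qed

subsection \<open>Valuations\<close>

lemma scaleQ_basics:
  fixes x y :: "'h::linordered_rat_vector"
  shows "0 *\<^sub>Q x = 0" "q *\<^sub>Q (0::'h) = 0" "q *\<^sub>Q (- x) = - (q *\<^sub>Q x)" "(- q) *\<^sub>Q x = - (q *\<^sub>Q x)"
    "q *\<^sub>Q (x - y) = q *\<^sub>Q x - q *\<^sub>Q y" "(q - r) *\<^sub>Q x = q *\<^sub>Q x - r *\<^sub>Q x"
proof -
  show 1: "0 *\<^sub>Q x = 0" for x :: 'h using scaleQ_add_left[of 0 0 x] by simp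
  show 2: "q *\<^sub>Q (0::'h) = 0" for q using scaleQ_add_right[of q 0 "0::'h"] by simp
  show 3: "q *\<^sub>Q (- x) = - (q *\<^sub>Q x)" for q and x :: 'h
    using scaleQ_add_right[of q x "- x"] 2 by (simp add: eq_neg_iff_add_eq_0 add.commute)
  show 4: "(- q) *\<^sub>Q x = - (q *\<^sub>Q x)" for q and x :: 'h
    using scaleQ_add_left[of q "- q" x] 1 by (simp add: eq_neg_iff_add_eq_0 add.commute)
  show "q *\<^sub>Q (x - y) = q *\<^sub>Q x - q *\<^sub>Q y" using scaleQ_add_right[of q x "- y"] 3 by simp
  show "(q - r) *\<^sub>Q x = q *\<^sub>Q x - r *\<^sub>Q x" using scaleQ_add_left[of q "- r" x] 4 by simp
qed

text \<open>For q = a/b the b-fold sum of q x is the a-fold sum of x; so q x \<le> 0 would make a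
  sum of copies of x nonpositive.\<close>

lemma scaleQ_pos:
  fixes x :: "'h::linordered_rat_vector"
  assumes "x > 0" "q > 0" shows "q *\<^sub>Q x > 0"
proof (rule ccontr)
  have nat_nonpos: "of_nat n *\<^sub>Q y \<le> 0" if "y \<le> 0" for n and y :: 'h
    using that by (induction n) (auto simp: scaleQ_basics scaleQ_add_left scaleQ_one add_nonpos_nonpos)
  have nat_pos: "of_nat (Suc n) *\<^sub>Q x > 0" for n
  proof (induction n)
    case (Suc n)
    have "of_nat (Suc (Suc n)) *\<^sub>Q x = x + of_nat (Suc n) *\<^sub>Q x"
      by (subst of_nat_Suc) (simp only: scaleQ_add_left scaleQ_one)
    then show ?case using Suc assms(1) by (simp add: add_pos_pos del: of_nat_Suc)
  qed (simp add: scaleQ_one assms(1))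
  assume "\<not> ?thesis"
  then have le: "q *\<^sub>Q x \<le> 0" by simp
  obtain a b where ab: "quotient_of q = (a, b)" by (cases "quotient_of q")
  have b: "b > 0" using quotient_of_denom_pos[OF ab] .
  have q: "q = of_int a / of_int b" using quotient_of_div[OF ab] .
  have a: "a > 0" using assms(2) b q by (simp add: zero_less_divide_iff)
  have "(of_int b * q) *\<^sub>Q x = of_int a *\<^sub>Q x" using b q by simp
  moreover have "(of_int b * q) *\<^sub>Q x \<le> 0"
    using nat_nonpos[OF le, of "nat b"] b by (simp add: scaleQ_scaleQ)
  moreover have "of_int a *\<^sub>Q x > 0" using nat_pos[of "nat a - 1"] a by simp
  ultimately show False by simp
qed

lemma scaleQ_mono:
  fixes x y :: "'h::linordered_rat_vector"
  shows "q > 0 \<Longrightarrow> q *\<^sub>Q x < q *\<^sub>Q y \<longleftrightarrow> x < y" "q > 0 \<Longrightarrow> q *\<^sub>Q x \<le> q *\<^sub>Q y \<longleftrightarrow> x \<le> y"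
    "q > 0 \<Longrightarrow> q *\<^sub>Q x = q *\<^sub>Q y \<longleftrightarrow> x = y"
proof -
  have *: "x < y \<Longrightarrow> q > 0 \<Longrightarrow> q *\<^sub>Q x < q *\<^sub>Q y" for x y :: 'h
    using scaleQ_pos[of "y - x" q] by (simp add: scaleQ_basics)
  show "q > 0 \<Longrightarrow> q *\<^sub>Q x < q *\<^sub>Q y \<longleftrightarrow> x < y" "q > 0 \<Longrightarrow> q *\<^sub>Q x \<le> q *\<^sub>Q y \<longleftrightarrow> x \<le> y"
    "q > 0 \<Longrightarrow> q *\<^sub>Q x = q *\<^sub>Q y \<longleftrightarrow> x = y"
    using *[of x y] *[of y x] by (cases x y rule: linorder_cases; force)+
qed

lemma scaleQ_mono_left:
  fixes x :: "'h::linordered_rat_vector"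
  shows "0 < x \<Longrightarrow> q < r \<Longrightarrow> q *\<^sub>Q x < r *\<^sub>Q x" "0 \<le> x \<Longrightarrow> q \<le> r \<Longrightarrow> q *\<^sub>Q x \<le> r *\<^sub>Q x"
proof -
  show *: "0 < x \<Longrightarrow> q < r \<Longrightarrow> q *\<^sub>Q x < r *\<^sub>Q x" for x :: 'h and q r
    using scaleQ_pos[of x "r - q"] by (simp add: scaleQ_basics)
  show "0 \<le> x \<Longrightarrow> q \<le> r \<Longrightarrow> q *\<^sub>Q x \<le> r *\<^sub>Q x"
    using *[of x q r] by (cases "x = 0"; cases "q = r") (auto simp: scaleQ_basics intro: less_imp_le)
qed

lemma scaleQ_cancel: "n > 0 \<Longrightarrow> n *\<^sub>Q inverse n *\<^sub>Q (x::'h::linordered_rat_vector) = x"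
  by (simp add: scaleQ_scaleQ scaleQ_one)

section \<open>Arithmetic of extended values and basic rules for valuations\<close>

instance vext :: (linordered_ab_group_add) ordered_comm_monoid_add
proof
  fix a b c :: "'a vext"
  assume "a \<le> b"
  then show "c + a \<le> c + b" by (cases a; cases b; cases c) auto
qed

lemma vext_basics:
  fixes x y z :: "'h::linordered_ab_group_add vext"
  shows "x \<le> Infty" "x + Infty = Infty" "Infty + x = Infty" "Infty \<le> x \<longleftrightarrow> x = Infty" "x < Infty \<longleftrightarrow> x \<noteq> Infty" "\<not> Infty < x"
    "x + y = Infty \<longleftrightarrow> x = Infty \<or> y = Infty" "Fin a < Fin b \<longleftrightarrow> a < b" "Infty \<noteq> 0" "0 = Fin b \<longleftrightarrow> b = 0"
    "0 < Fin b \<longleftrightarrow> 0 < b" "0 \<le> Fin b \<longleftrightarrow> 0 \<le> b" "Fin b < 0 \<longleftrightarrow> b < 0"  "Fin b \<le> 0 \<longleftrightarrow> b \<le> 0" "Fin b = 0 \<longleftrightarrow> b = 0"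
  by (cases x; cases y; auto simp: zero_vext_def less_vext_def)+

lemma vext_add_cancel:
  fixes x y z :: "'h::linordered_ab_group_add vext"
  assumes "z \<noteq> Infty"
  shows "x + z \<le> y + z \<longleftrightarrow> x \<le> y" "x + z < y + z \<longleftrightarrow> x < y" "x + z = y + z \<longleftrightarrow> x = y"
    "z + x \<le> z + y \<longleftrightarrow> x \<le> y" "z + x < z + y \<longleftrightarrow> x < y" "z + x = z + y \<longleftrightarrow> x = y"
  using assms by (cases x; cases y; cases z; auto simp: less_vext_def)+

lemma vext_add_less_le:
  fixes a b c d :: "'h::linordered_ab_group_add vext"
  shows "a < b \<Longrightarrow> c \<le> d \<Longrightarrow> c \<noteq> Infty \<Longrightarrow> a + c < b + d"
    "a \<le> b \<Longrightarrow> a \<noteq> Infty \<Longrightarrow> c < d \<Longrightarrow> a + c < b + d"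
proof -
  show *: "a < b \<Longrightarrow> c \<le> d \<Longrightarrow> c \<noteq> Infty \<Longrightarrow> a + c < b + d" for a b c d :: "'h vext"
    using vext_add_cancel(2)[of c a b] add_left_mono[of c d b] by (meson less_le_trans)
  show "a \<le> b \<Longrightarrow> a \<noteq> Infty \<Longrightarrow> c < d \<Longrightarrow> a + c < b + d" using *[of c d a b] by (simp add: add.commute)
qed

text \<open>Valuations are also needed on E[x] and on subfields, which are sets and not types; hence
  the subring S is a parameter.\<close>

definition valuation_on :: "'r::comm_ring_1 set \<Rightarrow> ('r \<Rightarrow> 'h::linordered_ab_group_add vext) \<Rightarrow> bool" where
  "valuation_on S u \<longleftrightarrow> 1 \<in> S \<and> (\<forall>a\<in>S. \<forall>b\<in>S. a - b \<in> S \<and> a * b \<in> S) \<and> u 0 = Infty \<and> u 1 = 0 \<and>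
     (\<forall>a\<in>S. \<forall>b\<in>S. u (a * b) = u a + u b) \<and> (\<forall>a\<in>S. \<forall>b\<in>S. min (u a) (u b) \<le> u (a + b))"

lemma is_valuation_iff: "is_valuation u \<longleftrightarrow> valuation_on UNIV u"
  by (auto simp: is_valuation_def valuation_on_def)

locale val_on =
  fixes S :: "'r::comm_ring_1 set" and u :: "'r \<Rightarrow> 'h::linordered_ab_group_add vext"
  assumes val: "valuation_on S u"
begin

lemma closed: "1 \<in> S" "0 \<in> S" "a \<in> S \<Longrightarrow> b \<in> S \<Longrightarrow> a - b \<in> S" "a \<in> S \<Longrightarrow> b \<in> S \<Longrightarrow> a * b \<in> S"
  "a \<in> S \<Longrightarrow> - a \<in> S" "a \<in> S \<Longrightarrow> b \<in> S \<Longrightarrow> a + b \<in> S" "a \<in> S \<Longrightarrow> a ^ n \<in> S"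
proof -
  show 1: "1 \<in> S" and m: "\<And>a b. a \<in> S \<Longrightarrow> b \<in> S \<Longrightarrow> a - b \<in> S" and t: "\<And>a b. a \<in> S \<Longrightarrow> b \<in> S \<Longrightarrow> a * b \<in> S"
    using val by (auto simp: valuation_on_def)
  show 0: "0 \<in> S" using m[OF 1 1] by simp
  show n: "a \<in> S \<Longrightarrow> - a \<in> S" for a using m[OF 0, of a] by simp
  show "a \<in> S \<Longrightarrow> b \<in> S \<Longrightarrow> a + b \<in> S" using m[of a "- b"] n by simp
  show "a \<in> S \<Longrightarrow> a ^ n \<in> S" by (induction n) (auto intro: 1 t)
qed

lemma zero: "u 0 = Infty" and one: "u 1 = 0"
  using val by (auto simp: valuation_on_def)

lemma mult: "a \<in> S \<Longrightarrow> b \<in> S \<Longrightarrow> u (a * b) = u a + u b"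
  using val by (auto simp: valuation_on_def)

lemma add_ge: "a \<in> S \<Longrightarrow> b \<in> S \<Longrightarrow> x \<le> u a \<Longrightarrow> x \<le> u b \<Longrightarrow> x \<le> u (a + b)"
  using val unfolding valuation_on_def by (meson min.boundedI order.trans)

lemma uminus: assumes "a \<in> S" shows "u (- a) = u a"
proof -
  have "u (- 1) + u (- 1) = 0" using mult[of "- 1" "- 1"] closed one by simp
  then have "u (- 1) = 0"
  proof (cases "u (- 1)")
    case (Fin x)
    then have "x + x = 0" using \<open>u (- 1) + u (- 1) = 0\<close> by (simp add: zero_vext_def)
    then show ?thesis using Fin by (simp add: zero_vext_def)
  qed (simp add: zero_vext_def)
  then show ?thesis using mult[of "- 1" a] closed assms by simp
qed

lemma add_gt: "a \<in> S \<Longrightarrow> b \<in> S \<Longrightarrow> x < u a \<Longrightarrow> x < u b \<Longrightarrow> x < u (a + b)"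
  using val unfolding valuation_on_def by (meson min_less_iff_conj less_le_trans)

lemma diff_ge: "a \<in> S \<Longrightarrow> b \<in> S \<Longrightarrow> x \<le> u a \<Longrightarrow> x \<le> u b \<Longrightarrow> x \<le> u (a - b)"
  using add_ge[of a "- b" x] uminus closed by simp

lemma diff_gt: "a \<in> S \<Longrightarrow> b \<in> S \<Longrightarrow> x < u a \<Longrightarrow> x < u b \<Longrightarrow> x < u (a - b)"
  using add_gt[of a "- b" x] uminus closed by simp

lemma add_eq: assumes "a \<in> S" "b \<in> S" "u a < u b" shows "u (a + b) = u a" "u (b + a) = u a"
proof -
  have "u a \<le> u (a + b)" using add_ge assms by simp
  moreover have "\<not> u a < u (a + b)"
  proof
    assume "u a < u (a + b)"
    then have "u a < u (a + b - b)" using diff_gt[OF closed(6)[OF assms(1,2)] assms(2)] assms(3) by blast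
    then show False by simp
  qed
  ultimately show "u (a + b) = u a" by simp
  then show "u (b + a) = u a" by (simp add: add.commute)
qed

lemma diff_eq: assumes "a \<in> S" "b \<in> S" "u a < u b" shows "u (a - b) = u a" "u (b - a) = u a"
  using add_eq(1)[of a "- b"] add_eq(2)[of "- a" b] uminus closed assms by simp_all

lemma sum_ge: "(\<And>i. i \<in> I \<Longrightarrow> f i \<in> S \<and> x \<le> u (f i)) \<Longrightarrow> sum f I \<in> S \<and> x \<le> u (sum f I)"
  by (induction I rule: infinite_finite_induct) (auto simp: zero vext_basics closed intro: add_ge)

lemma sum_gt: "x \<noteq> Infty \<Longrightarrow> (\<And>i. i \<in> I \<Longrightarrow> f i \<in> S \<and> x < u (f i)) \<Longrightarrow> sum f I \<in> S \<and> x < u (sum f I)"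
  by (induction I rule: infinite_finite_induct) (auto simp: zero vext_basics closed intro: add_gt)

lemma power_ge_0: "a \<in> S \<Longrightarrow> 0 \<le> u a \<Longrightarrow> 0 \<le> u (a ^ n)"
  by (induction n) (auto simp: one mult closed intro: add_nonneg_nonneg)

lemma power_gt_0: "a \<in> S \<Longrightarrow> 0 < u a \<Longrightarrow> n > 0 \<Longrightarrow> 0 < u (a ^ n)"
proof (induction n)
  case (Suc n)
  then have "0 \<le> u (a ^ n)" using power_ge_0 by simp
  then have "0 + 0 < u a + u (a ^ n)" using Suc.prems by (intro vext_add_less_le(1)) (auto simp: zero_vext_def)
  then show ?case using Suc.prems by (simp add: mult closed)
qed simp

lemma unit: "a \<in> S \<Longrightarrow> b \<in> S \<Longrightarrow> a * b = 1 \<Longrightarrow> u a \<noteq> Infty"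
  using mult[of a b] one vext_basics(9) by (auto simp: vext_basics(3))

end

lemma val_on_UNIV: "is_valuation u \<Longrightarrow> val_on UNIV u"
  by unfold_locales (simp add: is_valuation_iff)

lemma valuation_power:
  fixes u :: "'r::comm_ring_1 \<Rightarrow> 'h::linordered_rat_vector vext"
  assumes "valuation_on S u" "a \<in> S" "u a = Fin \<gamma>"
  shows "u (a ^ n) = Fin (of_nat n *\<^sub>Q \<gamma>)"
proof -
  interpret val_on S u by unfold_locales (rule assms)
  show ?thesis
  proof (induction n)
    case (Suc n)
    then show ?case using assms by (simp add: mult closed scaleQ_add_left scaleQ_one)
  qed (simp add: one scaleQ_basics zero_vext_def)
qed

lemma field_valuation:
  fixes u :: "'c::field \<Rightarrow> 'h::linordered_ab_group_add vext"
  assumes "is_valuation u"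
  shows "u x = Infty \<longleftrightarrow> x = 0" "u x = Fin \<gamma> \<Longrightarrow> u (inverse x) = Fin (- \<gamma>)"
proof -
  interpret val_on UNIV u using assms by (rule val_on_UNIV)
  show inf: "u x = Infty \<longleftrightarrow> x = 0" for x
    using unit[of x "inverse x"] zero by (cases "x = 0") auto
  assume x: "u x = Fin \<gamma>"
  then have "x \<noteq> 0" using zero by auto
  then have "u x + u (inverse x) = 0" using mult[of x "inverse x"] one by simp
  then show "u (inverse x) = Fin (- \<gamma>)" using x
    by (cases "u (inverse x)") (auto simp: zero_vext_def eq_neg_iff_add_eq_0 add.commute)
qed

subsection \<open>Gauss valuations and balls\<close>

definition gauss :: "('r::comm_ring_1 \<Rightarrow> 'h::linordered_rat_vector vext) \<Rightarrow> 'h \<Rightarrow> 'r poly \<Rightarrow> 'h vext" where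
  "gauss u \<delta> f = (MIN i\<in>{..degree f}. u (coeff f i) + Fin (of_nat i *\<^sub>Q \<delta>))"

lemma gauss_attained: "\<exists>i. gauss u \<delta> f = u (coeff f i) + Fin (of_nat i *\<^sub>Q \<delta>)"
proof -
  have "gauss u \<delta> f \<in> (\<lambda>i. u (coeff f i) + Fin (of_nat i *\<^sub>Q \<delta>)) ` {..degree f}"
    unfolding gauss_def by (rule Min_in) auto
  then show ?thesis by blast
qed

lemma le_gauss_iff:
  assumes "is_valuation u"
  shows "x \<le> gauss u \<delta> f \<longleftrightarrow> (\<forall>i. x \<le> u (coeff f i) + Fin (of_nat i *\<^sub>Q \<delta>))"
proof -
  interpret val_on UNIV u using assms by (rule val_on_UNIV)
  have "x \<le> u (coeff f i) + Fin (of_nat i *\<^sub>Q \<delta>)" if "\<not> i \<le> degree f" for i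
    using that by (simp add: coeff_eq_0 zero vext_basics)
  moreover have "x \<le> gauss u \<delta> f \<longleftrightarrow> (\<forall>i\<le>degree f. x \<le> u (coeff f i) + Fin (of_nat i *\<^sub>Q \<delta>))"
    unfolding gauss_def by (subst Min_ge_iff) auto
  ultimately show ?thesis by blast
qed

text \<open>Gauss's lemma: if i and j are the least indices at which f and g attain their minima,
  then in the coefficient of index i + j exactly one summand has the least value.\<close>

lemma is_valuation_gauss:
  fixes u :: "'r::comm_ring_1 \<Rightarrow> 'h::linordered_rat_vector vext"
  assumes "is_valuation u"
  shows "is_valuation (gauss u \<delta>)"
proof -
  interpret val_on UNIV u using assms by (rule val_on_UNIV)
  let ?G = "gauss u \<delta>"
  let ?t = "\<lambda>f i. u (coeff f i) + Fin (of_nat i *\<^sub>Q \<delta>)"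
  have le: "?G f \<le> ?t f i" for f i using le_gauss_iff[OF assms, of "?G f"] by blast
  have shift: "Fin (of_nat (i + j) *\<^sub>Q \<delta>) = Fin (of_nat i *\<^sub>Q \<delta>) + Fin (of_nat j *\<^sub>Q \<delta>)" for i j
    by (simp add: scaleQ_add_left)
  have tm: "u (coeff f i * coeff g j) + Fin (of_nat (i + j) *\<^sub>Q \<delta>) = ?t f i + ?t g j" for f g i j
    unfolding shift by (simp add: mult add.assoc add.commute add.left_commute)
  have mult_ge: "?G f + ?G g \<le> ?G (f * g)" for f g
    unfolding le_gauss_iff[OF assms]
  proof
    fix n
    \<comment> \<open>Adding -n \<delta> moves the contribution of the radius to the other side, so
      that the coefficients can be compared alone.\<close>
    define d where "d = Fin (- (of_nat n *\<^sub>Q \<delta>))"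
    have dd: "Fin (of_nat n *\<^sub>Q \<delta>) + d = 0" by (simp add: d_def zero_vext_def)
    have "?G f + ?G g + d \<le> u (coeff f i * coeff g (n - i))" if "i \<le> n" for i
    proof -
      have "?G f + ?G g \<le> u (coeff f i * coeff g (n - i)) + Fin (of_nat n *\<^sub>Q \<delta>)"
        using tm[of f i g "n - i"] that add_mono[OF le[of f i] le[of g "n - i"]] by simp
      then have "?G f + ?G g + d \<le> u (coeff f i * coeff g (n - i)) + Fin (of_nat n *\<^sub>Q \<delta>) + d"
        by (rule add_right_mono)
      then show ?thesis by (simp add: add.assoc dd)
    qed
    then have "?G f + ?G g + d \<le> u (coeff (f * g) n)"
      unfolding coeff_mult using sum_ge[of "{..n}" "\<lambda>i. coeff f i * coeff g (n - i)"] by auto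
    then have "?G f + ?G g + d + Fin (of_nat n *\<^sub>Q \<delta>) \<le> u (coeff (f * g) n) + Fin (of_nat n *\<^sub>Q \<delta>)"
      by (rule add_right_mono)
    then show "?G f + ?G g \<le> ?t (f * g) n" using dd by (simp add: add.assoc add.commute[of d])
  qed
  have mult_le: "?G (f * g) \<le> ?G f + ?G g" for f g
  proof (cases "?G f = Infty \<or> ?G g = Infty")
    case False
    \<comment> \<open>Least indices: any other pair of indices with sum i + j has one member below i
      or below j, where the inequality is strict.\<close>
    define i where "i = (LEAST i. ?t f i = ?G f)"
    define j where "j = (LEAST j. ?t g j = ?G g)"
    have i: "?t f i = ?G f" unfolding i_def by (rule LeastI_ex) (metis gauss_attained)
    have j: "?t g j = ?G g" unfolding j_def by (rule LeastI_ex) (metis gauss_attained)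
    have i': "?G f < ?t f k" if "k < i" for k using le[of f k] not_less_Least[of k "\<lambda>i. ?t f i = ?G f"] that
      by (auto simp: i_def order.strict_iff_order)
    have j': "?G g < ?t g k" if "k < j" for k using le[of g k] not_less_Least[of k "\<lambda>i. ?t g i = ?G g"] that
      by (auto simp: j_def order.strict_iff_order)
    let ?x = "u (coeff f i * coeff g j)"
    have xfin: "?x \<noteq> Infty" using i j False by (auto simp: mult vext_basics)
    have gt: "?x < u (coeff f k * coeff g (i + j - k))" if k: "k \<le> i + j" "k \<noteq> i" for k
    proof -
      have "?G f + ?G g < ?t f k + ?t g (i + j - k)"
      proof (cases "k < i")
        case True
        then show ?thesis using vext_add_less_le(1)[OF i'[OF True] le] False by blast
      next
        case False': False
        then have "i + j - k < j" using k by auto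
        from vext_add_less_le(2)[OF le _ j'[OF this]] False show ?thesis by blast
      qed
      then have "?x + Fin (of_nat (i + j) *\<^sub>Q \<delta>) < u (coeff f k * coeff g (i + j - k)) + Fin (of_nat (i + j) *\<^sub>Q \<delta>)"
        using tm[of f i g j] tm[of f k g "i + j - k"] k i j by simp
      then show ?thesis by (simp add: vext_add_cancel)
    qed
    have "coeff (f * g) (i + j) = coeff f i * coeff g j + (\<Sum>k\<in>{..i+j} - {i}. coeff f k * coeff g (i + j - k))"
      unfolding coeff_mult by (subst sum.remove[of _ i]) auto
    moreover have "?x < u (\<Sum>k\<in>{..i+j} - {i}. coeff f k * coeff g (i + j - k))"
      using sum_gt[OF xfin, of "{..i+j} - {i}" "\<lambda>k. coeff f k * coeff g (i + j - k)"] gt by auto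
    ultimately have "u (coeff (f * g) (i + j)) = ?x" using add_eq(1) by simp
    then have "?t (f * g) (i + j) = ?G f + ?G g" using tm[of f i g j] i j by simp
    then show ?thesis using le[of "f * g" "i + j"] by simp
  qed (auto simp: vext_basics)
  show ?thesis unfolding is_valuation_def
  proof (intro conjI allI)
    show "?G 0 = Infty" by (simp add: gauss_def zero vext_basics)
    show "?G 1 = 0" by (simp add: gauss_def one scaleQ_basics zero_vext_def)
    show "?G (f * g) = ?G f + ?G g" for f g using mult_ge mult_le by (rule antisym[rotated])
    show "min (?G f) (?G g) \<le> ?G (f + g)" for f g
      unfolding le_gauss_iff[OF assms]
    proof
      fix i
      have "min (u (coeff f i)) (u (coeff g i)) \<le> u (coeff (f + g) i)" unfolding coeff_add by (rule add_ge) auto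
      then have "min (u (coeff f i)) (u (coeff g i)) + Fin (of_nat i *\<^sub>Q \<delta>) \<le> ?t (f + g) i" by (rule add_right_mono)
      moreover have "min (?G f) (?G g) \<le> min (u (coeff f i)) (u (coeff g i)) + Fin (of_nat i *\<^sub>Q \<delta>)"
        using le[of f i] le[of g i] unfolding min_def by auto
      ultimately show "min (?G f) (?G g) \<le> ?t (f + g) i" by (rule order.trans[rotated])
    qed
  qed
qed

text \<open>The Gauss valuation of the Taylor expansion at a, which belongs to the ball of all x
  with u(x - a) \<ge> \<delta>.\<close>

definition ball_val :: "('c::field \<Rightarrow> 'h::linordered_rat_vector vext) \<Rightarrow> 'c \<Rightarrow> 'h \<Rightarrow> 'c poly \<Rightarrow> 'h vext" where
  "ball_val u a \<delta> f = gauss u \<delta> (pcompose f [:a, 1:])"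

lemma is_valuation_ball_val: assumes "is_valuation u" shows "is_valuation (ball_val u a \<delta>)"
proof -
  have "pcompose 0 [:a, 1:] = 0" "pcompose 1 [:a, 1:] = 1" by (simp_all add: pcompose_1)
  then show ?thesis using is_valuation_gauss[OF assms, of \<delta>]
    unfolding ball_val_def is_valuation_def pcompose_mult pcompose_add by metis
qed

lemma ball_val_const: "ball_val u a \<delta> [:c:] = u c"
proof -
  have "u c + Fin 0 = u c" by (metis add.right_neutral zero_vext_def)
  then show ?thesis by (simp add: ball_val_def gauss_def scaleQ_basics)
qed

lemma ball_val_linear: "is_valuation u \<Longrightarrow> ball_val u a \<delta> [:- b, 1:] = min (u (a - b)) (Fin \<delta>)"
proof -
  assume u: "is_valuation u"
  have "{..Suc 0} = {0, Suc 0}" by auto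
  then show ?thesis using u by (simp add: ball_val_def gauss_def pcompose_pCons scaleQ_basics scaleQ_one
      zero_vext_def[symmetric] is_valuation_def)
qed

lemma ball_val_le_poly: assumes "is_valuation u" shows "ball_val u a \<delta> f \<le> u (poly f a)"
proof -
  have "ball_val u a \<delta> f \<le> u (coeff (pcompose f [:a, 1:]) 0) + Fin (of_nat 0 *\<^sub>Q \<delta>)"
    unfolding ball_val_def using le_gauss_iff[OF assms] by blast
  also have "coeff (pcompose f [:a, 1:]) 0 = poly f a" by (simp add: poly_0_coeff_0[symmetric] poly_pcompose)
  finally show ?thesis by (simp add: scaleQ_basics zero_vext_def[symmetric])
qed

section \<open>Ball valuations in terms of the roots\<close>

lemma valuation_prod_mset:
  assumes "is_valuation u" shows "u (\<Prod>x\<in>#A. f x) = (\<Sum>x\<in>#A. u (f x))"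
proof -
  interpret val_on UNIV u using assms by (rule val_on_UNIV)
  show ?thesis by (induction A) (auto simp: one mult)
qed

lemma poly_factorization:
  fixes f :: "'c::alg_closed_field poly"
  shows "f = smult (lead_coeff f) (\<Prod>x\<in>#proots f. [:- x, 1:])"
proof (cases "f = 0")
  case False
  then obtain A where A: "f = smult (lead_coeff f) (\<Prod>x\<in>#A. [:- x, 1:])"
    using alg_closed_imp_factorization by blast
  have "proots (\<Prod>x\<in>#A. [:- x, 1:]) = A" for A :: "'c multiset"
  proof (induction A)
    case (add x A)
    have "(\<Prod>x\<in>#A. [:- x, 1:]) \<noteq> 0" by (auto simp: prod_mset_zero_iff)
    then show ?case using add proots_mult[of "[:- x, 1:]" "\<Prod>x\<in>#A. [:- x, 1:]"] by simp
  qed simp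
  then have "proots f = A" using False by (subst A) simp
  then show ?thesis using A by simp
qed simp

lemma poly_as_product:
  fixes f :: "'c::alg_closed_field poly"
  shows "poly f a = lead_coeff f * (\<Prod>x\<in>#proots f. a - x)"
proof -
  have "poly (\<Prod>x\<in>#A. [:- x, 1:]) a = (\<Prod>x\<in>#A. a - x)" for A :: "'c multiset"
    by (induction A) (auto simp: algebra_simps)
  then show ?thesis by (subst poly_factorization[of f]) simp
qed

lemma valuation_poly:
  fixes f :: "'c::alg_closed_field poly"
  assumes "is_valuation u"
  shows "u (poly f a) = u (lead_coeff f) + (\<Sum>x\<in>#proots f. u (a - x))"
proof -
  interpret val_on UNIV u using assms by (rule val_on_UNIV)
  show ?thesis by (subst poly_as_product) (simp add: mult valuation_prod_mset[OF assms])
qed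

lemma ball_val_eq:
  fixes f :: "'c::alg_closed_field poly"
  assumes "is_valuation u"
  shows "ball_val u a \<delta> f = u (lead_coeff f) + (\<Sum>x\<in>#proots f. min (u (a - x)) (Fin \<delta>))"
proof -
  interpret val_on UNIV "ball_val u a \<delta>" using is_valuation_ball_val[OF assms] by (rule val_on_UNIV)
  have "ball_val u a \<delta> f = ball_val u a \<delta> ([:lead_coeff f:] * (\<Prod>x\<in>#proots f. [:- x, 1:]))"
    by (subst poly_factorization[of f]) simp
  then show ?thesis
    unfolding mult[OF UNIV_I UNIV_I] valuation_prod_mset[OF is_valuation_ball_val[OF assms]] ball_val_const ball_val_linear[OF assms] .
qed

text \<open>By \<open>ball_val_eq\<close> the center enters only through the truncated distances
  min(u(a - x), \<delta>), which agree for two points of the same ball.\<close>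

lemma ball_val_center:
  fixes f :: "'c::alg_closed_field poly"
  assumes u: "is_valuation u" and ab: "Fin \<delta> \<le> u (a - b)"
  shows "ball_val u a \<delta> f = ball_val u b \<delta> f"
proof -
  interpret val_on UNIV u using u by (rule val_on_UNIV)
  have "min (u (a - x)) (Fin \<delta>) = min (u (b - x)) (Fin \<delta>)" for x
  proof -
    have 1: "min (u (a - x)) (Fin \<delta>) \<le> u (b - x)" if "Fin \<delta> \<le> u (a - b)" for a b
      using diff_ge[of "a - x" "a - b" "min (u (a - x)) (Fin \<delta>)"] that by (auto simp: min.coboundedI2)
    moreover have "Fin \<delta> \<le> u (b - a)" using ab uminus[of "a - b"] by simp
    ultimately show ?thesis using 1[OF ab] 1[of b a] by (intro antisym) auto
  qed
  then show ?thesis unfolding ball_val_eq[OF u] by simp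
qed

subsection \<open>Extending valuations to algebraic extensions\<close>

text \<open>Cancellation in x i + y i ^ N needs equal values. For each i at most one N > 0 gives
  these: the values of the powers of y i are distinct, or they are constant and different from the
  negative value of x i. This serves as a weak approximation statement for several conjugate
  valuations.\<close>

lemma neg_combination:
  fixes u :: "'c::field \<Rightarrow> 'h::linordered_rat_vector vext"
  assumes u: "is_valuation u" and I: "finite I" and neg: "\<And>i. i \<in> I \<Longrightarrow> u (x i) < 0 \<or> u (y i) < 0"
  shows "\<exists>N>0. \<forall>i\<in>I. u (x i + y i ^ N) < 0"
proof -
  interpret val_on UNIV u using u by (rule val_on_UNIV)
  define bad where "bad i = {N. N > 0 \<and> u (x i) = u (y i ^ N)}" for i
  have "finite (bad i)" if i: "i \<in> I" for i
  proof (cases "u (y i)")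
    case (Fin \<gamma>)
    have pw: "u (y i ^ N) = Fin (of_nat N *\<^sub>Q \<gamma>)" for N
      using valuation_power[of UNIV u "y i" \<gamma> N] u Fin by (simp add: is_valuation_iff)
    show ?thesis
    proof (cases "\<gamma> = 0")
      case True
      then have "u (y i) = 0" using Fin by (simp add: zero_vext_def)
      then have "u (x i) < 0" using neg[OF i] by simp
      then have "bad i = {}" using pw True by (auto simp: bad_def scaleQ_basics zero_vext_def)
      then show ?thesis by simp
    next
      case False
      have "M = N" if "of_nat M *\<^sub>Q \<gamma> = of_nat N *\<^sub>Q \<gamma>" for M N
      proof -
        have "of_nat M *\<^sub>Q \<gamma> \<noteq> of_nat N *\<^sub>Q \<gamma>" if "M < N" for M N
        proof (cases "\<gamma> > 0")
          case True
          then show ?thesis using scaleQ_mono_left(1)[OF True, of "of_nat M" "of_nat N"] that by simp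
        next
          case False': False
          then have "- \<gamma> > 0" using False by simp
          from scaleQ_mono_left(1)[OF this, of "of_nat M" "of_nat N"] that show ?thesis by (simp add: scaleQ_basics)
        qed
        then show ?thesis using that by (metis linorder_neqE_nat)
      qed
      moreover define M where "M = (SOME N. u (x i) = Fin (of_nat N *\<^sub>Q \<gamma>))"
      ultimately have "N = M" if "u (x i) = Fin (of_nat N *\<^sub>Q \<gamma>)" for N
        using someI[of "\<lambda>N. u (x i) = Fin (of_nat N *\<^sub>Q \<gamma>)" N] that by (metis vext.inject)
      then have "bad i \<subseteq> {M}" unfolding bad_def pw by blast
      then show ?thesis by (rule finite_subset) simp
    qed
  next
    case Infty
    then have "u (x i) < 0" using neg[OF i] by (simp add: vext_basics)
    moreover have "u (y i ^ N) = Infty" if "N > 0" for N using Infty that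
      by (cases N) (auto simp: mult vext_basics)
    ultimately have "bad i = {}" by (auto simp: bad_def vext_basics)
    then show ?thesis by simp
  qed
  then have "finite (insert 0 (\<Union>i\<in>I. bad i))" using I by simp
  then obtain N where N: "N \<notin> insert 0 (\<Union>i\<in>I. bad i)" using ex_new_if_finite[OF infinite_UNIV_nat] by blast
  then have "N > 0" by simp
  moreover have "u (x i + y i ^ N) < 0" if i: "i \<in> I" for i
  proof -
    have ne: "u (x i) \<noteq> u (y i ^ N)" using N i \<open>N > 0\<close> by (auto simp: bad_def)
    have yN: "u (y i ^ N) < 0" if "u (y i) < 0"
    proof -
      have nz: "u (y i) \<noteq> Infty" using that by (auto simp: vext_basics)
      then obtain \<gamma> where \<gamma>: "u (y i) = Fin \<gamma>" by (cases "u (y i)") auto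
      then have "of_nat N *\<^sub>Q (- \<gamma>) > 0" using that \<open>N > 0\<close> by (intro scaleQ_pos) (auto simp: vext_basics)
      then show ?thesis using valuation_power[of UNIV u "y i" \<gamma> N] u \<gamma>
        by (simp add: is_valuation_iff vext_basics scaleQ_basics)
    qed
    consider "u (x i) < u (y i ^ N)" | "u (y i ^ N) < u (x i)" using ne by (metis linorder_neqE)
    then show ?thesis
    proof cases
      case 1
      then show ?thesis using add_eq(1)[OF UNIV_I UNIV_I 1] neg[OF i] yN 1 by (metis less_trans)
    next
      case 2
      then show ?thesis using add_eq(2)[OF UNIV_I UNIV_I 2] neg[OF i] yN 2 by (metis less_trans)
    qed
  qed
  ultimately show ?thesis by blast
qed

text \<open>Multiplication by T - c with u(c) < 0 adds u(c) to the value of the constant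
  coefficient, and no other coefficient can catch up: all slopes of the Newton polygon have the same
  sign.\<close>

lemma dominant_constant_coefficient:
  fixes u :: "'c::field \<Rightarrow> 'h::linordered_rat_vector vext"
  assumes u: "is_valuation u" and neg: "\<And>c. c \<in># A \<Longrightarrow> u c < 0"
  defines "P \<equiv> (\<Prod>c\<in>#A. [:- c, 1:])"
  shows "u (coeff P 0) \<noteq> Infty \<and> (\<forall>i>0. u (coeff P 0) < u (coeff P i))"
  unfolding P_def using neg
proof (induction A)
  interpret val_on UNIV u using u by (rule val_on_UNIV)
  case empty
  then show ?case by (auto simp: one zero vext_basics zero_vext_def)
next
  interpret val_on UNIV u using u by (rule val_on_UNIV)
  case (add c A)
  let ?P = "\<Prod>c\<in>#A. [:- c, 1:]"
  have IH: "u (coeff ?P 0) \<noteq> Infty" "\<And>i. i > 0 \<Longrightarrow> u (coeff ?P 0) < u (coeff ?P i)" using add by auto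
  have c: "u c < 0" "u c \<noteq> Infty" using add.prems[of c] by (auto simp: vext_basics)
  have co: "coeff (\<Prod>c\<in>#add_mset c A. [:- c, 1:]) i = (case i of 0 \<Rightarrow> 0 | Suc j \<Rightarrow> coeff ?P j) - c * coeff ?P i" for i
    by (simp add: coeff_pCons split: nat.splits)
  have u0: "u (coeff (\<Prod>c\<in>#add_mset c A. [:- c, 1:]) 0) = u c + u (coeff ?P 0)" unfolding co by (simp add: uminus mult)
  have "u c + u (coeff ?P 0) < u (coeff (\<Prod>c\<in>#add_mset c A. [:- c, 1:]) i)" if i: "i > 0" for i
    unfolding co
  proof (rule diff_gt)
    obtain j where j: "i = Suc j" using i by (cases i) auto
    have "u (coeff ?P 0) \<le> u (coeff ?P j)" using IH(2)[of j] by (cases j) auto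
    then have "u c + u (coeff ?P 0) < 0 + u (coeff ?P j)" using vext_add_less_le(1)[OF c(1) _ IH(1)] by blast
    then show "u c + u (coeff ?P 0) < u (case i of 0 \<Rightarrow> 0 | Suc j \<Rightarrow> coeff ?P j)" using j by simp
    show "u c + u (coeff ?P 0) < u (c * coeff ?P i)" using IH(2)[OF i] c(2) by (simp add: mult vext_add_cancel)
  qed auto
  then show ?case using u0 c IH(1) by (auto simp: vext_basics)
qed

lemma pcompose_pCons': "pcompose (pCons a p) q = [:a:] + q * pcompose p q"
  by (rule pcompose_pCons)

section \<open>Valued fields inside an algebraic closure\<close>

locale valued_closure =
  fixes K :: "'c::alg_closed_field set" and u :: "'c \<Rightarrow> 'g::linordered_rat_vector vext"
  assumes K: "is_subfield K" and alg: "algebraic_over K x"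
    and val: "is_valuation u"
    and value_dense: "\<exists>a\<in>K. \<exists>n>0. u a = Fin (of_nat n *\<^sub>Q \<gamma>)"
begin

sublocale u: val_on UNIV u using val by (rule val_on_UNIV)

lemma alg': "K \<subseteq> E \<Longrightarrow> algebraic_over E x"
  using alg algebraic_over_mono by blast

lemma valuation_on_root: "is_subfield E \<Longrightarrow> valuation_on (polys_over E) (\<lambda>f. u (poly f x))"
  by (auto simp: valuation_on_def polys_over_closed u.zero u.one u.mult intro: u.add_ge)

text \<open>Let m be the minimal polynomial of F(\<theta>). Its roots are values of F at roots of
  \<phi>, hence negative, so the constant coefficient of m is dominant. As \<nu> F \<ge> 0, the
  value of m(F) under \<nu> is that of this coefficient and finite, although \<phi> divides
  m(F).\<close>

lemma negative_at_roots_contradiction: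
  assumes E: "is_subfield E" "K \<subseteq> E" and \<phi>: "\<phi> \<in> Irr E" and \<nu>: "valuation_on (polys_over E) \<nu>"
    and const: "\<And>a. a \<in> E \<Longrightarrow> \<nu> [:a:] = u a" and supp: "\<nu> \<phi> = Infty"
    and F: "F \<in> polys_over E" "0 \<le> \<nu> F" "\<And>\<theta>. poly \<phi> \<theta> = 0 \<Longrightarrow> u (poly F \<theta>) < 0"
  shows False
proof -
  interpret n: val_on "polys_over E" \<nu> by unfold_locales (rule \<nu>)
  obtain \<theta> where \<theta>: "poly \<phi> \<theta> = 0" using alg_closed_imp_poly_has_root IrrD(3)[OF \<phi>] by blast
  obtain m where m: "m \<in> Irr E" "poly m (poly F \<theta>) = 0" using Irr_exists[OF E(1) alg'[OF E(2)]] by blast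
  have "u c < 0" if "c \<in># proots m" for c
  proof -
    have "poly m c = 0" using that IrrD(4)[OF m(1)] by simp
    then obtain \<theta>' where "poly \<phi> \<theta>' = 0" "poly F \<theta>' = c"
      using conjugate_lift[OF E(1) alg'[OF E(2)] m _ F(1) refl IrrD(1)[OF \<phi>] \<theta>] by blast
    then show ?thesis using F(3) by auto
  qed
  then have "u (coeff (\<Prod>c\<in>#proots m. [:- c, 1:]) 0) \<noteq> Infty \<and> (\<forall>i>0. u (coeff (\<Prod>c\<in>#proots m. [:- c, 1:]) 0)
      < u (coeff (\<Prod>c\<in>#proots m. [:- c, 1:]) i))" by (rule dominant_constant_coefficient[OF val])
  then have dom: "u (coeff m 0) \<noteq> Infty" "\<And>i. i > 0 \<Longrightarrow> u (coeff m 0) < u (coeff m i)"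
    using poly_factorization[of m] unfolding IrrD(2)[OF m(1)] by auto
  have mF: "pcompose m F \<in> polys_over E" using polys_over_pcompose[OF E(1) IrrD(1)[OF m(1)] F(1)] .
  then have "\<phi> dvd pcompose m F" using Irr_dvd[OF E(1) \<phi> mF \<theta>] m(2) by (simp add: poly_pcompose)
  then obtain h where h: "pcompose m F = \<phi> * h" by blast
  then have "h \<in> polys_over E" using polys_over_dvd_factor[OF E(1) _ IrrD(1)[OF \<phi>] IrrD(4)[OF \<phi>]] mF by simp
  then have inf: "\<nu> (pcompose m F) = Infty" using h supp n.mult[OF IrrD(1)[OF \<phi>]] by (simp add: vext_basics)
  \<comment> \<open>Horner evaluation at an element of nonnegative value preserves a strict lower
    bound for the coefficients.\<close>
  have gt: "x < \<nu> (pcompose p F)" if "x \<noteq> Infty" "p \<in> polys_over E" "\<And>i. x < u (coeff p i)" for p x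
    using that(2,3)
  proof (induction p)
    case 0
    then show ?case using n.zero that(1) by (simp add: vext_basics)
  next
    case (pCons a p)
    have a: "a \<in> E" "x < u a" using polys_overD[OF pCons.prems(1), of 0] pCons.prems(2)[of 0] by auto
    have p: "p \<in> polys_over E" using polys_overD[OF pCons.prems(1), of "Suc i" for i] by (intro polys_overI) auto
    have IH: "x < \<nu> (pcompose p F)" using pCons.IH[OF p] pCons.prems(2)[of "Suc i" for i] by simp
    have pF: "pcompose p F \<in> polys_over E" by (rule polys_over_pcompose[OF E(1) p F(1)])
    have "x < \<nu> F + \<nu> (pcompose p F)" using add_mono[OF F(2), of "\<nu> (pcompose p F)"] IH by (auto intro: less_le_trans)
    then have "x < \<nu> (F * pcompose p F)" using n.mult[OF F(1) pF] by simp
    moreover have "x < \<nu> [:a:]" using a const by simp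
    ultimately show ?case unfolding pcompose_pCons'
      using n.add_gt polys_over_closed(6)[OF E(1) F(1) pF] polys_over_closed(1,7)[OF E(1)] a(1) by simp
  qed
  obtain a m' where m': "m = pCons a m'" by (cases m)
  have mE: "m \<in> polys_over E" by (rule IrrD(1)[OF m(1)])
  have a: "a \<in> E" "u a \<noteq> Infty" "\<And>i. u a < u (coeff m' i)" using polys_overD[OF mE, of 0] dom(1) dom(2)[of "Suc i" for i] m' by auto
  have m'E: "m' \<in> polys_over E" using polys_overD[OF mE, of "Suc i" for i] m' by (intro polys_overI) auto
  have "u a < \<nu> (pcompose m' F)" by (rule gt[OF a(2) m'E a(3)])
  moreover have pF: "pcompose m' F \<in> polys_over E" by (rule polys_over_pcompose[OF E(1) m'E F(1)])
  ultimately have "u a < \<nu> F + \<nu> (pcompose m' F)" using add_mono[OF F(2), of "\<nu> (pcompose m' F)"] by (auto intro: less_le_trans)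
  then have "\<nu> [:a:] < \<nu> (F * pcompose m' F)" using n.mult[OF F(1) pF] const a(1) by simp
  then have "\<nu> (pcompose m F) = \<nu> [:a:]" unfolding m' pcompose_pCons'
    using n.add_eq(1) polys_over_closed(6)[OF E(1) F(1) pF] polys_over_closed(1,7)[OF E(1)] a(1) by simp
  then show False using inf a(2) const[OF a(1)] by simp
qed

text \<open>The threshold \<gamma> need not be a value of K, but some n \<gamma> is; dividing f^n by
  a constant of that value moves the threshold to 0. The map c sends constants of K into the ring
  S.\<close>

lemma separating_element:
  assumes "valuation_on S \<nu>" "valuation_on S \<omega>" "f \<in> S" "\<omega> f < \<nu> f" "\<nu> f \<noteq> Infty"
    and const: "\<And>a. a \<in> K \<Longrightarrow> c a \<in> S \<and> \<nu> (c a) = u a \<and> \<omega> (c a) = u a"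
    and \<gamma>: "\<omega> f < Fin \<gamma>" "Fin \<gamma> \<le> \<nu> f"
  shows "\<exists>h\<in>S. \<omega> h < 0 \<and> 0 \<le> \<nu> h \<and> (Fin \<gamma> < \<nu> f \<longrightarrow> 0 < \<nu> h)"
proof -
  interpret n: val_on S \<nu> by unfold_locales (rule assms)
  interpret w: val_on S \<omega> by unfold_locales (rule assms)
  obtain a n where an: "a \<in> K" "n > 0" "u a = Fin (of_nat n *\<^sub>Q \<gamma>)" using value_dense by blast
  have ia: "inverse a \<in> K" "u (inverse a) = Fin (- (of_nat n *\<^sub>Q \<gamma>))"
    using is_subfieldD(5)[OF K an(1)] field_valuation(2)[OF val an(3)] by auto
  have ci: "c (inverse a) \<in> S" "\<nu> (c (inverse a)) = u (inverse a)" "\<omega> (c (inverse a)) = u (inverse a)"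
    using const[OF ia(1)] by auto
  define h where "h = f ^ n * c (inverse a)"
  obtain \<alpha> where \<alpha>: "\<omega> f = Fin \<alpha>" using assms(4) by (cases "\<omega> f") (auto simp: vext_basics)
  obtain \<beta> where \<beta>: "\<nu> f = Fin \<beta>" using assms(5) by (cases "\<nu> f") auto
  have fn: "f ^ n \<in> S" using n.closed(7) assms(3) by blast
  have n0: "(0::rat) < of_nat n" using an(2) by simp
  have "\<omega> h = Fin (of_nat n *\<^sub>Q (\<alpha> - \<gamma>))"
    using valuation_power[OF assms(2,3) \<alpha>, of n] w.mult[OF fn ci(1)] ci(3) ia(2)
    by (simp add: h_def scaleQ_basics)
  moreover have "of_nat n *\<^sub>Q (\<alpha> - \<gamma>) < 0"
    using scaleQ_mono(1)[OF n0, of \<alpha> \<gamma>] \<gamma>(1) \<alpha> by (simp add: scaleQ_basics vext_basics)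
  moreover have "\<nu> h = Fin (of_nat n *\<^sub>Q (\<beta> - \<gamma>))"
    using valuation_power[OF assms(1,3) \<beta>, of n] n.mult[OF fn ci(1)] ci(2) ia(2)
    by (simp add: h_def scaleQ_basics)
  moreover have "0 \<le> of_nat n *\<^sub>Q (\<beta> - \<gamma>)" "\<gamma> < \<beta> \<longrightarrow> 0 < of_nat n *\<^sub>Q (\<beta> - \<gamma>)"
    using scaleQ_mono(1)[OF n0, of \<gamma> \<beta>] scaleQ_mono(2)[OF n0, of \<gamma> \<beta>] \<gamma>(2) \<beta> by (simp_all add: scaleQ_basics)
  moreover have "h \<in> S" unfolding h_def by (rule n.closed(4)[OF fn ci(1)])
  ultimately show ?thesis using \<beta> by (intro bexI[of _ h]) (auto simp: vext_basics)
qed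

text \<open>Every extension of the valuation to the quotient field of E[x] by \<phi> comes from a
  root of \<phi>. If no root dominated \<nu>, then elements negative at single roots could be
  combined into one that is negative at all of them.\<close>

lemma valuation_on_algebraic_extension:
  assumes E: "is_subfield E" "K \<subseteq> E" and \<phi>: "\<phi> \<in> Irr E" and \<nu>: "valuation_on (polys_over E) \<nu>"
    and const: "\<And>a. a \<in> E \<Longrightarrow> \<nu> [:a:] = u a" and supp: "\<nu> \<phi> = Infty"
  shows "\<exists>\<theta>. poly \<phi> \<theta> = 0 \<and> (\<forall>f\<in>polys_over E. \<nu> f = u (poly f \<theta>))"
proof -
  interpret n: val_on "polys_over E" \<nu> by unfold_locales (rule \<nu>)
  note c = polys_over_closed[OF E(1)]
  have inf: "\<phi> dvd f" if f: "f \<in> polys_over E" "\<nu> f = Infty" for f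
  proof (rule ccontr)
    assume "\<not> \<phi> dvd f"
    then obtain A B where AB: "A \<in> polys_over E" "B \<in> polys_over E" "A * \<phi> + B * f = 1"
      using Irr_bezout[OF E(1) \<phi> f(1)] by blast
    have "\<nu> (A * \<phi>) = Infty" "\<nu> (B * f) = Infty"
      using n.mult AB(1,2) IrrD(1)[OF \<phi>] f supp by (auto simp: vext_basics)
    then have "Infty \<le> \<nu> (A * \<phi> + B * f)"
      by (intro n.add_ge c(6) AB IrrD(1)[OF \<phi>] f(1)) simp_all
    then show False using AB(3) n.one by (simp add: zero_vext_def)
  qed
  have "\<exists>\<theta>. poly \<phi> \<theta> = 0 \<and> (\<forall>f\<in>polys_over E. \<nu> f \<le> u (poly f \<theta>))"
  proof (rule ccontr)
    assume neg: "\<not> ?thesis"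
    \<comment> \<open>The threshold is the value \<nu> f itself, so the separating element has value
      0 under \<nu>, and negative value at \<theta>.\<close>
    have sep: "\<exists>h\<in>polys_over E. u (poly h \<theta>) < 0 \<and> 0 \<le> \<nu> h" if \<theta>: "poly \<phi> \<theta> = 0" for \<theta>
    proof -
      obtain f where f: "f \<in> polys_over E" "u (poly f \<theta>) < \<nu> f" using neg \<theta> by force
      have fin: "\<nu> f \<noteq> Infty"
      proof
        assume "\<nu> f = Infty"
        then have "poly f \<theta> = 0" using inf[OF f(1)] \<theta> by (auto elim: dvdE)
        then show False using f(2) u.zero by (simp add: vext_basics)
      qed
      then obtain \<gamma> where \<gamma>: "\<nu> f = Fin \<gamma>" by (cases "\<nu> f") auto
      have "[:a:] \<in> polys_over E \<and> \<nu> [:a:] = u a \<and> u (poly [:a:] \<theta>) = u a" if "a \<in> K" for a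
        using that E(2) const c by auto
      then show ?thesis
        using separating_element[OF \<nu> valuation_on_root[OF E(1)] f fin, of "\<lambda>a. [:a:]" \<gamma>] f \<gamma> by auto
    qed
    have "\<exists>F\<in>polys_over E. 0 \<le> \<nu> F \<and> (\<forall>\<theta>\<in>T. u (poly F \<theta>) < 0)" if "finite T" "\<forall>\<theta>\<in>T. poly \<phi> \<theta> = 0" for T
      using that
    proof (induction T rule: finite_induct)
      case empty
      then show ?case using c(2) n.one by (intro bexI[of _ 1]) auto
    next
      case (insert \<theta> T)
      then obtain F where F: "F \<in> polys_over E" "0 \<le> \<nu> F" "\<forall>\<theta>\<in>T. u (poly F \<theta>) < 0" by auto
      obtain h where h: "h \<in> polys_over E" "u (poly h \<theta>) < 0" "0 \<le> \<nu> h" using sep insert.prems by auto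
      have "u (poly F i) < 0 \<or> u (poly h i) < 0" if "i \<in> insert \<theta> T" for i using that F(3) h(2) by auto
      then obtain N where N: "\<forall>i\<in>insert \<theta> T. u (poly F i + poly h i ^ N) < 0"
        using neg_combination[OF val, of "insert \<theta> T" "poly F" "poly h"] insert.hyps by auto
      have "0 \<le> \<nu> (F + h ^ N)" using n.add_ge[OF F(1) n.closed(7)[OF h(1)] F(2) n.power_ge_0[OF h(1,3)]] .
      then show ?case using N c(3)[OF F(1) n.closed(7)[OF h(1)]] by (intro bexI[of _ "F + h ^ N"]) auto
    qed
    from this[OF poly_roots_finite[OF IrrD(4)[OF \<phi>]]]
    have "\<exists>F\<in>polys_over E. 0 \<le> \<nu> F \<and> (\<forall>\<theta>\<in>{\<theta>. poly \<phi> \<theta> = 0}. u (poly F \<theta>) < 0)" by simp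
    then obtain F where "F \<in> polys_over E" "0 \<le> \<nu> F" "\<And>\<theta>. poly \<phi> \<theta> = 0 \<Longrightarrow> u (poly F \<theta>) < 0"
      by blast
    then show False using negative_at_roots_contradiction[OF E \<phi> \<nu> const supp] by blast
  qed
  then obtain \<theta> where \<theta>: "poly \<phi> \<theta> = 0" "\<And>f. f \<in> polys_over E \<Longrightarrow> \<nu> f \<le> u (poly f \<theta>)" by blast
  have "u (poly f \<theta>) \<le> \<nu> f" if f: "f \<in> polys_over E" for f
  proof (cases "\<nu> f = Infty")
    case False
    have "\<not> \<phi> dvd f"
    proof
      assume "\<phi> dvd f"
      then obtain h where h: "f = \<phi> * h" by blast
      then have "h \<in> polys_over E" using polys_over_dvd_factor[OF E(1) _ IrrD(1)[OF \<phi>] IrrD(4)[OF \<phi>]] f by simp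
      then show False using n.mult[OF IrrD(1)[OF \<phi>]] h supp False by (simp add: vext_basics)
    qed
    \<comment> \<open>B inverts f modulo \<phi>. For both the values under \<nu> are at most those
      at \<theta>, and either pair of values adds up to 0; so equality holds.\<close>
    then obtain A B where AB: "A \<in> polys_over E" "B \<in> polys_over E" "A * \<phi> + B * f = 1"
      using Irr_bezout[OF E(1) \<phi> f] by blast
    have "\<nu> (A * \<phi>) = Infty" using n.mult[OF AB(1) IrrD(1)[OF \<phi>]] supp by (simp add: vext_basics)
    moreover have Bf: "B * f = 1 - A * \<phi>" using AB(3) by (simp add: eq_diff_eq add.commute)
    ultimately have "\<nu> (B * f) = 0"
      using n.diff_eq(1)[of 1 "A * \<phi>"] n.one c(2) c(6)[OF AB(1) IrrD(1)[OF \<phi>]] by (simp add: zero_vext_def vext_basics)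
    then have 1: "\<nu> B + \<nu> f = 0" using n.mult[OF AB(2) f] by simp
    have "poly B \<theta> * poly f \<theta> = 1" using arg_cong[OF Bf, of "\<lambda>p. poly p \<theta>"] \<theta>(1) by simp
    then have 2: "u (poly B \<theta>) + u (poly f \<theta>) = 0" using u.mult[of "poly B \<theta>" "poly f \<theta>"] u.one by simp
    show ?thesis using 1 2 \<theta>(2)[OF AB(2)] \<theta>(2)[OF f]
      by (cases "\<nu> B"; cases "\<nu> f"; cases "u (poly B \<theta>)"; cases "u (poly f \<theta>)")
        (auto simp: zero_vext_def add_eq_0_iff)
  qed (simp add: vext_basics)
  then show ?thesis using \<theta> antisym by blast
qed

text \<open>The valuation of E(x) is transported to polynomials over \<sigma>(E) by applying the
  inverse of \<sigma> to the coefficients and evaluating at x. It is infinite at \<sigma>P, so it is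
  realized by a root y of \<sigma>P, and sending x to y preserves values.\<close>

lemma extend_valued_embedding_step:
  assumes E: "K \<subseteq> E" "is_subfield E" and s: "is_embedding E \<sigma>" "\<forall>a\<in>K. \<sigma> a = a" "\<forall>a\<in>E. u (\<sigma> a) = u a"
  shows "\<exists>\<tau>. is_embedding (adjoin E x) \<tau> \<and> (\<forall>a\<in>E. \<tau> a = \<sigma> a) \<and> (\<forall>a\<in>adjoin E x. u (\<tau> a) = u a)"
proof -
  note e = is_subfieldD[OF E(2)] and se = is_embeddingD[OF E(2) s(1)]
  define E' where "E' = \<sigma> ` E"
  define \<rho> where "\<rho> = inv_into E \<sigma>"
  have inj: "inj_on \<sigma> E" using se(10) by (auto intro: inj_onI)
  have \<rho>\<sigma>: "\<rho> (\<sigma> a) = a" if "a \<in> E" for a using that inj by (simp add: \<rho>_def)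
  have E': "is_subfield E'"
    unfolding is_subfield_def E'_def
  proof (intro conjI ballI)
    show "1 \<in> \<sigma> ` E" using e(1) se(1) by (metis imageI)
    fix a assume "a \<in> \<sigma> ` E"
    then obtain a' where a': "a = \<sigma> a'" "a' \<in> E" by blast
    show "inverse a \<in> \<sigma> ` E" using a' se(7)[OF a'(2)] e(5)[OF a'(2)] by (metis imageI)
    fix b assume "b \<in> \<sigma> ` E"
    then obtain b' where b': "b = \<sigma> b'" "b' \<in> E" by blast
    show "a - b \<in> \<sigma> ` E" using a' b' se(6)[OF a'(2) b'(2)] e(3)[OF a'(2) b'(2)] by (metis imageI)
    show "a * b \<in> \<sigma> ` E" using a' b' se(4)[OF a'(2) b'(2)] e(4)[OF a'(2) b'(2)] by (metis imageI)
  qed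
  have r: "is_embedding E' \<rho>"
    unfolding is_embedding_def E'_def
  proof (intro conjI ballI)
    show "\<rho> 1 = 1" using \<rho>\<sigma>[OF e(1)] se(1) by simp
    fix a b assume "a \<in> \<sigma> ` E" "b \<in> \<sigma> ` E"
    then obtain a' b' where ab: "a = \<sigma> a'" "a' \<in> E" "b = \<sigma> b'" "b' \<in> E" by blast
    show "\<rho> (a + b) = \<rho> a + \<rho> b" using ab se(3)[OF ab(2,4), symmetric] \<rho>\<sigma> e by simp
    show "\<rho> (a * b) = \<rho> a * \<rho> b" using ab se(4)[OF ab(2,4), symmetric] \<rho>\<sigma> e by simp
  qed
  have KE': "K \<subseteq> E'" unfolding E'_def using E(1) s(2) by (metis imageI subsetD subsetI)
  note m = map_poly_embedding[OF E(2) s(1)] and mr = map_poly_embedding[OF E' r]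
  have m_in: "map_poly \<sigma> f \<in> polys_over E'" if "f \<in> polys_over E" for f
    using polys_overD[OF that] by (intro polys_overI) (simp add: coeff_map_poly_embedding[OF E(2) s(1)] E'_def)
  have mr_in: "map_poly \<rho> f \<in> polys_over E" if f: "f \<in> polys_over E'" for f
  proof (rule polys_overI)
    fix i
    obtain a where "a \<in> E" "coeff f i = \<sigma> a" using polys_overD[OF f, of i] by (auto simp: E'_def)
    then show "coeff (map_poly \<rho> f) i \<in> E" by (simp add: coeff_map_poly_embedding[OF E' r] \<rho>\<sigma>)
  qed
  have mm: "map_poly \<rho> (map_poly \<sigma> f) = f" if "f \<in> polys_over E" for f
    using polys_overD[OF that] by (intro poly_eqI)
      (simp add: coeff_map_poly_embedding[OF E(2) s(1)] coeff_map_poly_embedding[OF E' r] \<rho>\<sigma>)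
  obtain P where P: "P \<in> Irr E" "poly P x = 0" using Irr_exists[OF E(2) alg'[OF E(1)]] by blast
  define P' where "P' = map_poly \<sigma> P"
  have PE: "P \<in> polys_over E" by (rule IrrD(1)[OF P(1)])
  have dP': "degree P' = degree P" unfolding P'_def by (rule m(7)[OF PE])
  have P': "P' \<in> Irr E'"
    unfolding Irr_def mem_Collect_eq
  proof (intro conjI ballI impI)
    show P'E: "P' \<in> polys_over E'" unfolding P'_def by (rule m_in[OF PE])
    show "lead_coeff P' = 1" unfolding dP' using IrrD(2)[OF P(1)] se(1) by (simp add: P'_def coeff_map_poly_embedding[OF E(2) s(1)])
    show "degree P' > 0" using dP' IrrD(3)[OF P(1)] by simp
    fix a b assume ab: "a \<in> polys_over E'" "b \<in> polys_over E'" "P' = a * b"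
    then have "P = map_poly \<rho> a * map_poly \<rho> b" using mm[OF PE] mr(3)[OF ab(1,2)] by (simp add: P'_def)
    then show "degree a = 0 \<or> degree b = 0"
      using IrrD(5)[OF P(1) mr_in[OF ab(1)] mr_in[OF ab(2)]] mr(7) ab by simp
  qed
  define \<nu> where "\<nu> g = u (poly (map_poly \<rho> g) x)" for g
  have "valuation_on (polys_over E') \<nu>"
    by (auto simp: valuation_on_def \<nu>_def polys_over_closed[OF E'] u.zero u.one u.mult mr intro: u.add_ge)
  moreover have "\<nu> [:a:] = u a" if "a \<in> E'" for a
  proof -
    have "map_poly \<rho> [:a:] = [:\<rho> a:]" using is_embeddingD(2)[OF E' r] by (simp add: map_poly_pCons)
    moreover have "u (\<rho> a) = u a" using that s(3) \<rho>\<sigma> by (auto simp: E'_def)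
    ultimately show ?thesis by (simp add: \<nu>_def)
  qed
  moreover have "\<nu> P' = Infty" using P(2) mm[OF PE] u.zero by (simp add: \<nu>_def P'_def)
  ultimately obtain y where y: "poly P' y = 0" "\<And>f. f \<in> polys_over E' \<Longrightarrow> \<nu> f = u (poly f y)"
    using valuation_on_algebraic_extension[OF E' KE' P'] by blast
  obtain \<tau> where \<tau>: "is_embedding (adjoin E x) \<tau>" "\<forall>f\<in>polys_over E. \<tau> (poly f x) = poly (map_poly \<sigma> f) y"
    "\<forall>a\<in>E. \<tau> a = \<sigma> a" using extend_embedding[OF E(2) s(1) P] y(1) unfolding P'_def by blast
  have "u (\<tau> a) = u a" if "a \<in> adjoin E x" for a
  proof -
    obtain f where f: "f \<in> polys_over E" "a = poly f x" using \<open>a \<in> adjoin E x\<close> by (auto simp: adjoin_def)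
    then have "u (\<tau> a) = \<nu> (map_poly \<sigma> f)" using \<tau>(2) y(2)[OF m_in[OF f(1)]] by simp
    then show ?thesis using f mm by (simp add: \<nu>_def)
  qed
  then show ?thesis using \<tau> by blast
qed

lemma extend_valued_embedding:
  assumes "K \<subseteq> E" "is_subfield E" "is_embedding E \<sigma>" "\<forall>a\<in>K. \<sigma> a = a" "\<forall>a\<in>E. u (\<sigma> a) = u a"
  shows "\<exists>\<tau>. is_embedding UNIV \<tau> \<and> (\<forall>a\<in>E. \<tau> a = \<sigma> a) \<and> (\<forall>a. u (\<tau> a) = u a)"
  by (rule extend_embedding_UNIV[OF alg _ assms]) (rule extend_valued_embedding_step)

text \<open>Equal values include equal zeros, so \<theta>' is a root of the minimal polynomial of
  \<theta>; on K(\<theta>) the resulting embedding preserves values by hypothesis.\<close>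

lemma valued_conjugates:
  assumes "\<And>f. f \<in> polys_over K \<Longrightarrow> u (poly f \<theta>) = u (poly f \<theta>')"
  shows "\<exists>\<tau>. is_embedding UNIV \<tau> \<and> (\<forall>a\<in>K. \<tau> a = a) \<and> (\<forall>a. u (\<tau> a) = u a) \<and> \<tau> \<theta> = \<theta>'"
proof -
  obtain P where P: "P \<in> Irr K" "poly P \<theta> = 0" using Irr_exists[OF K alg] by blast
  have "u (poly P \<theta>') = Infty" using assms[OF IrrD(1)[OF P(1)]] P(2) u.zero by simp
  then have "poly P \<theta>' = 0" by (simp only: field_valuation(1)[OF val])
  then have "poly (map_poly (\<lambda>x. x) P) \<theta>' = 0" by (simp add: map_poly_idI)
  then obtain \<tau>0 where \<tau>0: "is_embedding (adjoin K \<theta>) \<tau>0" "\<forall>f\<in>polys_over K. \<tau>0 (poly f \<theta>) = poly (map_poly (\<lambda>x. x) f) \<theta>'"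
    "\<tau>0 \<theta> = \<theta>'" "\<forall>a\<in>K. \<tau>0 a = a" using extend_embedding[OF K is_embedding_id P] by blast
  have "u (\<tau>0 a) = u a" if "a \<in> adjoin K \<theta>" for a
    using that \<tau>0(2) assms by (auto simp: adjoin_def map_poly_idI)
  then obtain \<tau> where \<tau>: "is_embedding UNIV \<tau>" "\<forall>a\<in>adjoin K \<theta>. \<tau> a = \<tau>0 a" "\<forall>a. u (\<tau> a) = u a"
    using extend_valued_embedding[OF _ is_subfield_adjoin[OF K alg] \<tau>0(1,4)] adjoin_base[OF K] by blast
  then show ?thesis using \<tau>0(3,4) adjoin_base[OF K] adjoin_gen[OF K] by (intro exI[of _ \<tau>]) auto
qed

lemma conjugates:
  assumes P: "P \<in> Irr K" "poly P \<theta> = 0" "poly P \<theta>' = 0"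
  shows "\<exists>\<tau>. is_embedding UNIV \<tau> \<and> (\<forall>a\<in>K. \<tau> a = a) \<and> \<tau> \<theta> = \<theta>'"
proof -
  have "poly (map_poly (\<lambda>x. x) P) \<theta>' = 0" using P by (simp add: map_poly_idI)
  then obtain \<tau>0 where \<tau>0: "is_embedding (adjoin K \<theta>) \<tau>0" "\<tau>0 \<theta> = \<theta>'" "\<forall>a\<in>K. \<tau>0 a = a"
    using extend_embedding[OF K is_embedding_id P(1,2)] by blast
  \<comment> \<open>The function to be preserved is constant, so the embedding alone is
    extended.\<close>
  have "\<exists>\<tau>. is_embedding UNIV \<tau> \<and> (\<forall>a\<in>adjoin K \<theta>. \<tau> a = \<tau>0 a) \<and> (\<forall>a::'c. () = ())"
  proof (rule extend_embedding_UNIV[OF alg _ _ is_subfield_adjoin[OF K alg] \<tau>0(1,3)])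
    fix E \<sigma> x assume E: "K \<subseteq> E" "is_subfield E" and s: "is_embedding E \<sigma>"
    obtain Q where Q: "Q \<in> Irr E" "poly Q x = 0" using Irr_exists[OF E(2) alg'[OF E(1)]] by blast
    have "degree (map_poly \<sigma> Q) > 0" using map_poly_embedding(7)[OF E(2) s IrrD(1)[OF Q(1)]] IrrD(3)[OF Q(1)] by simp
    then obtain y where "poly (map_poly \<sigma> Q) y = 0" using alg_closed_imp_poly_has_root by blast
    then show "\<exists>\<tau>. is_embedding (adjoin E x) \<tau> \<and> (\<forall>a\<in>E. \<tau> a = \<sigma> a) \<and> (\<forall>a\<in>adjoin E x. () = ())"
      using extend_embedding[OF E(2) s Q] by blast
  qed (use adjoin_base[OF K] in auto)
  then show ?thesis using \<tau>0 adjoin_base[OF K] adjoin_gen[OF K] by (metis)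
qed

end

subsection \<open>The henselization\<close>

lemma map_poly_prod_embedding:
  assumes E: "is_subfield E" and s: "is_embedding E \<sigma>" and "\<And>i. i \<in> I \<Longrightarrow> f i \<in> polys_over E"
  shows "map_poly \<sigma> (prod f I) = (\<Prod>i\<in>I. map_poly \<sigma> (f i))"
  using assms(3)
  by (induction I rule: infinite_finite_induct)
    (simp_all add: map_poly_embedding[OF E s] polys_over_prod[OF E])

lemma valuation_power_inj:
  fixes u :: "'r::comm_ring_1 \<Rightarrow> 'h::linordered_rat_vector vext"
  assumes u: "is_valuation u" and q: "q > 0" and eq: "u (x ^ q) = u (y ^ q)"
  shows "u x = u y"
proof -
  interpret val_on UNIV u using u by (rule val_on_UNIV)
  have fin: "u (z ^ q) = Fin (of_nat q *\<^sub>Q \<gamma>)" if "u z = Fin \<gamma>" for z \<gamma>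
    using valuation_power[of UNIV u z \<gamma> q] u that by (simp add: is_valuation_iff)
  have inf: "u (z ^ q) = Infty" if "u z = Infty" for z
    using q that by (cases q) (auto simp: mult vext_basics)
  show ?thesis
    using eq fin inf scaleQ_mono(3)[of "of_nat q"] q by (cases "u x"; cases "u y") auto
qed

text \<open>If R(T) = (T - \<theta>^q) S(T), then R(T^q) = (T - \<theta>)^q S(T^q), and the second
  factor does not vanish at \<theta>.\<close>

lemma order_pcompose_frob:
  fixes R :: "'c::field poly"
  assumes q: "frob TYPE('c) q" and R: "poly R (\<theta> ^ q) = 0" "poly (pderiv R) (\<theta> ^ q) \<noteq> 0"
  shows "Polynomial.order \<theta> (pcompose R (monom 1 q)) = q"
proof -
  let ?m = "monom (1::'c) q"
  obtain S where S: "R = [:- (\<theta> ^ q), 1:] * S" using R(1) poly_eq_0_iff_dvd by blast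
  have "pderiv R = S + [:- (\<theta> ^ q), 1:] * pderiv S" unfolding S by (subst pderiv_mult) (simp add: pderiv_pCons)
  then have S0: "poly S (\<theta> ^ q) \<noteq> 0" using R(2) by auto
  have X: "[:0, 1:] ^ q = ?m" by (simp add: monom_altdef)
  have add: "\<And>x y :: 'c poly. (x + y) ^ q = x ^ q + y ^ q" using q by (simp add: frob_def)
  have "([:- \<theta>, 1:] + [:\<theta>:]) ^ q = [:- \<theta>, 1:] ^ q + [:\<theta> ^ q:]" unfolding add by (simp add: poly_const_pow)
  then have lin: "[:- \<theta>, 1:] ^ q = ?m - [:\<theta> ^ q:]" using X by simp
  have "pcompose R ?m = [:- \<theta>, 1:] ^ q * pcompose S ?m"
    unfolding S pcompose_mult lin by (simp add: pcompose_pCons)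
  moreover have "poly (pcompose S ?m) \<theta> \<noteq> 0" using S0 by (simp add: poly_pcompose poly_monom)
  moreover from this have "pcompose S ?m \<noteq> 0" by auto
  moreover have "[:- \<theta>, 1:] ^ q \<noteq> 0" by simp
  ultimately show ?thesis using order_mult[of "[:- \<theta>, 1:] ^ q" "pcompose S ?m" \<theta>] order_power_n_n[of \<theta> q]
    by (simp add: order_0I)
qed

locale field_embedding =
  fixes emb :: "'a::field \<Rightarrow> 'c::field"
  assumes emb_1: "emb 1 = 1" and emb_plus: "emb (a + b) = emb a + emb b" and emb_times: "emb (a * b) = emb a * emb b"
begin

abbreviation "mp \<equiv> map_poly emb"

lemma emb_hom: "emb 0 = 0" "emb (- a) = - emb a" "emb (a - b) = emb a - emb b" "emb a = emb b \<longleftrightarrow> a = b"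
  "emb (inverse a) = inverse (emb a)" "emb a = 0 \<longleftrightarrow> a = 0"
proof -
  show 0: "emb 0 = 0" using emb_plus[of 0 0] by (metis add.right_neutral add_cancel_right_right)
  show n: "emb (- a) = - emb a" for a using emb_plus[of a "- a"] 0 by (simp add: eq_neg_iff_add_eq_0 add.commute)
  show d: "emb (a - b) = emb a - emb b" for a b using emb_plus[of a "- b"] n by simp
  have inv: "emb (inverse a) * emb a = 1" if "a \<noteq> 0" for a using emb_times[of "inverse a" a] that emb_1 by simp
  show z: "emb a = 0 \<longleftrightarrow> a = 0" for a using inv[of a] 0 by (cases "a = 0") auto
  show "emb a = emb b \<longleftrightarrow> a = b" using d[of a b] z[of "a - b"] by auto
  show "emb (inverse a) = inverse (emb a)" using inv[of a] 0 inverse_unique[of "emb a" "emb (inverse a)"]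
    by (cases "a = 0") (simp_all add: mult.commute)
qed

lemma coeff_mp [simp]: "coeff (mp p) i = emb (coeff p i)"
  by (rule coeff_map_poly) (rule emb_hom)

lemma emb_sum: "emb (sum f I) = (\<Sum>i\<in>I. emb (f i))"
  by (induction I rule: infinite_finite_induct) (auto simp: emb_hom emb_plus)

lemma mp_hom: "mp 0 = 0" "mp 1 = 1" "mp (p + q) = mp p + mp q" "mp (p - q) = mp p - mp q" "mp (p * q) = mp p * mp q"
  "mp [:a:] = [:emb a:]" "mp p = mp q \<longleftrightarrow> p = q" "degree (mp p) = degree p" "lead_coeff (mp p) = emb (lead_coeff p)"
  "mp p = 0 \<longleftrightarrow> p = 0"
proof -
  show "mp 0 = 0" "mp 1 = 1" by (simp_all add: map_poly_1' emb_1)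
  show "mp (p + q) = mp p + mp q" "mp (p - q) = mp p - mp q" by (simp_all add: poly_eq_iff emb_plus emb_hom)
  show "mp (p * q) = mp p * mp q" by (simp add: poly_eq_iff coeff_mult emb_sum emb_times)
  show "mp [:a:] = [:emb a:]" by (simp add: map_poly_pCons emb_hom)
  show "mp p = mp q \<longleftrightarrow> p = q" "mp p = 0 \<longleftrightarrow> p = 0" by (auto simp: poly_eq_iff emb_hom)
  show dg: "degree (mp p) = degree p" by (cases "p = 0") (auto simp: emb_hom intro!: map_poly_degree_eq)
  show "lead_coeff (mp p) = emb (lead_coeff p)" by (simp add: dg)
qed

end

section \<open>The base field, its separable closure and the decomposition group\<close>

context valued_field_closure
begin

sublocale field_embedding emb
  by unfold_locales (rule emb_one emb_add emb_mult)+

abbreviation "K\<^sub>0 \<equiv> range emb"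
abbreviation "Kh \<equiv> henselization emb vbar"
abbreviation "Ks \<equiv> separable_closure emb"

lemma is_subfield_K0: "is_subfield K\<^sub>0"
  unfolding is_subfield_def
proof (intro conjI ballI)
  show "1 \<in> K\<^sub>0" using emb_one by (metis rangeI)
  fix x y assume "x \<in> K\<^sub>0" "y \<in> K\<^sub>0"
  then show "x - y \<in> K\<^sub>0" "x * y \<in> K\<^sub>0" by (auto simp flip: emb_hom emb_mult)
next
  fix x assume "x \<in> K\<^sub>0"
  then show "inverse x \<in> K\<^sub>0" by (auto simp flip: emb_hom)
qed

lemma mp_in [simp]: "mp p \<in> polys_over K\<^sub>0"
  by (rule polys_overI) simp

lemma polys_over_K0: assumes "f \<in> polys_over K\<^sub>0" obtains p where "f = mp p"
proof
  have inv: "inv_into UNIV emb (emb a) = a" for a using emb_hom(4) by (intro inv_f_f injI) auto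
  have "inv_into UNIV emb 0 = 0" using inv[of 0] by (simp add: emb_hom)
  then have "coeff f i = coeff (mp (map_poly (inv_into UNIV emb) f)) i" for i
    using polys_overD[OF assms, of i] inv by (auto simp: coeff_map_poly)
  then show "f = mp (map_poly (inv_into UNIV emb) f)" by (rule poly_eqI)
qed

lemma algebraic_K0: "algebraic_over K\<^sub>0 x"
proof -
  obtain p where "p \<noteq> 0" "poly (mp p) x = 0" using emb_algebraic by blast
  then show ?thesis unfolding algebraic_over_def using mp_hom(10) by (intro bexI[of _ "mp p"]) auto
qed

sublocale valued_closure K\<^sub>0 vbar
proof
  show "is_subfield K\<^sub>0" by (rule is_subfield_K0)
  show "algebraic_over K\<^sub>0 x" for x by (rule algebraic_K0)
  show "is_valuation vbar" by (rule valuation_vbar)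
  show "\<exists>a\<in>K\<^sub>0. \<exists>n>0. vbar a = Fin (of_nat n *\<^sub>Q \<gamma>)" for \<gamma> using value_group[of \<gamma>] vbar_extends by auto
qed

lemma Irr_K0_iff: "mp p \<in> Irr K\<^sub>0 \<longleftrightarrow> lead_coeff p = 1 \<and> irreducible p"
proof -
  have lc: "lead_coeff (mp p) = 1 \<longleftrightarrow> lead_coeff p = 1" unfolding mp_hom(9) using emb_hom(4)[of "lead_coeff p" 1] emb_one by simp
  have irr: "irreducible p \<longleftrightarrow> p \<noteq> 0 \<and> degree p > 0 \<and> (\<forall>a b. p = a * b \<longrightarrow> degree a = 0 \<or> degree b = 0)"
  proof (intro iffI conjI allI impI)
    assume i: "irreducible p"
    show "p \<noteq> 0" using i by auto
    then show "degree p > 0" using irreducible_not_unit[OF i] by (simp add: is_unit_iff_degree)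
    fix a b assume "p = a * b"
    then have "a dvd 1 \<or> b dvd 1" "a \<noteq> 0" "b \<noteq> 0" using i irreducibleD[OF i] by auto
    then show "degree a = 0 \<or> degree b = 0" by (auto simp: is_unit_iff_degree)
  next
    assume i: "p \<noteq> 0 \<and> degree p > 0 \<and> (\<forall>a b. p = a * b \<longrightarrow> degree a = 0 \<or> degree b = 0)"
    show "irreducible p"
    proof (rule irreducibleI)
      show "p \<noteq> 0" using i by simp
      show "\<not> p dvd 1" using i by (auto simp: is_unit_iff_degree)
      fix a b assume ab: "p = a * b"
      then have "a \<noteq> 0" "b \<noteq> 0" using i by auto
      moreover have "degree a = 0 \<or> degree b = 0" using conjunct2[OF conjunct2[OF i], rule_format, OF ab] .
      ultimately show "a dvd 1 \<or> b dvd 1" by (auto simp: is_unit_iff_degree)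
    qed
  qed
  have fact: "(\<forall>f\<in>polys_over K\<^sub>0. \<forall>g\<in>polys_over K\<^sub>0. mp p = f * g \<longrightarrow> degree f = 0 \<or> degree g = 0)
      \<longleftrightarrow> (\<forall>a b. p = a * b \<longrightarrow> degree a = 0 \<or> degree b = 0)" (is "?L \<longleftrightarrow> ?R")
  proof
    assume L: ?L
    show ?R
    proof (intro allI impI)
      fix a b assume "p = a * b"
      then have "mp p = mp a * mp b" by (simp add: mp_hom(5))
      then have "degree (mp a) = 0 \<or> degree (mp b) = 0" by (rule L[rule_format, OF mp_in mp_in])
      then show "degree a = 0 \<or> degree b = 0" by (simp add: mp_hom(8))
    qed
  next
    assume R: ?R
    show ?L
    proof (intro ballI impI)
      fix f g assume fg: "f \<in> polys_over K\<^sub>0" "g \<in> polys_over K\<^sub>0" "mp p = f * g"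
      obtain a b where ab: "f = mp a" "g = mp b" using polys_over_K0 fg(1,2) by metis
      then have "p = a * b" using fg(3) mp_hom(5,7) by metis
      then show "degree f = 0 \<or> degree g = 0" using R ab by (simp add: mp_hom(8))
    qed
  qed
  show ?thesis unfolding Irr_def mem_Collect_eq fact irr mp_hom(8) using mp_in[of p] lc mp_hom(8)[of p]
    by (cases "p = 0") auto
qed

text \<open>All roots of an irreducible polynomial are simple once one of them is separable, so
  squarefreeness amounts to a condition at x.\<close>

lemma separable_closure_eq: "Ks = {x. separable_over K\<^sub>0 x}"
proof (intro equalityI subsetI)
  fix x assume "x \<in> Ks"
  then obtain p where p: "irreducible p" "rsquarefree (mp p)" "poly (mp p) x = 0"
    by (auto simp: separable_closure_def)
  have "poly (pderiv (mp p)) x \<noteq> 0"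
    using order_multiple_root[of "mp p" x] p mp_hom(10)[of p] by (auto simp: rsquarefree_def) (metis less_irrefl not_less_zero)
  then show "x \<in> {x. separable_over K\<^sub>0 x}" using p(3) mp_in by (auto simp: separable_over_def)
next
  fix x assume x: "x \<in> {x. separable_over K\<^sub>0 x}"
  obtain P where P: "P \<in> Irr K\<^sub>0" "poly P x = 0" using Irr_exists[OF K alg] by blast
  then obtain p where p: "P = mp p" using polys_over_K0 IrrD(1) by metis
  have "Polynomial.order a P = 0 \<or> Polynomial.order a P = 1" for a
  proof (cases "poly P a = 0")
    case True
    then show ?thesis using order_simple_root Irr_simple_root_separable[OF K P _ True] x by blast
  qed (simp add: order_0I)
  then have "rsquarefree (mp p)" using IrrD(4)[OF P(1)] by (simp add: rsquarefree_def p)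
  then show "x \<in> Ks" using P p Irr_K0_iff by (auto simp: separable_closure_def)
qed

lemma is_subfield_Ks: "is_subfield Ks"
  unfolding separable_closure_eq by (rule is_subfield_separable_closure[OF K alg])

lemma K0_Ks: "K\<^sub>0 \<subseteq> Ks"
proof
  fix x assume "x \<in> K\<^sub>0"
  then show "x \<in> Ks" unfolding separable_closure_eq separable_over_def
    using polys_over_closed[OF K] is_subfieldD[OF K] by (auto simp: pderiv_pCons intro!: bexI[of _ "[:- x, 1:]"])
qed

lemma decomposition_group_iff:
  "\<sigma> \<in> decomposition_group emb vbar \<longleftrightarrow> bij_betw \<sigma> Ks Ks \<and> is_embedding Ks \<sigma> \<and> (\<forall>a\<in>K\<^sub>0. \<sigma> a = a) \<and> (\<forall>x\<in>Ks. vbar (\<sigma> x) = vbar x)"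
proof -
  have "\<sigma> 1 = 1" if "\<forall>a. \<sigma> (emb a) = emb a" using that emb_one by metis
  then show ?thesis by (auto simp: decomposition_group_def galois_group_def is_embedding_def)
qed

lemma henselization_iff: "x \<in> Kh \<longleftrightarrow> x \<in> Ks \<and> (\<forall>\<sigma>\<in>decomposition_group emb vbar. \<sigma> x = x)"
  by (auto simp: henselization_def)

lemma is_subfield_Kh: "is_subfield Kh"
  unfolding is_subfield_def
proof (intro conjI ballI)
  note s = is_subfieldD[OF is_subfield_Ks]
  have e: "is_embedding Ks \<sigma>" if "\<sigma> \<in> decomposition_group emb vbar" for \<sigma> using that by (simp add: decomposition_group_iff)
  note d = is_embeddingD[OF is_subfield_Ks e]
  show "1 \<in> Kh" using s d by (auto simp: henselization_iff)
  fix x assume x: "x \<in> Kh"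
  then have xs: "x \<in> Ks" "\<And>\<sigma>. \<sigma> \<in> decomposition_group emb vbar \<Longrightarrow> \<sigma> x = x" by (auto simp: henselization_iff)
  show "inverse x \<in> Kh" unfolding henselization_iff using s(5)[OF xs(1)] d(7)[OF _ xs(1)] xs(2) by metis
  fix y assume y: "y \<in> Kh"
  then have ys: "y \<in> Ks" "\<And>\<sigma>. \<sigma> \<in> decomposition_group emb vbar \<Longrightarrow> \<sigma> y = y" by (auto simp: henselization_iff)
  show "x - y \<in> Kh" unfolding henselization_iff using s(3)[OF xs(1) ys(1)] d(6)[OF _ xs(1) ys(1)] xs(2) ys(2) by metis
  show "x * y \<in> Kh" unfolding henselization_iff using s(4)[OF xs(1) ys(1)] d(4)[OF _ xs(1) ys(1)] xs(2) ys(2) by metis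
qed

lemma K0_Kh: "K\<^sub>0 \<subseteq> Kh" and Kh_Ks: "Kh \<subseteq> Ks"
  using K0_Ks by (auto simp: henselization_iff decomposition_group_iff)

text \<open>For surjectivity: an embedding over K permutes the finite root set of each irreducible
  polynomial over K.\<close>

lemma embedding_Ks:
  assumes t: "is_embedding UNIV \<tau>" "\<forall>a\<in>K\<^sub>0. \<tau> a = a" shows "bij_betw \<tau> Ks Ks"
proof -
  have inj: "inj_on \<tau> A" for A using is_embeddingD(10)[OF is_subfield_UNIV t(1)] by (auto intro: inj_onI)
  have root: "poly f (\<tau> x) = \<tau> (poly f x)" if "f \<in> polys_over K\<^sub>0" for f x
      proof -
    have "map_poly \<tau> f = f" by (rule map_poly_fixed[OF that _ is_subfieldD(2)[OF K]]) (use t(2) in blast)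
    then show ?thesis using map_poly_embedding(8)[OF is_subfield_UNIV t(1), of x f] by simp
  qed
  have t0: "\<tau> x = 0 \<longleftrightarrow> x = 0" for x using is_embeddingD(8)[OF is_subfield_UNIV t(1)] by simp
  have "\<tau> x \<in> Ks" if x: "x \<in> Ks" for x
  proof -
    obtain R where R: "R \<in> polys_over K\<^sub>0" "poly R x = 0" "poly (pderiv R) x \<noteq> 0" using x by (auto simp: separable_closure_eq separable_over_def)
    then have "poly R (\<tau> x) = 0" "poly (pderiv R) (\<tau> x) \<noteq> 0" using root[OF R(1)] root[OF polys_over_pderiv[OF K R(1)]] t0 by auto
    then show ?thesis using R(1) by (auto simp: separable_closure_eq separable_over_def)
  qed
  moreover have "\<exists>x\<in>Ks. y = \<tau> x" if y: "y \<in> Ks" for y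
  proof -
    obtain P where P: "P \<in> Irr K\<^sub>0" "poly P y = 0" using Irr_exists[OF K alg] by blast
    let ?Z = "{x. poly P x = 0}"
    have "\<tau> ` ?Z \<subseteq> ?Z" using root[OF IrrD(1)[OF P(1)]] t0 by auto
    then have "\<tau> ` ?Z = ?Z" using endo_inj_surj[OF poly_roots_finite[OF IrrD(4)[OF P(1)]] _ inj] by simp
    then obtain x where x: "poly P x = 0" "y = \<tau> x" using P(2) by (metis (mono_tags, lifting) imageE mem_Collect_eq)
    have "poly (pderiv P) x \<noteq> 0" using Irr_simple_root_separable[OF K P _ x(1)] y by (simp add: separable_closure_eq)
    then show ?thesis using x IrrD(1)[OF P(1)] by (auto simp: separable_closure_eq separable_over_def)
  qed
  ultimately show ?thesis using inj by (auto simp: bij_betw_def)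
qed

text \<open>The restriction to the separable closure belongs to the decomposition group. In this way
  maps of the whole closure, inseparable elements included, act on polynomials over the
  henselization.\<close>

lemma valued_embedding_fixes_Kh:
  assumes "is_embedding UNIV \<tau>" "\<forall>a\<in>K\<^sub>0. \<tau> a = a" "\<forall>a. vbar (\<tau> a) = vbar a" "x \<in> Kh"
  shows "\<tau> x = x"
proof -
  have "\<tau> \<in> decomposition_group emb vbar"
    using assms embedding_Ks[OF assms(1,2)] is_embedding_mono[OF assms(1)] by (simp add: decomposition_group_iff)
  then show ?thesis using assms(4) by (simp add: henselization_iff)
qed

text \<open>The transitivity of the decomposition group on the roots of a separable irreducible polynomial over
  the henselization, in the form in which the proof gives it.\<close>

lemma decomposition_orbit_polynomial:
  assumes x: "x \<in> Ks"
  defines "D \<equiv> decomposition_group emb vbar"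
  shows "\<exists>P\<in>polys_over Kh. P \<noteq> 0 \<and> (\<forall>y. poly P y = 0 \<longleftrightarrow> (\<exists>\<sigma>\<in>D. y = \<sigma> x))"
proof -
  define O' where "O' = (\<lambda>\<sigma>. \<sigma> x) ` D"
  obtain m where m: "m \<in> Irr K\<^sub>0" "poly m x = 0" using Irr_exists[OF K alg] by blast
  have in_Ks: "\<sigma> y \<in> Ks" if "\<sigma> \<in> D" "y \<in> Ks" for \<sigma> y using that unfolding D_def decomposition_group_iff bij_betw_def by blast
  have emb: "is_embedding Ks \<sigma>" if "\<sigma> \<in> D" for \<sigma> using that by (simp add: D_def decomposition_group_iff)
  note s = is_subfieldD[OF is_subfield_Ks]
  have "poly m (\<sigma> x) = 0" if "\<sigma> \<in> D" for \<sigma>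
  proof -
    have mKs: "m \<in> polys_over Ks" using polys_over_mono[OF IrrD(1)[OF m(1)] K0_Ks] .
    have "map_poly \<sigma> m = m"
      by (rule map_poly_fixed[OF IrrD(1)[OF m(1)] _ is_subfieldD(2)[OF K]])
        (use that in \<open>unfold D_def decomposition_group_iff, blast\<close>)
    then show ?thesis using map_poly_embedding(8)[OF is_subfield_Ks emb[OF that] x mKs] m(2) is_embeddingD(2)[OF is_subfield_Ks emb[OF that]] by simp
  qed
  then have "O' \<subseteq> {y. poly m y = 0}" by (auto simp: O'_def)
  then have fin: "finite O'" using poly_roots_finite[OF IrrD(4)[OF m(1)]] by (rule finite_subset)
  have O_Ks: "O' \<subseteq> Ks" using in_Ks x by (auto simp: O'_def)
  have comp: "(\<lambda>y. \<rho> (\<sigma> y)) \<in> D" if "\<rho> \<in> D" "\<sigma> \<in> D" for \<rho> \<sigma>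
  proof -
    have "bij_betw (\<rho> \<circ> \<sigma>) Ks Ks" using that bij_betw_trans[of \<sigma> Ks Ks \<rho> Ks] by (simp add: D_def decomposition_group_iff)
    moreover have "is_embedding Ks (\<rho> \<circ> \<sigma>)"
      using is_embeddingD(1,3,4)[OF is_subfield_Ks emb[OF that(1)]] is_embeddingD(1,3,4)[OF is_subfield_Ks emb[OF that(2)]] in_Ks[OF that(2)]
      by (simp add: is_embedding_def)
    ultimately show ?thesis using that in_Ks[OF that(2)] by (simp add: D_def decomposition_group_iff o_def)
  qed
  define P where "P = (\<Prod>y\<in>O'. [:- y, 1:])"
  have lin: "[:- y, 1:] \<in> polys_over Ks" if "y \<in> Ks" for y using that polys_over_closed[OF is_subfield_Ks] s by simp
  have P_Ks: "P \<in> polys_over Ks" unfolding P_def using lin O_Ks by (intro polys_over_prod[OF is_subfield_Ks]) auto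
  \<comment> \<open>An element of the group permutes the orbit, so it fixes the coefficients of
    P.\<close>
  have fixP: "map_poly \<rho> P = P" if \<rho>: "\<rho> \<in> D" for \<rho>
  proof -
    have inj: "inj_on \<rho> O'" using \<rho> O_Ks by (auto simp: D_def decomposition_group_iff bij_betw_def intro: inj_on_subset)
    have "\<rho> ` O' \<subseteq> O'" using comp[OF \<rho>] by (auto simp: O'_def)
    then have im: "\<rho> ` O' = O'" by (rule endo_inj_surj[OF fin _ inj])
    have "map_poly \<rho> P = (\<Prod>y\<in>O'. map_poly \<rho> [:- y, 1:])"
      unfolding P_def using lin O_Ks by (intro map_poly_prod_embedding[OF is_subfield_Ks emb[OF \<rho>]]) auto
    also have "\<dots> = (\<Prod>y\<in>O'. [:- \<rho> y, 1:])"
      using O_Ks is_embeddingD(5)[OF is_subfield_Ks emb[OF \<rho>]]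
      by (intro prod.cong refl) (auto simp: map_poly_embedding(9)[OF is_subfield_Ks emb[OF \<rho>]])
    also have "\<dots> = (\<Prod>y\<in>\<rho> ` O'. [:- y, 1:])" by (simp add: prod.reindex[OF inj])
    finally show ?thesis by (simp add: im P_def)
  qed
  have "P \<in> polys_over Kh"
  proof (rule polys_overI)
    fix i
    have "\<sigma> (coeff P i) = coeff P i" if "\<sigma> \<in> D" for \<sigma>
      using arg_cong[OF fixP[OF that], of "\<lambda>p. coeff p i"] by (simp add: coeff_map_poly_embedding[OF is_subfield_Ks emb[OF that]])
    then show "coeff P i \<in> Kh" using polys_overD[OF P_Ks] by (simp add: henselization_iff D_def)
  qed
  moreover have "P \<noteq> 0" using fin by (auto simp: P_def)
  moreover have "poly P y = 0 \<longleftrightarrow> y \<in> O'" for y using fin by (auto simp: P_def poly_prod)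
  ultimately show ?thesis by (auto simp: O'_def intro!: bexI[of _ P])
qed

text \<open>As \<theta> may be inseparable, the orbit polynomial is formed for a separable power
  \<theta>^q and yields \<theta>'^q = \<sigma>(\<theta>^q). The q-th power can be undone on values
  because the value group is torsion-free.\<close>

lemma root_value_unique:
  assumes G: "G \<in> Irr Kh" "poly G \<theta> = 0" "poly G \<theta>' = 0" and f: "f \<in> polys_over K\<^sub>0"
  shows "vbar (poly f \<theta>) = vbar (poly f \<theta>')"
proof -
  obtain q where q: "frob TYPE('c) q" "separable_over K\<^sub>0 (\<theta> ^ q)" using frob_separable[OF K alg] by blast
  then have \<eta>: "\<theta> ^ q \<in> Ks" by (simp add: separable_closure_eq)
  obtain P where P: "P \<in> polys_over Kh" "\<And>y. poly P y = 0 \<longleftrightarrow> (\<exists>\<sigma>\<in>decomposition_group emb vbar. y = \<sigma> (\<theta> ^ q))"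
    using decomposition_orbit_polynomial[OF \<eta>] by blast
  have "(\<lambda>y. y) \<in> decomposition_group emb vbar" using is_embedding_id by (auto simp: decomposition_group_iff bij_betw_def)
  then have "poly P (\<theta> ^ q) = 0" using P(2) by metis
  then have r: "poly (pcompose P (monom 1 q)) \<theta> = 0" by (simp add: poly_pcompose poly_monom)
  have "monom 1 q \<in> polys_over Kh" using polys_over_closed(9)[OF is_subfield_Kh] is_subfieldD[OF is_subfield_Kh] by simp
  then have "pcompose P (monom 1 q) \<in> polys_over Kh" using polys_over_pcompose[OF is_subfield_Kh P(1)] by blast
  then have "G dvd pcompose P (monom 1 q)" using Irr_dvd[OF is_subfield_Kh G(1) _ G(2) r] by blast
  then have "poly (pcompose P (monom 1 q)) \<theta>' = 0" using G(3) by (auto elim: dvdE)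
  then obtain \<sigma> where \<sigma>: "\<sigma> \<in> decomposition_group emb vbar" "\<theta>' ^ q = \<sigma> (\<theta> ^ q)" using P(2) by (auto simp: poly_pcompose poly_monom)
  have s: "is_embedding Ks \<sigma>" "\<forall>a\<in>K\<^sub>0. \<sigma> a = a" "\<forall>x\<in>Ks. vbar (\<sigma> x) = vbar x" using \<sigma>(1) by (auto simp: decomposition_group_iff)
  \<comment> \<open>The coefficients of g are the q-th powers of those of f, so that g(y^q) =
    f(y)^q.\<close>
  define g where "g = map_poly (\<lambda>x. x ^ q) f"
  note fr = frob_embedding[OF q(1)]
  have g0: "g \<in> polys_over K\<^sub>0" unfolding g_def
    by (rule polys_overI) (simp add: coeff_map_poly_embedding[OF is_subfield_UNIV fr] is_subfieldD[OF K] polys_overD[OF f])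
  then have gs: "g \<in> polys_over Ks" using K0_Ks by (rule polys_over_mono)
  have pw: "poly g (y ^ q) = poly f y ^ q" for y
    using map_poly_embedding(8)[OF is_subfield_UNIV fr UNIV_I polys_over_UNIV, of f y] by (simp add: g_def)
  have "map_poly \<sigma> g = g" by (rule map_poly_fixed[OF g0 _ is_subfieldD(2)[OF K]]) (use s(2) in blast)
  then have "poly g (\<sigma> (\<theta> ^ q)) = \<sigma> (poly g (\<theta> ^ q))"
    using map_poly_embedding(8)[OF is_subfield_Ks s(1) \<eta> gs] by simp
  moreover have "poly g (\<theta> ^ q) \<in> Ks" by (rule poly_in_subfield[OF is_subfield_Ks gs \<eta>])
  ultimately have "vbar (poly g (\<theta>' ^ q)) = vbar (poly g (\<theta> ^ q))" using s(3) \<sigma>(2) by simp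
  then show ?thesis unfolding pw using valuation_power_inj[OF val] q(1) by (metis frob_def)
qed

text \<open>Converse to \<open>root_value_unique\<close>: a value-preserving automorphism taking
  \<theta> to \<theta>' fixes the coefficients of G.\<close>

lemma same_values_same_factor:
  assumes G: "G \<in> Irr Kh" "poly G \<theta> = 0" and eq: "\<And>f. f \<in> polys_over K\<^sub>0 \<Longrightarrow> vbar (poly f \<theta>) = vbar (poly f \<theta>')"
  shows "poly G \<theta>' = 0"
proof -
  obtain \<tau> where \<tau>: "is_embedding UNIV \<tau>" "\<forall>a\<in>K\<^sub>0. \<tau> a = a" "\<forall>a. vbar (\<tau> a) = vbar a" "\<tau> \<theta> = \<theta>'"
    using valued_conjugates[OF eq] by blast
  have "map_poly \<tau> G = G"
    by (rule map_poly_fixed[OF IrrD(1)[OF G(1)] valued_embedding_fixes_Kh[OF \<tau>(1-3)] is_subfieldD(2)[OF is_subfield_Kh]])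
  then have "poly G (\<tau> \<theta>) = \<tau> (poly G \<theta>)" using map_poly_embedding(8)[OF is_subfield_UNIV \<tau>(1), of \<theta> G] by simp
  then show ?thesis using G(2) \<tau>(4) is_embeddingD(2)[OF is_subfield_UNIV \<tau>(1)] by simp
qed

text \<open>This holds because the henselization is separable over the base field.\<close>

lemma order_henselization:
  assumes \<Phi>: "\<Phi> \<in> Irr K\<^sub>0" "poly \<Phi> \<theta> = 0" and Q: "Q \<in> Irr Kh" "poly Q \<theta> = 0"
  shows "Polynomial.order \<theta> Q = Polynomial.order \<theta> \<Phi>"
proof (rule antisym)
  have "Q dvd \<Phi>" using Irr_dvd[OF is_subfield_Kh Q(1) polys_over_mono[OF IrrD(1)[OF \<Phi>(1)] K0_Kh] Q(2) \<Phi>(2)] .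
  then show "Polynomial.order \<theta> Q \<le> Polynomial.order \<theta> \<Phi>" using IrrD(4)[OF \<Phi>(1)] by (rule dvd_imp_order_le[rotated])
  obtain q R where q: "frob TYPE('c) q" "R \<in> Irr Kh" "Q = pcompose R (monom 1 q)" "poly R (\<theta> ^ q) = 0" "poly (pderiv R) (\<theta> ^ q) \<noteq> 0"
    using Irr_separable_decomposition[OF is_subfield_Kh Q] by blast
  \<comment> \<open>\<theta>^q is separable over the henselization, hence over the separable
    closure, and so over K. With P its minimal polynomial over K, the multiplicity of \<theta> in
    P(T^q) is q as well, and \<Phi> divides P(T^q).\<close>
  have "separable_over Ks (\<theta> ^ q)" unfolding separable_over_def
    using q(4,5) polys_over_mono[OF IrrD(1)[OF q(2)] Kh_Ks] by blast
  then have sep: "separable_over K\<^sub>0 (\<theta> ^ q)" using separable_over_separable_closure[OF K alg] by (simp add: separable_closure_eq)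
  obtain P where P: "P \<in> Irr K\<^sub>0" "poly P (\<theta> ^ q) = 0" using Irr_exists[OF K alg] by blast
  have simple: "poly (pderiv P) (\<theta> ^ q) \<noteq> 0" by (rule Irr_simple_root_separable[OF K P sep P(2)])
  have "monom 1 q \<in> polys_over K\<^sub>0" using polys_over_closed(9)[OF K] is_subfieldD[OF K] by simp
  then have PK: "pcompose P (monom 1 q) \<in> polys_over K\<^sub>0" using polys_over_pcompose[OF K IrrD(1)[OF P(1)]] by blast
  have "\<Phi> dvd pcompose P (monom 1 q)" using Irr_dvd[OF K \<Phi>(1) PK \<Phi>(2)] P(2) by (simp add: poly_pcompose poly_monom)
  moreover have "pcompose P (monom 1 q) \<noteq> 0"
  proof
    assume "pcompose P (monom 1 q) = 0"
    then have "degree P * q = 0" using degree_pcompose[of P "monom (1::'c) q"] by (simp add: degree_monom_eq)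
    then show False using IrrD(3)[OF P(1)] q(1) by (auto simp: frob_def)
  qed
  ultimately have "Polynomial.order \<theta> \<Phi> \<le> Polynomial.order \<theta> (pcompose P (monom 1 q))" by (rule dvd_imp_order_le[rotated])
  then show "Polynomial.order \<theta> \<Phi> \<le> Polynomial.order \<theta> Q"
    using order_pcompose_frob[OF q(1) P(2) simple] order_pcompose_frob[OF q(1) q(4,5)] q(3) by simp
qed

end

subsection \<open>Initial forms and key polynomials\<close>

lemma degree_mod_lt: "degree \<psi> > 0 \<Longrightarrow> degree (f mod \<psi>) < degree (\<psi> :: 'a::field poly)"
  using degree_mod_less'[of \<psi> f] by (cases "f mod \<psi> = 0"; cases "\<psi> = 0") auto

lemma degree_div_lt: "degree \<psi> > 0 \<Longrightarrow> f div \<psi> \<noteq> 0 \<Longrightarrow> degree (f div \<psi>) < degree (f :: 'a::field poly)"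
  using degree_div_less[of f \<psi>] by (auto simp: div_poly_eq_0_iff)

section \<open>The graded algebra in terms of polynomials\<close>

lemma val_gt_0: "is_valuation \<mu> \<Longrightarrow> 0 \<in> val_gt \<mu> \<alpha>"
  by (simp add: val_gt_def is_valuation_def vext_basics)

lemma initial_form_support:
  assumes m: "is_valuation \<mu>" and f: "\<mu> f = Fin \<alpha>"
  shows "{\<beta>. initial_form \<mu> f \<beta> \<noteq> val_gt \<mu> \<beta>} = {\<alpha>}"
proof -
  have "f \<in> f +o val_gt \<mu> \<alpha>" using val_gt_0[OF m] set_plus_intro2[of 0 "val_gt \<mu> \<alpha>" f] by simp
  moreover have "f \<notin> val_gt \<mu> \<alpha>" using f by (simp add: val_gt_def)
  ultimately show ?thesis using f by (auto simp: initial_form_def)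
qed

lemma coset_mult:
  assumes m: "is_valuation \<mu>" and f: "Fin \<alpha> \<le> \<mu> f" and g: "Fin \<beta> \<le> \<mu> g"
  shows "(f +o val_gt \<mu> \<alpha>) * (g +o val_gt \<mu> \<beta>) + val_gt \<mu> (\<alpha> + \<beta>) = (f * g) +o val_gt \<mu> (\<alpha> + \<beta>)"
proof -
  interpret val_on UNIV \<mu> using m by (rule val_on_UNIV)
  show ?thesis
  proof (intro equalityI subsetI)
    fix x assume "x \<in> (f +o val_gt \<mu> \<alpha>) * (g +o val_gt \<mu> \<beta>) + val_gt \<mu> (\<alpha> + \<beta>)"
    then obtain a b c where abc: "a \<in> val_gt \<mu> \<alpha>" "b \<in> val_gt \<mu> \<beta>" "c \<in> val_gt \<mu> (\<alpha> + \<beta>)" "x = (f + a) * (g + b) + c"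
      by (auto simp: set_plus_def set_times_def elt_set_plus_def)
    have a: "Fin \<alpha> < \<mu> a" and b: "Fin \<beta> < \<mu> b" and c: "Fin (\<alpha> + \<beta>) < \<mu> c" using abc by (auto simp: val_gt_def)
    have "Fin \<alpha> + Fin \<beta> < \<mu> f + \<mu> b" by (rule vext_add_less_le(2)[OF f _ b]) simp
    moreover have "Fin \<alpha> + Fin \<beta> < \<mu> a + \<mu> g" by (rule vext_add_less_le(1)[OF a g]) simp
    moreover have "Fin \<alpha> + Fin \<beta> < \<mu> a + \<mu> b" by (rule vext_add_less_le(1)[OF a less_imp_le[OF b]]) simp
    ultimately have "Fin (\<alpha> + \<beta>) < \<mu> (f * b + a * g + a * b + c)"
      using c by (auto intro!: add_gt simp: mult)
    moreover have "x = f * g + (f * b + a * g + a * b + c)" unfolding abc(4) by (simp add: algebra_simps)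
    ultimately show "x \<in> (f * g) +o val_gt \<mu> (\<alpha> + \<beta>)" by (auto simp: elt_set_plus_def val_gt_def)
  next
    fix x assume "x \<in> (f * g) +o val_gt \<mu> (\<alpha> + \<beta>)"
    then obtain c where c: "c \<in> val_gt \<mu> (\<alpha> + \<beta>)" "x = f * g + c" by (auto simp: elt_set_plus_def)
    have "f \<in> f +o val_gt \<mu> \<alpha>" "g \<in> g +o val_gt \<mu> \<beta>"
      using val_gt_0[OF m] set_plus_intro2[of 0 "val_gt \<mu> \<alpha>" f] set_plus_intro2[of 0 "val_gt \<mu> \<beta>" g] by simp_all
    then show "x \<in> (f +o val_gt \<mu> \<alpha>) * (g +o val_gt \<mu> \<beta>) + val_gt \<mu> (\<alpha> + \<beta>)"
      unfolding c(2) by (intro set_plus_intro set_times_intro c(1))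
  qed
qed

lemma graded_mult_initial_form:
  assumes m: "is_valuation \<mu>" and f: "\<mu> f = Fin \<alpha>" and q: "Fin (\<gamma> - \<alpha>) \<le> \<mu> q" "y (\<gamma> - \<alpha>) = q +o val_gt \<mu> (\<gamma> - \<alpha>)"
  shows "(initial_form \<mu> f \<otimes>\<^bsub>graded_algebra \<mu>\<^esub> y) \<gamma> = (f * q) +o val_gt \<mu> \<gamma>"
proof -
  have "(initial_form \<mu> f \<otimes>\<^bsub>graded_algebra \<mu>\<^esub> y) \<gamma> = (f +o val_gt \<mu> \<alpha>) * (q +o val_gt \<mu> (\<gamma> - \<alpha>)) + val_gt \<mu> \<gamma>"
    unfolding graded_algebra_def by (simp add: initial_form_support[OF m f] q(2)) (simp add: initial_form_def f)
  then show ?thesis using coset_mult[OF m, of \<alpha> f "\<gamma> - \<alpha>" q] q(1) f by simp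
qed

lemma initial_form_mult:
  assumes m: "is_valuation \<mu>" and f: "\<mu> f = Fin \<alpha>"
  shows "initial_form \<mu> f \<otimes>\<^bsub>graded_algebra \<mu>\<^esub> initial_form \<mu> g = initial_form \<mu> (f * g)"
proof
  fix \<gamma>
  interpret val_on UNIV \<mu> using m by (rule val_on_UNIV)
  have fg: "\<mu> (f * g) = Fin \<gamma> \<longleftrightarrow> \<mu> g = Fin (\<gamma> - \<alpha>)" using f by (cases "\<mu> g") (auto simp: mult algebra_simps)
  show "(initial_form \<mu> f \<otimes>\<^bsub>graded_algebra \<mu>\<^esub> initial_form \<mu> g) \<gamma> = initial_form \<mu> (f * g) \<gamma>"
  proof (cases "\<mu> g = Fin (\<gamma> - \<alpha>)")
    case True
    then show ?thesis using graded_mult_initial_form[OF m f, of \<gamma> g "initial_form \<mu> g"] fg by (simp add: initial_form_def)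
  next
    case False
    then have "(initial_form \<mu> f \<otimes>\<^bsub>graded_algebra \<mu>\<^esub> initial_form \<mu> g) \<gamma> = (f * 0) +o val_gt \<mu> \<gamma>"
      by (intro graded_mult_initial_form[OF m f]) (auto simp: zero vext_basics initial_form_def)
    then show ?thesis using False fg by (simp add: initial_form_def)
  qed
qed

lemma initial_form_carrier:
  assumes m: "is_valuation \<mu>" shows "initial_form \<mu> f \<in> carrier (graded_algebra \<mu>)"
proof -
  interpret val_on UNIV \<mu> using m by (rule val_on_UNIV)
  have "\<exists>g. Fin \<alpha> \<le> \<mu> g \<and> initial_form \<mu> f \<alpha> = g +o val_gt \<mu> \<alpha>" for \<alpha>
  proof (cases "\<mu> f = Fin \<alpha>")
    case True
    then show ?thesis by (intro exI[of _ f]) (simp add: initial_form_def)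
  next
    case False
    then show ?thesis by (intro exI[of _ 0]) (simp add: initial_form_def zero vext_basics)
  qed
  moreover have "finite {\<alpha>. initial_form \<mu> f \<alpha> \<noteq> val_gt \<mu> \<alpha>}"
  proof (cases "\<mu> f")
    case (Fin \<alpha>)
    then show ?thesis using initial_form_support[OF m Fin] by simp
  qed (simp add: initial_form_def)
  ultimately show ?thesis by (simp add: graded_algebra_def)
qed

lemma initial_form_eq_iff:
  assumes m: "is_valuation \<mu>" and f: "\<mu> f = Fin \<alpha>"
  shows "initial_form \<mu> g = initial_form \<mu> f \<longleftrightarrow> Fin \<alpha> < \<mu> (g - f)"
proof
  interpret val_on UNIV \<mu> using m by (rule val_on_UNIV)
  have "f \<in> f +o val_gt \<mu> \<alpha>" using val_gt_0[OF m] set_plus_intro2[of 0 "val_gt \<mu> \<alpha>" f] by simp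
  { assume "initial_form \<mu> g = initial_form \<mu> f"
    then have "initial_form \<mu> g \<alpha> = f +o val_gt \<mu> \<alpha>" using f by (simp add: initial_form_def)
    then have *: "f \<in> initial_form \<mu> g \<alpha>" using \<open>f \<in> f +o val_gt \<mu> \<alpha>\<close> by simp
    moreover have "f \<notin> val_gt \<mu> \<alpha>" using f by (simp add: val_gt_def)
    ultimately have "f \<in> g +o val_gt \<mu> \<alpha>" by (auto simp: initial_form_def split: if_splits)
    then have "f - g \<in> val_gt \<mu> \<alpha>" by (rule set_plus_imp_minus)
    then show "Fin \<alpha> < \<mu> (g - f)" using uminus[of "f - g"] by (simp add: val_gt_def) }
  assume gt: "Fin \<alpha> < \<mu> (g - f)"
  have g: "\<mu> g = Fin \<alpha>" using add_eq(1)[of f "g - f"] gt f by simp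
  have "f +o val_gt \<mu> \<alpha> = g +o val_gt \<mu> \<alpha>"
  proof -
    have sub: "f +o val_gt \<mu> \<alpha> \<subseteq> g +o val_gt \<mu> \<alpha>" if "Fin \<alpha> < \<mu> (g - f)" for f g
    proof
      fix x assume "x \<in> f +o val_gt \<mu> \<alpha>"
      then have "Fin \<alpha> < \<mu> (x - f)" using set_plus_imp_minus by (auto simp: val_gt_def)
      from this that have "Fin \<alpha> < \<mu> ((x - f) - (g - f))" by (rule diff_gt[OF UNIV_I UNIV_I])
      then show "x \<in> g +o val_gt \<mu> \<alpha>" by (intro set_minus_imp_plus) (simp add: val_gt_def)
    qed
    have "Fin \<alpha> < \<mu> (f - g)" using gt uminus[of "g - f"] by simp
    then show ?thesis using sub[OF gt] sub[where f = g and g = f] by blast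
  qed
  then show "initial_form \<mu> g = initial_form \<mu> f" using f g by (auto simp: initial_form_def fun_eq_iff)
qed

text \<open>Only the component of the cofactor in degree \<gamma> - \<alpha> contributes in degree
  \<gamma>, and any representative q of it works; conversely the initial form of q is a
  cofactor.\<close>

lemma mu_dvd_iff:
  assumes m: "is_valuation \<mu>" and \<phi>: "\<mu> \<phi> = Fin \<alpha>" and f: "\<mu> f = Fin \<gamma>"
  shows "mu_dvd \<mu> \<phi> f \<longleftrightarrow> (\<exists>q. \<mu> f < \<mu> (f - \<phi> * q))"
proof
  interpret val_on UNIV \<mu> using m by (rule val_on_UNIV)
  { assume "mu_dvd \<mu> \<phi> f"
    then obtain y where y: "y \<in> carrier (graded_algebra \<mu>)" "initial_form \<mu> f = initial_form \<mu> \<phi> \<otimes>\<^bsub>graded_algebra \<mu>\<^esub> y"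
      by (auto simp: mu_dvd_def factor_def)
    then obtain q where q: "Fin (\<gamma> - \<alpha>) \<le> \<mu> q" "y (\<gamma> - \<alpha>) = q +o val_gt \<mu> (\<gamma> - \<alpha>)" by (auto simp: graded_algebra_def)
    have "f +o val_gt \<mu> \<gamma> = (\<phi> * q) +o val_gt \<mu> \<gamma>"
    proof -
      have "f +o val_gt \<mu> \<gamma> = initial_form \<mu> f \<gamma>" by (simp add: initial_form_def f)
      then show ?thesis using graded_mult_initial_form[where y = y, OF m \<phi> q] y(2) by simp
    qed
    moreover have "f \<in> f +o val_gt \<mu> \<gamma>" using val_gt_0[OF m] set_plus_intro2[of 0 "val_gt \<mu> \<gamma>" f] by simp
    ultimately have "f - \<phi> * q \<in> val_gt \<mu> \<gamma>" using set_plus_imp_minus by metis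
    then show "\<exists>q. \<mu> f < \<mu> (f - \<phi> * q)" using f by (auto simp: val_gt_def) }
  assume "\<exists>q. \<mu> f < \<mu> (f - \<phi> * q)"
  then obtain q where q: "Fin \<gamma> < \<mu> (f - \<phi> * q)" using f by auto
  then have "Fin \<gamma> < \<mu> (\<phi> * q - f)" using uminus[of "f - \<phi> * q"] by simp
  then have "initial_form \<mu> (\<phi> * q) = initial_form \<mu> f" using initial_form_eq_iff[OF m f] by blast
  then show "mu_dvd \<mu> \<phi> f" unfolding mu_dvd_def factor_def
    using initial_form_mult[OF m \<phi>, of q] initial_form_carrier[OF m, of q]
    by (intro bexI[of _ "initial_form \<mu> q"]) simp_all
qed

text \<open>Primeness and minimality of the initial form, written as inequalities between values. In
  this form they survive an enlargement of the value group, whereas the graded algebra becomes a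
  different object.\<close>

locale key_polynomial =
  fixes \<mu> :: "'a::field poly \<Rightarrow> 'h::linordered_ab_group_add vext" and \<phi> :: "'a poly"
  assumes val: "is_valuation \<mu>" and monic: "lead_coeff \<phi> = 1" and deg: "degree \<phi> > 0" and fin: "\<mu> \<phi> \<noteq> Infty"
    and min_fin: "c \<noteq> 0 \<Longrightarrow> degree c < degree \<phi> \<Longrightarrow> \<mu> c \<noteq> Infty"
    and minimal: "c \<noteq> 0 \<Longrightarrow> degree c < degree \<phi> \<Longrightarrow> \<mu> (c + \<phi> * h) \<le> \<mu> c"
    and prime: "\<mu> (f * g) < \<mu> (f * g - \<phi> * q) \<Longrightarrow> (\<exists>q. \<mu> f < \<mu> (f - \<phi> * q)) \<or> (\<exists>q. \<mu> g < \<mu> (g - \<phi> * q))"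

lemma KP_key_polynomial:
  fixes \<mu> :: "'a::field poly \<Rightarrow> 'h::linordered_ab_group_add vext"
  assumes m: "is_valuation \<mu>" and \<phi>: "\<phi> \<in> KP \<mu>"
  shows "key_polynomial \<mu> \<phi>"
proof -
  interpret val_on UNIV \<mu> using m by (rule val_on_UNIV)
  have lc: "lead_coeff \<phi> = 1" and pr: "ring_prime\<^bsub>graded_algebra \<mu>\<^esub> (initial_form \<mu> \<phi>)"
    and nd: "\<And>f. f \<noteq> 0 \<Longrightarrow> degree f < degree \<phi> \<Longrightarrow> \<not> mu_dvd \<mu> \<phi> f" using \<phi> by (auto simp: KP_def)
  have nz: "initial_form \<mu> \<phi> \<noteq> val_gt \<mu>" and nu: "initial_form \<mu> \<phi> \<notin> Units (graded_algebra \<mu>)"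
    and pm: "\<And>a b. a \<in> carrier (graded_algebra \<mu>) \<Longrightarrow> b \<in> carrier (graded_algebra \<mu>) \<Longrightarrow>
      initial_form \<mu> \<phi> divides\<^bsub>graded_algebra \<mu>\<^esub> (a \<otimes>\<^bsub>graded_algebra \<mu>\<^esub> b) \<Longrightarrow>
      initial_form \<mu> \<phi> divides\<^bsub>graded_algebra \<mu>\<^esub> a \<or> initial_form \<mu> \<phi> divides\<^bsub>graded_algebra \<mu>\<^esub> b"
  proof -
    have "\<zero>\<^bsub>graded_algebra \<mu>\<^esub> = val_gt \<mu>" by (simp add: graded_algebra_def)
    then show "initial_form \<mu> \<phi> \<noteq> val_gt \<mu>" using pr by (simp add: ring_prime_def)
    have p: "Divisibility.prime (graded_algebra \<mu>) (initial_form \<mu> \<phi>)" using pr by (simp only: ring_prime_def)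
    show "initial_form \<mu> \<phi> \<notin> Units (graded_algebra \<mu>)" using p by (simp only: Divisibility.prime_def not_False_eq_True)
    show "\<And>a b. a \<in> carrier (graded_algebra \<mu>) \<Longrightarrow> b \<in> carrier (graded_algebra \<mu>) \<Longrightarrow>
      initial_form \<mu> \<phi> divides\<^bsub>graded_algebra \<mu>\<^esub> (a \<otimes>\<^bsub>graded_algebra \<mu>\<^esub> b) \<Longrightarrow>
      initial_form \<mu> \<phi> divides\<^bsub>graded_algebra \<mu>\<^esub> a \<or> initial_form \<mu> \<phi> divides\<^bsub>graded_algebra \<mu>\<^esub> b"
      using p unfolding Divisibility.prime_def by blast
  qed
  have "\<mu> \<phi> \<noteq> Infty" using nz by (auto simp: initial_form_def)
  then obtain \<alpha> where \<alpha>: "\<mu> \<phi> = Fin \<alpha>" by (cases "\<mu> \<phi>") auto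
  \<comment> \<open>A polynomial of infinite value has initial form 0, a multiple of everything;
    therefore nonzero polynomials of degree below that of \<phi> have finite value.\<close>
  have inf_dvd: "mu_dvd \<mu> \<phi> f" if "\<mu> f = Infty" for f
  proof -
    have "initial_form \<mu> f = initial_form \<mu> (\<phi> * 0)" using that zero by (simp add: initial_form_def)
    then show ?thesis using initial_form_mult[OF m \<alpha>, of 0] initial_form_carrier[OF m, of 0] unfolding mu_dvd_def factor_def
      by (intro bexI[of _ "initial_form \<mu> 0"]) simp_all
  qed
  show ?thesis
  proof
    show "is_valuation \<mu>" "lead_coeff \<phi> = 1" "\<mu> \<phi> \<noteq> Infty" by fact+
    \<comment> \<open>A monic constant is 1, whose initial form is a unit and so not prime.\<close>
    show "degree \<phi> > 0"
    proof (rule ccontr)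
      assume "\<not> ?thesis"
      then obtain c where "\<phi> = [:c:]" by (auto elim: degree_eq_zeroE)
      then have "\<phi> = 1" using lc by (simp add: one_pCons)
      moreover have "\<one>\<^bsub>graded_algebra \<mu>\<^esub> = initial_form \<mu> 1"
        by (rule ext) (auto simp: graded_algebra_def initial_form_def one zero_vext_def)
      moreover have "\<mu> 1 = Fin 0" using one by (simp add: zero_vext_def)
      ultimately have "initial_form \<mu> \<phi> \<in> Units (graded_algebra \<mu>)"
        using initial_form_carrier[OF m, of 1] initial_form_mult[OF m, of 1 0 1] by (auto simp: Units_def)
      then show False using nu by simp
    qed
    fix c h :: "'a poly" assume c: "c \<noteq> 0" "degree c < degree \<phi>"
    show cf: "\<mu> c \<noteq> Infty" using nd[OF c] inf_dvd by blast
    then obtain \<gamma> where "\<mu> c = Fin \<gamma>" by (cases "\<mu> c") auto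
    then have "\<not> \<mu> c < \<mu> (c - \<phi> * (- h))" using mu_dvd_iff[OF m \<alpha>] nd[OF c] by blast
    then show "\<mu> (c + \<phi> * h) \<le> \<mu> c" by simp
  next
    fix f g q :: "'a poly" assume lt: "\<mu> (f * g) < \<mu> (f * g - \<phi> * q)"
    then have "\<mu> (f * g) \<noteq> Infty" by (auto simp: vext_basics)
    then obtain \<beta> \<gamma> where fg: "\<mu> f = Fin \<beta>" "\<mu> g = Fin \<gamma>" by (cases "\<mu> f"; cases "\<mu> g") (auto simp: mult)
    then have "\<mu> (f * g) = Fin (\<beta> + \<gamma>)" by (simp add: mult)
    then have "mu_dvd \<mu> \<phi> (f * g)" using mu_dvd_iff[OF m \<alpha>] lt by blast
    then have "mu_dvd \<mu> \<phi> f \<or> mu_dvd \<mu> \<phi> g"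
      unfolding mu_dvd_def using pm[OF initial_form_carrier[OF m] initial_form_carrier[OF m], of f g] initial_form_mult[OF m fg(1), of g] by simp
    then show "(\<exists>q. \<mu> f < \<mu> (f - \<phi> * q)) \<or> (\<exists>q. \<mu> g < \<mu> (g - \<phi> * q))"
      using mu_dvd_iff[OF m \<alpha>] fg by blast
  qed
qed

text \<open>Let \<open>\<psi>\<close> be of minimal degree with \<open>\<omega> \<psi> < \<nu> \<psi>\<close>. On \<open>\<psi>\<close>-expansions, \<open>\<omega>\<close> is the minimum of the values
  of the terms; if \<open>\<psi>\<close> had smaller degree than \<open>\<phi>\<close>, this would force \<open>\<omega> \<le> \<mu>\<close>.\<close>

lemma valuations_below_agree:
  fixes \<mu> \<nu> \<omega> :: "'a::field poly \<Rightarrow> 'h::linordered_ab_group_add vext"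
  assumes m: "is_valuation \<mu>" and n: "is_valuation \<nu>" and w: "is_valuation \<omega>"
    and mn: "\<And>f. \<mu> f \<le> \<nu> f" and wn: "\<And>f. \<omega> f \<le> \<nu> f" and const: "\<And>a. \<omega> [:a:] = \<nu> [:a:]"
    and small: "\<And>c. degree c < degree \<phi> \<Longrightarrow> \<mu> c = \<nu> c" and lt: "\<mu> \<phi> < \<omega> \<phi>"
    and c: "degree c < degree \<phi>"
  shows "\<omega> c = \<nu> c"
proof (rule ccontr)
  interpret m: val_on UNIV \<mu> using m by (rule val_on_UNIV)
  interpret n: val_on UNIV \<nu> using n by (rule val_on_UNIV)
  interpret w: val_on UNIV \<omega> using w by (rule val_on_UNIV)
  assume "\<omega> c \<noteq> \<nu> c"
  then obtain \<psi> where \<psi>: "\<omega> \<psi> \<noteq> \<nu> \<psi>" and min: "\<And>d. \<omega> d \<noteq> \<nu> d \<Longrightarrow> degree \<psi> \<le> degree d"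
    using arg_min_nat_lemma[of "\<lambda>d. \<omega> d \<noteq> \<nu> d" c degree] by blast
  have ds: "degree \<psi> < degree \<phi>" using min[OF \<open>\<omega> c \<noteq> \<nu> c\<close>] c by simp
  have \<psi>': "\<omega> \<psi> < \<nu> \<psi>" using wn[of \<psi>] \<psi> by simp
  have dpos: "degree \<psi> > 0" using \<psi> const by (metis degree_eq_zeroE gr0I)
  have le: "\<omega> f \<le> \<mu> f" for f
  proof (induction "degree f" arbitrary: f rule: less_induct)
    case less
    show ?case
    proof (cases "f = 0")
      case False
      define r h where "r = f mod \<psi>" and "h = f div \<psi>"
      have f: "f = r + \<psi> * h" by (simp add: r_def h_def)
      have "degree r < degree \<psi>" unfolding r_def by (rule degree_mod_lt[OF dpos])
      then have r: "\<omega> r = \<nu> r" "\<mu> r = \<nu> r" using min[of r] small[of r] ds by auto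
      have h: "\<omega> h \<le> \<mu> h"
      proof (cases "h = 0")
        case False
        have "degree h < degree f" using False unfolding h_def by (rule degree_div_lt[OF dpos])
        then show ?thesis by (rule less)
      qed (simp add: m.zero w.zero)
      \<comment> \<open>Cancellation between r and \<psi> h would take place for \<omega> and \<nu>
        alike and force \<omega> and \<nu> to agree on \<psi> h, against \<omega> \<psi> < \<nu>
        \<psi>.\<close>
      have "\<omega> f \<le> \<omega> r"
      proof (rule ccontr)
        assume "\<not> ?thesis"
        then have gt: "\<omega> r < \<omega> (r + \<psi> * h)" by (simp add: f)
        then have eq: "\<omega> (\<psi> * h) = \<omega> r" using w.diff_eq(2)[OF UNIV_I UNIV_I gt] by simp
        then have fin: "\<omega> \<psi> + \<omega> h \<noteq> Infty" using gt by (auto simp: vext_basics w.mult)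
        have "\<nu> r < \<nu> (r + \<psi> * h)" using gt wn[of "r + \<psi> * h"] r(1) by simp
        then have "\<nu> (\<psi> * h) = \<nu> r" using n.diff_eq(2)[of r "r + \<psi> * h"] by simp
        moreover have "\<omega> \<psi> + \<omega> h < \<nu> \<psi> + \<nu> h" using fin \<psi>' wn[of h] by (intro vext_add_less_le(1)) (auto simp: vext_basics)
        ultimately show False using eq r(1) by (simp add: w.mult n.mult)
      qed
      moreover have "\<omega> f \<le> \<omega> (\<psi> * h)" using w.diff_ge[of f r "\<omega> f"] \<open>\<omega> f \<le> \<omega> r\<close> f by simp
      moreover have "\<omega> (\<psi> * h) \<le> \<mu> (\<psi> * h)"
        using h \<psi>' small[OF ds] by (auto simp: w.mult m.mult intro!: add_mono)
      ultimately have "\<omega> f \<le> \<mu> (r + \<psi> * h)" using r by (intro m.add_ge) auto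
      then show ?thesis by (simp add: f)
    qed (simp add: m.zero vext_basics)
  qed
  show False using le[of \<phi>] lt by simp
qed

section \<open>Expansions with respect to a key polynomial\<close>

context key_polynomial
begin

sublocale val_on UNIV \<mu> using val by (rule val_on_UNIV)

text \<open>Minimality of \<phi> excludes cancellation between c and \<phi> h. So \<mu> is
  determined by its values at \<phi> and below the degree of \<phi>.\<close>

lemma horner: assumes "degree c < degree \<phi>" shows "\<mu> (c + \<phi> * h) = min (\<mu> c) (\<mu> \<phi> + \<mu> h)"
proof (cases "c = 0")
  case False
  have "min (\<mu> c) (\<mu> (\<phi> * h)) \<le> \<mu> (c + \<phi> * h)" by (intro add_ge) auto
  moreover have "\<mu> (c + \<phi> * h) \<le> \<mu> c" using minimal[OF False assms] .
  moreover from this have "\<mu> (c + \<phi> * h) \<le> \<mu> (\<phi> * h)"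
    using diff_ge[of "c + \<phi> * h" c "\<mu> (c + \<phi> * h)"] by simp
  ultimately show ?thesis by (intro antisym) (simp_all add: mult)
qed (simp add: zero mult vext_basics min_def)

lemma mod_degree: "degree (f mod \<phi>) < degree \<phi>"
  using degree_mod_lt[OF deg] .

lemma expansion: "\<mu> f = min (\<mu> (f mod \<phi>)) (\<mu> \<phi> + \<mu> (f div \<phi>))"
  using horner[OF mod_degree, of f "f div \<phi>"] by simp

lemma div_degree: "f div \<phi> \<noteq> 0 \<Longrightarrow> degree (f div \<phi>) < degree f"
  by (rule degree_div_lt[OF deg])

text \<open>In an expansion an infinite value passes to remainder and quotient, and a remainder of
  infinite value is 0.\<close>

lemma trivial_support: "\<mu> f = Infty \<longleftrightarrow> f = 0"
proof
  show "\<mu> f = Infty \<Longrightarrow> f = 0"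
  proof (induction "degree f" arbitrary: f rule: less_induct)
    case less
    then have *: "\<mu> (f mod \<phi>) = Infty" "\<mu> (f div \<phi>) = Infty"
      using expansion[of f] fin by (auto simp: min_def vext_basics split: if_splits)
    have "f div \<phi> = 0" using less.hyps[OF div_degree _] *(2) by blast
    moreover have "f mod \<phi> = 0" using min_fin[OF _ mod_degree] *(1) by blast
    ultimately show ?case by (metis div_mult_mod_eq add.right_neutral mult_zero_left)
  qed
qed (simp add: zero)

lemma no_equivalent_multiple: "c \<noteq> 0 \<Longrightarrow> degree c < degree \<phi> \<Longrightarrow> \<not> (\<exists>q. \<mu> c < \<mu> (c - \<phi> * q))"
  using minimal[of c "- q" for q] by (auto simp: not_less)

text \<open>If \<phi> = f g, then \<phi> divides f g in the graded algebra and hence one factor,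
  which cannot be of smaller degree.\<close>

lemma factor_degree: assumes "\<phi> = f * g" shows "degree f = 0 \<or> degree g = 0"
proof (rule ccontr)
  assume neg: "\<not> ?thesis"
  have nz: "f \<noteq> 0" "g \<noteq> 0" using assms deg by auto
  then have "degree \<phi> = degree f + degree g" using assms degree_mult_eq by blast
  then have d: "degree f < degree \<phi>" "degree g < degree \<phi>" using neg by auto
  have "\<mu> (f * g) < \<mu> (f * g - \<phi> * 1)" using fin by (simp add: assms[symmetric] zero vext_basics)
  from prime[OF this] show False using no_equivalent_multiple[OF nz(1) d(1)] no_equivalent_multiple[OF nz(2) d(2)] by blast
qed

text \<open>This is the augmentation of \<mu> by \<phi> with infinite value. A product of two
  nonzero remainders keeps its value when reduced modulo \<phi>, since otherwise \<phi> would divide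
  it, and by primeness one of them, in the graded algebra.\<close>

lemma valuation_mod: "is_valuation (\<lambda>f. \<mu> (f mod \<phi>))"
  unfolding is_valuation_def
proof (intro conjI allI)
  show "\<mu> (0 mod \<phi>) = Infty" by (simp add: zero)
  show "\<mu> (1 mod \<phi>) = 0" using deg by (simp add: one mod_poly_less)
  fix f g
  show "min (\<mu> (f mod \<phi>)) (\<mu> (g mod \<phi>)) \<le> \<mu> ((f + g) mod \<phi>)" unfolding poly_mod_add_left by (intro add_ge) auto
  show "\<mu> ((f * g) mod \<phi>) = \<mu> (f mod \<phi>) + \<mu> (g mod \<phi>)"
  proof (cases "f mod \<phi> = 0 \<or> g mod \<phi> = 0")
    case True
    then have "(f * g) mod \<phi> = 0" by auto
    then show ?thesis using True by (auto simp: zero vext_basics)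
  next
    case False
    let ?a = "f mod \<phi>" and ?b = "g mod \<phi>"
    define r q where "r = (?a * ?b) mod \<phi>" and "q = (?a * ?b) div \<phi>"
    have ab: "?a * ?b = r + \<phi> * q" by (simp add: r_def q_def)
    have le: "\<mu> (?a * ?b) \<le> \<mu> r" using expansion[of "?a * ?b"] by (simp add: r_def)
    have "\<not> \<mu> (?a * ?b) < \<mu> (?a * ?b - \<phi> * q)"
      using prime[of ?a ?b q] no_equivalent_multiple[OF _ mod_degree] False by blast
    moreover have "?a * ?b - \<phi> * q = r" using ab by simp
    ultimately have "\<mu> r = \<mu> (?a * ?b)" using le by simp
    then show ?thesis by (simp add: r_def mod_mult_eq mult)
  qed
qed

lemma augmentation_Infty: "augmentation \<mu> \<phi> Infty f = \<mu> (f mod \<phi>)"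
proof -
  have sum: "(\<Sum>i<n. Infty) = (Infty::'h vext)" if n: "n > 0" for n :: nat
  proof -
    have "(\<Sum>i<Suc m. Infty) = (Infty::'h vext)" for m :: nat by (simp add: vext_basics)
    from this[of "n - 1"] show ?thesis using n by simp
  qed
  have *: "\<mu> (phi_coeff \<phi> f n) + (\<Sum>i<n. Infty) = (if n = 0 then \<mu> (f mod \<phi>) else Infty)" for n
  proof (cases "n = 0")
    case False
    then show ?thesis unfolding sum[OF False[unfolded neq0_conv]] by (simp add: vext_basics)
  qed (simp add: phi_coeff_def)
  show ?thesis unfolding augmentation_def *
    by (intro Min_eqI) (auto simp: vext_basics)
qed

text \<open>For \<psi> of least degree with \<mu> \<psi> < \<nu> \<psi> write \<phi> = \<psi> q + r.
  Either \<phi> and \<psi> q have the same initial form, against primeness, or \<nu>(\<psi> q) =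
  \<mu> r \<le> \<mu>(\<psi> q), against \<mu> \<psi> < \<nu> \<psi>.\<close>

lemma agree_below_degree:
  assumes n: "is_valuation \<nu>" and mn: "\<And>f. \<mu> f \<le> \<nu> f" and const: "\<And>a. \<mu> [:a:] = \<nu> [:a:]" and lt: "\<mu> \<phi> < \<nu> \<phi>"
    and c: "degree c < degree \<phi>"
  shows "\<mu> c = \<nu> c"
proof (rule ccontr)
  interpret n: val_on UNIV \<nu> using n by (rule val_on_UNIV)
  assume "\<mu> c \<noteq> \<nu> c"
  then obtain \<psi> where \<psi>: "\<mu> \<psi> \<noteq> \<nu> \<psi>" and min: "\<And>d. \<mu> d \<noteq> \<nu> d \<Longrightarrow> degree \<psi> \<le> degree d"
    using arg_min_nat_lemma[of "\<lambda>d. \<mu> d \<noteq> \<nu> d" c degree] by blast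
  have ds: "degree \<psi> < degree \<phi>" using min[OF \<open>\<mu> c \<noteq> \<nu> c\<close>] c by simp
  have \<psi>': "\<mu> \<psi> < \<nu> \<psi>" using mn[of \<psi>] \<psi> by simp
  have dpos: "degree \<psi> > 0" using \<psi> const by (metis degree_eq_zeroE gr0I)
  define r q where "r = \<phi> mod \<psi>" and "q = \<phi> div \<psi>"
  have f: "\<phi> = \<psi> * q + r" by (simp add: r_def q_def)
  have dr: "degree r < degree \<psi>" unfolding r_def by (rule degree_mod_lt[OF dpos])
  have r: "\<mu> r = \<nu> r" using min[of r] dr by auto
  have q: "q \<noteq> 0" using f dr ds by auto
  have dq: "degree q < degree \<phi>" unfolding q_def using dpos ds by (intro degree_div_less) auto
  have \<psi>0: "\<psi> \<noteq> 0" using dpos by auto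
  have \<psi>q: "\<psi> * q = \<phi> - r" using f by simp
  show False
  proof (cases "\<mu> \<phi> < \<mu> r")
    case True
    then have "\<mu> (\<psi> * q) = \<mu> \<phi>" unfolding \<psi>q by (intro diff_eq) auto
    moreover have "\<psi> * q - \<phi> * 1 = - r" using f by simp
    ultimately have "\<mu> (\<psi> * q) < \<mu> (\<psi> * q - \<phi> * 1)" using True by (simp add: uminus)
    from prime[OF this] show False
      using no_equivalent_multiple[OF \<psi>0 ds] no_equivalent_multiple[OF q dq] by blast
  next
    case False
    then have "\<nu> r < \<nu> \<phi>" using lt r by simp
    then have nq: "\<nu> (\<psi> * q) = \<mu> r" unfolding \<psi>q using n.diff_eq(2) r by simp
    have "\<mu> r \<le> \<mu> (\<psi> * q)" unfolding \<psi>q using False by (intro diff_ge) auto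
    moreover have "\<mu> \<psi> + \<mu> q < \<nu> \<psi> + \<nu> q" using \<psi>' mn[of q] trivial_support[of q] q by (intro vext_add_less_le) auto
    ultimately show False using nq by (simp add: mult n.mult)
  qed
qed

end

text \<open>This reduces the condition on tangent directions to an inequality at \<phi>. No
  polynomial of smaller degree gains value, so one of minimal degree that does is \<phi> + c with
  deg c < deg \<phi> and \<mu> c = \<nu> c.\<close>

lemma tangent_direction_eq_iff:
  assumes m: "is_valuation \<mu>" and n: "is_valuation \<nu>" and mn: "\<And>f. \<mu> f \<le> \<nu> f" and const: "\<And>a. \<mu> [:a:] = \<nu> [:a:]"
    and \<phi>: "\<phi> \<in> KP \<mu>"
  shows "tangent_direction \<mu> \<nu> = KP_class \<mu> \<phi> \<longleftrightarrow> \<mu> \<phi> < \<nu> \<phi>"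
proof
  interpret key_polynomial \<mu> \<phi> using m \<phi> by (rule KP_key_polynomial)
  interpret n: val_on UNIV \<nu> using n by (rule val_on_UNIV)
  have "\<phi> \<in> KP_class \<mu> \<phi>" using \<phi> by (simp add: KP_class_def mu_equiv_def)
  then show "tangent_direction \<mu> \<nu> = KP_class \<mu> \<phi> \<Longrightarrow> \<mu> \<phi> < \<nu> \<phi>" by (auto simp: tangent_direction_def)
  assume lt: "\<mu> \<phi> < \<nu> \<phi>"
  obtain \<alpha> where \<alpha>: "\<mu> \<phi> = Fin \<alpha>" using fin by (cases "\<mu> \<phi>") auto
  show "tangent_direction \<mu> \<nu> = KP_class \<mu> \<phi>"
  proof (intro equalityI subsetI)
    fix \<psi> assume \<psi>: "\<psi> \<in> tangent_direction \<mu> \<nu>"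
    then have \<psi>': "lead_coeff \<psi> = 1" "\<mu> \<psi> < \<nu> \<psi>" "degree \<psi> \<le> degree \<phi>" using monic lt by (auto simp: tangent_direction_def)
    moreover have "\<not> degree \<psi> < degree \<phi>" using agree_below_degree[OF n mn const lt, of \<psi>] \<psi>'(2) by auto
    ultimately have d: "degree \<psi> = degree \<phi>" by simp
    define c where "c = \<psi> - \<phi>"
    have dc: "degree c < degree \<phi>"
    proof -
      have "degree c \<le> degree \<phi>" unfolding c_def using d by (intro degree_diff_le) auto
      moreover have "coeff c (degree \<phi>) = 0" using \<psi>'(1) monic d by (simp add: c_def)
      ultimately show ?thesis using deg by (metis degree_0 eq_zero_or_degree_less)
    qed
    have c: "\<mu> c = \<nu> c" by (rule agree_below_degree[OF n mn const lt dc])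
    \<comment> \<open>If \<mu> c \<le> \<mu> \<phi>, then \<nu> \<psi> = \<nu> c = \<mu> c \<le>
      \<mu> \<psi>, and \<psi> would gain no value.\<close>
    have gt: "\<mu> \<phi> < \<mu> c"
    proof (rule ccontr)
      assume le: "\<not> ?thesis"
      then have "\<nu> c < \<nu> \<phi>" using lt c by simp
      then have "\<nu> \<psi> = \<mu> c" using n.add_eq(2)[of c \<phi>] c by (simp add: c_def)
      moreover have "\<mu> c \<le> \<mu> (\<phi> + c)" using le by (intro add_ge) auto
      ultimately show False using \<psi>'(2) by (simp add: c_def)
    qed
    then have eq: "initial_form \<mu> \<psi> = initial_form \<mu> \<phi>" using initial_form_eq_iff[OF m \<alpha>] \<alpha> by (simp add: c_def)
    then have "\<psi> \<in> KP \<mu>" using \<phi> \<psi>'(1) d by (simp add: KP_def mu_dvd_def)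
    then show "\<psi> \<in> KP_class \<mu> \<phi>" using eq by (simp add: KP_class_def mu_equiv_def)
  next
    fix \<psi> assume "\<psi> \<in> KP_class \<mu> \<phi>"
    then have \<psi>: "\<psi> \<in> KP \<mu>" "initial_form \<mu> \<psi> = initial_form \<mu> \<phi>" by (auto simp: KP_class_def mu_equiv_def)
    then have gt: "\<mu> \<phi> < \<mu> (\<psi> - \<phi>)" using initial_form_eq_iff[OF m \<alpha>] \<alpha> by simp
    have "\<mu> \<psi> = \<mu> \<phi>" using add_eq(1)[OF UNIV_I UNIV_I gt] by simp
    moreover have "\<mu> \<phi> < \<nu> (\<phi> + (\<psi> - \<phi>))" using gt mn[of "\<psi> - \<phi>"] lt by (intro n.add_gt) (auto intro: less_le_trans)
    ultimately have lt': "\<mu> \<psi> < \<nu> \<psi>" by simp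
    \<comment> \<open>Every member of the class is itself a key polynomial, so it too has minimal
      degree among those gaining value.\<close>
    interpret p: key_polynomial \<mu> \<psi> using m \<psi>(1) by (rule KP_key_polynomial)
    have "degree \<psi> \<le> degree \<chi>" if "\<mu> \<chi> < \<nu> \<chi>" for \<chi>
      using p.agree_below_degree[OF n mn const lt', of \<chi>] that by (force simp: not_le[symmetric])
    then show "\<psi> \<in> tangent_direction \<mu> \<nu>" using p.monic lt' by (auto simp: tangent_direction_def)
  qed
qed

subsection \<open>Counting roots in balls\<close>

text \<open>At a root of p the constant Taylor coefficient vanishes, so every term that can attain
  the minimum depends strictly on the radius.\<close>

lemma ball_val_strict_mono:
  assumes u: "is_valuation u" and p: "poly p a = 0" "p \<noteq> 0" and lt: "\<delta> < \<delta>'"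
  shows "ball_val u a \<delta> p < ball_val u a \<delta>' p"
proof -
  let ?c = "\<lambda>i. coeff (pcompose p [:a, 1:]) i"
  obtain i where i: "ball_val u a \<delta>' p = u (?c i) + Fin (of_nat i *\<^sub>Q \<delta>')"
    using gauss_attained unfolding ball_val_def by blast
  have le: "ball_val u a d p \<le> u (?c i) + Fin (of_nat i *\<^sub>Q d)" for d i
    using le_gauss_iff[OF u] unfolding ball_val_def by blast
  have nz: "pcompose p [:a, 1:] \<noteq> 0" using pcompose_eq_0[of p "[:a, 1:]"] p(2) by auto
  obtain j where j: "?c j \<noteq> 0" using nz by (auto simp: poly_eq_iff)
  have fin: "ball_val u a d p \<noteq> Infty" for d
    using le[of d j] field_valuation(1)[OF u, of "?c j"] j by (auto simp: vext_basics)
  have c0: "?c 0 = 0" using p(1) by (simp add: poly_0_coeff_0[symmetric] poly_pcompose)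
  have uc: "u (?c i) \<noteq> Infty" using i fin[of \<delta>'] by (auto simp: vext_basics)
  then have "i \<noteq> 0" using c0 field_valuation(1)[OF u, of "?c i"] by (cases i) auto
  then have "of_nat i *\<^sub>Q \<delta> < of_nat i *\<^sub>Q \<delta>'" using lt by (simp add: scaleQ_mono)
  then have "u (?c i) + Fin (of_nat i *\<^sub>Q \<delta>) < u (?c i) + Fin (of_nat i *\<^sub>Q \<delta>')"
    using uc by (simp add: vext_add_cancel vext_basics)
  then show ?thesis using le[of \<delta> i] i by (metis le_less_trans)
qed

text \<open>The term of index i reaches \<gamma> at the radius (\<gamma> - g i)/i, where g i is the
  value of its coefficient. At the largest of these radii all terms are at least \<gamma> and one is
  equal. Divisibility of the value group enters here.\<close>

lemma ball_val_radius_exists: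
  assumes u: "is_valuation u" and p: "poly p a = 0" "p \<noteq> 0"
  shows "\<exists>\<delta>. ball_val u a \<delta> p = Fin \<gamma>"
proof -
  let ?c = "\<lambda>i. coeff (pcompose p [:a, 1:]) i"
  define I where "I = {i. ?c i \<noteq> 0}"
  have nz: "pcompose p [:a, 1:] \<noteq> 0" using pcompose_eq_0[of p "[:a, 1:]"] p(2) by auto
  have I: "finite I" "I \<noteq> {}" using nz MOST_coeff_eq_0[of "pcompose p [:a, 1:]"]
    by (auto simp: I_def poly_eq_iff eventually_cofinite)
  have c0: "?c 0 = 0" using p(1) by (simp add: poly_0_coeff_0[symmetric] poly_pcompose)
  then have pos: "i > 0" if "i \<in> I" for i using that by (cases i) (auto simp: I_def)
  define g where "g i = (case u (?c i) of Fin x \<Rightarrow> x | Infty \<Rightarrow> 0)" for i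
  have g: "u (?c i) = Fin (g i)" if "i \<in> I" for i
    using that field_valuation(1)[OF u, of "?c i"] by (cases "u (?c i)") (auto simp: I_def g_def)
  define t where "t i = inverse (of_nat i) *\<^sub>Q (\<gamma> - g i)" for i
  define \<delta> where "\<delta> = Max (t ` I)"
  have ti: "of_nat i *\<^sub>Q t i = \<gamma> - g i" if "i \<in> I" for i
    unfolding t_def using pos[OF that] by (intro scaleQ_cancel) simp
  have "\<delta> \<in> t ` I" unfolding \<delta>_def using I by (intro Max_in) auto
  then obtain j where j: "j \<in> I" "\<delta> = t j" by blast
  have ge: "\<gamma> \<le> g i + of_nat i *\<^sub>Q \<delta>" if "i \<in> I" for i
  proof -
    have "t i \<le> \<delta>" unfolding \<delta>_def using I that by (intro Max_ge) auto
    then have "of_nat i *\<^sub>Q t i \<le> of_nat i *\<^sub>Q \<delta>" using pos[OF that] by (simp add: scaleQ_mono)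
    then show ?thesis using ti[OF that] by (simp add: algebra_simps)
  qed
  have "Fin \<gamma> \<le> ball_val u a \<delta> p"
    unfolding ball_val_def le_gauss_iff[OF u]
  proof
    fix i
    show "Fin \<gamma> \<le> u (?c i) + Fin (of_nat i *\<^sub>Q \<delta>)"
    proof (cases "i \<in> I")
      case True
      then show ?thesis using ge g by simp
    next
      case False
      then have "u (?c i) = Infty" using field_valuation(1)[OF u, of "?c i"] by (simp add: I_def)
      then show ?thesis by (simp add: vext_basics)
    qed
  qed
  moreover have "ball_val u a \<delta> p \<le> u (?c j) + Fin (of_nat j *\<^sub>Q \<delta>)"
    using le_gauss_iff[OF u] unfolding ball_val_def by blast
  moreover have "u (?c j) + Fin (of_nat j *\<^sub>Q \<delta>) = Fin \<gamma>" using g[OF j(1)] ti[OF j(1)] j(2) by simp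
  ultimately show ?thesis by (metis antisym)
qed

definition count_roots :: "'c::idom poly \<Rightarrow> 'c set \<Rightarrow> nat" where
  "count_roots p S = size (filter_mset (\<lambda>x. x \<in> S) (proots p))"

lemma count_roots_Union:
  assumes "finite \<B>" "\<And>A B. A \<in> \<B> \<Longrightarrow> B \<in> \<B> \<Longrightarrow> A \<inter> B \<noteq> {} \<Longrightarrow> A = B"
  shows "count_roots p (\<Union>\<B>) = (\<Sum>B\<in>\<B>. count_roots p B)"
proof -
  have "size (filter_mset (\<lambda>x. x \<in> \<Union>\<B>) M) = (\<Sum>B\<in>\<B>. size (filter_mset (\<lambda>x. x \<in> B) M))" for M
  proof (induction M)
    case (add x M)
    have "(\<Sum>B\<in>\<B>. size (filter_mset (\<lambda>y. y \<in> B) (add_mset x M))) =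
        (\<Sum>B\<in>\<B>. (if x \<in> B then 1 else 0) + size (filter_mset (\<lambda>y. y \<in> B) M))"
      by (intro sum.cong) auto
    also have "\<dots> = (\<Sum>B\<in>\<B>. if x \<in> B then 1 else 0) + (\<Sum>B\<in>\<B>. size (filter_mset (\<lambda>y. y \<in> B) M))"
      by (rule sum.distrib)
    also have "(\<Sum>B\<in>\<B>. if x \<in> B then 1 else (0::nat)) = (if x \<in> \<Union>\<B> then 1 else 0)"
    proof (cases "x \<in> \<Union>\<B>")
      case True
      then obtain B where B: "B \<in> \<B>" "x \<in> B" by blast
      then have "C \<in> \<B> \<Longrightarrow> x \<in> C \<longleftrightarrow> C = B" for C using assms(2)[of B C] by blast
      then have "(\<Sum>C\<in>\<B>. if x \<in> C then 1 else (0::nat)) = (\<Sum>C\<in>\<B>. if C = B then 1 else 0)"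
        by (intro sum.cong) auto
      then show ?thesis using True B(1) assms(1) by simp
    qed auto
    finally show ?case using add by auto
  qed simp
  then show ?thesis by (simp add: count_roots_def)
qed

text \<open>The value group is arbitrary, because the locale is applied after infinitesimals have
  been adjoined.\<close>

locale discoid = key_polynomial \<mu> \<phi> + field_embedding emb
  for \<mu> :: "'a::field poly \<Rightarrow> 'h::linordered_rat_vector vext" and \<phi> and emb :: "'a \<Rightarrow> 'c::alg_closed_field" +
  fixes u :: "'c \<Rightarrow> 'h vext" and \<gamma> :: 'h
  assumes u: "is_valuation u" and const: "\<mu> [:a:] = u (emb a)" and \<gamma>: "\<mu> \<phi> < Fin \<gamma>"
begin

definition "pv \<theta> f = u (poly (mp f) \<theta>)"
definition "dominates \<theta> \<longleftrightarrow> (\<forall>f. \<mu> f \<le> pv \<theta> f)"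
definition "orbit = {a. poly (mp \<phi>) a = 0 \<and> dominates a}"
definition "disc = {\<theta>. dominates \<theta> \<and> Fin \<gamma> \<le> pv \<theta> \<phi>}"
text \<open>The value \<gamma> of \<phi> is prescribed and not the radius, which may vary with the
  root; at a root of \<phi> the choice is unique.\<close>

definition "rad a = (SOME \<delta>. ball_val u a \<delta> (mp \<phi>) = Fin \<gamma>)"
definition "ball a = {\<theta>. Fin (rad a) \<le> u (\<theta> - a)}"

sublocale u: val_on UNIV u using u by (rule val_on_UNIV)

lemma is_valuation_pv: "is_valuation (pv \<theta>)"
  unfolding is_valuation_def pv_def
proof (intro conjI allI)
  fix f g
  show "min (u (poly (mp f) \<theta>)) (u (poly (mp g) \<theta>)) \<le> u (poly (mp (f + g)) \<theta>)"
    unfolding mp_hom poly_add by (rule u.add_ge) auto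
qed (simp_all add: mp_hom u.zero u.one u.mult)

lemma is_valuation_ball: "is_valuation (\<lambda>f. ball_val u a \<delta> (mp f))"
  using is_valuation_ball_val[OF u, of a \<delta>] unfolding is_valuation_def mp_hom by blast

lemma ball_const: "ball_val u a \<delta> (mp [:c:]) = u (emb c)"
  by (simp add: mp_hom ball_val_const)

lemma pv_const: "pv \<theta> [:c:] = u (emb c)"
  by (simp add: mp_hom pv_def)

lemma mp_phi_nz: "mp \<phi> \<noteq> 0" using deg by (auto simp: mp_hom)

lemma rad: assumes "poly (mp \<phi>) a = 0" shows "ball_val u a (rad a) (mp \<phi>) = Fin \<gamma>"
  unfolding rad_def using ball_val_radius_exists[OF u assms mp_phi_nz] by (rule someI_ex)

lemma rad_unique:
  assumes "poly (mp \<phi>) a = 0" "ball_val u a \<delta> (mp \<phi>) = Fin \<gamma>" shows "\<delta> = rad a"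
proof (rule ccontr)
  assume "\<delta> \<noteq> rad a"
  then consider "\<delta> < rad a" | "rad a < \<delta>" by (metis linorder_neqE)
  then show False
    by cases (use ball_val_strict_mono[OF u assms(1) mp_phi_nz] rad[OF assms(1)] assms(2) in \<open>metis less_irrefl\<close>)+
qed

text \<open>A valuation that lies below that of a dominating point, agrees with \<mu> on constants
  and exceeds \<mu> at \<phi> lies above \<mu> everywhere: below the degree of \<phi> all three
  agree, and the expansion does the rest.\<close>

lemma below_agree:
  assumes \<theta>: "dominates \<theta>" and w: "is_valuation \<omega>" "\<And>f. \<omega> f \<le> pv \<theta> f" "\<And>a. \<omega> [:a:] = u (emb a)" "\<mu> \<phi> < \<omega> \<phi>"
  shows "degree c < degree \<phi> \<Longrightarrow> \<omega> c = \<mu> c" "\<mu> f \<le> \<omega> f"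
proof -
  have mn: "\<mu> f \<le> pv \<theta> f" for f using \<theta> by (simp add: dominates_def)
  have "\<mu> \<phi> < pv \<theta> \<phi>" using w(2)[of \<phi>] w(4) by simp
  then have small: "\<mu> c = pv \<theta> c" if "degree c < degree \<phi>" for c
    using agree_below_degree[OF is_valuation_pv[of \<theta>] mn _ _ that] const pv_const by simp
  show eq: "\<omega> c = \<mu> c" if "degree c < degree \<phi>" for c
    using valuations_below_agree[OF val is_valuation_pv[of \<theta>] w(1) mn w(2) _ small w(4) that] small[OF that] w(3) pv_const
    by simp
  interpret w: val_on UNIV \<omega> using w(1) by (rule val_on_UNIV)
  show "\<mu> f \<le> \<omega> f"
  proof (induction "degree f" arbitrary: f rule: less_induct)
    case less
    have f: "f = f mod \<phi> + \<phi> * (f div \<phi>)" by simp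
    have h: "\<mu> (f div \<phi>) \<le> \<omega> (f div \<phi>)"
    proof (cases "f div \<phi> = 0")
      case False
      then show ?thesis using less div_degree by blast
    qed (simp add: zero w.zero)
    have "\<mu> f \<le> \<omega> (f mod \<phi>)" using expansion[of f] eq[OF mod_degree] by simp
    moreover have "\<mu> \<phi> + \<mu> (f div \<phi>) \<le> \<omega> \<phi> + \<omega> (f div \<phi>)" using h w(4) by (intro add_mono) auto
    then have "\<mu> f \<le> \<omega> (\<phi> * (f div \<phi>))" using expansion[of f] by (auto simp: w.mult min_le_iff_disj)
    ultimately have "\<mu> f \<le> \<omega> (f mod \<phi> + \<phi> * (f div \<phi>))" by (intro w.add_ge) auto
    then show ?case using f by simp
  qed
qed

lemma ball_agree:
  assumes a: "a \<in> orbit" shows "degree c < degree \<phi> \<Longrightarrow> ball_val u a (rad a) (mp c) = \<mu> c"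
    "\<mu> f \<le> ball_val u a (rad a) (mp f)"
proof -
  have root: "poly (mp \<phi>) a = 0" and dom: "dominates a" using a by (auto simp: orbit_def)
  have le: "ball_val u a (rad a) (mp f) \<le> pv a f" for f unfolding pv_def by (rule ball_val_le_poly[OF u])
  have lt: "\<mu> \<phi> < ball_val u a (rad a) (mp \<phi>)" using \<gamma> rad[OF root] by simp
  show "degree c < degree \<phi> \<Longrightarrow> ball_val u a (rad a) (mp c) = \<mu> c" "\<mu> f \<le> ball_val u a (rad a) (mp f)"
    using below_agree[OF dom is_valuation_ball le ball_const lt] by blast+
qed

text \<open>As \<phi>(a) = 0, evaluation at the center bounds the value of f by that of its
  remainder; this rules out cancellation with the multiple of \<phi>.\<close>

lemma ball_horner:
  assumes a: "a \<in> orbit"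
  shows "ball_val u a (rad a) (mp f) = min (\<mu> (f mod \<phi>)) (Fin \<gamma> + ball_val u a (rad a) (mp (f div \<phi>)))"
proof -
  interpret w: val_on UNIV "\<lambda>f. ball_val u a (rad a) (mp f)" using is_valuation_ball by (rule val_on_UNIV)
  let ?w = "\<lambda>f. ball_val u a (rad a) (mp f)"
  have root: "poly (mp \<phi>) a = 0" and ab: "dominates a" using a by (auto simp: orbit_def)
  let ?c = "f mod \<phi>" and ?h = "f div \<phi>"
  have f: "f = ?c + \<phi> * ?h" by simp
  have w\<phi>: "?w (\<phi> * ?h) = Fin \<gamma> + ?w ?h" using w.mult[of \<phi> ?h] rad[OF root] by simp
  have wc: "?w ?c = \<mu> ?c" using ball_agree(1)[OF a mod_degree] .
  have "pv a f = pv a ?c" by (subst f, simp only: pv_def mp_hom poly_add poly_mult root) simp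
  moreover have "pv a ?c = \<mu> ?c"
  proof -
    have "\<mu> g \<le> pv a g" for g using ab by (simp add: dominates_def)
    moreover have "\<mu> \<phi> < pv a \<phi>" using root fin by (simp add: pv_def u.zero vext_basics)
    ultimately show ?thesis using agree_below_degree[OF is_valuation_pv[of a] _ _ _ mod_degree[of f]] const pv_const by simp
  qed
  ultimately have 1: "?w f \<le> \<mu> ?c" using ball_val_le_poly[OF u, of a "rad a" "mp f"] by (simp add: pv_def)
  then have "?w f \<le> ?w (f - ?c)" using wc by (intro w.diff_ge) auto
  moreover have "f - ?c = \<phi> * ?h" by (simp add: minus_mod_eq_mult_div)
  ultimately have 2: "?w f \<le> Fin \<gamma> + ?w ?h" using w\<phi> by simp
  have "min (\<mu> ?c) (Fin \<gamma> + ?w ?h) \<le> ?w (?c + \<phi> * ?h)" using wc w\<phi> by (intro w.add_ge) auto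
  then show ?thesis using 1 2 by (intro antisym) auto
qed

text \<open>On K[x] the ball valuation is the augmentation of \<mu> by \<phi> with value \<gamma>.
  Describing the minimum by its lower bounds x avoids index ranges, so that induction over f div
  \<phi> applies directly.\<close>

lemma ball_expansion:
  assumes a: "a \<in> orbit"
  shows "x \<le> ball_val u a (rad a) (mp f) \<longleftrightarrow> (\<forall>n. x \<le> \<mu> (phi_coeff \<phi> f n) + Fin (of_nat n *\<^sub>Q \<gamma>))"
proof (induction "degree f" arbitrary: f x rule: less_induct)
  case less
  have split: "(\<forall>n. P n) \<longleftrightarrow> P 0 \<and> (\<forall>n. P (Suc n))" for P :: "nat \<Rightarrow> bool" by (metis nat.exhaust)
  have pc: "phi_coeff \<phi> f (Suc n) = phi_coeff \<phi> (f div \<phi>) n" for n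
    by (simp add: phi_coeff_def poly_div_mult_right)
  have sh: "\<mu> p + Fin (of_nat (Suc n) *\<^sub>Q \<gamma>) = \<mu> p + Fin (of_nat n *\<^sub>Q \<gamma>) + Fin \<gamma>" for p n
  proof -
    have "Fin (of_nat (Suc n) *\<^sub>Q \<gamma>) = Fin (of_nat n *\<^sub>Q \<gamma>) + Fin \<gamma>"
      by (simp add: scaleQ_add_left scaleQ_one add.commute)
    then show ?thesis by (simp add: add.assoc del: of_nat_Suc)
  qed
  have neg: "x \<le> y + Fin \<gamma> \<longleftrightarrow> x + Fin (- \<gamma>) \<le> y" for x y by (cases x; cases y) (auto simp: algebra_simps)
  have IH: "x \<le> ball_val u a (rad a) (mp (f div \<phi>)) \<longleftrightarrow> (\<forall>n. x \<le> \<mu> (phi_coeff \<phi> (f div \<phi>) n) + Fin (of_nat n *\<^sub>Q \<gamma>))" for x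
  proof (cases "f div \<phi> = 0")
    case True
    have "ball_val u a (rad a) (mp 0) = Infty" using is_valuation_ball[of a "rad a"] unfolding is_valuation_def by blast
    then show ?thesis using True by (simp add: phi_coeff_def zero vext_basics)
  next
    case False
    then show ?thesis using less div_degree by blast
  qed
  have "x \<le> ball_val u a (rad a) (mp f) \<longleftrightarrow> x \<le> \<mu> (f mod \<phi>) \<and> x \<le> ball_val u a (rad a) (mp (f div \<phi>)) + Fin \<gamma>"
    by (subst ball_horner[OF a]) (simp add: add.commute)
  also have "\<dots> \<longleftrightarrow> x \<le> \<mu> (phi_coeff \<phi> f 0) + Fin (of_nat 0 *\<^sub>Q \<gamma>) \<and> (\<forall>n. x \<le> \<mu> (phi_coeff \<phi> f (Suc n)) + Fin (of_nat (Suc n) *\<^sub>Q \<gamma>))"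
    unfolding pc sh neg IH by (simp add: phi_coeff_def scaleQ_basics zero_vext_def[symmetric])
  also have "\<dots> \<longleftrightarrow> (\<forall>n. x \<le> \<mu> (phi_coeff \<phi> f n) + Fin (of_nat n *\<^sub>Q \<gamma>))"
    using split[of "\<lambda>n. x \<le> \<mu> (phi_coeff \<phi> f n) + Fin (of_nat n *\<^sub>Q \<gamma>)"] by (rule sym)
  finally show ?case .
qed

lemma ball_subset_disc: assumes a: "a \<in> orbit" shows "ball a \<subseteq> disc"
proof
  fix \<theta> assume "\<theta> \<in> ball a"
  then have "ball_val u \<theta> (rad a) p = ball_val u a (rad a) p" for p
    using ball_val_center[OF u] by (auto simp: ball_def)
  then have le: "ball_val u a (rad a) (mp f) \<le> pv \<theta> f" for f
    using ball_val_le_poly[OF u, of \<theta> "rad a" "mp f"] by (simp add: pv_def)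
  have "dominates \<theta>" using ball_agree(2)[OF a] le by (auto simp: dominates_def intro: order.trans)
  moreover have "Fin \<gamma> \<le> pv \<theta> \<phi>" using le[of \<phi>] rad[of a] a by (simp add: orbit_def)
  ultimately show "\<theta> \<in> disc" by (simp add: disc_def)
qed

text \<open>The center is a root b of \<phi> nearest to \<theta>. On the smallest ball about b
  containing \<theta> the polynomial \<phi> has the value of \<phi>(\<theta>), which is above \<mu>
  \<phi>; so the valuation of this ball dominates \<mu>, and with it the point b.\<close>

lemma disc_subset_balls: assumes \<theta>: "\<theta> \<in> disc" shows "\<exists>b\<in>orbit. \<theta> \<in> ball b"
proof -
  have ab: "dominates \<theta>" and ge: "Fin \<gamma> \<le> pv \<theta> \<phi>" using \<theta> by (auto simp: disc_def)
  let ?R = "{b. poly (mp \<phi>) b = 0}"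
  have R: "finite ?R" using poly_roots_finite[OF mp_phi_nz] .
  have "?R \<noteq> {}" using alg_closed_imp_poly_has_root[of "mp \<phi>"] deg by (auto simp: mp_hom)
  then have "Max ((\<lambda>b. u (\<theta> - b)) ` ?R) \<in> (\<lambda>b. u (\<theta> - b)) ` ?R" using R by (intro Max_in) auto
  then obtain b where b: "poly (mp \<phi>) b = 0" "Max ((\<lambda>b. u (\<theta> - b)) ` ?R) = u (\<theta> - b)" by auto
  have max: "u (\<theta> - b') \<le> u (\<theta> - b)" if "poly (mp \<phi>) b' = 0" for b'
    unfolding b(2)[symmetric] using R that by (intro Max_ge) auto
  show ?thesis
  proof (cases "u (\<theta> - b)")
    case Infty
    then have "\<theta> = b" using field_valuation(1)[OF u, of "\<theta> - b"] by simp
    then show ?thesis using b(1) ab by (intro bexI[of _ b]) (auto simp: orbit_def ball_def u.zero vext_basics)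
  next
    case (Fin \<epsilon>)
    have eq: "ball_val u \<theta> \<epsilon> p = ball_val u b \<epsilon> p" for p using ball_val_center[OF u, of \<epsilon> \<theta> b] Fin by simp
    define \<omega> where "\<omega> f = ball_val u b \<epsilon> (mp f)" for f
    have w\<theta>: "\<omega> f \<le> pv \<theta> f" for f unfolding \<omega>_def eq[symmetric] pv_def by (rule ball_val_le_poly[OF u])
    have wb: "\<omega> f \<le> pv b f" for f unfolding \<omega>_def pv_def by (rule ball_val_le_poly[OF u])
    \<comment> \<open>No root of \<phi> is nearer to \<theta> than b, so truncation at \<epsilon>
      changes no summand.\<close>
    have "(\<Sum>x\<in>#proots (mp \<phi>). min (u (\<theta> - x)) (Fin \<epsilon>)) = (\<Sum>x\<in>#proots (mp \<phi>). u (\<theta> - x))"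
    proof (intro arg_cong[where f = sum_mset] image_mset_cong)
      fix x assume "x \<in># proots (mp \<phi>)"
      then have "u (\<theta> - x) \<le> Fin \<epsilon>" using max[of x] Fin mp_phi_nz by simp
      then show "min (u (\<theta> - x)) (Fin \<epsilon>) = u (\<theta> - x)" by simp
    qed
    then have "ball_val u \<theta> \<epsilon> (mp \<phi>) = u (poly (mp \<phi>) \<theta>)"
      by (simp only: ball_val_eq[OF u] valuation_poly[OF u])
    then have "\<omega> \<phi> = pv \<theta> \<phi>" by (simp only: \<omega>_def eq pv_def)
    then have w\<phi>: "\<mu> \<phi> < \<omega> \<phi>" "Fin \<gamma> \<le> \<omega> \<phi>" using ge \<gamma> by auto
    have wv: "is_valuation \<omega>" unfolding \<omega>_def by (rule is_valuation_ball)
    have wc: "\<omega> [:c:] = u (emb c)" for c unfolding \<omega>_def by (rule ball_const)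
    have "\<mu> f \<le> \<omega> f" for f by (rule below_agree(2)[OF ab wv w\<theta> wc w\<phi>(1)])
    then have "dominates b" using wb by (auto simp: dominates_def intro: order.trans)
    then have bo: "b \<in> orbit" using b(1) by (simp add: orbit_def)
    have "rad b \<le> \<epsilon>"
    proof (rule ccontr)
      assume "\<not> ?thesis"
      then have "\<omega> \<phi> < Fin \<gamma>" using ball_val_strict_mono[OF u b(1) mp_phi_nz, of \<epsilon> "rad b"] rad[OF b(1)] by (simp add: \<omega>_def)
      then show False using w\<phi>(2) by simp
    qed
    then have "\<theta> \<in> ball b" using Fin by (simp add: ball_def)
    then show ?thesis using bo by blast
  qed
qed

lemma disc_eq: "disc = \<Union> (ball ` orbit)"
proof (intro equalityI subsetI)
  show "\<theta> \<in> disc \<Longrightarrow> \<theta> \<in> \<Union> (ball ` orbit)" for \<theta> using disc_subset_balls[of \<theta>] by auto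
  show "\<theta> \<in> \<Union> (ball ` orbit) \<Longrightarrow> \<theta> \<in> disc" for \<theta> using ball_subset_disc by auto
qed

text \<open>Of two balls that meet, the larger contains both centers. At its radius \<phi> has value
  \<gamma> around either center, and uniqueness equates the radii.\<close>

lemma balls_disjoint: assumes a: "a \<in> orbit" and b: "b \<in> orbit" and ne: "ball a \<inter> ball b \<noteq> {}"
  shows "ball a = ball b"
proof -
  have sym: "u (x - y) = u (y - x)" for x y using u.uminus[of "x - y"] by simp
  have *: "rad a = rad b \<and> Fin (rad a) \<le> u (a - b)" if ab: "a \<in> orbit" "b \<in> orbit" and \<theta>: "\<theta> \<in> ball a" "\<theta> \<in> ball b" and le: "rad a \<le> rad b" for a b \<theta>
  proof -
    have "Fin (rad a) \<le> u (\<theta> - a)" "Fin (rad a) \<le> u (\<theta> - b)"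
      using \<theta> le order.trans[of "Fin (rad a)" "Fin (rad b)" "u (\<theta> - b)"] by (auto simp: ball_def)
    then have "Fin (rad a) \<le> u ((\<theta> - b) - (\<theta> - a))" by (rule u.diff_ge[OF UNIV_I UNIV_I, rotated])
    then have d: "Fin (rad a) \<le> u (a - b)" by simp
    have "ball_val u b (rad a) (mp \<phi>) = Fin \<gamma>" using ball_val_center[OF u d, of "mp \<phi>"] rad[of a] ab by (simp add: orbit_def)
    then show ?thesis using rad_unique[of b "rad a"] ab d by (simp add: orbit_def)
  qed
  obtain \<theta> where \<theta>: "\<theta> \<in> ball a" "\<theta> \<in> ball b" using ne by blast
  have "rad a = rad b \<and> Fin (rad a) \<le> u (a - b)"
  proof (cases "rad a \<le> rad b")
    case True
    then show ?thesis by (rule *[OF a b \<theta>])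
  next
    case False
    then have "rad b = rad a \<and> Fin (rad b) \<le> u (b - a)" by (intro *[OF b a \<theta>(2,1)]) simp
    then show ?thesis using sym[of a b] by metis
  qed
  then have r: "rad a = rad b" "Fin (rad a) \<le> u (a - b)" by auto
  have "Fin (rad a) \<le> u (x - a) \<longleftrightarrow> Fin (rad a) \<le> u (x - b)" for x
    using u.add_ge[of "x - a" "a - b" "Fin (rad a)"] u.diff_ge[of "x - b" "a - b" "Fin (rad a)"] r(2) by auto
  then show ?thesis using r(1) by (simp add: ball_def)
qed

lemma finite_orbit: "finite orbit"
  by (rule finite_subset[OF _ poly_roots_finite[OF mp_phi_nz]]) (auto simp: orbit_def)

text \<open>The counts for \<phi> may vary from ball to ball as long as the factor n is the same for
  all. The roots of \<phi> in the disc are those of the orbit.\<close>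

lemma count_roots_disc:
  assumes "\<And>a. a \<in> orbit \<Longrightarrow> rat_of_nat (count_roots p (ball a)) = n * of_nat (count_roots (mp \<phi>) (ball a))"
  shows "rat_of_nat (count_roots p disc) = n * of_nat (count_roots (mp \<phi>) orbit)"
proof -
  have un: "count_roots q disc = (\<Sum>B\<in>ball ` orbit. count_roots q B)" for q
    unfolding disc_eq using balls_disjoint finite_orbit by (intro count_roots_Union) auto
  have "rat_of_nat (count_roots p disc) = (\<Sum>B\<in>ball ` orbit. n * of_nat (count_roots (mp \<phi>) B))"
    unfolding un of_nat_sum using assms by (intro sum.cong) auto
  also have "\<dots> = n * of_nat (count_roots (mp \<phi>) disc)" by (simp add: un sum_distrib_left)
  also have "count_roots (mp \<phi>) disc = count_roots (mp \<phi>) orbit"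
    unfolding count_roots_def
    by (intro arg_cong[where f = size] filter_mset_cong refl) (auto simp: disc_def orbit_def pv_def u.zero vext_basics mp_phi_nz)
  finally show ?thesis .
qed

end

subsection \<open>Counting roots with infinitesimally perturbed radii\<close>

instance prod :: (linordered_ab_group_add, linordered_ab_group_add) linordered_ab_group_add
  by standard (auto simp: less_eq_prod_def)

instantiation rat :: linordered_rat_vector
begin
definition scaleQ_rat :: "rat \<Rightarrow> rat \<Rightarrow> rat" where "scaleQ_rat q x = q * x"
instance by standard (auto simp: scaleQ_rat_def algebra_simps)
end

instantiation prod :: (linordered_rat_vector, linordered_rat_vector) linordered_rat_vector
begin
definition scaleQ_prod :: "rat \<Rightarrow> 'a \<times> 'b \<Rightarrow> 'a \<times> 'b" where "scaleQ_prod q x = (q *\<^sub>Q fst x, q *\<^sub>Q snd x)"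
instance by standard (auto simp: scaleQ_prod_def scaleQ_add_left scaleQ_add_right scaleQ_scaleQ scaleQ_one)
end

text \<open>The lexicographic product with \<open>\<rat>\<close> adjoins infinitesimal elements \<open>(0, s)\<close>. The second
  component of a Gauss value at a radius \<open>(\<delta>, s)\<close> counts roots in a closed (\<open>s < 0\<close>) or open (\<open>s > 0\<close>) ball.\<close>

fun lift_vext :: "'g vext \<Rightarrow> ('g \<times> rat) vext" where
  "lift_vext (Fin x) = Fin (x, 0)"
| "lift_vext Infty = Infty"

lemma lift_vext_simps:
  fixes x y :: "'g::linordered_ab_group_add vext"
  shows "lift_vext x \<le> lift_vext y \<longleftrightarrow> x \<le> y" "lift_vext x < lift_vext y \<longleftrightarrow> x < y"
    "lift_vext (x + y) = lift_vext x + lift_vext y" "lift_vext x = Infty \<longleftrightarrow> x = Infty" "lift_vext 0 = 0"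
  by (cases x; cases y; auto simp: less_vext_def zero_vext_def zero_prod_def)+

lemma lift_vext_perturbed:
  fixes x :: "'g::linordered_ab_group_add vext"
  shows "s < 0 \<Longrightarrow> Fin (\<gamma>, s) \<le> lift_vext x \<longleftrightarrow> Fin \<gamma> \<le> x" "s > 0 \<Longrightarrow> Fin (\<gamma>, s) \<le> lift_vext x \<longleftrightarrow> Fin \<gamma> < x"
    "x < Fin \<gamma> \<Longrightarrow> lift_vext x < Fin (\<gamma>, s)"
  by (cases x; auto simp: less_vext_def)+

lemma is_valuation_lift: assumes "is_valuation u" shows "is_valuation (\<lambda>x. lift_vext (u x))"
proof -
  have min: "min (lift_vext a) (lift_vext b) = lift_vext (min a b)" for a b :: "'b vext"
    by (simp add: min_def lift_vext_simps)
  show ?thesis using assms unfolding is_valuation_def min by (simp add: lift_vext_simps)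
qed

lemma key_polynomial_lift:
  assumes "key_polynomial \<mu> \<phi>" shows "key_polynomial (\<lambda>f. lift_vext (\<mu> f)) \<phi>"
proof -
  interpret key_polynomial \<mu> \<phi> by fact
  show ?thesis
  proof
    show "is_valuation (\<lambda>f. lift_vext (\<mu> f))" using val by (rule is_valuation_lift)
  qed (auto simp: lift_vext_simps monic deg fin min_fin minimal prime)
qed

text \<open>Each truncated summand contributes the infinitesimal part of \<delta>, every other
  summand contributes 0.\<close>

lemma perturbed_sum_mset:
  fixes \<delta> :: "'g::linordered_rat_vector \<times> rat" and M :: "'x multiset"
  shows "\<exists>X. (\<Sum>x\<in>#M. min (lift_vext (w x)) (Fin \<delta>)) = Fin (X, snd \<delta> * of_nat (size (filter_mset (\<lambda>x. Fin \<delta> \<le> lift_vext (w x)) M)))"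
proof (induction M)
  case empty
  then show ?case by (simp add: zero_vext_def zero_prod_def)
next
  case (add y M)
  then obtain X where X: "(\<Sum>x\<in>#M. min (lift_vext (w x)) (Fin \<delta>)) =
     Fin (X, snd \<delta> * of_nat (size (filter_mset (\<lambda>x. Fin \<delta> \<le> lift_vext (w x)) M)))" by blast
  show ?case
  proof (cases "Fin \<delta> \<le> lift_vext (w y)")
    case True
    then have "(\<Sum>x\<in>#add_mset y M. min (lift_vext (w x)) (Fin \<delta>)) =
      Fin (fst \<delta> + X, snd \<delta> * of_nat (size (filter_mset (\<lambda>x. Fin \<delta> \<le> lift_vext (w x)) (add_mset y M))))"
      using X by (cases \<delta>) (simp add: min_absorb2 algebra_simps)
    then show ?thesis by blast
  next
    case False
    then obtain c where c: "w y = Fin c" by (cases "w y") (auto simp: vext_basics)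
    then have "(\<Sum>x\<in>#add_mset y M. min (lift_vext (w x)) (Fin \<delta>)) =
      Fin (c + X, snd \<delta> * of_nat (size (filter_mset (\<lambda>x. Fin \<delta> \<le> lift_vext (w x)) (add_mset y M))))"
      using X False by (simp add: min_absorb1)
    then show ?thesis by blast
  qed
qed

lemma ball_val_perturbed:
  fixes p :: "'c::alg_closed_field poly" and u :: "'c \<Rightarrow> 'g::linordered_rat_vector vext"
  assumes u: "is_valuation u" and p: "p \<noteq> 0"
  shows "\<exists>X. ball_val (\<lambda>x. lift_vext (u x)) a \<delta> p = Fin (X, snd \<delta> * of_nat (count_roots p {x. Fin \<delta> \<le> lift_vext (u (x - a))}))"
proof -
  interpret u: val_on UNIV u using u by (rule val_on_UNIV)
  have sym: "u (a - x) = u (x - a)" for x using u.uminus[of "a - x"] by simp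
  obtain c where c: "u (lead_coeff p) = Fin c" using field_valuation(1)[OF u, of "lead_coeff p"] p by (cases "u (lead_coeff p)") auto
  obtain X where "(\<Sum>x\<in>#proots p. min (lift_vext (u (a - x))) (Fin \<delta>)) =
     Fin (X, snd \<delta> * of_nat (size (filter_mset (\<lambda>x. Fin \<delta> \<le> lift_vext (u (a - x))) (proots p))))"
    using perturbed_sum_mset[of "\<lambda>x. u (a - x)" \<delta> "proots p"] by blast
  then have "ball_val (\<lambda>x. lift_vext (u x)) a \<delta> p = Fin (c + X, snd \<delta> * of_nat (count_roots p {x. Fin \<delta> \<le> lift_vext (u (x - a))}))"
    unfolding ball_val_eq[OF is_valuation_lift[OF u]] c by (simp add: count_roots_def sym)
  then show ?thesis by blast
qed

section \<open>Perturbed discs over a valued field\<close>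

locale newton_setting = valued_field_closure emb v vbar + key: key_polynomial \<mu> \<phi>
  for emb :: "'a::field \<Rightarrow> 'c::alg_closed_field" and v :: "'a \<Rightarrow> 'g::linordered_rat_vector vext"
    and vbar :: "'c \<Rightarrow> 'g vext" and \<mu> :: "'a poly \<Rightarrow> 'g vext" and \<phi> +
  assumes \<mu>_const: "\<mu> [:a:] = v a"
begin

definition "value_at \<theta> f = vbar (poly (mp f) \<theta>)"
definition "dominating \<theta> \<longleftrightarrow> (\<forall>f. \<mu> f \<le> value_at \<theta> f)"
definition "orb = {a. poly (mp \<phi>) a = 0 \<and> dominating a}"
abbreviation "u' \<equiv> \<lambda>x. lift_vext (vbar x)"
abbreviation "\<mu>' \<equiv> \<lambda>f. lift_vext (\<mu> f)"

text \<open>For s < 0 this is the closed condition that \<phi> has value at least \<gamma>, for s >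
  0 the open condition that it has value above \<gamma>.\<close>

definition "pdisc \<gamma> s = {\<theta>. dominating \<theta> \<and> Fin (\<gamma>, s) \<le> lift_vext (value_at \<theta> \<phi>)}"

lemma discoid: assumes "\<mu> \<phi> < Fin \<gamma>" shows "discoid \<mu>' \<phi> emb u' (\<gamma>, s)"
proof -
  interpret k: key_polynomial \<mu>' \<phi> by (rule key_polynomial_lift[OF key.key_polynomial_axioms])
  show ?thesis
    by unfold_locales (auto simp: is_valuation_lift[OF val] \<mu>_const vbar_extends lift_vext_perturbed(3)[OF assms])
qed

text \<open>Domination and the orbit do not involve the perturbation, so the counts for different
  \<gamma> and s refer to the same set \<open>orb\<close>.\<close>

lemma discoid_eqs:
  assumes "\<mu> \<phi> < Fin \<gamma>"
  shows "discoid.dominates \<mu>' emb u' = dominating" "discoid.orbit \<mu>' \<phi> emb u' = orb"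
    "discoid.disc \<mu>' \<phi> emb u' (\<gamma>, s) = pdisc \<gamma> s"
proof -
  interpret d: discoid \<mu>' \<phi> emb u' "(\<gamma>, s)" by (rule discoid[OF assms])
  show dom: "discoid.dominates \<mu>' emb u' = dominating"
    by (rule ext) (simp add: d.dominates_def d.pv_def dominating_def value_at_def lift_vext_simps)
  show "discoid.orbit \<mu>' \<phi> emb u' = orb" unfolding d.orbit_def dom orb_def ..
  show "discoid.disc \<mu>' \<phi> emb u' (\<gamma>, s) = pdisc \<gamma> s" unfolding d.disc_def dom pdisc_def d.pv_def value_at_def ..
qed

text \<open>Let \<epsilon> be the infinitesimal part of the radius of a ball, and let k and y be the
  numbers of roots of \<phi> and p in it. The perturbed values give s = \<epsilon> k and s n =
  \<epsilon> y, hence y = n k.\<close>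

lemma count_roots_pdisc:
  assumes \<gamma>: "\<mu> \<phi> < Fin \<gamma>" and s: "s \<noteq> 0" and p: "p \<noteq> 0"
    and w: "\<And>a. a \<in> orb \<Longrightarrow> \<exists>X. ball_val u' a (discoid.rad \<phi> emb u' (\<gamma>, s) a) p = Fin (X, s * n)"
  shows "of_nat (count_roots p (pdisc \<gamma> s)) = n * of_nat (count_roots (mp \<phi>) orb)"
proof -
  interpret d: discoid \<mu>' \<phi> emb u' "(\<gamma>, s)" by (rule discoid[OF \<gamma>])
  have aux: "y = n * k" if "s * n = d * y" "s = d * k" "s \<noteq> 0" for d y k :: rat
  proof -
    have "d * y = d * (n * k)" using that(1,2) by (auto simp: mult_ac)
    then show ?thesis using that(2,3) by auto
  qed
  have orb: "d.orbit = orb" and disc: "d.disc = pdisc \<gamma> s" using discoid_eqs[OF \<gamma>] by auto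
  have "of_nat (count_roots p d.disc) = n * of_nat (count_roots (mp \<phi>) d.orbit)"
  proof (rule d.count_roots_disc)
    fix a assume a: "a \<in> d.orbit"
    then have root: "poly (mp \<phi>) a = 0" by (simp add: d.orbit_def)
    obtain X where "ball_val u' a (d.rad a) (mp \<phi>) = Fin (X, snd (d.rad a) * of_nat (count_roots (mp \<phi>) (d.ball a)))"
      using ball_val_perturbed[OF val d.mp_phi_nz, of a "d.rad a"] by (auto simp: d.ball_def)
    then have k: "s = snd (d.rad a) * of_nat (count_roots (mp \<phi>) (d.ball a))" using d.rad[OF root] by (metis snd_conv vext.inject)
    obtain Y where "ball_val u' a (d.rad a) p = Fin (Y, snd (d.rad a) * of_nat (count_roots p (d.ball a)))"
      using ball_val_perturbed[OF val p, of a "d.rad a"] by (auto simp: d.ball_def)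
    moreover obtain Z where "ball_val u' a (d.rad a) p = Fin (Z, s * n)" using w a orb by auto
    ultimately have "s * n = snd (d.rad a) * of_nat (count_roots p (d.ball a))" by (metis snd_conv vext.inject)
    then show "of_nat (count_roots p (d.ball a)) = n * of_nat (count_roots (mp \<phi>) (d.ball a))"
      by (rule aux[OF _ k s])
  qed
  then show ?thesis by (simp add: orb disc)
qed

definition "cpt f \<gamma> n = \<mu> (phi_coeff \<phi> f n) + Fin (of_nat n *\<^sub>Q \<gamma>)"
text \<open>The indices at which a line of slope -\<gamma> supports the Newton polygon of f.\<close>

definition "min_indices f \<gamma> = {n. phi_coeff \<phi> f n \<noteq> 0 \<and> (\<forall>m. cpt f \<gamma> n \<le> cpt f \<gamma> m)}"

lemma phi_coeff_zero: "n > degree f \<Longrightarrow> phi_coeff \<phi> f n = 0"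
proof -
  assume n: "n > degree f"
  have nz: "\<phi> \<noteq> 0" using key.deg by auto
  have "n * 1 \<le> n * degree \<phi>" using key.deg by (intro mult_left_mono) auto
  then have "degree f < n * degree \<phi>" using n by linarith
  then have "degree f < degree (\<phi> ^ n)" using nz by (simp add: degree_power_eq)
  then show ?thesis by (simp add: phi_coeff_def div_poly_less)
qed

lemma phi_coeff_nonzero: assumes "f \<noteq> 0" shows "\<exists>n. phi_coeff \<phi> f n \<noteq> 0"
  using assms
proof (induction "degree f" arbitrary: f rule: less_induct)
  case less
  show ?case
  proof (cases "f mod \<phi> = 0")
    case True
    then have "f div \<phi> \<noteq> 0" using less.prems by (metis add.right_neutral div_mult_mod_eq mult_zero_left)
    then obtain n where "phi_coeff \<phi> (f div \<phi>) n \<noteq> 0" using less.hyps key.div_degree by blast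
    then have "phi_coeff \<phi> f (Suc n) \<noteq> 0" by (simp add: phi_coeff_def poly_div_mult_right)
    then show ?thesis by blast
  next
    case False
    then show ?thesis by (intro exI[of _ 0]) (simp add: phi_coeff_def)
  qed
qed

lemma min_indices: assumes "f \<noteq> 0" shows "finite (min_indices f \<gamma>)" "min_indices f \<gamma> \<noteq> {}"
proof -
  let ?N = "{n. phi_coeff \<phi> f n \<noteq> 0}"
  have N: "?N \<subseteq> {..degree f}" using phi_coeff_zero by (auto simp: not_less[symmetric])
  then have fin: "finite ?N" by (rule finite_subset) simp
  have ne: "?N \<noteq> {}" using phi_coeff_nonzero[OF assms] by auto
  show "finite (min_indices f \<gamma>)" using fin by (rule finite_subset[rotated]) (auto simp: min_indices_def)
  have "Min (cpt f \<gamma> ` ?N) \<in> cpt f \<gamma> ` ?N" using fin ne by (intro Min_in) auto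
  then obtain n where n: "phi_coeff \<phi> f n \<noteq> 0" "cpt f \<gamma> n = Min (cpt f \<gamma> ` ?N)" by auto
  have "cpt f \<gamma> n \<le> cpt f \<gamma> m" for m
  proof (cases "phi_coeff \<phi> f m = 0")
    case True
    then show ?thesis by (simp add: cpt_def key.zero vext_basics)
  next
    case False
    then show ?thesis unfolding n(2) using fin by (intro Min_le) auto
  qed
  then show "min_indices f \<gamma> \<noteq> {}" using n(1) by (auto simp: min_indices_def)
qed

text \<open>Among the terms of minimal value the infinitesimal part decides: the largest minimal
  index wins for s < 0, the smallest for s > 0.\<close>

lemma perturbed_value:
  assumes \<gamma>: "\<mu> \<phi> < Fin \<gamma>" and n: "n \<in> min_indices f \<gamma>"
    and ext: "\<And>m. m \<in> min_indices f \<gamma> \<Longrightarrow> s * of_nat n \<le> s * of_nat m" and a: "a \<in> orb"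
  shows "\<exists>M. ball_val u' a (discoid.rad \<phi> emb u' (\<gamma>, s) a) (mp f) = Fin (M, s * of_nat n)"
proof -
  interpret d: discoid \<mu>' \<phi> emb u' "(\<gamma>, s)" by (rule discoid[OF \<gamma>])
  have "\<mu> (phi_coeff \<phi> f n) \<noteq> Infty" using n key.trivial_support by (simp add: min_indices_def)
  then obtain M where M: "cpt f \<gamma> n = Fin M" by (cases "cpt f \<gamma> n") (auto simp: cpt_def vext_basics)
  have sc: "of_nat m *\<^sub>Q (\<gamma>, s) = (of_nat m *\<^sub>Q \<gamma>, s * of_nat m)" for m by (simp add: scaleQ_prod_def scaleQ_rat_def)
  have t: "\<mu>' (phi_coeff \<phi> f m) + Fin (of_nat m *\<^sub>Q (\<gamma>, s)) = (case cpt f \<gamma> m of Fin x \<Rightarrow> Fin (x, s * of_nat m) | Infty \<Rightarrow> Infty)" for m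
    unfolding sc cpt_def by (cases "\<mu> (phi_coeff \<phi> f m)") (auto simp: vext_basics)
  have a: "a \<in> d.orbit" using a by (simp add: discoid_eqs[OF \<gamma>])
  have "ball_val u' a (d.rad a) (mp f) = Fin (M, s * of_nat n)"
  proof (rule antisym)
    have "ball_val u' a (d.rad a) (mp f) \<le> \<mu>' (phi_coeff \<phi> f n) + Fin (of_nat n *\<^sub>Q (\<gamma>, s))"
      using d.ball_expansion[OF a] by blast
    then show "ball_val u' a (d.rad a) (mp f) \<le> Fin (M, s * of_nat n)" using t M by simp
    show "Fin (M, s * of_nat n) \<le> ball_val u' a (d.rad a) (mp f)"
      unfolding d.ball_expansion[OF a]
    proof
      fix m
      show "Fin (M, s * of_nat n) \<le> \<mu>' (phi_coeff \<phi> f m) + Fin (of_nat m *\<^sub>Q (\<gamma>, s))"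
      proof (cases "cpt f \<gamma> m")
        case (Fin x)
        have le: "Fin M \<le> cpt f \<gamma> m" using n M by (auto simp: min_indices_def)
        \<comment> \<open>In the case of a tie m is a minimal index too, and the extremality of n
          applies.\<close>
        have "M < x \<or> (M = x \<and> s * of_nat n \<le> s * of_nat m)"
        proof (cases "M = x")
          case True
          have "m \<in> min_indices f \<gamma>" unfolding min_indices_def mem_Collect_eq
          proof (intro conjI allI)
            show "phi_coeff \<phi> f m \<noteq> 0" using Fin by (auto simp: cpt_def key.zero vext_basics)
            show "cpt f \<gamma> m \<le> cpt f \<gamma> k" for k using n M Fin True by (auto simp: min_indices_def)
          qed
          then show ?thesis using ext True by blast
        next
          case False
          then show ?thesis using le Fin by auto
        qed
        then show ?thesis using t Fin by auto
      next
        case Infty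
        then show ?thesis using t by (simp add: vext_basics)
      qed
    qed
  qed
  then show ?thesis by blast
qed

lemma count_roots_pdisc_poly:
  assumes \<gamma>: "\<mu> \<phi> < Fin \<gamma>" and f: "f \<noteq> 0"
  shows "count_roots (mp f) (pdisc \<gamma> (- 1)) = Max (min_indices f \<gamma>) * count_roots (mp \<phi>) orb"
    "count_roots (mp f) (pdisc \<gamma> 1) = Min (min_indices f \<gamma>) * count_roots (mp \<phi>) orb"
proof -
  have *: "count_roots (mp f) (pdisc \<gamma> s) = n * count_roots (mp \<phi>) orb"
    if s: "s \<noteq> 0" and n: "n \<in> min_indices f \<gamma>" and ext: "\<And>m. m \<in> min_indices f \<gamma> \<Longrightarrow> s * of_nat n \<le> s * of_nat m" for s n
  proof -
    have "mp f \<noteq> 0" using f by (simp add: mp_hom)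
    from count_roots_pdisc[OF \<gamma> s this perturbed_value[OF \<gamma> n ext]]
    have "rat_of_nat (count_roots (mp f) (pdisc \<gamma> s)) = of_nat n * of_nat (count_roots (mp \<phi>) orb)" .
    then show ?thesis by (metis of_nat_eq_iff of_nat_mult)
  qed
  show "count_roots (mp f) (pdisc \<gamma> (- 1)) = Max (min_indices f \<gamma>) * count_roots (mp \<phi>) orb"
    using min_indices[OF f] by (intro *) (auto intro: Max_in)
  show "count_roots (mp f) (pdisc \<gamma> 1) = Min (min_indices f \<gamma>) * count_roots (mp \<phi>) orb"
    using min_indices[OF f] by (intro *) (auto intro: Min_in)
qed

text \<open>The number of roots of \<open>f\<close> at which \<open>\<phi>\<close> has value \<open>\<gamma>\<close> is the difference of the numbers of roots
  in the closed and in the open discoid.\<close>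

lemma count_roots_slope:
  assumes \<gamma>: "\<mu> \<phi> < Fin \<gamma>" and f: "f \<noteq> 0"
  shows "count_roots (mp f) {\<theta>. dominating \<theta> \<and> value_at \<theta> \<phi> = Fin \<gamma>} =
    (Max (min_indices f \<gamma>) - Min (min_indices f \<gamma>)) * count_roots (mp \<phi>) orb"
proof -
  let ?S = "{\<theta>. dominating \<theta> \<and> value_at \<theta> \<phi> = Fin \<gamma>}"
  have split: "pdisc \<gamma> (- 1) = ?S \<union> pdisc \<gamma> 1" "?S \<inter> pdisc \<gamma> 1 = {}"
    by (auto simp: pdisc_def lift_vext_perturbed)
  have "count_roots (mp f) (?S \<union> pdisc \<gamma> 1) = count_roots (mp f) ?S + count_roots (mp f) (pdisc \<gamma> 1)"
  proof -
    have "size (filter_mset (\<lambda>x. x \<in> A \<union> B) M) = size (filter_mset (\<lambda>x. x \<in> A) M) + size (filter_mset (\<lambda>x. x \<in> B) M)"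
      if "A \<inter> B = {}" for A B and M :: "'c multiset" using that by (induction M) auto
    then show ?thesis unfolding count_roots_def using split(2) by blast
  qed
  then have "Max (min_indices f \<gamma>) * count_roots (mp \<phi>) orb = count_roots (mp f) ?S + Min (min_indices f \<gamma>) * count_roots (mp \<phi>) orb"
    using count_roots_pdisc_poly[OF assms] split(1) by simp
  then show ?thesis by (simp add: diff_mult_distrib)
qed

end

subsection \<open>The henselization is immediate\<close>

lemma finite_bounded_polys:
  assumes "finite (S :: 'c::comm_monoid_add set)"
  shows "finite {p. degree p \<le> d \<and> (\<forall>i\<le>d. coeff p i \<in> S)}"
proof (rule finite_subset)
  show "finite (Poly ` {xs. set xs \<subseteq> S \<and> length xs = Suc d})" using finite_lists_length_eq[OF assms] by simp
  show "{p. degree p \<le> d \<and> (\<forall>i\<le>d. coeff p i \<in> S)} \<subseteq> Poly ` {xs. set xs \<subseteq> S \<and> length xs = Suc d}"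
  proof
    fix p assume p: "p \<in> {p. degree p \<le> d \<and> (\<forall>i\<le>d. coeff p i \<in> S)}"
    let ?xs = "map (coeff p) [0..<Suc d]"
    have "coeff p i = coeff (Poly ?xs) i" for i
    proof (cases "i < Suc d")
      case True
      then show ?thesis by (simp add: nth_default_nth del: upt_Suc)
    next
      case False
      then have "coeff p i = 0" using p by (intro coeff_eq_0) auto
      then show ?thesis using False by (simp add: nth_default_beyond del: upt_Suc)
    qed
    then have "p = Poly ?xs" by (rule poly_eqI)
    moreover have "set ?xs \<subseteq> S" using p by (auto simp del: upt_Suc simp: less_Suc_eq_le)
    ultimately show "p \<in> Poly ` {xs. set xs \<subseteq> S \<and> length xs = Suc d}" by (auto simp del: upt_Suc)
  qed
qed

text \<open>Here the coefficients are themselves polynomials, so the statement is made for a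
  commutative ring and not for a subfield.\<close>

lemma map_poly_linear_prod:
  fixes g :: "'r::comm_ring_1 \<Rightarrow> 'r"
  assumes g: "g 0 = 0" "g 1 = 1" "\<And>x y. g (x - y) = g x - g y" "\<And>x y. g (x * y) = g x * g y"
  shows "map_poly g (\<Prod>i\<in>I. [:- f i, 1:]) = (\<Prod>i\<in>I. [:- g (f i), 1:])"
proof -
  have co: "coeff (map_poly g p) i = g (coeff p i)" for p i by (rule coeff_map_poly) (rule g(1))
  have lin: "coeff ([:- y, 1:] * p) i = (case i of 0 \<Rightarrow> 0 | Suc j \<Rightarrow> coeff p j) - y * coeff p i" for y :: 'r and p i
    by (simp add: coeff_pCons split: nat.splits)
  have step: "map_poly g ([:- y, 1:] * p) = [:- g y, 1:] * map_poly g p" for y p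
    by (rule poly_eqI, unfold co lin) (simp add: g split: nat.splits)
  show ?thesis
  proof (induction I rule: infinite_finite_induct)
    case (insert x F)
    show ?case unfolding prod.insert[OF insert.hyps] step insert.IH ..
  qed (simp_all add: map_poly_1' g)
qed

text \<open>Equality of initial forms, for f of finite value.\<close>

definition approx :: "('r::comm_ring_1 \<Rightarrow> 'h::linordered_ab_group_add vext) \<Rightarrow> 'r \<Rightarrow> 'r \<Rightarrow> bool" where
  "approx V f g \<longleftrightarrow> V f < V (f - g)"

lemma approx_mult:
  assumes "is_valuation V" "approx V f f'" "approx V g g'"
  shows "approx V (f * g) (f' * g')" and "V f' = V f"
proof -
  interpret val_on UNIV V using assms(1) by (rule val_on_UNIV)
  have a: "V f < V (f - f')" "V g < V (g - g')" using assms by (auto simp: approx_def)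
  have fin: "V f \<noteq> Infty" "V g \<noteq> Infty" using a by (auto simp: vext_basics)
  show f': "V f' = V f" using diff_eq(1)[OF UNIV_I UNIV_I a(1)] by simp
  have "V f + V g < V ((f - f') * g)" "V f + V g < V (f' * (g - g'))"
    using a fin f' by (auto simp: mult vext_add_cancel)
  then have "V f + V g < V ((f - f') * g + f' * (g - g'))" by (rule add_gt[OF UNIV_I UNIV_I])
  moreover have "(f - f') * g + f' * (g - g') = f * g - f' * g'" by (simp add: algebra_simps)
  ultimately show "approx V (f * g) (f' * g')" by (simp add: approx_def mult)
qed

text \<open>If \<open>W z = \<gamma>\<close> for a single root \<open>z\<close> of \<open>P\<close>, then \<open>\<gamma>\<close> is the slope of a side of length one of the
  Newton polygon of \<open>P\<close>, so \<open>z\<close> has the value of a quotient of two coefficients.\<close>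

lemma isolated_root_value:
  fixes W :: "'r::idom \<Rightarrow> 'h::linordered_rat_vector vext"
  assumes W: "is_valuation W" and fin: "\<And>x. W x = Infty \<longleftrightarrow> x = 0" and Z: "finite Z" "z \<in> Z" "z \<noteq> 0"
    and iso: "\<And>y. y \<in> Z \<Longrightarrow> y \<noteq> z \<Longrightarrow> W y \<noteq> W z"
  defines "P \<equiv> (\<Prod>y\<in>Z. [:- y, 1:])"
  shows "\<exists>l. coeff P (Suc l) \<noteq> 0 \<and> coeff P l \<noteq> 0 \<and> W z + W (coeff P (Suc l)) = W (coeff P l)"
proof -
  interpret val_on UNIV W using W by (rule val_on_UNIV)
  obtain \<gamma> where \<gamma>: "W z = Fin \<gamma>" using fin Z(3) by (cases "W z") auto
  \<comment> \<open>At the radius \<gamma> = W z every factor T - y with W y \<noteq> \<gamma> has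
    the initial form of a single monomial, so P behaves like (T - z) C T^l.\<close>
  define V where "V = gauss W \<gamma>"
  have V: "is_valuation V" unfolding V_def by (rule is_valuation_gauss[OF W])
  interpret V: val_on UNIV V using V by (rule val_on_UNIV)
  have Vle: "V p \<le> W (coeff p i) + Fin (of_nat i *\<^sub>Q \<gamma>)" for p i using le_gauss_iff[OF W] unfolding V_def by blast
  have Vmon: "V (monom c k) = W c + Fin (of_nat k *\<^sub>Q \<gamma>)" for c k
  proof (rule antisym)
    show "V (monom c k) \<le> W c + Fin (of_nat k *\<^sub>Q \<gamma>)" using Vle[of "monom c k" k] by simp
    show "W c + Fin (of_nat k *\<^sub>Q \<gamma>) \<le> V (monom c k)" unfolding V_def le_gauss_iff[OF W]
      by (auto simp: zero vext_basics)
  qed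
  have const: "V [:c:] = W c" for c using Vmon[of c 0] by (simp add: monom_0 scaleQ_basics zero_vext_def[symmetric])
  have X: "V [:0, 1:] = Fin \<gamma>" using Vmon[of 1 1] by (simp add: monom_altdef one scaleQ_one)
  have lin: "[:- y, 1:] = [:- y:] + [:0, 1:]" for y :: 'r by simp
  have factor: "\<exists>c k. c \<noteq> 0 \<and> approx V [:- y, 1:] (monom c k)" if y: "W y \<noteq> Fin \<gamma>" for y
  proof (cases "W y < Fin \<gamma>")
    case True
    then have "V [:- y:] < V [:0, 1:]" by (simp add: const X uminus)
    then have "V [:- y, 1:] = V [:- y:]" unfolding lin by (rule V.add_eq(1)[OF UNIV_I UNIV_I])
    then have "approx V [:- y, 1:] (monom (- y) 0)" using True by (simp add: approx_def monom_0 const X uminus)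
    moreover have "- y \<noteq> 0" using True zero by (auto simp: vext_basics)
    ultimately show ?thesis by blast
  next
    case False
    then have lt: "V [:0, 1:] < V [:- y:]" using y by (auto simp: const X uminus)
    then have "V [:- y, 1:] = V [:0, 1:]" unfolding lin by (rule V.add_eq(2)[OF UNIV_I UNIV_I])
    then have "approx V [:- y, 1:] (monom 1 1)" using lt by (simp add: approx_def monom_altdef)
    then show ?thesis using one_neq_zero by blast
  qed
  have "\<exists>C l. C \<noteq> 0 \<and> approx V (\<Prod>y\<in>Y. [:- y, 1:]) (monom C l)" if "finite Y" "\<forall>y\<in>Y. W y \<noteq> Fin \<gamma>" for Y
    using that
  proof (induction Y rule: finite_induct)
    case empty
    have "approx V 1 (monom 1 0)" by (simp add: approx_def V.one V.zero zero_vext_def vext_basics)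
    then show ?case using one_neq_zero by (metis prod.empty)
  next
    case (insert y Y)
    then obtain C l where C: "C \<noteq> 0" "approx V (\<Prod>y\<in>Y. [:- y, 1:]) (monom C l)" by auto
    obtain c k where c: "c \<noteq> 0" "approx V [:- y, 1:] (monom c k)" using factor[of y] insert.prems by blast
    have "approx V ([:- y, 1:] * (\<Prod>y\<in>Y. [:- y, 1:])) (monom c k * monom C l)" by (rule approx_mult(1)[OF V c(2) C(2)])
    then have "approx V (\<Prod>y\<in>insert y Y. [:- y, 1:]) (monom (c * C) (k + l))" using insert.hyps by (simp add: mult_monom)
    then show ?case using c(1) C(1) no_zero_divisors by blast
  qed
  from this[of "Z - {z}"] obtain C l where C: "C \<noteq> 0" and ap: "approx V (\<Prod>y\<in>Z - {z}. [:- y, 1:]) (monom C l)"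
    using Z iso \<gamma> by auto
  let ?Q = "\<Prod>y\<in>Z - {z}. [:- y, 1:]"
  have P: "P = [:- z, 1:] * ?Q" unfolding P_def using Z by (simp add: prod.remove)
  have VQ: "V ?Q = W C + Fin (of_nat l *\<^sub>Q \<gamma>)" using approx_mult(2)[OF V ap ap] Vmon[of C l] by simp
  have Vz: "Fin \<gamma> \<le> V [:- z, 1:]" unfolding lin by (rule V.add_ge) (simp_all add: const X uminus \<gamma>)
  obtain D where D: "W C = Fin D" using fin C by (cases "W C") auto
  have gt: "Fin (\<gamma> + D + of_nat l *\<^sub>Q \<gamma>) < V (P - [:- z, 1:] * monom C l)"
  proof -
    have "Fin \<gamma> + (W C + Fin (of_nat l *\<^sub>Q \<gamma>)) < V [:- z, 1:] + V (?Q - monom C l)"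
      using ap VQ by (intro vext_add_less_le(2)[OF Vz]) (auto simp: approx_def)
    then have "Fin (\<gamma> + D + of_nat l *\<^sub>Q \<gamma>) < V ([:- z, 1:] * (?Q - monom C l))" by (simp only: V.mult[OF UNIV_I UNIV_I]) (simp add: D add.assoc)
    moreover have "[:- z, 1:] * (?Q - monom C l) = P - [:- z, 1:] * monom C l" unfolding P by (simp only: right_diff_distrib)
    ultimately show ?thesis by simp
  qed
  have co: "coeff ([:- z, 1:] * monom C l) i = (if i = Suc l then C else 0) - (if i = l then z * C else 0)" for i
    by (cases i) (auto simp: coeff_pCons split: nat.splits)
  have sub: "Fin x < y" if "Fin (x + b) < y + Fin b" for x b and y :: "'h vext" using that by (cases y) (auto simp: vext_basics)
  \<comment> \<open>Comparison with the coefficients of (T - z) C T^l at the indices l and l + 1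
    gives the values \<gamma> + D and D.\<close>
  have "Fin (\<gamma> + D) < W (coeff P l + z * C)"
  proof -
    have "Fin (\<gamma> + D + of_nat l *\<^sub>Q \<gamma>) < W (coeff (P - [:- z, 1:] * monom C l) l) + Fin (of_nat l *\<^sub>Q \<gamma>)"
      using gt Vle by (rule less_le_trans)
    moreover have "coeff (P - [:- z, 1:] * monom C l) l = coeff P l + z * C" unfolding coeff_diff co by simp
    ultimately show ?thesis using sub by metis
  qed
  moreover have zC: "W (z * C) = Fin (\<gamma> + D)" by (simp add: mult \<gamma> D)
  ultimately have "W (coeff P l + z * C - z * C) = W (z * C)" using diff_eq(2)[of "z * C" "coeff P l + z * C"] by simp
  then have l: "W (coeff P l) = Fin (\<gamma> + D)" using zC by simp
  have "Fin D < W (coeff P (Suc l) - C)"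
  proof -
    have "Fin (\<gamma> + D + of_nat l *\<^sub>Q \<gamma>) < W (coeff (P - [:- z, 1:] * monom C l) (Suc l)) + Fin (of_nat (Suc l) *\<^sub>Q \<gamma>)"
      using gt Vle by (rule less_le_trans)
    moreover have "coeff (P - [:- z, 1:] * monom C l) (Suc l) = coeff P (Suc l) - C" unfolding coeff_diff co by simp
    moreover have "\<gamma> + D + of_nat l *\<^sub>Q \<gamma> = D + of_nat (Suc l) *\<^sub>Q \<gamma>" by (simp add: scaleQ_add_left scaleQ_one algebra_simps)
    ultimately show ?thesis using sub by metis
  qed
  then have "W (C + (coeff P (Suc l) - C)) = W C" using D by (intro add_eq(1)) auto
  then have Sl: "W (coeff P (Suc l)) = Fin D" using D by simp
  show ?thesis using l Sl \<gamma> zero by (intro exI[of _ l]) auto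
qed

section \<open>Conjugates over the base field and elements that separate them\<close>

context valued_field_closure
begin

text \<open>These embeddings need not preserve \<open>vbar\<close>; they produce the conjugates over
  K, not over the henselization.\<close>

definition "auts = {\<tau>. is_embedding UNIV \<tau> \<and> (\<forall>a\<in>K\<^sub>0. \<tau> a = a)}"

lemma auts_id: "(\<lambda>x. x) \<in> auts"
  by (simp add: auts_def is_embedding_id)

lemma auts_comp: "\<sigma> \<in> auts \<Longrightarrow> \<tau> \<in> auts \<Longrightarrow> (\<lambda>x. \<sigma> (\<tau> x)) \<in> auts"
  by (simp add: auts_def is_embedding_def)

lemma auts_emb: "\<tau> \<in> auts \<Longrightarrow> is_embedding UNIV \<tau>"
  by (simp add: auts_def)

lemmas aut_simps = is_embeddingD[OF is_subfield_UNIV auts_emb, simplified]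
lemmas aut_map = map_poly_embedding[OF is_subfield_UNIV auts_emb, simplified]

lemma coeff_aut: "\<tau> \<in> auts \<Longrightarrow> coeff (map_poly \<tau> p) i = \<tau> (coeff p i)"
  by (rule coeff_map_poly) (rule aut_simps)

lemma finite_conjugates: "finite ((\<lambda>\<tau>. \<tau> x) ` auts)"
proof -
  obtain P where P: "P \<in> Irr K\<^sub>0" "poly P x = 0" using Irr_exists[OF K alg] by blast
  have "poly P (\<tau> x) = 0" if \<tau>: "\<tau> \<in> auts" for \<tau>
  proof -
    have "map_poly \<tau> P = P"
      by (rule map_poly_fixed[OF IrrD(1)[OF P(1)] _ is_subfieldD(2)[OF K]]) (use \<tau> in \<open>unfold auts_def, blast\<close>)
    then show ?thesis using aut_map(8)[OF \<tau>, of P x] P(2) aut_simps(2)[OF \<tau>] by simp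
  qed
  then have "(\<lambda>\<tau>. \<tau> x) ` auts \<subseteq> {y. poly P y = 0}" by auto
  then show ?thesis using poly_roots_finite[OF IrrD(4)[OF P(1)]] by (rule finite_subset)
qed

lemma finite_conjugate_polys: "finite ((\<lambda>\<tau>. map_poly \<tau> p) ` auts)"
proof (rule finite_subset)
  let ?S = "\<Union>i\<le>degree p. (\<lambda>\<tau>. \<tau> (coeff p i)) ` auts"
  show "finite {q. degree q \<le> degree p \<and> (\<forall>i\<le>degree p. coeff q i \<in> ?S)}"
    by (rule finite_bounded_polys) (simp add: finite_conjugates)
  show "(\<lambda>\<tau>. map_poly \<tau> p) ` auts \<subseteq> {q. degree q \<le> degree p \<and> (\<forall>i\<le>degree p. coeff q i \<in> ?S)}"
  proof
    fix q assume "q \<in> (\<lambda>\<tau>. map_poly \<tau> p) ` auts"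
    then obtain \<tau> where \<tau>: "\<tau> \<in> auts" "q = map_poly \<tau> p" by blast
    then have q: "coeff q i \<in> (\<lambda>\<tau>. \<tau> (coeff p i)) ` auts" for i by (simp add: coeff_aut)
    show "q \<in> {q. degree q \<le> degree p \<and> (\<forall>i\<le>degree p. coeff q i \<in> ?S)}"
    proof (intro CollectI conjI allI impI)
      show "degree q \<le> degree p" using aut_map(7)[OF \<tau>(1), of p] \<tau>(2) by simp
      fix i assume "i \<le> degree p"
      then show "coeff q i \<in> ?S" using q[of i] by (intro UN_I[of i]) simp
    qed
  qed
qed

text \<open>All roots of the minimal polynomial are images of x, so x is its only root, and a simple
  one.\<close>

lemma fixed_separable_in_base:
  assumes x: "x \<in> Ks" and fixed: "\<And>\<tau>. \<tau> \<in> auts \<Longrightarrow> \<tau> x = x"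
  shows "x \<in> K\<^sub>0"
proof -
  obtain P where P: "P \<in> Irr K\<^sub>0" "poly P x = 0" using Irr_exists[OF K alg] by blast
  have sep: "separable_over K\<^sub>0 x" using x by (simp add: separable_closure_eq)
  have one: "y = x" if "poly P y = 0" for y
    using conjugates[OF P that] fixed unfolding auts_def by auto
  have "Polynomial.order x P = 1" by (rule order_simple_root[OF P(2) Irr_simple_root_separable[OF K P sep P(2)]])
  then have "count (proots P) x = 1" using IrrD(4)[OF P(1)] by simp
  moreover have "count (proots P) y = 0" if "y \<noteq> x" for y using one that IrrD(4)[OF P(1)] by (auto intro!: order_0I)
  ultimately have "proots P = {#x#}" by (intro multiset_eqI) auto
  then have "P = [:- x, 1:]" using poly_factorization[of P] IrrD(2)[OF P(1)] by simp
  then have "- x \<in> K\<^sub>0" using polys_overD[OF IrrD(1)[OF P(1)], of 0] by simp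
  then show ?thesis using is_subfieldD(6)[OF K, of "- x"] by simp
qed

text \<open>An embedding that moves A cannot preserve \<open>vbar\<close> on the field F below. This
  gives elements x of positive value with negative conjugates, which are combined for the finitely
  many conjugates of A.\<close>

lemma separating_henselization:
  assumes A: "A \<in> polys_over Kh"
  shows "\<exists>y\<in>Kh. vbar y = 0 \<and>
    (\<forall>\<sigma>\<in>auts. \<forall>\<tau>\<in>auts. map_poly \<sigma> A = map_poly \<tau> A \<longrightarrow> \<sigma> y = \<tau> y) \<and> (\<forall>\<tau>\<in>auts. map_poly \<tau> A \<noteq> A \<longrightarrow> 0 < vbar (\<tau> y))"
proof -
  \<comment> \<open>F stands in for the field generated over K by the coefficients of A. It makes
    \<tau> x a function of \<tau>A for x in F, so finitely many embeddings have to be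
    treated.\<close>
  define F where "F = {x\<in>Kh. \<forall>\<sigma>\<in>auts. \<forall>\<tau>\<in>auts. map_poly \<sigma> A = map_poly \<tau> A \<longrightarrow> \<sigma> x = \<tau> x}"
  have F_eq: "\<sigma> x = \<tau> x" if "x \<in> F" "\<sigma> \<in> auts" "\<tau> \<in> auts" "map_poly \<sigma> A = map_poly \<tau> A" for \<sigma> \<tau> x
    using that by (auto simp: F_def)
  note h = is_subfieldD[OF is_subfield_Kh]
  have FI: "x \<in> F" if "x \<in> Kh" "\<And>\<sigma> \<tau>. \<sigma> \<in> auts \<Longrightarrow> \<tau> \<in> auts \<Longrightarrow> map_poly \<sigma> A = map_poly \<tau> A \<Longrightarrow> \<sigma> x = \<tau> x" for x
    using that by (auto simp: F_def)
  have F: "is_subfield F"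
    unfolding is_subfield_def
  proof (intro conjI ballI)
    show "1 \<in> F" by (rule FI[OF h(1)]) (simp add: aut_simps(1))
    fix a assume a: "a \<in> F"
    then have aK: "a \<in> Kh" by (simp add: F_def)
    show "inverse a \<in> F" by (rule FI[OF h(5)[OF aK]]) (metis aut_simps(7) F_eq[OF a])
    fix b assume b: "b \<in> F"
    then have bK: "b \<in> Kh" by (simp add: F_def)
    show "a - b \<in> F" by (rule FI[OF h(3)[OF aK bK]]) (metis aut_simps(6) F_eq[OF a] F_eq[OF b])
    show "a * b \<in> F" by (rule FI[OF h(4)[OF aK bK]]) (metis aut_simps(4) F_eq[OF a] F_eq[OF b])
  qed
  have K0F: "K\<^sub>0 \<subseteq> F"
  proof
    fix a assume a: "a \<in> K\<^sub>0"
    then have fixa: "\<tau> a = a" if "\<tau> \<in> auts" for \<tau> using that by (auto simp: auts_def)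
    show "a \<in> F"
    proof (rule FI)
      show "a \<in> Kh" using a K0_Kh by blast
      show "\<sigma> \<in> auts \<Longrightarrow> \<tau> \<in> auts \<Longrightarrow> \<sigma> a = \<tau> a" for \<sigma> \<tau> using fixa[of \<sigma>] fixa[of \<tau>] by simp
    qed
  qed
  have AF: "coeff A i \<in> F" for i
  proof -
    have "\<sigma> (coeff A i) = \<tau> (coeff A i)" if "\<sigma> \<in> auts" "\<tau> \<in> auts" "map_poly \<sigma> A = map_poly \<tau> A" for \<sigma> \<tau>
      using arg_cong[OF that(3), of "\<lambda>p. coeff p i"] unfolding coeff_aut[OF that(1)] coeff_aut[OF that(2)] .
    then show ?thesis by (rule FI[OF polys_overD[OF A]])
  qed
  have ring: "1 \<in> F \<and> (\<forall>a\<in>F. \<forall>b\<in>F. a - b \<in> F \<and> a * b \<in> F)"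
    using F unfolding is_subfield_def by blast
  have valF: "valuation_on F vbar"
    using val ring unfolding is_valuation_def valuation_on_def by simp
  have valT: "valuation_on F (\<lambda>x. vbar (\<tau> x))" if \<tau>: "\<tau> \<in> auts" for \<tau>
    using val ring unfolding is_valuation_def valuation_on_def by (simp add: aut_simps[OF \<tau>])
  have sep: "\<exists>x\<in>F. 0 < vbar x \<and> vbar (\<tau> x) < 0" if \<tau>: "\<tau> \<in> auts" and ne: "map_poly \<tau> A \<noteq> A" for \<tau>
  proof -
    have fixK: "\<forall>a\<in>K\<^sub>0. \<tau> a = a" using \<tau> by (simp add: auts_def)
    \<comment> \<open>Otherwise the restriction of \<tau> to F extends to a value-preserving
      embedding, which fixes the henselization and therefore A.\<close>
    have "\<exists>f\<in>F. vbar (\<tau> f) \<noteq> vbar f"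
    proof (rule ccontr)
      assume "\<not> ?thesis"
      then have "\<forall>a\<in>F. vbar (\<tau> a) = vbar a" by blast
      with fixK obtain \<rho> where \<rho>: "is_embedding UNIV \<rho>" "\<forall>a\<in>F. \<rho> a = \<tau> a" "\<forall>a. vbar (\<rho> a) = vbar a"
        using extend_valued_embedding[OF K0F F is_embedding_mono[OF auts_emb[OF \<tau>]]] by blast
      have fixr: "\<rho> a = a" if "a \<in> K\<^sub>0" for a using that \<rho>(2) K0F fixK by (metis subsetD)
      have "\<rho> x = x" if "x \<in> Kh" for x using valued_embedding_fixes_Kh[OF \<rho>(1)] fixr \<rho>(3) that by simp
      then have "\<tau> (coeff A i) = coeff A i" for i using bspec[OF \<rho>(2) AF[of i]] polys_overD[OF A, of i] by metis
      then have "map_poly \<tau> A = A" by (intro poly_eqI) (simp add: coeff_aut[OF \<tau>])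
      then show False using ne by simp
    qed
    then obtain f0 where f0: "f0 \<in> F" "vbar (\<tau> f0) \<noteq> vbar f0" by blast
    \<comment> \<open>Passing to the inverse reverses the inequality.\<close>
    have "\<exists>f\<in>F. vbar (\<tau> f) < vbar f \<and> vbar f \<noteq> Infty"
    proof -
      have nz: "f0 \<noteq> 0" using f0(2) aut_simps(2)[OF \<tau>] by auto
      then obtain \<alpha> \<beta> where ab: "vbar f0 = Fin \<alpha>" "vbar (\<tau> f0) = Fin \<beta>"
        using field_valuation(1)[OF val] aut_simps(8)[OF \<tau>, of f0] by (metis vext.exhaust)
      have inv: "vbar (inverse f0) = Fin (- \<alpha>)" "vbar (\<tau> (inverse f0)) = Fin (- \<beta>)"
        using field_valuation(2)[OF val ab(1)] field_valuation(2)[OF val ab(2)] aut_simps(7)[OF \<tau>] by auto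
      show ?thesis
      proof (cases "\<beta> < \<alpha>")
        case True
        then show ?thesis using f0(1) ab by (intro bexI[of _ f0]) (auto simp: vext_basics)
      next
        case False
        then have "\<alpha> < \<beta>" using f0(2) ab by auto
        then show ?thesis using is_subfieldD(5)[OF F f0(1)] inv by (intro bexI[of _ "inverse f0"]) (auto simp: vext_basics)
      qed
    qed
    then obtain f where f: "f \<in> F" "vbar (\<tau> f) < vbar f" "vbar f \<noteq> Infty" by blast
    then obtain \<alpha> \<beta> where ab: "vbar f = Fin \<alpha>" "vbar (\<tau> f) = Fin \<beta>" "\<beta> < \<alpha>"
      by (cases "vbar f"; cases "vbar (\<tau> f)") (auto simp: vext_basics)
    \<comment> \<open>The midpoint, so that both values are strictly separated by the
      threshold.\<close>
    define \<gamma> where "\<gamma> = inverse 2 *\<^sub>Q (\<alpha> + \<beta>)"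
    have two: "2 *\<^sub>Q \<alpha> = \<alpha> + \<alpha>" "2 *\<^sub>Q \<beta> = \<beta> + \<beta>"
      using scaleQ_add_left[of 1 1 \<alpha>] scaleQ_add_left[of 1 1 \<beta>] by (simp_all add: scaleQ_one)
    have "2 *\<^sub>Q \<gamma> = \<alpha> + \<beta>" unfolding \<gamma>_def by (rule scaleQ_cancel) simp
    then have "2 *\<^sub>Q \<beta> < 2 *\<^sub>Q \<gamma>" "2 *\<^sub>Q \<gamma> < 2 *\<^sub>Q \<alpha>" using ab(3) by (simp_all add: two)
    then have "\<beta> < \<gamma>" "\<gamma> < \<alpha>" by (simp_all add: scaleQ_mono)
    then have g: "vbar (\<tau> f) < Fin \<gamma>" "Fin \<gamma> \<le> vbar f" "Fin \<gamma> < vbar f" using ab by (auto simp: vext_basics)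
    have c: "a \<in> F \<and> vbar a = vbar a \<and> vbar (\<tau> a) = vbar a" if "a \<in> K\<^sub>0" for a using subsetD[OF K0F that] bspec[OF fixK that] by metis
    show ?thesis using separating_element[OF valF valT[OF \<tau>] f c g(1,2)] g(3) by auto
  qed
  have "\<exists>x\<in>F. 0 < vbar x \<and> (\<forall>\<tau>\<in>auts. map_poly \<tau> A \<in> T \<longrightarrow> vbar (\<tau> x) < 0)" if "finite T" "A \<notin> T" for T
    using that
  proof (induction T rule: finite_induct)
    case empty
    \<comment> \<open>The induction starts with 0, whose value is infinite.\<close>
    then show ?case using is_subfieldD(2)[OF F] by (intro bexI[of _ 0]) (auto simp: u.zero zero_vext_def vext_basics)
  next
    case (insert B T)
    then obtain x where x: "x \<in> F" "0 < vbar x" "\<And>\<tau>. \<tau> \<in> auts \<Longrightarrow> map_poly \<tau> A \<in> T \<Longrightarrow> vbar (\<tau> x) < 0" by auto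
    show ?case
    proof (cases "\<exists>\<tau>\<in>auts. map_poly \<tau> A = B")
      case False
      then show ?thesis using x by (intro bexI[of _ x]) auto
    next
      case True
      then obtain \<tau>0 where \<tau>0: "\<tau>0 \<in> auts" "map_poly \<tau>0 A = B" by blast
      moreover have "B \<noteq> A" using insert.prems by auto
      ultimately obtain y where y: "y \<in> F" "0 < vbar y" "vbar (\<tau>0 y) < 0" using sep by metis
      define I where "I = {C \<in> insert B T. \<exists>\<tau>\<in>auts. map_poly \<tau> A = C}"
      \<comment> \<open>One representative embedding for each conjugate of A; on F the choice does
        not matter.\<close>
      define t where "t C = (SOME \<tau>. \<tau> \<in> auts \<and> map_poly \<tau> A = C)" for C
      have t: "t C \<in> auts \<and> map_poly (t C) A = C" if "C \<in> I" for C
      proof -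
        have "\<exists>\<tau>. \<tau> \<in> auts \<and> map_poly \<tau> A = C" using that unfolding I_def by blast
        then show ?thesis unfolding t_def by (rule someI_ex)
      qed
      have "vbar (t C x) < 0 \<or> vbar (t C y) < 0" if C: "C \<in> I" for C
      proof (cases "C = B")
        case True
        then have "t C y = \<tau>0 y" using F_eq[OF y(1) conjunct1[OF t[OF C]] \<tau>0(1)] conjunct2[OF t[OF C]] \<tau>0(2) by simp
        then show ?thesis using y by simp
      next
        case False
        then have "map_poly (t C) A \<in> T" using t[OF C] C unfolding I_def by auto
        then show ?thesis using x(3) t[OF C] by blast
      qed
      then obtain N where N: "N > 0" "\<forall>C\<in>I. vbar (t C x + t C y ^ N) < 0"
        using neg_combination[OF val, of I "\<lambda>C. t C x" "\<lambda>C. t C y"] insert.hyps by (auto simp: I_def)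
      have xF: "x + y ^ N \<in> F" by (rule is_subfieldD(7)[OF F x(1) is_subfieldD(9)[OF F y(1)]])
      moreover have "0 < vbar (x + y ^ N)" by (intro u.add_gt u.power_gt_0 x(2) y(2) N(1)) auto
      moreover have "vbar (\<tau> (x + y ^ N)) < 0" if \<tau>: "\<tau> \<in> auts" "map_poly \<tau> A \<in> insert B T" for \<tau>
      proof -
        have C: "map_poly \<tau> A \<in> I" using \<tau> by (auto simp: I_def)
        then have "\<tau> (x + y ^ N) = t (map_poly \<tau> A) (x + y ^ N)"
          using F_eq[OF xF \<tau>(1) conjunct1[OF t[OF C]]] conjunct2[OF t[OF C]] by simp
        also have "\<dots> = t (map_poly \<tau> A) x + t (map_poly \<tau> A) y ^ N" by (simp add: aut_simps[OF conjunct1[OF t[OF C]]])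
        finally show ?thesis using N(2) C by simp
      qed
      ultimately show ?thesis by blast
    qed
  qed
  from this[of "(\<lambda>\<tau>. map_poly \<tau> A) ` auts - {A}"]
  obtain x where x: "x \<in> F" "0 < vbar x" "\<And>\<tau>. \<tau> \<in> auts \<Longrightarrow> map_poly \<tau> A \<noteq> A \<Longrightarrow> vbar (\<tau> x) < 0"
    using finite_conjugate_polys[of A] by auto
  \<comment> \<open>1 + x has value 0, while 1 + \<tau> x has the negative value of \<tau>
    x.\<close>
  define y where "y = inverse (1 + x)"
  have yF: "y \<in> F" unfolding y_def by (rule is_subfieldD(5)[OF F is_subfieldD(7)[OF F is_subfieldD(1)[OF F] x(1)]])
  have "vbar (1 + x) = 0" using u.add_eq(1)[of 1 x] x(2) u.one by simp
  then have vy: "vbar y = 0" using field_valuation(2)[OF val, of "1 + x" 0] by (simp add: y_def zero_vext_def)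
  have "0 < vbar (\<tau> y)" if \<tau>: "\<tau> \<in> auts" "map_poly \<tau> A \<noteq> A" for \<tau>
  proof -
    have lt: "vbar (\<tau> x) < vbar 1" using x(3)[OF \<tau>] u.one by simp
    have "vbar (1 + \<tau> x) = vbar (\<tau> x)" using u.add_eq(2)[OF UNIV_I UNIV_I lt] by simp
    then obtain c where c: "vbar (1 + \<tau> x) = Fin c" "c < 0" using x(3)[OF \<tau>] by (cases "vbar (\<tau> x)") (auto simp: vext_basics)
    have "\<tau> y = inverse (1 + \<tau> x)" by (simp add: y_def aut_simps[OF \<tau>(1)])
    then show ?thesis using field_valuation(2)[OF val c(1)] c(2) by (simp add: vext_basics)
  qed
  moreover have "\<sigma> y = \<tau> y" if "\<sigma> \<in> auts" "\<tau> \<in> auts" "map_poly \<sigma> A = map_poly \<tau> A" for \<sigma> \<tau>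
    using F_eq[OF yF that] .
  moreover have "y \<in> Kh" using yF by (simp add: F_def)
  ultimately show ?thesis using vy by blast
qed

text \<open>W need not be invariant under conjugation, so conjugates of A may share its value. The
  product z = y^N A still has the value of A, and for suitable N no other conjugate of z has this
  value. Then \<open>isolated_root_value\<close> applies to the polynomial whose roots are the
  conjugates of z, and its coefficients lie in K[x] by Galois descent.\<close>

lemma henselization_immediate:
  fixes W :: "'c poly \<Rightarrow> 'h::linordered_rat_vector vext" and \<iota> :: "'g vext \<Rightarrow> 'h vext"
  assumes W: "is_valuation W" and fin: "\<And>p. W p = Infty \<longleftrightarrow> p = 0" and const: "\<And>c. W [:c:] = \<iota> (vbar c)"
    and \<iota>: "\<iota> 0 = 0" "\<And>x. 0 < x \<Longrightarrow> 0 < \<iota> x"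
    and A: "A \<in> polys_over Kh" "A \<noteq> 0"
  shows "\<exists>e e'. e \<noteq> 0 \<and> e' \<noteq> 0 \<and> W A + W (mp e) = W (mp e')"
proof -
  interpret W: val_on UNIV W using W by (rule val_on_UNIV)
  obtain y where y: "y \<in> Kh" "vbar y = 0"
    "\<And>\<sigma> \<tau>. \<sigma> \<in> auts \<Longrightarrow> \<tau> \<in> auts \<Longrightarrow> map_poly \<sigma> A = map_poly \<tau> A \<Longrightarrow> \<sigma> y = \<tau> y"
    "\<And>\<tau>. \<tau> \<in> auts \<Longrightarrow> map_poly \<tau> A \<noteq> A \<Longrightarrow> 0 < vbar (\<tau> y)"
    using separating_henselization[OF A(1)] by blast
  have y0: "y \<noteq> 0" using y(2) u.zero by (auto simp: vext_basics)
  have id: "map_poly (\<lambda>x. x) p = p" for p :: "'c poly" by (simp add: map_poly_idI)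
  define C where "C = (\<lambda>\<tau>. map_poly \<tau> A) ` auts - {A}"
  define t where "t B = (SOME \<tau>. \<tau> \<in> auts \<and> map_poly \<tau> A = B)" for B
  have t: "t B \<in> auts \<and> map_poly (t B) A = B" if "B \<in> C" for B
  proof -
    have "\<exists>\<tau>. \<tau> \<in> auts \<and> map_poly \<tau> A = B" using that by (auto simp: C_def)
    then show ?thesis unfolding t_def by (rule someI_ex)
  qed
  \<comment> \<open>A conjugate B \<noteq> A comes with a conjugate of y of positive value, so at
    most one exponent leads to a coincidence.\<close>
  define bad where "bad B = {N. W ([:t B y:] ^ N * B) = W A}" for B
  have "finite (bad B)" if B: "B \<in> C" for B
  proof -
    have BA: "B \<noteq> A" and B0: "B \<noteq> 0" using B A(2) by (auto simp: C_def aut_map(6))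
    have "t B y \<noteq> 0" using y0 t[OF B] by (simp add: aut_simps)
    then obtain x where x: "W [:t B y:] = Fin x" using fin[of "[:t B y:]"] by (cases "W [:t B y:]") auto
    have "0 < vbar (t B y)" using y(4)[of "t B"] t[OF B] BA by simp
    then have x0: "x > 0" using \<iota>(2) const[of "t B y"] x by (metis vext_basics(11))
    obtain b where b: "W B = Fin b" using fin[of B] B0 by (cases "W B") auto
    have val: "W ([:t B y:] ^ k * B) = Fin (of_nat k *\<^sub>Q x + b)" for k
      using valuation_power[of UNIV W "[:t B y:]" x k] W x b W.mult[of "[:t B y:] ^ k" B] by (simp add: is_valuation_iff)
    have "M = N" if "M \<in> bad B" "N \<in> bad B" for M N
    proof -
      have eq: "of_nat M *\<^sub>Q x = of_nat N *\<^sub>Q x" using that val by (metis (mono_tags, lifting) add_right_cancel bad_def mem_Collect_eq vext.inject)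
      show ?thesis
      proof (rule ccontr)
        assume "M \<noteq> N"
        then consider "M < N" | "N < M" by (metis linorder_neqE_nat)
        then show False
          by cases (use scaleQ_mono_left(1)[OF x0, of "of_nat M" "of_nat N"] scaleQ_mono_left(1)[OF x0, of "of_nat N" "of_nat M"] eq in auto)
      qed
    qed
    note uniq = this
    show ?thesis
    proof (cases "bad B = {}")
      case False
      then obtain M where "M \<in> bad B" by blast
      then have "bad B \<subseteq> {M}" using uniq by blast
      then show ?thesis by (rule finite_subset) simp
    qed simp
  qed
  moreover have "finite C" unfolding C_def using finite_conjugate_polys[of A] by simp
  ultimately have "finite (\<Union>B\<in>C. bad B)" by blast
  then obtain N where N: "N \<notin> (\<Union>B\<in>C. bad B)" using ex_new_if_finite[OF infinite_UNIV_nat] by blast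
  define z where "z = [:y:] ^ N * A"
  have Wz: "W z = W A"
  proof -
    have "W [:y:] = Fin 0" using const[of y] y(2) \<iota>(1) by (simp add: zero_vext_def)
    then have "W ([:y:] ^ N) = 0" using valuation_power[of UNIV W "[:y:]" 0 N] W by (simp add: is_valuation_iff scaleQ_basics zero_vext_def)
    then show ?thesis by (simp only: z_def W.mult[OF UNIV_I UNIV_I]) simp
  qed
  have mz: "map_poly \<tau> z = [:\<tau> y:] ^ N * map_poly \<tau> A" if \<tau>: "\<tau> \<in> auts" for \<tau>
  proof -
    have "map_poly \<tau> [:y ^ N:] = [:\<tau> y ^ N:]" using aut_simps(2,9)[OF \<tau>] by (simp add: map_poly_pCons)
    then show ?thesis unfolding z_def poly_const_pow aut_map(3)[OF \<tau>] by simp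
  qed
  define Z where "Z = (\<lambda>\<tau>. map_poly \<tau> z) ` auts"
  have Z: "finite Z" "z \<in> Z" "z \<noteq> 0"
  proof -
    show "finite Z" unfolding Z_def by (rule finite_conjugate_polys)
    show "z \<in> Z" unfolding Z_def using auts_id id by (intro image_eqI[of _ _ "\<lambda>x. x"]) auto
    show "z \<noteq> 0" using y0 A(2) by (simp add: z_def)
  qed
  have iso: "W x \<noteq> W z" if x: "x \<in> Z" "x \<noteq> z" for x
  proof -
    obtain \<tau> where \<tau>: "\<tau> \<in> auts" "x = map_poly \<tau> z" using x by (auto simp: Z_def)
    have ne: "map_poly \<tau> A \<noteq> A"
    proof
      assume eq: "map_poly \<tau> A = A"
      then have "\<tau> y = y" using y(3)[OF \<tau>(1) auts_id] id by simp
      then show False using x(2) \<tau> eq mz by (simp add: z_def)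
    qed
    then have C: "map_poly \<tau> A \<in> C" using \<tau>(1) by (auto simp: C_def)
    then have "\<tau> y = t (map_poly \<tau> A) y" using y(3)[OF \<tau>(1)] t[OF C] by metis
    then have "W x \<noteq> W A" using N C \<tau> mz by (auto simp: bad_def)
    then show ?thesis using Wz by simp
  qed
  define P where "P = (\<Prod>x\<in>Z. [:- x, 1:])"
  obtain l where l: "coeff P (Suc l) \<noteq> 0" "coeff P l \<noteq> 0" "W z + W (coeff P (Suc l)) = W (coeff P l)"
    using isolated_root_value[OF W fin Z iso] unfolding P_def by blast
  \<comment> \<open>The coefficients are polynomials over the separable closure, and they are fixed
    by all embeddings over K, because these permute the conjugates of z.\<close>
  have "coeff P i \<in> polys_over K\<^sub>0" for i
  proof (rule polys_overI)
    fix j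
    note c = polys_over_closed[OF is_subfield_Ks]
    have zKs: "z \<in> polys_over Ks"
    proof -
      have "[:y:] ^ N \<in> polys_over Ks" "A \<in> polys_over Ks"
        using y(1) A(1) Kh_Ks c by (auto intro: polys_over_mono)
      then show ?thesis unfolding z_def by (rule c(6))
    qed
    have ZKs: "x \<in> polys_over Ks" if x: "x \<in> Z" for x
    proof (rule polys_overI)
      fix k
      obtain \<tau> where \<tau>: "\<tau> \<in> auts" "x = map_poly \<tau> z" using x by (auto simp: Z_def)
      then have "bij_betw \<tau> Ks Ks" using embedding_Ks unfolding auts_def by blast
      then show "coeff x k \<in> Ks" using polys_overD[OF zKs, of k] coeff_aut[OF \<tau>(1), of z k] \<tau>(2) by (auto simp: bij_betw_def)
    qed
    have "\<forall>i. coeff (\<Prod>x\<in>Y. [:- x, 1:]) i \<in> polys_over Ks" if "finite Y" "Y \<subseteq> Z" for Y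
      using that
    proof (induction Y rule: finite_induct)
      case empty
      then show ?case using c(1,2) by (auto simp: one_pCons coeff_pCons split: nat.splits)
    next
      case (insert x Y)
      have co: "coeff ([:- x, 1:] * p) i = (case i of 0 \<Rightarrow> 0 | Suc j \<Rightarrow> coeff p j) - x * coeff p i" for p i
        by (simp add: coeff_pCons split: nat.splits)
      have IH: "coeff (\<Prod>x\<in>Y. [:- x, 1:]) i \<in> polys_over Ks" for i using insert by auto
      have "x \<in> polys_over Ks" using insert.prems ZKs by auto
      then have "coeff ([:- x, 1:] * (\<Prod>x\<in>Y. [:- x, 1:])) i \<in> polys_over Ks" for i
        unfolding co by (intro c(4) c(6) IH) (auto simp: IH c(1) split: nat.splits)
      then show ?case using insert.hyps by simp
    qed
    then have "coeff P i \<in> polys_over Ks" unfolding P_def using Z(1) by blast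
    then have 1: "coeff (coeff P i) j \<in> Ks" by (rule polys_overD)
    have "\<rho> (coeff (coeff P i) j) = coeff (coeff P i) j" if \<rho>: "\<rho> \<in> auts" for \<rho>
    proof -
      have inj: "inj_on (map_poly \<rho>) Z"
        by (rule inj_onI) (metis \<rho> aut_map(2,6) right_minus_eq)
      have "map_poly \<rho> (map_poly \<tau> z) = map_poly (\<lambda>x. \<rho> (\<tau> x)) z" if "\<tau> \<in> auts" for \<tau>
        by (rule poly_eqI) (simp add: coeff_aut[OF \<rho>] coeff_aut[OF that] coeff_aut[OF auts_comp[OF \<rho> that]])
      then have "map_poly \<rho> ` Z \<subseteq> Z" using auts_comp[OF \<rho>] by (auto simp: Z_def)
      then have im: "map_poly \<rho> ` Z = Z" by (rule endo_inj_surj[OF Z(1) _ inj])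
      have "map_poly (map_poly \<rho>) P = (\<Prod>x\<in>Z. [:- map_poly \<rho> x, 1:])"
        unfolding P_def by (rule map_poly_linear_prod) (simp_all add: map_poly_embedding[OF is_subfield_UNIV auts_emb[OF \<rho>]])
      also have "\<dots> = (\<Prod>x\<in>map_poly \<rho> ` Z. [:- x, 1:])" by (simp add: prod.reindex[OF inj])
      also have "\<dots> = P" by (simp add: im P_def)
      finally have "map_poly (map_poly \<rho>) P = P" .
      moreover have "coeff (map_poly (map_poly \<rho>) P) i = map_poly \<rho> (coeff P i)" by (rule coeff_map_poly) simp
      ultimately have "map_poly \<rho> (coeff P i) = coeff P i" by simp
      then show ?thesis using coeff_aut[OF \<rho>, of "coeff P i" j] by simp
    qed
    then show "coeff (coeff P i) j \<in> K\<^sub>0" using fixed_separable_in_base[OF 1] by blast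
  qed
  then have "\<exists>e. coeff P i = mp e" for i using polys_over_K0 by metis
  then obtain e e' where e: "coeff P (Suc l) = mp e" "coeff P l = mp e'" by metis
  have "mp 0 = 0" by simp
  then have "e \<noteq> 0" "e' \<noteq> 0" using l(1,2) e by metis+
  then show ?thesis using l(3) unfolding e Wz by blast
qed

end

subsection \<open>Newton polygons\<close>

text \<open>The height at which the line of slope \<open>- lam\<close> through the point meets the
  vertical axis.\<close>

definition height :: "'g::linordered_rat_vector \<Rightarrow> rat \<times> 'g \<Rightarrow> 'g" where
  "height lam p = snd p + fst p *\<^sub>Q lam"

lemma height_change: "height lam' p = height lam p + fst p *\<^sub>Q (lam' - lam)"
  by (simp add: height_def scaleQ_basics)

lemma scaleQ_sum_left: "(\<Sum>x\<in>S. w x) *\<^sub>Q (y::'g::linordered_rat_vector) = (\<Sum>x\<in>S. w x *\<^sub>Q y)"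
  by (induction S rule: infinite_finite_induct) (simp_all add: scaleQ_basics scaleQ_add_left)

text \<open>The height is linear, so a convex combination attains the minimum m only if its weight
  is on points that attain it.\<close>

lemma rat_convex_hull_height:
  assumes p: "p \<in> rat_convex_hull C" and m: "\<And>c. c \<in> C \<Longrightarrow> m \<le> height lam c"
  shows "m \<le> height lam p"
    and "height lam p = m \<Longrightarrow> (\<And>c. c \<in> C \<Longrightarrow> height lam c = m \<Longrightarrow> a \<le> fst c \<and> fst c \<le> b) \<Longrightarrow> a \<le> fst p \<and> fst p \<le> b"
proof -
  obtain S w where S: "finite S" "S \<subseteq> C" "\<And>c. c \<in> S \<Longrightarrow> 0 \<le> w c" "sum w S = 1"
    and p_eq: "p = (\<Sum>c\<in>S. w c * fst c, \<Sum>c\<in>S. w c *\<^sub>Q snd c)"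
    using p unfolding rat_convex_hull_def by blast
  have "height lam p = (\<Sum>c\<in>S. w c *\<^sub>Q height lam c)"
    unfolding height_def p_eq fst_conv snd_conv scaleQ_sum_left by (simp add: scaleQ_add_right scaleQ_scaleQ sum.distrib)
  moreover have "m = (\<Sum>c\<in>S. w c *\<^sub>Q m)" using S(4) by (simp add: scaleQ_sum_left[symmetric] scaleQ_one)
  ultimately have diff: "height lam p - m = (\<Sum>c\<in>S. w c *\<^sub>Q (height lam c - m))"
    by (simp add: scaleQ_basics sum_subtractf)
  have nonneg: "0 \<le> w c *\<^sub>Q (height lam c - m)" if c: "c \<in> S" for c
    using scaleQ_mono_left(2)[of "height lam c - m" 0 "w c"] m[of c] S(2,3) c by (auto simp: scaleQ_basics(1))
  have "0 \<le> height lam p - m" unfolding diff by (rule sum_nonneg) (rule nonneg)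
  then show "m \<le> height lam p" by simp
  assume eq: "height lam p = m" and ab: "\<And>c. c \<in> C \<Longrightarrow> height lam c = m \<Longrightarrow> a \<le> fst c \<and> fst c \<le> b"
  have w: "w c = 0 \<or> height lam c = m" if c: "c \<in> S" for c
  proof -
    have "w c *\<^sub>Q (height lam c - m) = 0" using sum_nonneg_eq_0_iff[OF S(1) nonneg] diff eq c by simp
    moreover have "m \<le> height lam c" using m S(2) c by blast
    ultimately show ?thesis using scaleQ_pos[of "height lam c - m" "w c"] S(3)[OF c] by fastforce
  qed
  have "w c * a \<le> w c * fst c \<and> w c * fst c \<le> w c * b" if c: "c \<in> S" for c
  proof (cases "w c = 0")
    case False
    then have "a \<le> fst c \<and> fst c \<le> b" using w[OF c] ab[of c] subsetD[OF S(2) c] by blast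
    then show ?thesis using S(3)[OF c] by (simp add: mult_left_mono)
  qed simp
  then have "(\<Sum>c\<in>S. w c * a) \<le> fst p" "fst p \<le> (\<Sum>c\<in>S. w c * b)" unfolding p_eq fst_conv by (auto intro: sum_mono)
  then show "a \<le> fst p \<and> fst p \<le> b" using S(4) by (simp add: sum_distrib_right[symmetric])
qed

lemma rat_convex_hull_superset: "C \<subseteq> rat_convex_hull C"
proof
  fix c :: "rat \<times> 'a" assume "c \<in> C"
  then show "c \<in> rat_convex_hull C" unfolding rat_convex_hull_def mem_Collect_eq
    by (intro exI[of _ "{c}"] exI[of _ "\<lambda>_. 1"]) (simp add: scaleQ_one)
qed

text \<open>A hull point of minimal height has no hull point vertically below it, so the whole face
  belongs to the lower boundary.\<close>

lemma polygon_component_lower_convex_hull: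
  assumes c: "c \<in> C" and min: "\<forall>d\<in>C. height lam c \<le> height lam d"
  shows "polygon_component lam (lower_convex_hull C) = {p \<in> rat_convex_hull C. height lam p = height lam c}"
proof -
  have ge: "height lam c \<le> height lam p" if "p \<in> rat_convex_hull C" for p
    by (rule rat_convex_hull_height(1)[OF that]) (simp add: min)
  have low: "p \<in> lower_convex_hull C" if p: "p \<in> rat_convex_hull C" "height lam p = height lam c" for p
  proof -
    have "snd p \<le> \<beta>" if "(fst p, \<beta>) \<in> rat_convex_hull C" for \<beta>
    proof -
      have "snd p + fst p *\<^sub>Q lam \<le> \<beta> + fst p *\<^sub>Q lam" using ge[OF that] p(2) by (simp add: height_def)
      then show ?thesis by (rule add_le_imp_le_right)
    qed
    then show ?thesis using p(1) unfolding lower_convex_hull_def by (cases p) auto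
  qed
  have sub: "lower_convex_hull C \<subseteq> rat_convex_hull C" by (auto simp: lower_convex_hull_def)
  have cL: "c \<in> lower_convex_hull C" using low[of c] c rat_convex_hull_superset by blast
  show ?thesis
  proof (intro equalityI subsetI)
    fix p assume p: "p \<in> polygon_component lam (lower_convex_hull C)"
    then have "p \<in> rat_convex_hull C" "height lam p \<le> height lam c"
      using cL sub by (auto simp: polygon_component_def height_def)
    then show "p \<in> {p \<in> rat_convex_hull C. height lam p = height lam c}" using ge[of p] by auto
  next
    fix p assume p: "p \<in> {p \<in> rat_convex_hull C. height lam p = height lam c}"
    then have "height lam p \<le> height lam q" if "q \<in> lower_convex_hull C" for q using ge[of q] sub that by auto
    then show "p \<in> polygon_component lam (lower_convex_hull C)" using p low unfolding polygon_component_def height_def by auto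
  qed
qed

lemma horizontal_length_eq:
  assumes "a \<in> fst ` S" "b \<in> fst ` S" "\<And>p. p \<in> S \<Longrightarrow> a \<le> fst p \<and> fst p \<le> b"
  shows "horizontal_length S = b - a"
proof -
  have "(GREATEST x. x \<in> fst ` S) = b" using assms by (intro Greatest_equality) auto
  moreover have "(LEAST x. x \<in> fst ` S) = a" using assms by (intro Least_equality) auto
  ultimately show ?thesis by (simp add: horizontal_length_def)
qed

text \<open>For \<open>S = {}\<close> the greatest and the least element are the same junk value.\<close>

lemma horizontal_length_0:
  assumes "\<And>p q. p \<in> S \<Longrightarrow> q \<in> S \<Longrightarrow> \<not> fst p < fst q"
  shows "horizontal_length S = 0"
proof (cases "S = {}")
  case True
  then show ?thesis by (simp add: horizontal_length_def Greatest_def Least_def)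
next
  case False
  then obtain p where p: "p \<in> S" by blast
  have "horizontal_length S = fst p - fst p"
    using p assms[OF p] assms[OF _ p] by (intro horizontal_length_eq imageI) (auto simp: not_less)
  then show ?thesis by simp
qed

lemma horizontal_length_lower_convex_hull:
  assumes c: "c \<in> C" "d \<in> C" "\<And>e. e \<in> C \<Longrightarrow> height lam c \<le> height lam e" "height lam d = height lam c"
    and ext: "\<And>e. e \<in> C \<Longrightarrow> height lam e = height lam c \<Longrightarrow> fst c \<le> fst e \<and> fst e \<le> fst d"
  shows "horizontal_length (polygon_component lam (lower_convex_hull C)) = fst d - fst c"
proof (rule horizontal_length_eq)
  have "\<forall>e\<in>C. height lam c \<le> height lam e" using c(3) by blast
  note comp = polygon_component_lower_convex_hull[OF c(1) this]
  show "fst c \<in> fst ` polygon_component lam (lower_convex_hull C)" "fst d \<in> fst ` polygon_component lam (lower_convex_hull C)"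
    using subsetD[OF rat_convex_hull_superset c(1)] subsetD[OF rat_convex_hull_superset c(2)] c(4) unfolding comp
    by (intro imageI; simp)+
  show "p \<in> polygon_component lam (lower_convex_hull C) \<Longrightarrow> fst c \<le> fst p \<and> fst p \<le> fst d" for p
    unfolding comp using rat_convex_hull_height(2)[of p C "height lam c" lam "fst c" "fst d"] c ext by blast
qed

text \<open>The case that needs an argument is that of a \<open>lam > \<kappa>\<close> which is not the slope of a side: then the
  vertex \<open>P\<close> of the full polygon that minimises the height with respect to \<open>lam\<close> still lies on the
  principal polygon, because the side to the left of \<open>P\<close>, if any, is steeper.\<close>

lemma horizontal_length_principal:
  fixes C :: "(rat \<times> 'g::linordered_rat_vector) set"
  defines "L \<equiv> lower_convex_hull C" and "\<Lambda> \<equiv> \<lambda>\<kappa>. {lam. has_side lam (lower_convex_hull C) \<and> \<kappa> < lam}"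
  assumes fin: "finite C" and ne: "C \<noteq> {}"
    and N: "N = (if \<Lambda> \<kappa> = {} then {p\<in>L. \<forall>q\<in>L. fst p \<le> fst q} else (\<Union>lam\<in>\<Lambda> \<kappa>. polygon_component lam L))"
  shows "horizontal_length (polygon_component lam N) =
    (if \<kappa> < lam then horizontal_length (polygon_component lam L) else 0)"
proof -
  have compD: "p \<in> polygon_component l L \<Longrightarrow> p \<in> L" "p \<in> polygon_component l L \<Longrightarrow> q \<in> L \<Longrightarrow> height l p \<le> height l q" for p q l
    by (auto simp: polygon_component_def height_def)
  have NL: "N \<subseteq> L" using compD(1) by (auto simp: N split: if_splits)
  have single: "horizontal_length (polygon_component l L) = 0" if "\<not> has_side l L" for l
    using that by (intro horizontal_length_0) (auto simp: has_side_def)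
  have min_ex: "\<exists>P\<in>C. \<forall>c\<in>C. height l P \<le> height l c" for l
  proof -
    have "Min (height l ` C) \<in> height l ` C" using fin ne by (intro Min_in) auto
    then obtain P where "P \<in> C" "height l P = Min (height l ` C)" by auto
    then show ?thesis using fin by (metis Min_le finite_imageI imageI)
  qed
  have compI: "P \<in> polygon_component l L" if "P \<in> C" "\<forall>c\<in>C. height l P \<le> height l c" for P l
    unfolding L_def polygon_component_lower_convex_hull[OF that] using subsetD[OF rat_convex_hull_superset that(1)] by simp
  consider "lam \<in> \<Lambda> \<kappa>" | "lam \<notin> \<Lambda> \<kappa>" "\<Lambda> \<kappa> = {}" | "lam \<notin> \<Lambda> \<kappa>" "\<Lambda> \<kappa> \<noteq> {}" "lam \<le> \<kappa>"
    | "lam \<notin> \<Lambda> \<kappa>" "\<Lambda> \<kappa> \<noteq> {}" "\<kappa> < lam" by fastforce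
  then show ?thesis
  proof cases
    case 1
    then have sub: "polygon_component lam L \<subseteq> N" by (auto simp: N)
    obtain P where P: "P \<in> polygon_component lam L" using min_ex[of lam] compI by blast
    have "polygon_component lam N = polygon_component lam L"
    proof (intro equalityI subsetI)
      fix p assume p: "p \<in> polygon_component lam L"
      then show "p \<in> polygon_component lam N" using sub NL unfolding polygon_component_def by auto
    next
      fix p assume p: "p \<in> polygon_component lam N"
      then have "p \<in> L" "height lam p \<le> height lam P" using P sub NL by (auto simp: polygon_component_def height_def)
      then have "height lam p \<le> height lam q" if "q \<in> L" for q using compD(2)[OF P that] by order
      with \<open>p \<in> L\<close> show "p \<in> polygon_component lam L" unfolding polygon_component_def height_def by blast
    qed
    then show ?thesis using 1 by (simp add: \<Lambda>_def)
  next
    case 2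
    then have "N = {p\<in>L. \<forall>q\<in>L. fst p \<le> fst q}" by (simp add: N)
    then have "horizontal_length (polygon_component lam N) = 0"
      by (intro horizontal_length_0) (auto simp: polygon_component_def not_less)
    moreover have "horizontal_length (polygon_component lam L) = 0" if "\<kappa> < lam"
      using 2(1) that by (intro single) (auto simp: \<Lambda>_def L_def)
    ultimately show ?thesis by simp
  next
    case 3
    have "\<not> fst p < fst q" if p: "p \<in> polygon_component lam N" and q: "q \<in> polygon_component lam N" for p q
    proof
      assume lt: "fst p < fst q"
      have "q \<in> N" "p \<in> N" using p q by (auto simp: polygon_component_def)
      then obtain l where l: "l \<in> \<Lambda> \<kappa>" "q \<in> polygon_component l L" using 3(2) by (auto simp: N)
      \<comment> \<open>From p to q, which lies to the right, the height for l grows by more than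
        the height for \<open>lam\<close>; the minimality of q for l and of p for \<open>lam\<close>
        contradicts this.\<close>
      have "lam < l" using l(1) 3(3) by (auto simp: \<Lambda>_def)
      then have "fst p *\<^sub>Q (l - lam) < fst q *\<^sub>Q (l - lam)" using lt by (intro scaleQ_mono_left) simp_all
      moreover have "height l q \<le> height l p" using compD(2)[OF l(2)] \<open>p \<in> N\<close> NL by blast
      moreover have "height lam p \<le> height lam q" using p \<open>q \<in> N\<close> by (simp add: polygon_component_def height_def)
      ultimately show False using add_le_less_mono[of "height lam p" "height lam q"] unfolding height_change[of l _ lam]
        by (meson leD)
    qed
    then show ?thesis using 3(3) by (subst horizontal_length_0) auto
  next
    case 4
    have noside: "\<not> has_side lam L" using 4(1,3) by (auto simp: \<Lambda>_def L_def)
    obtain P where P: "P \<in> C" "\<forall>c\<in>C. height lam P \<le> height lam c" using min_ex[of lam] by blast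
    note PL = compI[OF P]
    have unique: "p = P" if "p \<in> polygon_component lam L" for p using noside PL that unfolding has_side_def by blast
    have "\<not> fst p < fst q" if p: "p \<in> polygon_component lam N" and q: "q \<in> polygon_component lam N" for p q
    proof
      assume lt: "fst p < fst q"
      have pq: "p \<in> N" "q \<in> N" "height lam p = height lam q"
        using p q by (auto simp: polygon_component_def height_def intro: antisym)
      obtain l where l: "l \<in> \<Lambda> \<kappa>" "p \<in> polygon_component l L" using 4(2) pq by (auto simp: N)
      have "height l p \<le> height l q" using compD(2)[OF l(2)] pq(2) NL by blast
      then have "fst p *\<^sub>Q (l - lam) \<le> fst q *\<^sub>Q (l - lam)" by (simp add: height_change[of l _ lam] pq(3))
      then have "0 \<le> (fst q - fst p) *\<^sub>Q (l - lam)" by (simp add: scaleQ_basics(6))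
      then have "0 \<le> l - lam" using scaleQ_mono(2)[of "fst q - fst p" 0 "l - lam"] lt by (simp add: scaleQ_basics(2))
      moreover have "l \<noteq> lam" using l(1) 4(1) by blast
      ultimately have lam: "lam < l" by simp
      \<comment> \<open>If no point lies to the left of P, then P is still minimal for the larger l.
        Otherwise P is the right end of a side steeper than the slope \<open>- lam\<close>.\<close>
      have "P \<in> N"
      proof (cases "{c\<in>C. fst c < fst P} = {}")
        case True
        have "height l P \<le> height l c" if c: "c \<in> C" for c
        proof -
          have "fst P \<le> fst c" using True c by (metis (mono_tags, lifting) empty_iff mem_Collect_eq not_less)
          then have "fst P *\<^sub>Q (l - lam) \<le> fst c *\<^sub>Q (l - lam)" using lam by (intro scaleQ_mono_left) simp_all
          then show ?thesis using bspec[OF P(2) c] unfolding height_change[of l _ lam] by (rule add_mono[rotated])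
        qed
        then show ?thesis using compI[OF P(1), of l] l(1) by (auto simp: N)
      next
        case False
        define B where "B = {c\<in>C. fst c < fst P}"
        \<comment> \<open>The x for which c and P have the same height with respect to x.\<close>
        define slope where "slope c = inverse (fst P - fst c) *\<^sub>Q (snd c - snd P)" for c
        have slope: "(fst P - fst c) *\<^sub>Q slope c = snd c - snd P" if "c \<in> B" for c
          unfolding slope_def using that by (intro scaleQ_cancel) (simp add: B_def)
        have hdiff: "height x c - height x P = (fst P - fst c) *\<^sub>Q (slope c - x)" if "c \<in> B" for c x
          by (simp add: scaleQ_basics(5) slope[OF that]) (simp add: height_def scaleQ_basics(6))
        have "finite B" "B \<noteq> {}" using fin False by (auto simp: B_def)
        then have "Min (slope ` B) \<in> slope ` B" by (intro Min_in) auto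
        then obtain c0 where c0: "c0 \<in> B" "slope c0 = Min (slope ` B)" by auto
        have c0_le: "slope c0 \<le> slope c" if "c \<in> B" for c unfolding c0(2) using \<open>finite B\<close> that by (intro Min_le) auto
        \<comment> \<open>The least of these values belongs to the side that arrives at P from the
          left.\<close>
        define l' where "l' = slope c0"
        have c0': "c0 \<in> C" "c0 \<noteq> P" "0 < fst P - fst c0" using c0(1) by (auto simp: B_def)
        have "height lam P \<noteq> height lam c0"
        proof
          assume "height lam P = height lam c0"
          then have "c0 \<in> polygon_component lam L" using compI[of c0 lam] P(2) c0'(1) by auto
          then show False using unique c0'(2) by blast
        qed
        then have "0 < height lam c0 - height lam P" using bspec[OF P(2) c0'(1)] by simp
        then have "0 < (fst P - fst c0) *\<^sub>Q (l' - lam)" unfolding hdiff[OF c0(1)] l'_def .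
        then have l': "lam < l'" using scaleQ_mono(1)[OF c0'(3), of 0 "l' - lam"] by (simp add: scaleQ_basics(2))
        have min: "\<forall>c\<in>C. height l' P \<le> height l' c"
        proof
          fix c assume c: "c \<in> C"
          show "height l' P \<le> height l' c"
        proof (cases "c \<in> B")
          case True
          have "0 \<le> (fst P - fst c) *\<^sub>Q (slope c - l')"
            using scaleQ_mono(2)[of "fst P - fst c" 0 "slope c - l'"] c0_le[OF True] True by (simp add: scaleQ_basics(2) l'_def B_def)
          then show ?thesis unfolding hdiff[OF True, of l', symmetric] by simp
        next
          case False
          then have "fst P \<le> fst c" using c unfolding B_def by (metis (mono_tags, lifting) mem_Collect_eq not_less)
          then have "fst P *\<^sub>Q (l' - lam) \<le> fst c *\<^sub>Q (l' - lam)" using l' by (intro scaleQ_mono_left) simp_all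
          then show ?thesis using bspec[OF P(2) c] unfolding height_change[of l' _ lam] by (rule add_mono[rotated])
        qed
      qed
        have "height l' c0 = height l' P" using hdiff[OF c0(1), of l'] unfolding l'_def by (simp add: scaleQ_basics(2))
        then have "c0 \<in> polygon_component l' L" using compI[OF c0'(1), of l'] min by auto
        moreover have PL': "P \<in> polygon_component l' L" by (rule compI[OF P(1) min])
        ultimately have "l' \<in> \<Lambda> \<kappa>" using c0'(2) l' 4(3) by (auto simp: \<Lambda>_def has_side_def L_def)
        then show ?thesis using PL' by (auto simp: N)
      qed
      then have "height lam p \<le> height lam P" "height lam q \<le> height lam P" using p q by (auto simp: polygon_component_def height_def)
      then have "height lam p \<le> height lam r" "height lam q \<le> height lam r" if "r \<in> L" for r
        using compD(2)[OF PL that] by order+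
      then have "p \<in> polygon_component lam L" "q \<in> polygon_component lam L"
        using pq NL unfolding polygon_component_def height_def by blast+
      then show False using unique lt by blast
    qed
    then have "horizontal_length (polygon_component lam N) = 0" by (rule horizontal_length_0)
    then show ?thesis using single[OF noside] by simp
  qed
qed

section \<open>The principal polygon in terms of minimal indices\<close>

context newton_setting
begin

text \<open>The point of index n has the height given by \<open>cpt f \<gamma> n\<close>, so the
  minimal face extends from the least to the greatest minimal index.\<close>

lemma horizontal_length_principal_polygon:
  assumes f: "f \<noteq> 0"
  shows "horizontal_length (polygon_component \<gamma> (principal_polygon \<mu> \<phi> f)) =
    (if \<mu> \<phi> < Fin \<gamma> then of_nat (Max (min_indices f \<gamma>) - Min (min_indices f \<gamma>)) else 0)"
proof -
  define C :: "(rat \<times> 'g) set" where "C = {(of_nat n, \<alpha>) | n \<alpha>. phi_coeff \<phi> f n \<noteq> 0 \<and> \<mu> (phi_coeff \<phi> f n) = Fin \<alpha>}"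
  obtain \<kappa> where \<kappa>: "\<mu> \<phi> = Fin \<kappa>" using key.fin by (cases "\<mu> \<phi>") auto
  define val where "val n = (case \<mu> (phi_coeff \<phi> f n) of Fin \<alpha> \<Rightarrow> \<alpha> | Infty \<Rightarrow> 0)" for n
  have val: "\<mu> (phi_coeff \<phi> f n) = Fin (val n)" if "phi_coeff \<phi> f n \<noteq> 0" for n
    using key.trivial_support[of "phi_coeff \<phi> f n"] that by (cases "\<mu> (phi_coeff \<phi> f n)") (auto simp: val_def)
  have C_eq: "C = (\<lambda>n. (of_nat n, val n)) ` {n. phi_coeff \<phi> f n \<noteq> 0}"
    unfolding C_def using val by force
  have cpt: "cpt f \<gamma> n = Fin (height \<gamma> (of_nat n, val n))" if "phi_coeff \<phi> f n \<noteq> 0" for n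
    unfolding cpt_def val[OF that] height_def by (simp add: vext_basics)
  have "{n. phi_coeff \<phi> f n \<noteq> 0} \<subseteq> {..degree f}" using phi_coeff_zero by (auto simp: not_less[symmetric])
  then have fin: "finite C" unfolding C_eq by (intro finite_imageI) (rule finite_subset, auto)
  have ne: "C \<noteq> {}" unfolding C_eq using phi_coeff_nonzero[OF f] by auto
  have "Fin \<kappa> < Fin lam \<longleftrightarrow> \<kappa> < lam" for lam by (simp add: vext_basics)
  then have N: "principal_polygon \<mu> \<phi> f = (if {lam. has_side lam (lower_convex_hull C) \<and> \<kappa> < lam} = {}
      then {p\<in>lower_convex_hull C. \<forall>q\<in>lower_convex_hull C. fst p \<le> fst q}
      else (\<Union>lam\<in>{lam. has_side lam (lower_convex_hull C) \<and> \<kappa> < lam}. polygon_component lam (lower_convex_hull C)))"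
    unfolding principal_polygon_def newton_polygon_def C_def[symmetric] Let_def \<kappa> by (simp only:)
  have "horizontal_length (polygon_component \<gamma> (lower_convex_hull C)) = of_nat (Max (min_indices f \<gamma>)) - of_nat (Min (min_indices f \<gamma>))"
  proof -
    let ?M = "min_indices f \<gamma>"
    have M: "Max ?M \<in> ?M" "Min ?M \<in> ?M" using min_indices[OF f] by simp_all
    have le: "Min ?M \<le> n" "n \<le> Max ?M" if "n \<in> ?M" for n using min_indices(1)[OF f] that by simp_all
    have MD: "phi_coeff \<phi> f n \<noteq> 0" "cpt f \<gamma> n \<le> cpt f \<gamma> m" if "n \<in> ?M" for n m using that by (auto simp: min_indices_def)
    have in_C: "(of_nat n, val n) \<in> C" if "n \<in> ?M" for n unfolding C_eq using MD(1)[OF that] by blast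
    have h: "height \<gamma> (of_nat n, val n) \<le> height \<gamma> e" if that: "n \<in> ?M" "e \<in> C" for n e
    proof -
      obtain m where "phi_coeff \<phi> f m \<noteq> 0" "e = (of_nat m, val m)" using \<open>e \<in> C\<close> by (auto simp: C_eq)
      then show ?thesis using MD(2)[OF \<open>n \<in> ?M\<close>, of m] cpt MD(1)[OF \<open>n \<in> ?M\<close>] by simp
    qed
    have ext: "of_nat (Min ?M) \<le> fst e \<and> fst e \<le> of_nat (Max ?M)" if e: "e \<in> C" "height \<gamma> e = height \<gamma> (of_nat (Min ?M), val (Min ?M))" for e
    proof -
      obtain m where m: "phi_coeff \<phi> f m \<noteq> 0" "e = (of_nat m, val m)" using e(1) by (auto simp: C_eq)
      have "cpt f \<gamma> m = cpt f \<gamma> (Min ?M)" using cpt[OF m(1)] cpt[OF MD(1)[OF M(2)]] e(2) m(2) by simp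
      then have "m \<in> ?M" using MD(2)[OF M(2)] m(1) unfolding min_indices_def by simp
      then show ?thesis using le m(2) by simp
    qed
    show ?thesis
      using horizontal_length_lower_convex_hull[of "(of_nat (Min ?M), val (Min ?M))" C "(of_nat (Max ?M), val (Max ?M))" \<gamma>]
        in_C[OF M(1)] in_C[OF M(2)] h[OF M(2)] h[OF M(1) in_C[OF M(2)]] h[OF M(2) in_C[OF M(1)]] ext by auto
  qed
  moreover have "Min (min_indices f \<gamma>) \<le> Max (min_indices f \<gamma>)" using min_indices[OF f] by simp
  ultimately show ?thesis using horizontal_length_principal[OF fin ne N, of \<gamma>] by (simp add: \<kappa> vext_basics of_nat_diff)
qed

end

subsection \<open>Factors over the henselization\<close>

lemma ball_val_conjugate:
  assumes u: "is_valuation u" and \<tau>: "is_embedding UNIV \<tau>" and inv: "\<And>x. u (\<tau> x) = u x"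
  shows "ball_val u (\<tau> a) \<delta> (map_poly \<tau> p) = ball_val u a \<delta> p"
proof -
  note m = map_poly_embedding[OF is_subfield_UNIV \<tau>]
  have UNIV: "q \<in> polys_over UNIV" for q by (simp add: polys_over_def)
  have \<tau>0: "\<tau> 0 = 0" and \<tau>1: "\<tau> 1 = 1" using is_embeddingD[OF is_subfield_UNIV \<tau>] by simp_all
  have "pcompose (map_poly \<tau> p) [:\<tau> a, 1:] = map_poly \<tau> (pcompose p [:a, 1:])"
  proof (induction p)
    case (pCons b p)
    have "map_poly \<tau> (pcompose (pCons b p) [:a, 1:]) = map_poly \<tau> [:b:] + map_poly \<tau> [:a, 1:] * map_poly \<tau> (pcompose p [:a, 1:])"
      unfolding pcompose_pCons m(1)[OF UNIV UNIV] m(3)[OF UNIV UNIV] ..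
    also have "map_poly \<tau> [:b:] = [:\<tau> b:]" by (simp add: map_poly_pCons \<tau>0)
    also have "map_poly \<tau> [:a, 1:] = [:\<tau> a, 1:]" by (simp add: map_poly_pCons \<tau>0 \<tau>1)
    finally show ?case using pCons by (simp add: map_poly_pCons \<tau>0 pcompose_pCons)
  qed simp
  moreover have "gauss u \<delta> (map_poly \<tau> q) = gauss u \<delta> q" for q
  proof -
    have "u (coeff (map_poly \<tau> q) i) = u (coeff q i)" for i using coeff_map_poly[of \<tau> q i] \<tau>0 inv by simp
    then have "x \<le> gauss u \<delta> (map_poly \<tau> q) \<longleftrightarrow> x \<le> gauss u \<delta> q" for x unfolding le_gauss_iff[OF u] by simp
    then show ?thesis by (blast intro: antisym)
  qed
  ultimately show ?thesis by (simp add: ball_val_def)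
qed

lemma irr_factors_Irr: "G \<in># irr_factors E f \<Longrightarrow> G \<in> Irr E \<and> G dvd f"
proof -
  have "x \<in># (\<Sum>i\<in>I. h i) \<Longrightarrow> \<exists>i\<in>I. x \<in># h i" for x :: "'a poly" and h :: "'a poly \<Rightarrow> 'a poly multiset" and I
    by (induction I rule: infinite_finite_induct) auto
  moreover assume "G \<in># irr_factors E f"
  ultimately obtain H where "H \<in> {G. G \<in> Irr E \<and> G dvd f}" "G \<in># replicate_mset (GREATEST n. H ^ n dvd f) H"
    unfolding irr_factors_def by blast
  then show ?thesis by (auto split: if_splits)
qed

text \<open>Once the highest power of G is removed, the cofactor cannot vanish at x, for G would
  divide it once more.\<close>

lemma order_irr_factor:
  assumes E: "is_subfield E" and G: "G \<in> Irr E" "poly G x = 0" and f: "f \<in> polys_over E" "f \<noteq> 0"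
  shows "Polynomial.order x f = (GREATEST n. G ^ n dvd f) * Polynomial.order x G"
proof -
  define m where "m = (GREATEST n. G ^ n dvd f)"
  have bound: "n \<le> degree f" if "G ^ n dvd f" for n
  proof -
    have "n * 1 \<le> n * degree G" using IrrD(3)[OF G(1)] by (intro mult_le_mono2) simp
    also have "\<dots> = degree (G ^ n)" using IrrD(4)[OF G(1)] by (simp add: degree_power_eq)
    also have "\<dots> \<le> degree f" using dvd_imp_degree_le[OF that f(2)] .
    finally show ?thesis by simp
  qed
  have m: "G ^ m dvd f" unfolding m_def
  proof (rule GreatestI_nat)
    show "G ^ 0 dvd f" by simp
    show "\<And>n. G ^ n dvd f \<Longrightarrow> n \<le> degree f" by (rule bound)
  qed
  have max: "n \<le> m" if "G ^ n dvd f" for n unfolding m_def using that bound by (rule Greatest_le_nat)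
  obtain h where h: "f = G ^ m * h" using m by blast
  have nz: "G ^ m \<noteq> 0" "h \<noteq> 0" using IrrD(4)[OF G(1)] f(2) h by auto
  have "G ^ m \<in> polys_over E" by (induction m) (simp_all add: polys_over_closed[OF E] IrrD(1)[OF G(1)])
  then have hE: "h \<in> polys_over E" using polys_over_dvd_factor[OF E, of "G ^ m" h] f(1) h nz(1) by simp
  have "poly h x \<noteq> 0"
  proof
    assume "poly h x = 0"
    then obtain k where "h = G * k" using Irr_dvd[OF E G(1) hE G(2)] by blast
    then have "f = G ^ Suc m * k" using h by (simp add: mult_ac)
    then have "G ^ Suc m dvd f" by (rule dvdI)
    then show False using max[of "Suc m"] by simp
  qed
  then have "Polynomial.order x h = 0" by (rule order_0I)
  moreover have "Polynomial.order x (G ^ n) = n * Polynomial.order x G" for n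
    using IrrD(4)[OF G(1)] by (induction n) (simp_all add: order_mult)
  moreover have "Polynomial.order x f = Polynomial.order x (G ^ m) + Polynomial.order x h"
    using order_mult[of "G ^ m" h x] h f(2) by simp
  ultimately show ?thesis unfolding m_def by simp
qed

text \<open>Every root of f belongs to exactly one irreducible factor over E. A property of factors
  that can be read off from any root thus turns a sum of degrees into a root count.\<close>

lemma sum_degree_irr_factors:
  fixes E :: "'c::alg_closed_field set"
  assumes E: "is_subfield E" and alg: "\<And>x. algebraic_over E x" and f: "f \<in> polys_over E" "f \<noteq> 0"
    and P: "\<And>G x. G \<in> Irr E \<Longrightarrow> poly G x = 0 \<Longrightarrow> P G \<longleftrightarrow> x \<in> S"
  shows "(\<Sum>G\<in>#filter_mset P (irr_factors E f). degree G) = count_roots f S"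
proof -
  define I where "I = {G. G \<in> Irr E \<and> G dvd f}"
  define mult where "mult G = (GREATEST n. G ^ n dvd f)" for G
  \<comment> \<open>A factor is recovered from any of its roots, so there are finitely many.\<close>
  have "I \<subseteq> (\<lambda>x. THE G. G \<in> Irr E \<and> poly G x = 0) ` {x. poly f x = 0}"
  proof
    fix G assume G: "G \<in> I"
    then have "degree G > 0" "G \<in> Irr E" "G dvd f" using IrrD(3)[of G E] by (auto simp: I_def)
    then obtain x where x: "poly G x = 0" using alg_closed_imp_poly_has_root by blast
    have "(THE G. G \<in> Irr E \<and> poly G x = 0) = G"
      using \<open>G \<in> Irr E\<close> x by (intro the_equality) (auto intro: Irr_unique[OF E])
    moreover have "poly f x = 0" using \<open>G dvd f\<close> x by (auto elim: dvdE)
    ultimately show "G \<in> (\<lambda>x. THE G. G \<in> Irr E \<and> poly G x = 0) ` {x. poly f x = 0}" by force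
  qed
  then have fin: "finite I" using poly_roots_finite[OF f(2)] by (meson finite_imageI finite_subset)
  have "filter_mset (\<lambda>x. x \<in> S) (proots f) = (\<Sum>G\<in>I. if P G then repeat_mset (mult G) (proots G) else {#})"
  proof (rule multiset_eqI)
    fix x
    have nzI: "G \<noteq> 0" if "G \<in> I" for G using that IrrD(4) by (auto simp: I_def)
    have "count (\<Sum>G\<in>I. if P G then repeat_mset (mult G) (proots G) else {#}) x =
        (\<Sum>G\<in>I. if P G then mult G * Polynomial.order x G else 0)"
      unfolding count_sum using nzI by (intro sum.cong) auto
    also have "\<dots> = (if x \<in> S then Polynomial.order x f else 0)"
    proof (cases "poly f x = 0")
      case True
      obtain H where H: "H \<in> Irr E" "poly H x = 0" using Irr_exists[OF E alg] by blast
      have HI: "H \<in> I" using Irr_dvd[OF E H(1) f(1) H(2) True] H(1) by (simp add: I_def)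
      have "(\<Sum>G\<in>I. if P G then mult G * Polynomial.order x G else 0) = (\<Sum>G\<in>I. if G = H then (if P H then mult H * Polynomial.order x H else 0) else 0)"
      proof (rule sum.cong[OF refl])
        fix G assume G: "G \<in> I"
        show "(if P G then mult G * Polynomial.order x G else 0) = (if G = H then (if P H then mult H * Polynomial.order x H else 0) else 0)"
        proof (cases "G = H")
          case False
          then have "poly G x \<noteq> 0" using Irr_unique[OF E _ H(1) _ H(2), of G] G by (auto simp: I_def)
          then show ?thesis using False by (simp add: order_0I)
        qed simp
      qed
      then show ?thesis using HI fin P[OF H] order_irr_factor[OF E H f] by (simp add: mult_def)
    next
      case False
      then have "Polynomial.order x G = 0" if "G \<in> I" for G using that by (intro order_0I) (auto simp: I_def elim!: dvdE)
      then have "(\<Sum>G\<in>I. if P G then mult G * Polynomial.order x G else 0) = 0" by (intro sum.neutral) simp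
      then show ?thesis using False by (simp add: order_0I)
    qed
    finally show "count (filter_mset (\<lambda>x. x \<in> S) (proots f)) x = count (\<Sum>G\<in>I. if P G then repeat_mset (mult G) (proots G) else {#}) x"
      using f(2) by simp
  qed
  then have "count_roots f S = size (\<Sum>G\<in>I. if P G then repeat_mset (mult G) (proots G) else {#})" by (simp add: count_roots_def)
  also have "\<dots> = (\<Sum>G\<in>I. if P G then mult G * degree G else 0)"
    using fin by (induction I rule: finite_induct) (simp_all add: size_proots)
  also have "\<dots> = (\<Sum>G\<in>#filter_mset P (\<Sum>G\<in>I. replicate_mset (mult G) G). degree G)"
  proof -
    have "(\<Sum>G\<in>#filter_mset P (replicate_mset n H). degree G) = (if P H then n * degree H else 0)" for n H
      by (induction n) auto
    note replicate = this
    show ?thesis using fin by (induction I rule: finite_induct) (simp_all add: replicate)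
  qed
  finally show ?thesis by (simp add: irr_factors_def I_def mult_def)
qed

section \<open>Roots that dominate the valuation and the factors they belong to\<close>

context newton_setting
begin

lemma algebraic_Kh: "algebraic_over Kh x"
  by (rule alg'[OF K0_Kh])

lemma Irr_has_root: assumes "G \<in> Irr E" obtains \<theta> :: 'c where "poly G \<theta> = 0"
  using alg_closed_imp_poly_has_root[of G] IrrD(3)[OF assms] by blast

lemma is_valuation_value_at: "is_valuation (value_at \<theta>)"
  unfolding is_valuation_def value_at_def
proof (intro conjI allI)
  fix f g
  show "min (vbar (poly (mp f) \<theta>)) (vbar (poly (mp g) \<theta>)) \<le> vbar (poly (mp (f + g)) \<theta>)"
    unfolding mp_hom poly_add by (rule u.add_ge) auto
qed (simp_all add: mp_hom u.zero u.one u.mult)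

lemma value_at_const: "value_at \<theta> [:a:] = v a"
  by (simp add: value_at_def mp_hom vbar_extends)

lemma value_at_eq_Infty: "value_at \<theta> f = Infty \<longleftrightarrow> poly (mp f) \<theta> = 0"
  by (simp add: value_at_def field_valuation(1)[OF val])

lemma value_at_root: "G \<in> Irr Kh \<Longrightarrow> poly G \<theta> = 0 \<Longrightarrow> poly G \<theta>' = 0 \<Longrightarrow> value_at \<theta> = value_at \<theta>'"
  unfolding value_at_def by (rule ext) (rule root_value_unique[OF _ _ _ mp_in])

lemma root_val_eq: assumes "G \<in> Irr Kh" "poly G \<theta> = 0" shows "root_val emb vbar G = value_at \<theta>"
proof
  fix f
  have "poly G (SOME \<theta>. poly G \<theta> = 0) = 0" using assms(2) by (rule someI)
  then show "root_val emb vbar G f = value_at \<theta> f"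
    unfolding root_val_def value_at_def using root_value_unique[OF assms(1) _ assms(2) mp_in] by blast
qed

lemma same_value_at_root:
  assumes "G \<in> Irr Kh" "poly G \<theta> = 0" "value_at \<theta> = value_at \<theta>'" shows "poly G \<theta>' = 0"
proof (rule same_values_same_factor[OF assms(1,2)])
  fix F assume "F \<in> polys_over K\<^sub>0"
  then obtain f where "F = mp f" by (rule polys_over_K0)
  then show "vbar (poly F \<theta>) = vbar (poly F \<theta>')" using fun_cong[OF assms(3), of f] by (simp add: value_at_def)
qed

text \<open>At a root of \<phi> only the remainder modulo \<phi> counts, and if the point dominates
  \<mu>, its valuation agrees with \<mu> on remainders.\<close>

lemma orb_iff: "a \<in> orb \<longleftrightarrow> value_at a = (\<lambda>f. \<mu> (f mod \<phi>))"
proof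
  assume a: "a \<in> orb"
  then have root: "poly (mp \<phi>) a = 0" and dom: "\<And>f. \<mu> f \<le> value_at a f" by (simp_all add: orb_def dominating_def)
  show "value_at a = (\<lambda>f. \<mu> (f mod \<phi>))"
  proof
    fix f
    have "mp f = mp (f mod \<phi>) + mp \<phi> * mp (f div \<phi>)" unfolding mp_hom(3,5)[symmetric] by simp
    then have "value_at a f = value_at a (f mod \<phi>)" using root by (simp add: value_at_def)
    moreover have "\<mu> \<phi> < value_at a \<phi>" using root key.fin value_at_eq_Infty[of a \<phi>] by (simp add: vext_basics)
    ultimately show "value_at a f = \<mu> (f mod \<phi>)"
      using key.agree_below_degree[OF is_valuation_value_at dom _ _ key.mod_degree[of f]] by (simp add: \<mu>_const value_at_const)
  qed
next
  assume a: "value_at a = (\<lambda>f. \<mu> (f mod \<phi>))"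
  have "dominating a" unfolding dominating_def a using key.expansion by (metis min.cobounded1)
  moreover have "poly (mp \<phi>) a = 0" using value_at_eq_Infty[of a \<phi>] by (simp add: a key.zero)
  ultimately show "a \<in> orb" by (simp add: orb_def)
qed

lemma mp_phi_Irr: "mp \<phi> \<in> Irr K\<^sub>0"
proof -
  have "irreducible \<phi>"
  proof (rule irreducibleI)
    show nz: "\<phi> \<noteq> 0" using key.deg by auto
    show "\<not> \<phi> dvd 1" using key.deg by (simp add: is_unit_iff_degree[OF nz])
    fix f g assume fg: "\<phi> = f * g"
    then have "f \<noteq> 0" "g \<noteq> 0" using key.deg by auto
    then show "f dvd 1 \<or> g dvd 1" using key.factor_degree[OF fg] is_unit_iff_degree[of f] is_unit_iff_degree[of g] by blast
  qed
  then show ?thesis using key.monic by (simp add: Irr_K0_iff)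
qed

text \<open>The valuation \<open>\<lambda>f. \<mu> (f mod \<phi>)\<close> comes from a root of \<open>\<phi>\<close>.\<close>

lemma orb_nonempty: "orb \<noteq> {}"
proof -
  \<comment> \<open>The valuation is carried over from K[x] to polynomials with coefficients in the
    image of K.\<close>
  define \<nu> where "\<nu> F = \<mu> (inv_into UNIV mp F mod \<phi>)" for F
  have "inj mp" by (rule injI) (simp add: mp_hom)
  then have \<nu>: "\<nu> (mp f) = \<mu> (f mod \<phi>)" for f by (simp add: \<nu>_def)
  have "\<nu> 0 = Infty" "\<nu> 1 = 0" using \<nu>[of 0] \<nu>[of 1] key.valuation_mod unfolding is_valuation_def by (simp_all add: mp_hom)
  moreover have "\<nu> (F * G) = \<nu> F + \<nu> G \<and> min (\<nu> F) (\<nu> G) \<le> \<nu> (F + G)" if "F \<in> polys_over K\<^sub>0" "G \<in> polys_over K\<^sub>0" for F G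
  proof -
    obtain f where f: "F = mp f" using \<open>F \<in> polys_over K\<^sub>0\<close> by (rule polys_over_K0)
    obtain g where g: "G = mp g" using \<open>G \<in> polys_over K\<^sub>0\<close> by (rule polys_over_K0)
    show ?thesis using key.valuation_mod unfolding is_valuation_def f g mp_hom(3,5)[symmetric] \<nu> by blast
  qed
  ultimately have val: "valuation_on (polys_over K\<^sub>0) \<nu>"
    unfolding valuation_on_def using polys_over_closed(2,4,6)[OF is_subfield_K0] by simp
  have const: "\<nu> [:a:] = vbar a" if a: "a \<in> K\<^sub>0" for a
  proof -
    obtain c where c: "a = emb c" using a by blast
    have "[:c:] mod \<phi> = [:c:]" using key.deg by (simp add: mod_poly_less)
    then show ?thesis using \<nu>[of "[:c:]"] by (simp add: c mp_hom \<mu>_const vbar_extends)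
  qed
  have "\<nu> (mp \<phi>) = Infty" unfolding \<nu> by (simp add: key.zero)
  then obtain a where "\<forall>F\<in>polys_over K\<^sub>0. \<nu> F = vbar (poly F a)"
    using valuation_on_algebraic_extension[OF is_subfield_K0 order_refl mp_phi_Irr val const] by blast
  then have "value_at a f = \<mu> (f mod \<phi>)" for f using \<nu>[of f] by (simp add: value_at_def)
  then have "a \<in> orb" unfolding orb_iff by (rule ext)
  then show ?thesis by blast
qed

text \<open>The points with the same values on K[x] as a given point are the roots of one
  irreducible polynomial over the henselization; so \<open>orb\<close> is the root set of Q. The
  degree follows since \<phi> and Q have equal multiplicities at these roots.\<close>

lemma determined_factor:
  fixes Q defines "Q \<equiv> determined_factor emb vbar \<mu> \<phi>"
  shows "Q \<in> Irr Kh" "poly Q x = 0 \<longleftrightarrow> x \<in> orb" "degree Q = count_roots (mp \<phi>) orb"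
proof -
  obtain a where a: "a \<in> orb" using orb_nonempty by blast
  then have root: "poly (mp \<phi>) a = 0" by (simp add: orb_def)
  obtain R where R: "R \<in> Irr Kh" "poly R a = 0" using Irr_exists[OF is_subfield_Kh algebraic_Kh] by blast
  have dvd: "R dvd mp \<phi>" using Irr_dvd[OF is_subfield_Kh R(1) _ R(2) root] polys_over_mono[OF mp_in K0_Kh] by blast
  have aug: "augmentation \<mu> \<phi> Infty = value_at a" using a unfolding orb_iff by (simp add: key.augmentation_Infty fun_eq_iff)
  have Q: "Q = R" unfolding Q_def determined_factor_def
  proof (rule the_equality)
    show "R \<in> Irr Kh \<and> R dvd mp \<phi> \<and> augmentation \<mu> \<phi> Infty = root_val emb vbar R"
      using R dvd root_val_eq[OF R] aug by simp
    fix Q' assume Q': "Q' \<in> Irr Kh \<and> Q' dvd mp \<phi> \<and> augmentation \<mu> \<phi> Infty = root_val emb vbar Q'"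
    then have "Q' \<in> Irr Kh" by blast
    obtain \<theta> where \<theta>: "poly Q' \<theta> = 0" using Irr_has_root[OF \<open>Q' \<in> Irr Kh\<close>] by blast
    have "value_at a = value_at \<theta>" using Q' root_val_eq[OF \<open>Q' \<in> Irr Kh\<close> \<theta>] aug by simp
    then have "poly R \<theta> = 0" by (rule same_value_at_root[OF R])
    then show "Q' = R" using Irr_unique[OF is_subfield_Kh \<open>Q' \<in> Irr Kh\<close> R(1) \<theta>] by blast
  qed
  show 1: "Q \<in> Irr Kh" by (simp add: Q R)
  show 2: "poly Q x = 0 \<longleftrightarrow> x \<in> orb" for x
  proof
    assume "poly Q x = 0"
    then have "value_at a = value_at x" using value_at_root[OF R] by (simp add: Q)
    then show "x \<in> orb" using a unfolding orb_iff by simp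
  next
    assume "x \<in> orb"
    then have "value_at a = value_at x" using a unfolding orb_iff by simp
    then show "poly Q x = 0" unfolding Q by (rule same_value_at_root[OF R])
  qed
  have nz: "mp \<phi> \<noteq> 0" "Q \<noteq> 0" using IrrD(4)[OF mp_phi_Irr] IrrD(4)[OF 1] by auto
  have "proots Q = filter_mset (\<lambda>x. x \<in> orb) (proots (mp \<phi>))"
  proof (rule multiset_eqI)
    fix x
    have "Polynomial.order x Q = (if x \<in> orb then Polynomial.order x (mp \<phi>) else 0)"
    proof (cases "x \<in> orb")
      case True
      then have "poly (mp \<phi>) x = 0" "poly Q x = 0" unfolding 2 by (simp_all add: orb_def)
      then show ?thesis using order_henselization[OF mp_phi_Irr _ 1] True by simp
    next
      case False
      then show ?thesis using 2 by (simp add: order_0I)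
    qed
    then show "count (proots Q) x = count (filter_mset (\<lambda>x. x \<in> orb) (proots (mp \<phi>))) x" using nz by simp
  qed
  then show "degree Q = count_roots (mp \<phi>) orb" unfolding count_roots_def by (simp add: size_proots[symmetric])
qed

text \<open>This makes the condition on a factor one on any single root of it, as the counting
  requires.\<close>

lemma factor_along_iff:
  assumes \<phi>: "\<phi> \<in> KP \<mu>" and G: "G \<in> Irr Kh" "poly G \<theta> = 0"
  shows "\<mu> < root_val emb vbar G \<and> tangent_direction \<mu> (root_val emb vbar G) = KP_class \<mu> \<phi> \<longleftrightarrow>
    dominating \<theta> \<and> \<mu> \<phi> < value_at \<theta> \<phi>"
proof -
  have "tangent_direction \<mu> (value_at \<theta>) = KP_class \<mu> \<phi> \<longleftrightarrow> \<mu> \<phi> < value_at \<theta> \<phi>" if "dominating \<theta>"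
    using that by (intro tangent_direction_eq_iff[OF key.val is_valuation_value_at _ _ \<phi>]) (simp_all add: dominating_def \<mu>_const value_at_const)
  moreover have "\<mu> < value_at \<theta> \<longleftrightarrow> dominating \<theta> \<and> (\<exists>f. \<mu> f < value_at \<theta> f)"
    unfolding less_fun_def le_fun_def dominating_def by (meson leD leI)
  ultimately show ?thesis unfolding root_val_eq[OF G] by blast
qed

text \<open>By \<open>henselization_immediate\<close>, the infinitesimal part of the Gauss value of \<open>G\<close> is a difference
  of two indices, hence integral; and it is the same at all conjugates of the centre.\<close>

lemma count_roots_henselization:
  assumes \<gamma>: "\<mu> \<phi> < Fin \<gamma>" and G: "G \<in> polys_over Kh" "G \<noteq> 0"
  shows "count_roots (mp \<phi>) orb dvd count_roots G (pdisc \<gamma> (- 1))"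
proof -
  interpret d: discoid \<mu>' \<phi> emb u' "(\<gamma>, - 1)" by (rule discoid[OF \<gamma>])
  obtain a where a: "a \<in> orb" using orb_nonempty by blast
  let ?W = "\<lambda>b. ball_val u' b (d.rad b)"
  have integral: "\<exists>X. ?W a (mp e) = Fin (X, - of_nat (Max (min_indices e \<gamma>)))" if "e \<noteq> 0" for e
    using perturbed_value[OF \<gamma> _ _ a, of "Max (min_indices e \<gamma>)" e "- 1"] min_indices[OF that, of \<gamma>] by simp
  have fin: "?W a p = Infty \<longleftrightarrow> p = 0" for p
  proof (cases "p = 0")
    case True
    then show ?thesis using is_valuation_ball_val[OF d.u] unfolding is_valuation_def by simp
  next
    case False
    then show ?thesis using ball_val_perturbed[OF val False, of a "d.rad a"] by auto
  qed
  have const: "?W a [:c:] = lift_vext (vbar c)" for c by (rule ball_val_const)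
  have pos: "0 < x \<Longrightarrow> 0 < lift_vext x" for x :: "'g vext" using lift_vext_simps(2)[of 0 x] by (simp add: lift_vext_simps(5))
  obtain e e' where e: "e \<noteq> 0" "e' \<noteq> 0" and eq: "?W a G + ?W a (mp e) = ?W a (mp e')"
    using henselization_immediate[OF is_valuation_ball_val[OF d.u] fin const lift_vext_simps(5) pos G] by blast
  \<comment> \<open>The infinitesimal part of the value of G is -k; k is an integer of a priori
    unknown sign.\<close>
  define k :: int where "k = int (Max (min_indices e' \<gamma>)) - int (Max (min_indices e \<gamma>))"
  obtain X where X: "?W a G = Fin (X, - 1 * of_int k)"
  proof -
    obtain Y Z where YZ: "?W a (mp e) = Fin (Y, - of_nat (Max (min_indices e \<gamma>)))" "?W a (mp e') = Fin (Z, - of_nat (Max (min_indices e' \<gamma>)))"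
      using integral e by blast
    obtain x y where xy: "?W a G = Fin (x, y)" using fin[of G] G(2) by (cases "?W a G") auto
    have "y = - 1 * of_int k" using eq unfolding YZ xy k_def by (simp add: algebra_simps)
    then show thesis using xy that by blast
  qed
  \<comment> \<open>A value-preserving automorphism takes a to b, fixes G and \<phi>, and hence
    carries the radius at a to the radius at b.\<close>
  have "\<exists>X. ?W b G = Fin (X, - 1 * of_int k)" if b: "b \<in> orb" for b
  proof -
    have "vbar (poly F a) = vbar (poly F b)" if F: "F \<in> polys_over K\<^sub>0" for F
    proof -
      obtain f where f: "F = mp f" using F by (rule polys_over_K0)
      have "value_at a = value_at b" using a b unfolding orb_iff by simp
      then show ?thesis using fun_cong[of "value_at a" "value_at b" f] unfolding f value_at_def by blast
    qed
    then obtain \<tau> where \<tau>: "is_embedding UNIV \<tau>" "\<forall>x\<in>K\<^sub>0. \<tau> x = x" "\<forall>x. vbar (\<tau> x) = vbar x" "\<tau> a = b"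
      using valued_conjugates[of a b] by blast
    have inv: "u' (\<tau> x) = u' x" for x using \<tau>(3) by simp
    have fixes_Kh: "map_poly \<tau> p = p" if p: "p \<in> polys_over Kh" for p
      by (rule map_poly_fixed[OF p valued_embedding_fixes_Kh[OF \<tau>(1-3)] is_subfieldD(2)[OF is_subfield_Kh]])
    have conj: "ball_val u' b \<delta> p = ball_val u' a \<delta> p" if "p \<in> polys_over Kh" for \<delta> p
      using ball_val_conjugate[OF d.u \<tau>(1) inv, of a \<delta> p] fixes_Kh[OF that] by (simp add: \<tau>(4))
    have roots: "poly (mp \<phi>) a = 0" "poly (mp \<phi>) b = 0" using a b by (simp_all add: orb_def)
    have "mp \<phi> \<in> polys_over Kh" using mp_in K0_Kh by (rule polys_over_mono)
    then have "ball_val u' b (d.rad a) (mp \<phi>) = Fin (\<gamma>, - 1)" using conj d.rad[OF roots(1)] by simp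
    then have "d.rad a = d.rad b" by (rule d.rad_unique[OF roots(2)])
    then show ?thesis using conj[OF G(1)] X by auto
  qed
  then have "rat_of_nat (count_roots G (pdisc \<gamma> (- 1))) = of_int k * of_nat (count_roots (mp \<phi>) orb)"
    by (intro count_roots_pdisc[OF \<gamma> _ G(2)]) auto
  then have "rat_of_int (int (count_roots G (pdisc \<gamma> (- 1)))) = rat_of_int (k * int (count_roots (mp \<phi>) orb))" by simp
  then have "int (count_roots G (pdisc \<gamma> (- 1))) = k * int (count_roots (mp \<phi>) orb)" by (simp only: of_int_eq_iff)
  then have "int (count_roots (mp \<phi>) orb) dvd int (count_roots G (pdisc \<gamma> (- 1)))" by simp
  then show ?thesis by simp
qed

text \<open>If \<phi> vanishes at \<theta>, then G = Q. Otherwise \<phi> has the same finite value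
  \<gamma> at all roots of G, so the closed disc for \<gamma> contains all of them and the count is
  deg G.\<close>

lemma degree_multiple:
  assumes G: "G \<in> Irr Kh" "poly G \<theta> = 0" and \<theta>: "dominating \<theta>" "\<mu> \<phi> < value_at \<theta> \<phi>"
  shows "degree (determined_factor emb vbar \<mu> \<phi>) dvd degree G"
proof (cases "value_at \<theta> \<phi>")
  case Infty
  then have "\<theta> \<in> orb" using \<theta>(1) by (simp add: orb_def value_at_eq_Infty)
  then have "poly (determined_factor emb vbar \<mu> \<phi>) \<theta> = 0" by (simp add: determined_factor)
  then have "G = determined_factor emb vbar \<mu> \<phi>" using Irr_unique[OF is_subfield_Kh G(1) determined_factor(1) G(2)] by blast
  then show ?thesis by simp
next
  case (Fin \<gamma>)
  have "x \<in> pdisc \<gamma> (- 1)" if "poly G x = 0" for x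
    using value_at_root[OF G(1) that G(2)] \<theta>(1) Fin by (simp add: pdisc_def dominating_def)
  then have "filter_mset (\<lambda>x. x \<in> pdisc \<gamma> (- 1)) (proots G) = proots G"
    using IrrD(4)[OF G(1)] by (auto simp: filter_mset_eq_conv)
  then have "count_roots G (pdisc \<gamma> (- 1)) = degree G" by (simp add: count_roots_def size_proots)
  then show ?thesis using count_roots_henselization[of \<gamma> G] \<theta>(2) Fin G(1) IrrD(1,4)[OF G(1)] by (simp add: determined_factor)
qed

text \<open>If \<open>lam\<close> exceeds \<mu> \<phi>, this is the count of
  \<open>count_roots_slope\<close>. Otherwise there are no factors, and the component of the
  principal polygon has length 0.\<close>

lemma sum_degree_factors_at:
  assumes \<phi>: "\<phi> \<in> KP \<mu>" and g: "g \<noteq> 0"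
  shows "of_nat (\<Sum>G\<in>#factors_at emb vbar \<mu> \<phi> g lam. degree G) =
    horizontal_length (polygon_component lam (principal_polygon \<mu> \<phi> g)) * of_nat (degree (determined_factor emb vbar \<mu> \<phi>))"
proof -
  let ?S = "{\<theta>. dominating \<theta> \<and> \<mu> \<phi> < value_at \<theta> \<phi> \<and> value_at \<theta> \<phi> = Fin lam}"
  have "(\<Sum>G\<in>#factors_at emb vbar \<mu> \<phi> g lam. degree G) = count_roots (mp g) ?S"
    unfolding factors_at_def factors_along_def filter_filter_mset
  proof (rule sum_degree_irr_factors[OF is_subfield_Kh algebraic_Kh])
    show "mp g \<in> polys_over Kh" using mp_in K0_Kh by (rule polys_over_mono)
    show "mp g \<noteq> 0" using g mp_hom(7)[of g 0] by (simp add: mp_hom)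
    fix G x assume G: "G \<in> Irr Kh" "poly G x = 0"
    show "((\<mu> < root_val emb vbar G \<and> tangent_direction \<mu> (root_val emb vbar G) = KP_class \<mu> \<phi>) \<and>
           root_val emb vbar G \<phi> = Fin lam) \<longleftrightarrow> x \<in> ?S"
      using factor_along_iff[OF \<phi> G] root_val_eq[OF G] by simp
  qed
  also have "rat_of_nat (count_roots (mp g) ?S) = horizontal_length (polygon_component lam (principal_polygon \<mu> \<phi> g)) * of_nat (count_roots (mp \<phi>) orb)"
  proof (cases "\<mu> \<phi> < Fin lam")
    case True
    then have "?S = {\<theta>. dominating \<theta> \<and> value_at \<theta> \<phi> = Fin lam}" by auto
    then show ?thesis using True by (simp add: count_roots_slope[OF True g] horizontal_length_principal_polygon[OF g])
  next
    case False
    then have "?S = {}" by auto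
    then have "count_roots (mp g) ?S = 0" by (simp only: count_roots_def) simp
    then show ?thesis using False by (simp add: horizontal_length_principal_polygon[OF g])
  qed
  finally show ?thesis by (simp add: determined_factor)
qed

end

theorem theorem4p4:
  fixes emb :: "'a::field \<Rightarrow> 'c::alg_closed_field"
    and v :: "'a \<Rightarrow> 'g::linordered_rat_vector vext"
    and vbar :: "'c \<Rightarrow> 'g vext"
    and \<mu> :: "'a poly \<Rightarrow> 'g vext"
    and \<phi> g :: "'a poly"
    and N :: "(rat \<times> 'g) set"
    and Q :: "'c poly"
  assumes "valued_field_closure emb v vbar"
    and "inner_node v \<mu>"
    and "\<phi> \<in> KP \<mu>"
    and "g \<noteq> 0"
    and "N = principal_polygon \<mu> \<phi> g"
    and "Q = determined_factor emb vbar \<mu> \<phi>"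
  shows "(\<forall>G \<in># factors_along emb vbar \<mu> \<phi> g. degree Q dvd degree G) \<and>
    (\<forall>lam. of_nat (\<Sum>G \<in># factors_at emb vbar \<mu> \<phi> g lam. degree G) =
              horizontal_length (polygon_component lam N) * of_nat (degree Q)) \<and>
    (\<forall>lam. horizontal_length (polygon_component lam N) = 1 \<longrightarrow>
              (\<exists>G. factors_at emb vbar \<mu> \<phi> g lam = {#G#} \<and> degree G = degree Q))"
proof -
  interpret valued_field_closure emb v vbar by fact
  have \<mu>: "is_valuation \<mu>" "\<And>a. \<mu> [:a:] = v a" using assms(2) by (simp_all add: inner_node_def \<T>_def)
  interpret key: key_polynomial \<mu> \<phi> using \<mu>(1) assms(3) by (rule KP_key_polynomial)
  interpret newton_setting emb v vbar \<mu> \<phi> by unfold_locales (rule \<mu>(2))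
  have i: "degree Q dvd degree G \<and> 0 < degree G" if "G \<in># factors_along emb vbar \<mu> \<phi> g" for G
  proof -
    have G: "G \<in> Irr Kh" and along: "\<mu> < root_val emb vbar G" "tangent_direction \<mu> (root_val emb vbar G) = KP_class \<mu> \<phi>"
      using that irr_factors_Irr by (auto simp: factors_along_def)
    obtain \<theta> where \<theta>: "poly G \<theta> = 0" using Irr_has_root[OF G] by blast
    have "dominating \<theta>" "\<mu> \<phi> < value_at \<theta> \<phi>" using along factor_along_iff[OF assms(3) G \<theta>] by simp_all
    then show ?thesis using degree_multiple[OF G \<theta>] IrrD(3)[OF G] assms(6) by simp
  qed
  have ii: "of_nat (\<Sum>G \<in># factors_at emb vbar \<mu> \<phi> g lam. degree G) = horizontal_length (polygon_component lam N) * of_nat (degree Q)" for lam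
    using sum_degree_factors_at[OF assms(3,4)] assms(5,6) by simp
  have iii: "\<exists>G. factors_at emb vbar \<mu> \<phi> g lam = {#G#} \<and> degree G = degree Q"
    if "horizontal_length (polygon_component lam N) = 1" for lam
  proof -
    let ?M = "factors_at emb vbar \<mu> \<phi> g lam"
    \<comment> \<open>The degrees are positive multiples of deg Q and add up to deg Q, so there is
      only one of them.\<close>
    have sum: "(\<Sum>G \<in># ?M. degree G) = degree Q" using ii[of lam] unfolding that mult_1 of_nat_eq_iff .
    have along: "G \<in># factors_along emb vbar \<mu> \<phi> g" if "G \<in># ?M" for G using that by (simp add: factors_at_def)
    have "degree Q > 0" using IrrD(3)[OF determined_factor(1)] assms(6) by simp
    then have "?M \<noteq> {#}" using sum by auto
    then obtain G M where M: "?M = add_mset G M" by (meson multiset_cases)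
    have "degree Q \<le> degree G" using i[OF along[of G]] M by (intro dvd_imp_le) simp_all
    moreover have "degree G + (\<Sum>G \<in># M. degree G) = degree Q" using sum M by simp
    ultimately have deg: "degree G = degree Q" "(\<Sum>G \<in># M. degree G) = 0" by linarith+
    have "M = {#}"
    proof (rule ccontr)
      assume "M \<noteq> {#}"
      then obtain H where "H \<in># M" by blast
      then have "degree H = 0" "0 < degree H" using deg(2) i[OF along[of H]] M by auto
      then show False by simp
    qed
    then show ?thesis using M deg(1) by auto
  qed
  show ?thesis using i ii iii by blast
qed

end
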